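(* Consider the problem of minimizing, over $U\in L^2_{\mathcal F}([0,T],\mathbb R^m)$, $$J_R(U,X)=\mathbb E\Big[\int_h^TX(t)^TQ(t)X(t)\,dt+X(T)^TGX(T)\Big]+\mathbb E\Big[\int_0^{T-h}U(t)^TR(t)U(t)\,dt\Big],$$ where $X$ solves $$dX(t)=\big(A(t)X(t)+B(t)U(t-h)\big)\,dt+\sigma(t)\,dW_t,\qquad X(0)=0,\qquad U(s)=0\ \text{ for } s\in[-h,0).$$ The control $U^*$ solving this problem is given by $$U^*(t)=-R(t)^{-1}\overline B(t)^TP(t)Y(t),$$ where $Y(t)=X(t)+\int_{t-h}^t\Phi_A(t,s+h)B(s+h)U^*(s)\,ds$ is the Artstein transform of the corresponding state $X$ (which solves $dY=(AY+\overline BU^* )\,dt+\sigma\,dW_t$, $Y(0)=0$), and $P$ is the solution of the deterministic Riccati equation $$\dot P=-A^TP-PA-\overline Q+P\,\overline B R^{-1}\overline B^TP,\qquad P(0)=\overline G.$$ Here $\overline B(t)=\Phi_A(t,t+h)B(t+h)$, $\overline Q(t)=\Phi_A(t+h,t)^TQ(t+h)\Phi_A(t+h,t)$ and $\overline G=\Phi_A(T+h,T)^TG\,\Phi_A(T+h,T)$.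
   Context: Let $n,m$ be positive integers, $T>0$ and $0<h<T$. Let $(\Omega,(\mathcal F_t)_{t\ge0},\mathbb P)$ be a filtered probability space carrying a one-dimensional Wiener process $W$ with respect to $(\mathcal F_t)$ (adapted, with increments $W_t-W_s$ independent of $\mathcal F_s$ for $s<t$). $L^2_{\mathcal F}([0,T],\mathbb R^m)$ is the set of square-integrable $\mathcal F$-adapted processes on $[0,T]$ with values in $\mathbb R^m$. For an $L^\infty$ matrix function $M$, $\Phi_M(t,s)$ is the fundamental matrix: $\frac{d}{dt}\Phi_M(t,s)=M(t)\Phi_M(t,s)$, $\Phi_M(s,s)=I$. $\mathcal S_k^+$ and $\mathcal S_k^{++}$ denote the symmetric positive semi-definite and positive definite real $k\times k$ matrices. Standing assumptions: $A\in L^\infty([0,T+h],\mathbb R^{n\times n})$, $B\in L^\infty([0,T+h],\mathbb R^{n\times m})$, $\sigma\in L^\infty([0,T],\mathbb R^n)$ are deterministic, and the Gramian $G_\tau^{T+h}=\int_\tau^{T+h}\Phi_A(T+h,s)B(s)B(s)^T\Phi_A(T+h,s)^T\,ds$ is invertible for all $0<\tau<T+h$. The (deterministic) weights satisfy $Q\in L^\infty([0,T],\mathcal S_n^+)$, $G\in\mathcal S_n^+$, $R\in L^\infty([0,T],\mathcal S_m^{++})$.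
   Formalization: P(0)=Ḡ is corrected to P(T-h)=Ḡ, and Ḡ to Φ_A(T,T-h)^T G Φ_A(T,T-h); the Riccati equation and feedback are on [0,T-h]. Existence of P and U* is claimed when R^{-1} is in L^∞; optimality and uniqueness hold for any R, given symmetric P and U*. *)

theory Defs
  imports "HOL-Probability.Probability"
begin

section \<open>Deterministic data\<close>

definition psd_matrices :: "(real^'k^'k) set" where
  "psd_matrices = {S. transpose S = S \<and> (\<forall>x. 0 \<le> x \<bullet> (S *v x))}"

definition pd_matrices :: "(real^'k^'k) set" where
  "pd_matrices = {S. transpose S = S \<and> (\<forall>x. x \<noteq> 0 \<longrightarrow> 0 < x \<bullet> (S *v x))}"

text \<open>Membership of (a Borel representative of) \<open>f\<close> in \<open>L\<^sup>\<infinity>(I, S)\<close>: essentially bounded on \<open>I\<close>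
  with values in \<open>S\<close> almost everywhere. Values of \<open>f\<close> outside \<open>I\<close> are irrelevant.\<close>

definition Linf_on :: "real set \<Rightarrow> 'a::euclidean_space set \<Rightarrow> (real \<Rightarrow> 'a) \<Rightarrow> bool" where
  "Linf_on I S f \<longleftrightarrow> set_borel_measurable borel I f \<and>
     (\<exists>C. AE t in lborel. t \<in> I \<longrightarrow> norm (f t) \<le> C) \<and>
     (AE t in lborel. t \<in> I \<longrightarrow> f t \<in> S)"

text \<open>With merely bounded measurable coefficients, a solution of \<open>\<dot>x = f(t, x)\<close> on \<open>[a, b]\<close> is an
  absolutely continuous function satisfying the equation almost everywhere, i.e. a solution of the
  integrated equation. For \<open>s > t\<close> the interval integral carries the usual sign.\<close>

definition caratheodory_solution ::
  "real \<Rightarrow> real \<Rightarrow> (real \<Rightarrow> 'a \<Rightarrow> 'a) \<Rightarrow> (real \<Rightarrow> 'a::euclidean_space) \<Rightarrow> bool" where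
  "caratheodory_solution a b f x \<longleftrightarrow> set_integrable lborel {a..b} (\<lambda>r. f r (x r)) \<and>
     (\<forall>s\<in>{a..b}. \<forall>t\<in>{a..b}. x t - x s = (LBINT r=ereal s..ereal t. f r (x r)))"

text \<open>\<open>fundamental_matrix L M t s\<close> is \<open>\<Phi>\<^sub>M(t, s)\<close> for \<open>M\<close> given on \<open>[0, L]\<close>. It is meaningful for
  \<open>s, t \<in> [0, L]\<close> in either order; the defining property determines the values there.\<close>

definition fundamental_matrix ::
  "real \<Rightarrow> (real \<Rightarrow> real^'n^'n) \<Rightarrow> real \<Rightarrow> real \<Rightarrow> real^'n^'n" where
  "fundamental_matrix L M t s =
     (SOME \<Phi>. caratheodory_solution 0 L (\<lambda>r Z. M r ** Z) \<Phi> \<and> \<Phi> s = mat 1) t"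

definition gramian ::
  "real \<Rightarrow> (real \<Rightarrow> real^'n^'n) \<Rightarrow> (real \<Rightarrow> real^'m^'n) \<Rightarrow> real \<Rightarrow> real^'n^'n" where
  "gramian L A B \<tau> = (LBINT s=ereal \<tau>..ereal L.
     fundamental_matrix L A L s ** B s ** transpose (B s) ** transpose (fundamental_matrix L A L s))"

section \<open>Stochastic calculus\<close>

definition filtered_prob_space :: "'w measure \<Rightarrow> (real \<Rightarrow> 'w measure) \<Rightarrow> bool" where
  "filtered_prob_space M F \<longleftrightarrow> prob_space M \<and> (\<forall>t\<ge>0. subalgebra M (F t)) \<and>
     (\<forall>s t. 0 \<le> s \<longrightarrow> s \<le> t \<longrightarrow> sets (F s) \<subseteq> sets (F t))"

definition wiener_process ::
  "'w measure \<Rightarrow> (real \<Rightarrow> 'w measure) \<Rightarrow> (real \<Rightarrow> 'w \<Rightarrow> real) \<Rightarrow> bool" where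
  "wiener_process M F W \<longleftrightarrow>
     (\<forall>t\<ge>0. W t \<in> borel_measurable (F t)) \<and>
     (AE \<omega> in M. W 0 \<omega> = 0) \<and>
     (AE \<omega> in M. continuous_on {0..} (\<lambda>t. W t \<omega>)) \<and>
     (\<forall>s t. 0 \<le> s \<longrightarrow> s < t \<longrightarrow>
        distributed M lborel (\<lambda>\<omega>. W t \<omega> - W s \<omega>) (normal_density 0 (sqrt (t - s))) \<and>
        prob_space.indep_set M
          (sets (vimage_algebra (space M) (\<lambda>\<omega>. W t \<omega> - W s \<omega>) borel)) (sets (F s)))"

definition measurable_process ::
  "'w measure \<Rightarrow> real \<Rightarrow> (real \<Rightarrow> 'w \<Rightarrow> 'a::euclidean_space) \<Rightarrow> bool" where
  "measurable_process M T X \<longleftrightarrow>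
     (\<lambda>(t, \<omega>). X t \<omega>) \<in> borel_measurable (restrict_space borel {0..T} \<Otimes>\<^sub>M M)"

definition adapted_on ::
  "(real \<Rightarrow> 'w measure) \<Rightarrow> real \<Rightarrow> (real \<Rightarrow> 'w \<Rightarrow> 'a::euclidean_space) \<Rightarrow> bool" where
  "adapted_on F T X \<longleftrightarrow> (\<forall>t\<in>{0..T}. X t \<in> borel_measurable (F t))"

definition L2_adapted ::
  "'w measure \<Rightarrow> (real \<Rightarrow> 'w measure) \<Rightarrow> real \<Rightarrow> (real \<Rightarrow> 'w \<Rightarrow> 'a::euclidean_space) \<Rightarrow> bool" where
  "L2_adapted M F T U \<longleftrightarrow> measurable_process M T U \<and> adapted_on F T U \<and>
     (\<integral>\<^sup>+\<omega>. (\<integral>\<^sup>+t\<in>{0..T}. ennreal ((norm (U t \<omega>))\<^sup>2) \<partial>lborel) \<partial>M) < \<infinity>"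

definition step_function :: "nat \<Rightarrow> (nat \<Rightarrow> real) \<Rightarrow> (nat \<Rightarrow> 'a) \<Rightarrow> real \<Rightarrow> 'a::real_vector" where
  "step_function k p c s = (\<Sum>i<k. indicator {p i<..p (Suc i)} s *\<^sub>R c i)"

definition step_integral ::
  "(real \<Rightarrow> 'w \<Rightarrow> real) \<Rightarrow> nat \<Rightarrow> (nat \<Rightarrow> real) \<Rightarrow> (nat \<Rightarrow> 'a) \<Rightarrow> 'w \<Rightarrow> 'a::real_vector" where
  "step_integral W k p c \<omega> = (\<Sum>i<k. (W (p (Suc i)) \<omega> - W (p i) \<omega>) *\<^sub>R c i)"

text \<open>\<open>is_wiener_integral M W t \<sigma> Z\<close> says that \<open>Z = \<integral>\<^sub>0\<^sup>t \<sigma> dW\<close> almost surely, for deterministic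
  \<open>\<sigma> \<in> L\<^sup>2(0, t)\<close>: \<open>Z\<close> is the mean-square limit of the integrals of step functions (with nodes
  \<open>p j 0 \<le> \<dots> \<le> p j (k j)\<close>) that converge to \<open>\<sigma>\<close> in \<open>L\<^sup>2(0, t)\<close>. By the Ito isometry the limit does
  not depend on the approximating sequence.\<close>

definition is_wiener_integral ::
  "'w measure \<Rightarrow> (real \<Rightarrow> 'w \<Rightarrow> real) \<Rightarrow> real \<Rightarrow> (real \<Rightarrow> 'a::euclidean_space) \<Rightarrow> ('w \<Rightarrow> 'a) \<Rightarrow> bool" where
  "is_wiener_integral M W t \<sigma> Z \<longleftrightarrow> Z \<in> borel_measurable M \<and>
     (\<exists>k p c.
        (\<forall>j. mono_on {..k j} (p j) \<and> p j ` {..k j} \<subseteq> {0..t}) \<and>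
        (\<lambda>j. \<integral>\<^sup>+s\<in>{0..t}. ennreal ((norm (step_function (k j) (p j) (c j) s - \<sigma> s))\<^sup>2) \<partial>lborel)
          \<longlonglongrightarrow> 0 \<and>
        (\<lambda>j. \<integral>\<^sup>+\<omega>. ennreal ((norm (step_integral W (k j) (p j) (c j) \<omega> - Z \<omega>))\<^sup>2) \<partial>M)
          \<longlonglongrightarrow> 0)"

text \<open>\<open>dX = b dt + \<sigma> dW\<close>, \<open>X(0) = 0\<close> on \<open>[0, T]\<close>. For the linear equations considered below the
  noise is additive with deterministic \<open>\<sigma>\<close>, so the equation alone determines \<open>X\<close> up to
  indistinguishability from \<open>W\<close> and the control; since the control is adapted, \<open>X\<close> is then
  automatically adapted up to null sets and no adaptedness clause is imposed.\<close>

definition solves_sde ::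
  "'w measure \<Rightarrow> (real \<Rightarrow> 'w \<Rightarrow> real) \<Rightarrow> real \<Rightarrow> (real \<Rightarrow> 'w \<Rightarrow> 'a) \<Rightarrow> (real \<Rightarrow> 'a)
     \<Rightarrow> (real \<Rightarrow> 'w \<Rightarrow> 'a::euclidean_space) \<Rightarrow> bool" where
  "solves_sde M W T b \<sigma> X \<longleftrightarrow> measurable_process M T X \<and>
     (AE \<omega> in M. continuous_on {0..T} (\<lambda>t. X t \<omega>)) \<and>
     (AE \<omega> in M. X 0 \<omega> = 0) \<and>
     (AE \<omega> in M. set_integrable lborel {0..T} (\<lambda>s. b s \<omega>)) \<and>
     (\<forall>t\<in>{0..T}. is_wiener_integral M W t \<sigma>
        (\<lambda>\<omega>. X t \<omega> - (LBINT s=ereal 0..ereal t. b s \<omega>)))"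

section \<open>The control problem with input delay\<close>

definition admissible ::
  "'w measure \<Rightarrow> (real \<Rightarrow> 'w measure) \<Rightarrow> (real \<Rightarrow> 'w \<Rightarrow> real) \<Rightarrow> real \<Rightarrow> real
     \<Rightarrow> (real \<Rightarrow> real^'n^'n) \<Rightarrow> (real \<Rightarrow> real^'m^'n) \<Rightarrow> (real \<Rightarrow> real^'n)
     \<Rightarrow> (real \<Rightarrow> 'w \<Rightarrow> real^'m) \<Rightarrow> (real \<Rightarrow> 'w \<Rightarrow> real^'n) \<Rightarrow> bool" where
  "admissible M F W T h A B \<sigma> U X \<longleftrightarrow> L2_adapted M F T U \<and>
     (\<forall>s\<in>{-h..<0}. \<forall>\<omega>. U s \<omega> = 0) \<and>
     solves_sde M W T (\<lambda>t \<omega>. A t *v X t \<omega> + B t *v U (t - h) \<omega>) \<sigma> X"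

definition cost ::
  "'w measure \<Rightarrow> real \<Rightarrow> real \<Rightarrow> (real \<Rightarrow> real^'n^'n) \<Rightarrow> real^'n^'n \<Rightarrow> (real \<Rightarrow> real^'m^'m)
     \<Rightarrow> (real \<Rightarrow> 'w \<Rightarrow> real^'m) \<Rightarrow> (real \<Rightarrow> 'w \<Rightarrow> real^'n) \<Rightarrow> real" where
  "cost M T h Q G R U X =
     (LINT \<omega>|M. (LBINT t=ereal h..ereal T. X t \<omega> \<bullet> (Q t *v X t \<omega>)) + X T \<omega> \<bullet> (G *v X T \<omega>)) +
     (LINT \<omega>|M. (LBINT t=ereal 0..ereal (T - h). U t \<omega> \<bullet> (R t *v U t \<omega>)))"

definition optimal ::
  "'w measure \<Rightarrow> (real \<Rightarrow> 'w measure) \<Rightarrow> (real \<Rightarrow> 'w \<Rightarrow> real) \<Rightarrow> real \<Rightarrow> real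
     \<Rightarrow> (real \<Rightarrow> real^'n^'n) \<Rightarrow> (real \<Rightarrow> real^'m^'n) \<Rightarrow> (real \<Rightarrow> real^'n)
     \<Rightarrow> (real \<Rightarrow> real^'n^'n) \<Rightarrow> real^'n^'n \<Rightarrow> (real \<Rightarrow> real^'m^'m)
     \<Rightarrow> (real \<Rightarrow> 'w \<Rightarrow> real^'m) \<Rightarrow> (real \<Rightarrow> 'w \<Rightarrow> real^'n) \<Rightarrow> bool" where
  "optimal M F W T h A B \<sigma> Q G R U X \<longleftrightarrow> admissible M F W T h A B \<sigma> U X \<and>
     (\<forall>U' X'. admissible M F W T h A B \<sigma> U' X' \<longrightarrow> cost M T h Q G R U X \<le> cost M T h Q G R U' X')"

definition B_bar ::
  "real \<Rightarrow> real \<Rightarrow> (real \<Rightarrow> real^'n^'n) \<Rightarrow> (real \<Rightarrow> real^'m^'n) \<Rightarrow> real \<Rightarrow> real^'m^'n" where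
  "B_bar T h A B t = fundamental_matrix (T + h) A t (t + h) ** B (t + h)"

definition Q_bar ::
  "real \<Rightarrow> real \<Rightarrow> (real \<Rightarrow> real^'n^'n) \<Rightarrow> (real \<Rightarrow> real^'n^'n) \<Rightarrow> real \<Rightarrow> real^'n^'n" where
  "Q_bar T h A Q t = transpose (fundamental_matrix (T + h) A (t + h) t) ** Q (t + h) **
     fundamental_matrix (T + h) A (t + h) t"

text \<open>Since \<open>X(T) = \<Phi>\<^sub>A(T, T-h) Y(T-h)\<close> up to noise independent of the control, the terminal weight
  for \<open>Y\<close> at time \<open>T-h\<close> is obtained from \<open>\<Phi>\<^sub>A(T, T-h)\<close>; for constant \<open>A\<close> this equals
  \<open>\<Phi>\<^sub>A(T+h, T)\<close>, but for time-varying \<open>A\<close> the two differ.\<close>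

definition G_bar :: "real \<Rightarrow> real \<Rightarrow> (real \<Rightarrow> real^'n^'n) \<Rightarrow> real^'n^'n \<Rightarrow> real^'n^'n" where
  "G_bar T h A G = transpose (fundamental_matrix (T + h) A T (T - h)) ** G **
     fundamental_matrix (T + h) A T (T - h)"

definition artstein ::
  "real \<Rightarrow> real \<Rightarrow> (real \<Rightarrow> real^'n^'n) \<Rightarrow> (real \<Rightarrow> real^'m^'n)
     \<Rightarrow> (real \<Rightarrow> 'w \<Rightarrow> real^'m) \<Rightarrow> (real \<Rightarrow> 'w \<Rightarrow> real^'n) \<Rightarrow> real \<Rightarrow> 'w \<Rightarrow> real^'n" where
  "artstein T h A B U X t \<omega> = X t \<omega> + (LBINT s=ereal (t - h)..ereal t.
     (fundamental_matrix (T + h) A t (s + h) ** B (s + h)) *v U s \<omega>)"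

text \<open>The cost, rewritten in terms of \<open>Y\<close>, lives on \<open>[0, T-h]\<close> (\<open>Q_bar\<close> at time \<open>t\<close> involves
  \<open>Q(t+h)\<close>, and controls after \<open>T-h\<close> do not act before \<open>T\<close>). The Riccati equation is thus posed on
  \<open>[0, T-h]\<close>, and the sign convention used makes it a backward equation with a terminal condition
  at \<open>T-h\<close>.\<close>

definition riccati_solution ::
  "real \<Rightarrow> real \<Rightarrow> (real \<Rightarrow> real^'n^'n) \<Rightarrow> (real \<Rightarrow> real^'m^'n)
     \<Rightarrow> (real \<Rightarrow> real^'n^'n) \<Rightarrow> real^'n^'n \<Rightarrow> (real \<Rightarrow> real^'m^'m) \<Rightarrow> (real \<Rightarrow> real^'n^'n) \<Rightarrow> bool" where
  "riccati_solution T h A B Q G R P \<longleftrightarrow>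
     caratheodory_solution 0 (T - h) (\<lambda>t p. - (transpose (A t) ** p) - p ** A t - Q_bar T h A Q t +
       p ** B_bar T h A B t ** matrix_inv (R t) ** transpose (B_bar T h A B t) ** p) P \<and>
     P (T - h) = G_bar T h A G"

definition feedback_law ::
  "'w measure \<Rightarrow> real \<Rightarrow> real \<Rightarrow> (real \<Rightarrow> real^'n^'n) \<Rightarrow> (real \<Rightarrow> real^'m^'n) \<Rightarrow> (real \<Rightarrow> real^'m^'m)
     \<Rightarrow> (real \<Rightarrow> real^'n^'n) \<Rightarrow> (real \<Rightarrow> 'w \<Rightarrow> real^'m) \<Rightarrow> (real \<Rightarrow> 'w \<Rightarrow> real^'n) \<Rightarrow> bool" where
  "feedback_law M T h A B R P U X \<longleftrightarrow> (AE (t, \<omega>) in lborel \<Otimes>\<^sub>M M. t \<in> {0..T - h} \<longrightarrow>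
     U t \<omega> = - ((matrix_inv (R t) ** transpose (B_bar T h A B t) ** P t) *v artstein T h A B U X t \<omega>))"

end

theory Submission
  imports Defs
begin

text \<open>Let \<open>\<Phi>\<close> be the fundamental matrix of \<open>A\<close> started at \<open>0\<close> and \<open>\<Theta> = \<Phi>\<^sup>-\<^sup>1\<close>. With \<open>\<beta>(s) = \<Theta>(s + h) B(s + h)\<close>
  and \<open>c(t) = \<integral>\<^sub>0\<^sup>t \<beta> U\<close>, every admissible state satisfies \<open>X(t) = \<Phi>(t) (z(t) + c(t - h))\<close> and its Artstein
  transform is \<open>Y(t) = \<Phi>(t) (z(t) + c(t))\<close>, where the noise \<open>z\<close> does not depend on the control and
  \<open>z(t) - z(s)\<close> is orthogonal to \<open>\<F>\<^sub>s\<close> for \<open>s \<le> t\<close>. The cost becomes a quadratic functional of \<open>U\<close>. If \<open>U\<close> obeys the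
  feedback law and \<open>V = U + D\<close>, the cost of \<open>V\<close> is that of \<open>U\<close> plus a definite quadratic form in \<open>D\<close>
  plus a cross term. By orthogonality the cross term only involves the deterministic, absolutely
  continuous moments \<open>e(t) = \<E>[(z(t) + c(t)) (\<integral>\<^sub>0\<^sup>t \<beta> D)\<^sup>T]\<close>, and differentiating \<open>\<langle>\<Phi>\<^sup>T P \<Phi>, e\<rangle>\<close> along the Riccati equation
  shows that it vanishes; no Ito formula is needed.

  The Riccati equation is solved through its linear Hamiltonian system, whose first block stays
  invertible by semidefiniteness. A continuous Wiener integral is a limit of integrals of step functions
  (maximal inequality and Borel-Cantelli); a progressively measurable version of it drives the closed loop,
  which is a linear equation path by path.\<close>

section \<open>Absolutely continuous functions\<close>

text \<open>The noise is additive, so after multiplication by \<Theta> all randomness sits in a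
  process z common to every control: two continuous Wiener integrals of \<sigma> agree almost surely
  at all times. Hence two admissible states differ by a pathwise absolutely continuous function, and
  ordinary integration by parts is enough. The cost sees z at time t + h together with the controls
  up to time t, the feedback sees z at time t; the gap z(t + h) - z(t) drops out of the cross term,
  though not out of the cost. The coefficients are merely measurable, so every differential identity
  is an equality of densities almost everywhere, and given coefficients are traded for bounded Borel
  representatives. The filtration need not be complete, so adapted objects are built by formulas
  valid for every outcome, not repaired on null sets. Existence asks for an essentially bounded
  inverse of R: positive definiteness at almost every time lets R degenerate, and the quadratic
  Riccati coefficient could then be unbounded.\<close>

definition primitive_on :: "real \<Rightarrow> real \<Rightarrow> (real \<Rightarrow> 'a::euclidean_space) \<Rightarrow> (real \<Rightarrow> 'a) \<Rightarrow> bool" where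
  "primitive_on a b g x \<longleftrightarrow> set_integrable lborel {a..b} g \<and>
     (\<forall>t\<in>{a..b}. x t - x a = (LBINT r:{a..t}. g r))"

lemma set_integral_Icc_split:
  fixes g :: "real \<Rightarrow> 'a::euclidean_space"
  assumes g: "set_integrable lborel {a..t} g" and "a \<le> s" "s \<le> t"
  shows "(LBINT r:{a..t}. g r) = (LBINT r:{a..s}. g r) + (LBINT r:{s..t}. g r)"
proof -
  have eq: "{a..t} = {a..s} \<union> {s<..t}" using assms by auto
  have "(LBINT r:{a..t}. g r) = (LBINT r:{a..s}. g r) + (LBINT r:{s<..t}. g r)"
    unfolding eq
    by (rule set_integral_Un) (use assms in \<open>auto intro: set_integrable_subset[OF g]\<close>)
  also have "(LBINT r:{s<..t}. g r) = (LBINT r:{s..t}. g r)"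
    by (rule set_integral_discrete_difference[where X="{s}"]) auto
  finally show ?thesis .
qed

lemma primitive_on_integrable: "primitive_on a b g x \<Longrightarrow> set_integrable lborel {a..b} g"
  by (simp add: primitive_on_def)

lemma primitive_onD:
  assumes "primitive_on a b g x" "t \<in> {a..b}"
  shows "x t = x a + (LBINT r:{a..t}. g r)"
proof -
  have "x t - x a = (LBINT r:{a..t}. g r)"
    using assms unfolding primitive_on_def by blast
  then show ?thesis by (metis add_diff_cancel_left' diff_add_cancel add.commute)
qed

lemma primitive_onI:
  assumes "set_integrable lborel {a..b} g" "\<And>t. t \<in> {a..b} \<Longrightarrow> x t = x a + (LBINT r:{a..t}. g r)"
  shows "primitive_on a b g x"
  unfolding primitive_on_def using assms by (metis add_diff_cancel_left')

lemma primitive_on_diff: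
  assumes "primitive_on a b g x" "a \<le> s" "s \<le> t" "t \<le> b"
  shows "x t - x s = (LBINT r:{s..t}. g r)"
proof -
  have i: "set_integrable lborel {a..t} g"
    using primitive_on_integrable[OF assms(1)] by (rule set_integrable_subset) (use assms in auto)
  have "x t - x s = (LBINT r:{a..t}. g r) - (LBINT r:{a..s}. g r)"
    using primitive_onD[OF assms(1), of t] primitive_onD[OF assms(1), of s] assms by simp
  then show ?thesis
    using set_integral_Icc_split[OF i assms(2,3)] by simp
qed

text \<open>The signed integral between two arbitrary times is recovered from integrals that start
  at \<open>a\<close>, by subtraction and, for \<open>s > t\<close>, by reversing the endpoints. All
  calculus below runs on the anchored form.\<close>

lemma caratheodory_solution_iff_primitive_on:
  assumes "a \<le> b"
  shows "caratheodory_solution a b f x \<longleftrightarrow> primitive_on a b (\<lambda>r. f r (x r)) x"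
proof
  assume c: "caratheodory_solution a b f x"
  have "x t - x a = (LBINT r:{a..t}. f r (x r))" if "t \<in> {a..b}" for t
  proof -
    have "x t - x a = (LBINT r=ereal a..ereal t. f r (x r))"
      using c that assms unfolding caratheodory_solution_def by auto
    then show ?thesis using that by (simp add: interval_integral_Icc)
  qed
  then show "primitive_on a b (\<lambda>r. f r (x r)) x"
    using c by (simp add: primitive_on_def caratheodory_solution_def)
next
  assume p: "primitive_on a b (\<lambda>r. f r (x r)) x"
  have "x t - x s = (LBINT r=ereal s..ereal t. f r (x r))" if "s \<in> {a..b}" "t \<in> {a..b}" for s t
  proof (cases "s \<le> t")
    case True
    then show ?thesis using primitive_on_diff[OF p, of s t] that
      by (simp add: interval_integral_Icc)
  next
    case False
    then have "x s - x t = (LBINT r=ereal t..ereal s. f r (x r))"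
      using primitive_on_diff[OF p, of t s] that by (simp add: interval_integral_Icc)
    then show ?thesis
      by (subst interval_integral_endpoints_reverse) (simp add: algebra_simps)
  qed
  then show "caratheodory_solution a b f x"
    using p by (simp add: caratheodory_solution_def primitive_on_def)
qed

lemma continuous_on_set_integral_Icc:
  fixes g :: "real \<Rightarrow> 'a::euclidean_space"
  assumes "set_integrable lborel {a..b} g"
  shows "continuous_on {a..b} (\<lambda>t. LBINT r:{a..t}. g r)"
proof -
  have "g integrable_on {a..b}"
    using assms set_borel_integral_eq_integral(1) by blast
  then have "continuous_on {a..b} (\<lambda>t. integral {a..t} g)"
    by (rule indefinite_integral_continuous_1)
  moreover have "(LBINT r:{a..t}. g r) = integral {a..t} g" if "t \<in> {a..b}" for t
    using that by (intro set_borel_integral_eq_integral(2) set_integrable_subset[OF assms]) auto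
  ultimately show ?thesis
    by (rule continuous_on_eq[OF _ sym])
qed

lemma primitive_on_continuous:
  assumes "primitive_on a b g x"
  shows "continuous_on {a..b} x"
proof -
  have "continuous_on {a..b} (\<lambda>t. x a + (LBINT r:{a..t}. g r))"
    using assms by (intro continuous_intros continuous_on_set_integral_Icc)
      (simp add: primitive_on_def)
  then show ?thesis
    by (rule continuous_on_eq) (rule primitive_onD[OF assms, symmetric])
qed

text \<open>Exchanges a coefficient for an almost everywhere equal one without touching the function
  itself. Measurability of the new density is a separate assumption because \<open>lborel\<close> is
  not complete.\<close>

lemma primitive_on_cong_AE:
  assumes "primitive_on a b g x" "set_borel_measurable lborel {a..b} g'"
    "AE r in lborel. r \<in> {a..b} \<longrightarrow> g r = g' r"
  shows "primitive_on a b g' x"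
proof -
  have m: "set_borel_measurable lborel {a..b} g"
    using primitive_on_integrable[OF assms(1)] borel_measurable_integrable
    unfolding set_borel_measurable_def set_integrable_def by blast
  have "set_integrable lborel {a..b} g \<longleftrightarrow> set_integrable lborel {a..b} g'"
    unfolding set_integrable_def
    by (rule integrable_cong_AE)
      (use m assms in \<open>auto simp: set_borel_measurable_def indicator_def elim!: eventually_mono\<close>)
  moreover have "(LBINT r:{a..t}. g r) = (LBINT r:{a..t}. g' r)" if "t \<in> {a..b}" for t
  proof -
    have sub: "{a..t} \<subseteq> {a..b}" using that by auto
    have "set_borel_measurable lborel {a..t} g" "set_borel_measurable lborel {a..t} g'"
      using m assms(2) by (auto intro: set_borel_measurable_subset[OF _ _ sub])
    then show ?thesis
      unfolding set_lebesgue_integral_def set_borel_measurable_def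
      by (rule integral_cong_AE)
        (use assms(3) sub in \<open>auto simp: indicator_def elim!: eventually_mono\<close>)
  qed
  ultimately show ?thesis
    using assms(1) by (simp add: primitive_on_def)
qed

lemma primitive_on_cong:
  assumes "\<And>t. t \<in> {a..b} \<Longrightarrow> x t = x' t" "\<And>t. t \<in> {a..b} \<Longrightarrow> g t = g' t"
  shows "primitive_on a b g x \<longleftrightarrow> primitive_on a b g' x'"
proof -
  have "set_integrable lborel {a..b} g \<longleftrightarrow> set_integrable lborel {a..b} g'"
    using assms(2) by (intro set_integrable_cong) auto
  moreover have "(LBINT r:{a..t}. g r) = (LBINT r:{a..t}. g' r)" if "t \<in> {a..b}" for t
    using assms(2) that by (intro set_lebesgue_integral_cong) auto
  moreover have "a \<in> {a..b}" if "t \<in> {a..b}" for t using that by auto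
  ultimately show ?thesis
    using assms(1) unfolding primitive_on_def by (metis (no_types, lifting))
qed

lemma primitive_on_set_integral:
  fixes g :: "real \<Rightarrow> 'a::euclidean_space"
  assumes "set_integrable lborel {a..b} g"
  shows "primitive_on a b g (\<lambda>t. c + (LBINT r:{a..t}. g r))"
proof -
  have "(LBINT r:{a..a}. g r) = 0"
    using interval_integral_Icc[of a a g] by simp
  then show ?thesis using assms by (simp add: primitive_on_def)
qed

lemma primitive_on_add:
  assumes "primitive_on a b g x" "primitive_on a b g' x'"
  shows "primitive_on a b (\<lambda>t. g t + g' t) (\<lambda>t. x t + x' t)"
proof -
  have "(LBINT r:{a..t}. g r + g' r) = (LBINT r:{a..t}. g r) + (LBINT r:{a..t}. g' r)"
    if "t \<in> {a..b}" for t
    using assms that unfolding primitive_on_def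
    by (intro set_integral_add set_integrable_subset[where A="{a..b}" and B="{a..t}"]) auto
  moreover have "set_integrable lborel {a..b} (\<lambda>t. g t + g' t)"
    using assms by (intro set_integral_add) (auto simp: primitive_on_def)
  moreover have "x t + x' t - (x a + x' a) = (x t - x a) + (x' t - x' a)" for t
    by simp
  ultimately show ?thesis
    using assms unfolding primitive_on_def by (simp only:) simp
qed

lemma primitive_on_linear:
  assumes "primitive_on a b g x" "bounded_linear L"
  shows "primitive_on a b (\<lambda>t. L (g t)) (\<lambda>t. L (x t))"
proof -
  interpret L: bounded_linear L by fact
  have i: "set_integrable lborel A (\<lambda>t. L (g t))" if "set_integrable lborel A g" for A
    using integrable_bounded_linear[OF assms(2) that[unfolded set_integrable_def]]
    by (simp add: set_integrable_def L.scaleR)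
  have "(LBINT r:{a..t}. L (g r)) = L (LBINT r:{a..t}. g r)" if "t \<in> {a..b}" for t
  proof -
    have "set_integrable lborel {a..t} g"
      using assms that by (auto simp: primitive_on_def intro: set_integrable_subset)
    then show ?thesis
      using integral_bounded_linear[OF assms(2), of lborel "\<lambda>r. indicator {a..t} r *\<^sub>R g r"]
      by (simp add: set_integrable_def set_lebesgue_integral_def L.scaleR)
  qed
  then show ?thesis
    using assms i by (simp add: primitive_on_def flip: L.diff)
qed

lemma primitive_on_uminus:
  "primitive_on a b g x \<Longrightarrow> primitive_on a b (\<lambda>t. - g t) (\<lambda>t. - x t)"
  by (erule primitive_on_linear) (intro bounded_linear_minus bounded_linear_ident)

lemma primitive_on_diff_fun:
  assumes "primitive_on a b g x" "primitive_on a b g' x'"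
  shows "primitive_on a b (\<lambda>t. g t - g' t) (\<lambda>t. x t - x' t)"
  using primitive_on_add[OF assms(1) primitive_on_uminus[OF assms(2)]] by simp

lemma primitive_on_subinterval:
  assumes "primitive_on a b g x" "a \<le> a'" "b' \<le> b"
  shows "primitive_on a' b' g x"
proof -
  have "x t - x a' = (LBINT r:{a'..t}. g r)" if "t \<in> {a'..b'}" for t
    using primitive_on_diff[OF assms(1), of a' t] assms that by simp
  then show ?thesis
    using assms by (auto simp: primitive_on_def intro: set_integrable_subset)
qed

text \<open>Conservation laws are proved this way: a quantity is written as a product or a
  difference, its density cancels, and it keeps its initial value. Inverse flows, uniqueness of
  solutions and the explicit state formula rest on it.\<close>

lemma primitive_on_zero_AE:
  assumes "primitive_on a b g x" "AE r in lborel. r \<in> {a..b} \<longrightarrow> g r = 0" "t \<in> {a..b}"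
  shows "x t = x a"
proof -
  have "primitive_on a b (\<lambda>_. 0) x"
    by (rule primitive_on_cong_AE[OF assms(1)]) (use assms in \<open>auto simp: set_borel_measurable_def\<close>)
  from primitive_onD[OF this assms(3)] show ?thesis
    by (simp add: set_lebesgue_integral_def)
qed

lemma primitive_on_shift:
  assumes "primitive_on a b g x"
  shows "primitive_on (a + h) (b + h) (\<lambda>t. g (t - h)) (\<lambda>t. x (t - h))"
proof -
  have ind: "indicator {a + h..t} (h + r) = (indicator {a..t - h} r :: real)" for r t
    by (auto simp: indicator_def)
  have "set_integrable lborel {a + h..b + h} (\<lambda>t. g (t - h))"
    using assms lborel_integrable_real_affine_iff[of 1 "\<lambda>t. indicator {a+h..b+h} t *\<^sub>R g (t - h)" h]
    by (simp add: primitive_on_def set_integrable_def ind)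
  moreover have "(LBINT r:{a+h..t}. g (r - h)) = (LBINT r:{a..t-h}. g r)" for t
    using lborel_integral_real_affine[of 1 "\<lambda>r. indicator {a+h..t} r *\<^sub>R g (r - h)" h]
    by (simp add: set_lebesgue_integral_def ind)
  moreover have "t - h \<in> {a..b}" if "t \<in> {a+h..b+h}" for t
    using that by auto
  ultimately show ?thesis
    using assms by (simp add: primitive_on_def)
qed

text \<open>Time reversal, which turns the terminal value problem for the Riccati equation into an
  initial value problem.\<close>

lemma primitive_on_reflect:
  assumes "primitive_on 0 b g x"
  shows "primitive_on 0 b (\<lambda>t. - g (b - t)) (\<lambda>t. x (b - t))"
proof -
  have ind: "indicator {0..t} (b - r) = (indicator {b - t..b} r :: real)" for r t :: real
    by (auto simp: indicator_def)
  have "set_integrable lborel {0..b} (\<lambda>t. g (b - t))"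
    using assms lborel_integrable_real_affine_iff[of "-1" "\<lambda>t. indicator {0..b} t *\<^sub>R g (b - t)" b]
    by (simp add: primitive_on_def set_integrable_def ind)
  moreover have "(LBINT r:{0..t}. g (b - r)) = (LBINT r:{b-t..b}. g r)" for t
    using lborel_integral_real_affine[of "-1" "\<lambda>r. indicator {0..t} r *\<^sub>R g (b - r)" b]
    by (simp add: set_lebesgue_integral_def ind)
  moreover have "x (b - t) - x b = - (LBINT r:{b-t..b}. g r)" if "t \<in> {0..b}" for t
  proof -
    have "x b - x (b - t) = (LBINT r:{b-t..b}. g r)"
      by (rule primitive_on_diff[OF assms]) (use that in auto)
    then show ?thesis by (metis minus_diff_eq)
  qed
  ultimately show ?thesis
    unfolding primitive_on_def by (simp add: set_integrable_def set_lebesgue_integral_def)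
qed

lemma bounded_bilinear_borel_measurable:
  fixes prod :: "'a::euclidean_space \<Rightarrow> 'b::euclidean_space \<Rightarrow> 'c::euclidean_space"
  assumes "bounded_bilinear prod" "u \<in> borel_measurable N" "v \<in> borel_measurable N"
  shows "(\<lambda>w. prod (u w) (v w)) \<in> borel_measurable N"
  using assms(2,3) by (rule borel_measurable_continuous_Pair)
    (intro bounded_bilinear.continuous_on[OF assms(1)] continuous_intros)

proposition primitive_on_product:
  fixes prod :: "'a::euclidean_space \<Rightarrow> 'b::euclidean_space \<Rightarrow> 'c::euclidean_space"
  assumes bil: "bounded_bilinear prod"
    and x: "primitive_on a b f x" and y: "primitive_on a b g y"
  shows "primitive_on a b (\<lambda>t. prod (f t) (y t) + prod (x t) (g t)) (\<lambda>t. prod (x t) (y t))"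
proof (cases "a \<le> b")
  case False
  then show ?thesis by (auto simp: primitive_on_def)
next
  case True
  interpret B: bounded_bilinear prod by fact
  obtain K where K: "\<And>u v. norm (prod u v) \<le> norm u * norm v * K" "0 \<le> K"
    using B.nonneg_bounded by blast
  define f1 where "f1 = (\<lambda>t r. indicator {a..t} r *\<^sub>R f r)"
  define g1 where "g1 = (\<lambda>t r. indicator {a..t} r *\<^sub>R g r)"
  have f1i: "integrable lborel (f1 t)" and g1i: "integrable lborel (g1 t)" if "t \<le> b" for t
    using x y that set_integrable_subset[of lborel "{a..b}" _ "{a..t}"]
    by (auto simp: primitive_on_def f1_def g1_def set_integrable_def)
  define F where "F = (\<lambda>t. LBINT r:{a..t}. f r)"
  define G where "G = (\<lambda>t. LBINT r:{a..t}. g r)"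
  have F: "F t = (LBINT r. f1 t r)" and G: "G t = (LBINT r. g1 t r)" for t
    by (simp_all add: F_def G_def f1_def g1_def set_lebesgue_integral_def)
  have key: "integrable lborel (\<lambda>r. prod (f1 t r) (G r)) \<and> integrable lborel (\<lambda>r. prod (F r) (g1 t r)) \<and>
     prod (F t) (G t) = (LBINT r. prod (f1 t r) (G r)) + (LBINT r. prod (F r) (g1 t r))"
    if t: "t \<in> {a..b}" for t
  proof -
    have [measurable]: "f1 t \<in> borel_measurable borel" "g1 t \<in> borel_measurable borel"
      using f1i[of t] g1i[of t] t by (auto dest: borel_measurable_integrable)
    define H where "H = (\<lambda>r q. prod (f1 t r) (g1 t q))"
    have [measurable]: "(\<lambda>(r,q). H r q) \<in> borel_measurable (lborel \<Otimes>\<^sub>M lborel)"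
      unfolding H_def split_beta by (rule bounded_bilinear_borel_measurable[OF bil]) measurable
    have Hi: "integrable (lborel \<Otimes>\<^sub>M lborel) (\<lambda>(r,q). H r q)"
    proof (rule lborel_pair.Fubini_integrable)
      show "integrable lborel (\<lambda>r. LBINT q. norm (case (r, q) of (r, q) \<Rightarrow> H r q))"
      proof (rule Bochner_Integration.integrable_bound)
        show "integrable lborel (\<lambda>r. norm (f1 t r) * ((LBINT q. norm (g1 t q)) * K))"
          using f1i[of t] t by (intro integrable_mult_left integrable_norm) auto
        have "(LBINT q. norm (H r q)) \<le> norm (f1 t r) * ((LBINT q. norm (g1 t q)) * K)" for r
        proof -
          have "(LBINT q. norm (H r q)) \<le> (LBINT q. norm (f1 t r) * norm (g1 t q) * K)"
            using g1i[of t] t K by (intro integral_mono' integrable_mult_left integrable_mult_right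
               integrable_norm) (auto simp: H_def)
          also have "\<dots> = norm (f1 t r) * ((LBINT q. norm (g1 t q)) * K)"
            by (simp add: mult.assoc)
          finally show ?thesis .
        qed
        then show "AE r in lborel. norm (LBINT q. norm (case (r, q) of (r, q) \<Rightarrow> H r q))
            \<le> norm (norm (f1 t r) * ((LBINT q. norm (g1 t q)) * K))"
          using K by (intro AE_I2) (simp add: abs_of_nonneg integral_nonneg_AE)
      qed measurable
      show "AE r in lborel. integrable lborel (\<lambda>q. case (r, q) of (r, q) \<Rightarrow> H r q)"
        using g1i[of t] t unfolding H_def prod.case
        by (intro AE_I2 integrable_bounded_linear[OF B.bounded_linear_right]) auto
    qed measurable
    \<comment> \<open>The two triangles of the square; the diagonal goes with
      \<open>H1\<close>.\<close>
    define H1 where "H1 = (\<lambda>r q. if q \<le> r then H r q else 0)"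
    define H2 where "H2 = (\<lambda>r q. if r < q then H r q else 0)"
    have H1i: "integrable (lborel \<Otimes>\<^sub>M lborel) (\<lambda>(r,q). H1 r q)"
      by (rule Bochner_Integration.integrable_bound[OF Hi]) (auto simp: H1_def split_beta)
    have H2i: "integrable (lborel \<Otimes>\<^sub>M lborel) (\<lambda>(r,q). H2 r q)"
      by (rule Bochner_Integration.integrable_bound[OF Hi]) (auto simp: H2_def split_beta)
    have H1r: "(LBINT q. H1 r q) = prod (f1 t r) (G r)" for r
    proof (cases "r \<in> {a..t}")
      case True
      have "H1 r q = prod (f1 t r) (g1 r q)" for q
        using True by (auto simp: H1_def H_def g1_def indicator_def B.zero_right)
      then show ?thesis
        using g1i[of r] True t by (simp add: G integral_bounded_linear[OF B.bounded_linear_right])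
    next
      case False
      then have "H1 r q = 0" "f1 t r = 0" for q
        by (auto simp: H1_def H_def f1_def B.zero_left)
      then show ?thesis by (simp add: B.zero_left)
    qed
    have H2q: "(LBINT r. H2 r q) = prod (F q) (g1 t q)" for q
    proof (cases "q \<in> {a..t}")
      case True
      \<comment> \<open>The strict inequality \<open>r < q\<close> in \<open>H2\<close> and the
        closed interval \<open>{a..q}\<close> in \<open>f1 q\<close> differ only at
        \<open>r = q\<close>, a null set.\<close>
      have "(LBINT r. H2 r q) = (LBINT r. prod (f1 q r) (g1 t q))"
      proof (rule integral_discrete_difference[where X="{q}"])
        fix r assume "r \<notin> {q}"
        then show "H2 r q = prod (f1 q r) (g1 t q)"
          using True by (auto simp: H2_def H_def f1_def indicator_def B.zero_left)
      qed auto
      then show ?thesis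
        using f1i[of q] True t by (simp add: F integral_bounded_linear[OF B.bounded_linear_left])
    next
      case False
      then have "H2 r q = 0" "g1 t q = 0" for r
        by (auto simp: H2_def H_def g1_def B.zero_right)
      then show ?thesis by (simp add: B.zero_right)
    qed
    have i1: "integrable lborel (\<lambda>r. prod (f1 t r) (G r))"
      using lborel_pair.integrable_fst[OF H1i] by (simp add: H1r)
    have i2: "integrable lborel (\<lambda>r. prod (F r) (g1 t r))"
      using lborel_pair.integrable_snd[OF H2i] by (simp add: H2q)
    have "(LBINT r. LBINT q. H r q) = (LBINT r. prod (f1 t r) (G t))"
      using g1i[of t] t unfolding H_def
      by (simp add: G integral_bounded_linear[OF B.bounded_linear_right])
    also have "\<dots> = prod (F t) (G t)"
      using f1i[of t] t by (simp add: F integral_bounded_linear[OF B.bounded_linear_left])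
    finally have "prod (F t) (G t) = integral\<^sup>L (lborel \<Otimes>\<^sub>M lborel) (\<lambda>(r,q). H r q)"
      using lborel_pair.integral_fst[OF Hi] by simp
    also have "(\<lambda>(r,q). H r q) = (\<lambda>w. (\<lambda>(r,q). H1 r q) w + (\<lambda>(r,q). H2 r q) w)"
      by (auto simp: H1_def H2_def)
    also have "integral\<^sup>L (lborel \<Otimes>\<^sub>M lborel) \<dots> =
        integral\<^sup>L (lborel \<Otimes>\<^sub>M lborel) (\<lambda>(r,q). H1 r q) + integral\<^sup>L (lborel \<Otimes>\<^sub>M lborel) (\<lambda>(r,q). H2 r q)"
      by (rule Bochner_Integration.integral_add[OF H1i H2i])
    also have "integral\<^sup>L (lborel \<Otimes>\<^sub>M lborel) (\<lambda>(r,q). H1 r q) = (LBINT r. prod (f1 t r) (G r))"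
      using lborel_pair.integral_fst[OF H1i] by (simp add: H1r)
    also have "integral\<^sup>L (lborel \<Otimes>\<^sub>M lborel) (\<lambda>(r,q). H2 r q) = (LBINT r. prod (F r) (g1 t r))"
      using lborel_pair.integral_snd[OF H2i] by (simp add: H2q)
    finally show ?thesis using i1 i2 by simp
  qed
  have xF: "x r = x a + F r" and yG: "y r = y a + G r" if "r \<in> {a..b}" for r
    unfolding F_def G_def using primitive_onD[OF x that] primitive_onD[OF y that] .
  \<comment> \<open>The values at \<open>a\<close> are put back by bilinearity: two terms are linear
    in \<open>f1\<close> or \<open>g1\<close> alone, the other two are those of
    \<open>key\<close>.\<close>
  have e: "indicator {a..t} r *\<^sub>R (prod (f r) (y r) + prod (x r) (g r)) =
     (prod (f1 t r) (y a) + prod (f1 t r) (G r)) + (prod (x a) (g1 t r) + prod (F r) (g1 t r))"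
    if "t \<in> {a..b}" for t r
  proof (cases "r \<in> {a..t}")
    case True
    then have "r \<in> {a..b}" using that by auto
    then show ?thesis
      using True by (simp add: f1_def g1_def xF[of r] yG[of r] B.add_left B.add_right)
  qed (simp_all add: f1_def g1_def B.zero_left B.zero_right)
  have i3: "integrable lborel (\<lambda>r. prod (f1 t r) (y a))" "integrable lborel (\<lambda>r. prod (x a) (g1 t r))"
    if "t \<in> {a..b}" for t
    using f1i[of t] g1i[of t] that integrable_bounded_linear[OF B.bounded_linear_left]
      integrable_bounded_linear[OF B.bounded_linear_right] by auto
  show ?thesis
    unfolding primitive_on_def
  proof (intro conjI ballI)
    show "set_integrable lborel {a..b} (\<lambda>t. prod (f t) (y t) + prod (x t) (g t))"
      unfolding set_integrable_def using key[of b] i3[of b] True by (simp add: e)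
    fix t assume t: "t \<in> {a..b}"
    have "(LBINT r:{a..t}. prod (f r) (y r) + prod (x r) (g r)) =
        (LBINT r. prod (f1 t r) (y a)) + (LBINT r. prod (f1 t r) (G r)) +
        ((LBINT r. prod (x a) (g1 t r)) + (LBINT r. prod (F r) (g1 t r)))"
      unfolding set_lebesgue_integral_def using key[OF t] i3[OF t] t by (simp add: e)
    also have "(LBINT r. prod (f1 t r) (y a)) = prod (F t) (y a)"
      using f1i[of t] t by (simp add: F integral_bounded_linear[OF B.bounded_linear_left])
    also have "(LBINT r. prod (x a) (g1 t r)) = prod (x a) (G t)"
      using g1i[of t] t by (simp add: G integral_bounded_linear[OF B.bounded_linear_right])
    finally show "prod (x t) (y t) - prod (x a) (y a) = (LBINT r:{a..t}. prod (f r) (y r) + prod (x r) (g r))"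
      using key[OF t] by (simp add: xF[OF t] yG[OF t] B.add_left B.add_right)
  qed
qed

text \<open>Integrating factor: \<open>exp (- C * t)\<close> times the integral of \<open>u\<close>
  starts at 0 and never increases, so the integral is at most 0, and then so is
  \<open>u\<close>.\<close>

lemma gronwall_zero:
  fixes u :: "real \<Rightarrow> real"
  assumes u: "continuous_on {a..b} u" and C: "\<And>t. t \<in> {a..b} \<Longrightarrow> u t \<le> C * integral {a..t} u"
    and nn: "\<And>t. t \<in> {a..b} \<Longrightarrow> 0 \<le> u t" and t: "t \<in> {a..b}" and "0 \<le> C"
  shows "u t = 0"
proof (cases "a < t")
  case True
  have sub: "{a..t} \<subseteq> {a..b}" using t by auto
  have ut: "continuous_on {a..t} u" using u sub by (rule continuous_on_subset)
  define v where "v = (\<lambda>t. exp (- C * t) * integral {a..t} u)"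
  have "v t \<le> v a"
  proof (rule DERIV_nonpos_imp_decreasing_open[of a t v])
    show "a \<le> t" using t by simp
  next
    fix s assume s: "a < s" "s < t"
    have "((\<lambda>t. integral {a..t} u) has_real_derivative u s) (at s within {a..t})"
      using integral_has_vector_derivative[OF ut, of s] s
      by (simp add: has_real_derivative_iff_has_vector_derivative)
    then have "((\<lambda>t. integral {a..t} u) has_real_derivative u s) (at s)"
      using s by (simp add: at_within_Icc_at)
    moreover have "((\<lambda>t. exp (- C * t)) has_real_derivative - C * exp (- C * s)) (at s)"
      by (auto intro!: derivative_eq_intros)
    ultimately have "(v has_real_derivative
        exp (- C * s) * u s + - C * exp (- C * s) * integral {a..s} u) (at s)"
      unfolding v_def by (rule DERIV_mult'[rotated])
    then have "(v has_real_derivative exp (- C * s) * (u s - C * integral {a..s} u)) (at s)"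
      by (simp add: algebra_simps)
    moreover have "exp (- C * s) * (u s - C * integral {a..s} u) \<le> 0"
      using C[of s] s t by (intro mult_nonneg_nonpos) auto
    ultimately show "\<exists>y. (v has_real_derivative y) (at s) \<and> y \<le> 0" by blast
  next
    show "continuous_on {a..t} v" unfolding v_def
      by (intro continuous_intros indefinite_integral_continuous_1 integrable_continuous_interval ut)
  qed
  then have "integral {a..t} u \<le> 0"
    by (simp add: v_def mult_le_0_iff)
  then have "u t \<le> 0"
    using C[OF t] \<open>0 \<le> C\<close> by (meson mult_nonneg_nonpos order_trans)
  then show ?thesis using nn[OF t] by simp
next
  case False
  then show ?thesis using C[OF t] nn[OF t] t by simp
qed

text \<open>Uniqueness for linear equations with merely measurable coefficients: the continuous
  function \<open>norm (x t)\<close> satisfies the integral inequality at every time, although the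
  density is bounded only almost everywhere.\<close>

lemma primitive_on_gronwall:
  fixes x :: "real \<Rightarrow> 'a::euclidean_space"
  assumes x: "primitive_on a b g x" and "x a = 0"
    and C: "AE r in lborel. r \<in> {a..b} \<longrightarrow> norm (g r) \<le> C * norm (x r)" and t: "t \<in> {a..b}"
  shows "x t = 0"
proof -
  have c: "continuous_on {a..b} (\<lambda>t. norm (x t))"
    using primitive_on_continuous[OF x] by (rule continuous_on_norm)
  \<comment> \<open>\<open>gronwall_zero\<close> asks for a nonnegative constant.\<close>
  have C': "AE r in lborel. r \<in> {a..b} \<longrightarrow> norm (g r) \<le> \<bar>C\<bar> * norm (x r)"
    using C by eventually_elim (meson abs_ge_self mult_right_mono norm_ge_zero order_trans)
  have "norm (x t) \<le> \<bar>C\<bar> * integral {a..t} (\<lambda>t. norm (x t))" if t: "t \<in> {a..b}" for t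
  proof -
    have ct: "continuous_on {a..t} (\<lambda>t. norm (x t))"
      by (rule continuous_on_subset[OF c]) (use t in auto)
    then have i: "set_integrable lborel {a..t} (\<lambda>t. norm (x t))"
      by (rule borel_integrable_atLeastAtMost')
    have gi: "set_integrable lborel {a..t} g"
      using primitive_on_integrable[OF x] by (rule set_integrable_subset) (use t in auto)
    have "norm (x t) = norm (LBINT r:{a..t}. g r)"
      using primitive_onD[OF x t] assms(2) by simp
    also have "\<dots> \<le> (LBINT r:{a..t}. norm (g r))"
      using gi unfolding set_integrable_def set_lebesgue_integral_def
      by (intro order_trans[OF integral_norm_bound]) simp
    also have "\<dots> \<le> (LBINT r:{a..t}. \<bar>C\<bar> * norm (x r))"
      by (rule set_integral_mono_AE) (use C' t i set_integrable_norm[OF gi] in auto)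
    also have "\<dots> = \<bar>C\<bar> * integral {a..t} (\<lambda>t. norm (x t))"
      by (simp add: set_borel_integral_eq_integral(2)[OF i])
    finally show ?thesis .
  qed
  from gronwall_zero[OF c this _ t] show ?thesis by simp
qed

section \<open>Matrices\<close>

lemma bounded_bilinear_matrix_mult:
  "bounded_bilinear ((**) :: real^'n^'m \<Rightarrow> real^'p^'n \<Rightarrow> real^'p^'m)"
  unfolding bilinear_conv_bounded_bilinear[symmetric] bilinear_def
  by (auto intro!: linearI simp: vec_eq_iff matrix_matrix_mult_def sum.distrib algebra_simps
      sum_distrib_left)

lemma bounded_bilinear_matrix_vector_mult:
  "bounded_bilinear ((*v) :: real^'n^'m \<Rightarrow> real^'n \<Rightarrow> real^'m)"
  unfolding bilinear_conv_bounded_bilinear[symmetric] bilinear_def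
  by (auto intro!: linearI simp: vec_eq_iff matrix_vector_mult_def sum.distrib algebra_simps
      sum_distrib_left)

interpretation mm: bounded_bilinear "(**) :: real^'n^'m \<Rightarrow> real^'p^'n \<Rightarrow> real^'p^'m"
  by (rule bounded_bilinear_matrix_mult)

interpretation mv: bounded_bilinear "(*v) :: real^'n^'m \<Rightarrow> real^'n \<Rightarrow> real^'m"
  by (rule bounded_bilinear_matrix_vector_mult)

lemma bounded_linear_transpose: "bounded_linear (transpose :: real^'n^'m \<Rightarrow> real^'m^'n)"
  unfolding linear_conv_bounded_linear[symmetric]
  by (auto intro!: linearI simp: vec_eq_iff transpose_def)

lemmas transpose_diff = linear_diff[OF bounded_linear.linear[OF bounded_linear_transpose]]
lemmas transpose_minus = linear_neg[OF bounded_linear.linear[OF bounded_linear_transpose]]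

lemmas borel_measurable_matrix_mult [measurable (raw)] =
  bounded_bilinear_borel_measurable[OF bounded_bilinear_matrix_mult]

lemmas borel_measurable_matrix_vector_mult [measurable (raw)] =
  bounded_bilinear_borel_measurable[OF bounded_bilinear_matrix_vector_mult]

lemma borel_measurable_transpose [measurable (raw)]:
  fixes f :: "'a \<Rightarrow> real^'n^'m"
  assumes "f \<in> borel_measurable N"
  shows "(\<lambda>x. transpose (f x)) \<in> borel_measurable N"
  using assms by (intro borel_measurable_continuous_on[OF _ assms] bounded_linear.continuous_on[OF bounded_linear_transpose] continuous_intros)

text \<open>Turns vector estimates into a bound on the matrix. It is applied to inverses, which are
  controlled only through their action on vectors.\<close>

lemma norm_matrix_le_columns:
  fixes M :: "real^'n^'m"
  shows "norm M \<le> (\<Sum>i\<in>(UNIV::'m set). \<Sum>j\<in>(UNIV::'n set). norm (M *v axis j 1))"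
proof -
  have "norm (M $ i) \<le> (\<Sum>j\<in>UNIV. norm (M *v axis j 1))" for i
  proof -
    have "norm (M $ i $ j) \<le> norm (M *v axis j 1)" for j
      using component_le_norm_cart[of "M *v axis j 1" i]
      by (simp add: matrix_vector_mult_basis column_def)
    then show ?thesis
      by (intro order_trans[OF norm_le_l1_cart] sum_mono) simp
  qed
  moreover have "norm M \<le> (\<Sum>i\<in>UNIV. norm (M $ i))"
    unfolding norm_vec_def[of M] by (rule L2_set_le_sum) simp
  ultimately show ?thesis by (meson order_trans sum_mono)
qed

lemma psd_matricesD:
  assumes "S \<in> psd_matrices"
  shows "transpose S = S" "0 \<le> x \<bullet> (S *v x)"
  using assms by (auto simp: psd_matrices_def)

lemma symmetric_matrix_inner:
  fixes S :: "real^'n^'n"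
  assumes "transpose S = S"
  shows "x \<bullet> (S *v y) = (S *v x) \<bullet> y"
  using dot_lmul_matrix[of x S y] assms by (metis transpose_matrix_vector)

lemma matrix_inner_transpose:
  fixes S :: "real^'n^'m"
  shows "x \<bullet> (S *v y) = (transpose S *v x) \<bullet> y"
  using dot_lmul_matrix[of x S y] by (simp add: transpose_matrix_vector)

text \<open>The form is tested at \<open>x - e *\<^sub>R w\<close> with \<open>w = S *v x\<close>:
  the term linear in \<open>e\<close> is \<open>- 2 * e * (w \<bullet> w)\<close>, and for small
  \<open>e\<close> it would make the value negative unless \<open>w = 0\<close>.\<close>

lemma psd_matrix_eq_0:
  fixes S :: "real^'n^'n"
  assumes S: "S \<in> psd_matrices" and "x \<bullet> (S *v x) = 0"
  shows "S *v x = 0"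
proof -
  define w where "w = S *v x"
  define c where "c = w \<bullet> (S *v w)"
  have "2 * (w \<bullet> w) \<le> e * c" if "0 < e" for e
  proof -
    have "0 \<le> (x - e *\<^sub>R w) \<bullet> (S *v (x - e *\<^sub>R w))"
      by (rule psd_matricesD[OF S])
    also have "\<dots> = e * (e * c) - 2 * e * (w \<bullet> w)"
      using assms(2) symmetric_matrix_inner[OF psd_matricesD(1)[OF S], of x w]
      by (simp add: mv.diff_right mv.scaleR_right inner_diff_left inner_diff_right c_def
          w_def[symmetric] inner_commute algebra_simps)
    finally have "e * (2 * (w \<bullet> w)) \<le> e * (e * c)" by (simp add: algebra_simps)
    then show ?thesis using that by simp
  qed
  \<comment> \<open>For this \<open>e\<close> the product \<open>e * c\<close> is at most
    \<open>w \<bullet> w\<close>, which contradicts the bound unless \<open>w \<bullet> w\<close>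
    vanishes.\<close>
  then have "0 < (w \<bullet> w) / (\<bar>c\<bar> + 1) \<longrightarrow> 2 * (w \<bullet> w) \<le> (w \<bullet> w) / (\<bar>c\<bar> + 1) * c"
    by blast
  then have "w \<bullet> w \<le> 0"
  proof (rule contrapos_pp)
    assume a: "\<not> w \<bullet> w \<le> 0"
    have "(w \<bullet> w) / (\<bar>c\<bar> + 1) * c \<le> w \<bullet> w"
      using a by (simp add: divide_simps mult_left_mono)
    then show "\<not> (0 < w \<bullet> w / (\<bar>c\<bar> + 1) \<longrightarrow> 2 * (w \<bullet> w) \<le> w \<bullet> w / (\<bar>c\<bar> + 1) * c)"
      using a by (auto simp: zero_less_divide_iff)
  qed
  then have "w \<bullet> w = 0" using inner_ge_zero[of w] by linarith
  then have "w = 0" by simp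
  then show ?thesis by (simp add: w_def)
qed

lemma psd_matrices_congruence:
  fixes S :: "real^'n^'n" and V :: "real^'m^'n"
  assumes "S \<in> psd_matrices"
  shows "transpose V ** S ** V \<in> psd_matrices"
proof -
  have "x \<bullet> ((transpose V ** S ** V) *v x) = (V *v x) \<bullet> (S *v (V *v x))" for x
    using matrix_inner_transpose[of x "transpose V"]
    by (simp add: matrix_vector_mul_assoc[symmetric])
  then show ?thesis
    using psd_matricesD[OF assms] by (simp add: psd_matrices_def matrix_transpose_mul matrix_mul_assoc)
qed

lemma pd_matrix_invertible:
  fixes R :: "real^'n^'n"
  assumes "R \<in> pd_matrices"
  shows "matrix_inv R ** R = mat 1" "R ** matrix_inv R = mat 1" "transpose (matrix_inv R) = matrix_inv R"
    "matrix_inv R \<in> psd_matrices"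
proof -
  have pd: "transpose R = R" "\<And>x. x \<noteq> 0 \<Longrightarrow> 0 < x \<bullet> (R *v x)"
    using assms by (auto simp: pd_matrices_def)
  have "x = 0" if "R *v x = 0" for x
    using pd(2)[of x] that by force
  then have inv: "invertible R"
    using matrix_left_invertible_ker invertible_left_inverse by blast
  then show 1: "matrix_inv R ** R = mat 1" "R ** matrix_inv R = mat 1"
    unfolding matrix_inv_def invertible_def by (metis (mono_tags, lifting) someI_ex)+
  have "transpose (matrix_inv R) ** R = mat 1"
    using 1(2) pd(1) by (metis matrix_transpose_mul transpose_mat)
  then show 2: "transpose (matrix_inv R) = matrix_inv R"
    by (metis 1(2) matrix_mul_assoc matrix_mul_lid matrix_mul_rid)
  have "0 \<le> x \<bullet> (matrix_inv R *v x)" for x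
  proof -
    define y where "y = matrix_inv R *v x"
    have x: "x = R *v y" by (simp add: y_def matrix_vector_mul_assoc 1)
    have "0 \<le> y \<bullet> (R *v y)" using pd(2)[of y] by (cases "y = 0") auto
    then show ?thesis by (simp add: y_def[symmetric]) (simp add: x inner_commute)
  qed
  then show "matrix_inv R \<in> psd_matrices" by (simp add: psd_matrices_def 2)
qed

section \<open>Essentially bounded coefficients\<close>

text \<open>The exceptional null set and everything outside \<open>I\<close> are overwritten with
  the default \<open>d\<close>, so that the bound and the constraint hold at every time, as linear
  algebra at a fixed time requires.\<close>

lemma Linf_on_representative:
  assumes "Linf_on I S f" "I \<in> sets borel" "d \<in> S"
  obtains g C where "g \<in> borel_measurable borel" "\<And>t. norm (g t) \<le> C" "\<And>t. g t \<in> S"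
    "AE t in lborel. t \<in> I \<longrightarrow> g t = f t"
proof -
  obtain C where C: "AE t in lborel. t \<in> I \<longrightarrow> norm (f t) \<le> C"
    using assms(1) by (auto simp: Linf_on_def)
  have "AE t in lborel. t \<in> I \<longrightarrow> norm (f t) \<le> C \<and> f t \<in> S"
    using assms(1) C by (auto simp: Linf_on_def)
  then obtain N where N: "{t. \<not> (t \<in> I \<longrightarrow> norm (f t) \<le> C \<and> f t \<in> S)} \<subseteq> N"
    "N \<in> null_sets lborel"
    by (auto elim!: AE_E simp: null_sets_def)
  \<comment> \<open>The indicator is there because only \<open>indicator I t *\<^sub>R f t\<close>
    is known to be measurable.\<close>
  define g where "g = (\<lambda>t. if t \<in> I - N then indicator I t *\<^sub>R f t else d)"
  have [measurable]: "N \<in> sets borel" "I \<in> sets borel" "(\<lambda>t. indicator I t *\<^sub>R f t) \<in> borel_measurable borel"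
    using N assms by (auto simp: null_sets_def Linf_on_def set_borel_measurable_def)
  have "g \<in> borel_measurable borel"
    unfolding g_def by measurable
  moreover have "norm (g t) \<le> max C (norm d)" "g t \<in> S" for t
    using N assms(3) by (auto simp: g_def le_max_iff_disj)
  moreover have "AE t in lborel. t \<in> I \<longrightarrow> g t = f t"
    using AE_not_in[OF N(2)] by eventually_elim (auto simp: g_def)
  ultimately show ?thesis using that by blast
qed

lemma set_integrable_bounded_Icc:
  fixes g :: "real \<Rightarrow> 'a::euclidean_space"
  assumes "set_borel_measurable lborel {a..b} g" "\<And>r. r \<in> {a..b} \<Longrightarrow> norm (g r) \<le> K"
  shows "set_integrable lborel {a..b} g"
  unfolding set_integrable_def
proof (rule Bochner_Integration.integrable_bound)
  show "integrable lborel (\<lambda>r. indicator {a..b} r *\<^sub>R K)"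
    using integrable_real_indicator[of "{a..b}" lborel]
    by (intro integrable_scaleR_left) (auto simp: emeasure_lborel_Icc_eq)
  show "(\<lambda>x. indicat_real {a..b} x *\<^sub>R g x) \<in> borel_measurable lborel"
    using assms(1) by (simp add: set_borel_measurable_def)
  show "AE x in lborel. norm (indicat_real {a..b} x *\<^sub>R g x) \<le> norm (indicat_real {a..b} x *\<^sub>R K)"
    using assms(2) by (auto simp: indicator_def intro!: AE_I2 intro: order_trans[OF _ abs_ge_self])
qed

lemma set_borel_measurable_bilinear:
  fixes prod :: "'a::euclidean_space \<Rightarrow> 'b::euclidean_space \<Rightarrow> 'c::euclidean_space"
  assumes "bounded_bilinear prod" "set_borel_measurable N I u" "set_borel_measurable N I v"
  shows "set_borel_measurable N I (\<lambda>r. prod (u r) (v r))"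
proof -
  interpret bounded_bilinear prod by fact
  have "indicator I r *\<^sub>R prod (u r) (v r) = prod (indicator I r *\<^sub>R u r) (indicator I r *\<^sub>R v r)" for r
    by (simp add: scaleR_left scaleR_right indicator_def)
  then show ?thesis
    using bounded_bilinear_borel_measurable[OF assms(1)] assms(2,3)
    by (simp add: set_borel_measurable_def)
qed

lemma continuous_on_set_borel_measurable:
  fixes x :: "real \<Rightarrow> 'a::euclidean_space"
  assumes "continuous_on {a..b} x"
  shows "set_borel_measurable lborel {a..b} x"
  using set_measurable_continuous_on[OF _ assms] by (simp add: set_borel_measurable_def)

section \<open>Linear equations with bounded measurable coefficients\<close>

text \<open>Expanding \<open>x r\<close> in the basis reduces the claim to the measurability of
  \<open>f r i\<close> for finitely many fixed vectors \<open>i\<close>.\<close>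

lemma borel_measurable_linear_family:
  fixes f :: "real \<Rightarrow> 'a::euclidean_space \<Rightarrow> 'a"
  assumes lin: "\<And>r. linear (f r)" and meas: "\<And>v. (\<lambda>r. f r v) \<in> borel_measurable borel"
    and x: "set_borel_measurable lborel {a..b} x"
  shows "set_borel_measurable lborel {a..b} (\<lambda>r. f r (x r))"
proof -
  have "indicator {a..b} r *\<^sub>R f r (x r) =
      (\<Sum>i\<in>Basis. ((indicator {a..b} r *\<^sub>R x r) \<bullet> i) *\<^sub>R f r i)" for r
  proof -
    have "f r (x r) = f r (\<Sum>i\<in>Basis. (x r \<bullet> i) *\<^sub>R i)"
      by (simp add: euclidean_representation)
    also have "\<dots> = (\<Sum>i\<in>Basis. (x r \<bullet> i) *\<^sub>R f r i)"
      by (simp add: linear_sum[OF lin] linear_scale[OF lin])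
    finally show ?thesis by (simp add: scaleR_sum_right)
  qed
  moreover have [measurable]: "(\<lambda>r. indicator {a..b} r *\<^sub>R x r) \<in> borel_measurable borel"
    using x by (simp add: set_borel_measurable_def)
  note meas[measurable]
  have "(\<lambda>r. \<Sum>i\<in>Basis. ((indicator {a..b} r *\<^sub>R x r) \<bullet> i) *\<^sub>R f r i) \<in> borel_measurable borel"
    by measurable
  ultimately show ?thesis
    by (simp add: set_borel_measurable_def)
qed

text \<open>Picard iteration written as a series. The terms are dominated by
  \<open>norm x0 * ((K * t) ^ n / fact n)\<close>, so they sum on the whole interval at once, and
  the sum may be exchanged with the integral.\<close>

proposition linear_equation_solution_exists:
  fixes f :: "real \<Rightarrow> 'a::euclidean_space \<Rightarrow> 'a"
  assumes lin: "\<And>r. linear (f r)" and meas: "\<And>v. (\<lambda>r. f r v) \<in> borel_measurable borel"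
    and C: "\<And>r v. norm (f r v) \<le> C * norm v"
  obtains x where "primitive_on 0 b (\<lambda>r. f r (x r)) x" "x 0 = x0"
proof -
  define K where "K = \<bar>C\<bar>"
  have K: "norm (f r v) \<le> K * norm v" "0 \<le> K" for r v
    using order_trans[OF C mult_right_mono[OF abs_ge_self norm_ge_zero], of r v] by (auto simp: K_def)
  \<comment> \<open>\<open>y n\<close> is the n-th increment of the Picard iteration, not the n-th
    iterate.\<close>
  define y where "y = rec_nat (\<lambda>_. x0) (\<lambda>_ y t. LBINT r:{0..t}. f r (y r))"
  have y0: "y 0 = (\<lambda>_. x0)" and yS: "y (Suc n) = (\<lambda>t. LBINT r:{0..t}. f r (y n r))" for n
    by (simp_all add: y_def)
  have fi: "set_integrable lborel {0..t} (\<lambda>r. f r (x r))" if "continuous_on {0..t} x" for x t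
  proof -
    have "compact (x ` {0..t})" using that by (intro compact_continuous_image) auto
    then obtain c where c: "\<And>r. r \<in> {0..t} \<Longrightarrow> norm (x r) \<le> c"
      using compact_imp_bounded bounded_iff by (metis imageI)
    have "norm (f r (x r)) \<le> K * c" if "r \<in> {0..t}" for r
      using K c[OF that] by (meson mult_left_mono order_trans)
    then show ?thesis
      using borel_measurable_linear_family[OF lin meas continuous_on_set_borel_measurable[OF that]]
      by (intro set_integrable_bounded_Icc) auto
  qed
  have y: "continuous_on {0..b} (y n) \<and> (\<forall>t\<in>{0..b}. norm (y n t) \<le> norm x0 * ((K * t) ^ n / fact n))" for n
  proof (induction n)
    case 0
    then show ?case by (simp add: y0)
  next
    case (Suc n)
    have "norm (y (Suc n) t) \<le> norm x0 * ((K * t) ^ Suc n / fact (Suc n))" if t: "t \<in> {0..b}" for t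
    proof -
      have i: "set_integrable lborel {0..t} (\<lambda>r. f r (y n r))"
        using t by (intro fi continuous_on_subset[OF conjunct1[OF Suc]]) auto
      have p: "has_bochner_integral lborel (\<lambda>r. r ^ n * indicator {0..t} r) (t ^ Suc n / Suc n)"
      proof -
        have "has_bochner_integral lborel (\<lambda>r. r ^ n * indicator {0..t} r)
            (t ^ Suc n / Suc n - 0 ^ Suc n / Suc n)"
          by (rule has_bochner_integral_FTC_Icc_nonneg[where F="\<lambda>r. r ^ Suc n / Suc n"])
            (use t in \<open>auto intro!: derivative_eq_intros simp del: of_nat_Suc power_Suc\<close>)
        then show ?thesis by simp
      qed
      have "norm (y (Suc n) t) \<le> (LBINT r:{0..t}. norm (f r (y n r)))"
        unfolding yS using i unfolding set_integrable_def set_lebesgue_integral_def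
        by (intro order_trans[OF integral_norm_bound]) simp
      also have "\<dots> \<le> (LBINT r. K * (norm x0 * K ^ n / fact n) * (r ^ n * indicator {0..t} r))"
        unfolding set_lebesgue_integral_def
      proof (rule integral_mono)
        show "integrable lborel (\<lambda>r. indicat_real {0..t} r *\<^sub>R norm (f r (y n r)))"
          using set_integrable_norm[OF i] by (simp add: set_integrable_def)
        show "integrable lborel (\<lambda>r. K * (norm x0 * K ^ n / fact n) * (r ^ n * indicator {0..t} r))"
          using p by (intro integrable_mult_right) (auto simp: has_bochner_integral_iff)
        fix r
        show "indicat_real {0..t} r *\<^sub>R norm (f r (y n r)) \<le>
           K * (norm x0 * K ^ n / fact n) * (r ^ n * indicator {0..t} r)"
        proof (cases "r \<in> {0..t}")
          case True
          then have "norm (y n r) \<le> norm x0 * ((K * r) ^ n / fact n)"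
            using Suc t by auto
          then have "norm (f r (y n r)) \<le> K * (norm x0 * ((K * r) ^ n / fact n))"
            using K by (meson mult_left_mono order_trans)
          then show ?thesis using True by (simp add: power_mult_distrib mult_ac)
        qed simp
      qed
      also have "\<dots> = K * (norm x0 * K ^ n / fact n) * (t ^ Suc n / Suc n)"
        using p by (simp add: has_bochner_integral_iff)
      also have "\<dots> = norm x0 * ((K * t) ^ Suc n / fact (Suc n))"
        by (simp add: power_mult_distrib divide_simps)
      finally show ?thesis .
    qed
    moreover have "continuous_on {0..b} (y (Suc n))"
      unfolding yS using Suc fi by (intro continuous_on_set_integral_Icc) auto
    ultimately show ?case by blast
  qed
  have sm: "summable (\<lambda>n. c * ((K * t) ^ n / fact n))" for t c :: real
    using summable_exp_generic[of "K * t"] by (intro summable_mult) (simp add: divide_inverse mult.commute)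
  have ys: "summable (\<lambda>n. norm (y n t))" if "t \<in> {0..b}" for t
    by (rule summable_comparison_test'[OF sm[of "norm x0" t]]) (use y that in auto)
  define x where "x = (\<lambda>t. \<Sum>n. y n t)"
  have fs: "(\<lambda>n. f r (y n r)) sums f r (x r)" if "r \<in> {0..b}" for r
    using bounded_linear.sums[OF lin[unfolded linear_conv_bounded_linear] summable_sums[OF summable_norm_cancel[OF ys[OF that]]]]
    by (simp add: x_def)
  have step: "set_integrable lborel {0..t} (\<lambda>r. f r (x r)) \<and> x t = x0 + (LBINT r:{0..t}. f r (x r))"
    if t: "t \<in> {0..b}" for t
  proof -
    define g where "g = (\<lambda>n r. indicator {0..t} r *\<^sub>R f r (y n r))"
    have gi: "integrable lborel (g n)" for n
      using t fi[of t "y n"] y continuous_on_subset[of "{0..b}" "y n" "{0..t}"]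
      by (auto simp: g_def set_integrable_def)
    have gb: "norm (g n r) \<le> indicator {0..t} r * (K * norm x0 * ((K * t) ^ n / fact n))" for n r
    proof (cases "r \<in> {0..t}")
      case True
      then have "norm (y n r) \<le> norm x0 * ((K * r) ^ n / fact n)" using y t by auto
      also have "\<dots> \<le> norm x0 * ((K * t) ^ n / fact n)"
        using True K by (intro mult_left_mono divide_right_mono power_mono) auto
      finally have "norm (f r (y n r)) \<le> K * (norm x0 * ((K * t) ^ n / fact n))"
        using K by (meson mult_left_mono order_trans)
      then show ?thesis using True by (simp add: g_def mult.assoc)
    qed (simp add: g_def)
    have s1: "summable (\<lambda>n. norm (g n r))" for r
    proof (rule summable_comparison_test'[OF sm[of "K * norm x0" t]])
      fix n
      have "indicator {0..t} r * (K * norm x0 * ((K * t) ^ n / fact n)) \<le> 1 * (K * norm x0 * ((K * t) ^ n / fact n))"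
        using K t by (intro mult_right_mono) (auto simp: indicator_def)
      with gb[of n r] show "norm (norm (g n r)) \<le> K * norm x0 * ((K * t) ^ n / fact n)"
        by simp
    qed
    have s2: "summable (\<lambda>n. LBINT r. norm (g n r))"
    proof (rule summable_comparison_test'[OF sm[of "t * (K * norm x0)" t]])
      fix n
      have "(LBINT r. norm (g n r)) \<le> (LBINT r. indicator {0..t} r * (K * norm x0 * ((K * t) ^ n / fact n)))"
        using gi[of n] gb t by (intro integral_mono integrable_norm integrable_mult_left) auto
      also have "\<dots> = t * (K * norm x0) * ((K * t) ^ n / fact n)"
        using t by simp
      finally show "norm (LBINT r. norm (g n r)) \<le> t * (K * norm x0) * ((K * t) ^ n / fact n)"
        by (simp add: integral_nonneg_AE)
    qed
    have gsum: "(\<Sum>n. g n r) = indicator {0..t} r *\<^sub>R f r (x r)" for r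
    proof (cases "r \<in> {0..t}")
      case True
      then show ?thesis using fs[of r] t by (simp add: g_def sums_unique[symmetric])
    qed (simp add: g_def)
    have s: "(\<lambda>n. integral\<^sup>L lborel (g n)) sums (LBINT r. (\<Sum>n. g n r))"
      by (rule sums_integral[OF gi _ s2]) (use s1 in auto)
    have int: "integrable lborel (\<lambda>r. \<Sum>n. g n r)"
      by (rule integrable_suminf[OF gi _ s2]) (use s1 in auto)
    have "(\<lambda>n. y (Suc n) t) sums (LBINT r:{0..t}. f r (x r))"
      using s unfolding gsum by (simp add: yS g_def set_lebesgue_integral_def)
    \<comment> \<open>Shift of the index: the terms from 1 on sum to the integral, and term 0
      restores the initial value.\<close>
    then have "(\<lambda>n. y n t) sums ((LBINT r:{0..t}. f r (x r)) + y 0 t)"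
      by (rule sums_Suc_iff[of "\<lambda>n. y n t", THEN iffD1])
    then have "x t = x0 + (LBINT r:{0..t}. f r (x r))"
      by (simp add: x_def y0 sums_unique[symmetric] add.commute)
    moreover have "set_integrable lborel {0..t} (\<lambda>r. f r (x r))"
      using int unfolding gsum set_integrable_def .
    ultimately show ?thesis by blast
  qed
  show ?thesis
  proof (cases "0 \<le> b")
    case True
    have "x 0 = x0"
      using step[of 0] True interval_integral_Icc[of 0 0 "\<lambda>r. f r (x r)"] by simp
    moreover have "primitive_on 0 b (\<lambda>r. f r (x r)) x"
      using step True \<open>x 0 = x0\<close> by (intro primitive_onI) auto
    ultimately show ?thesis using that by blast
  next
    case False
    then show ?thesis using that[of "\<lambda>_. x0"] by (auto simp: primitive_on_def)
  qed
qed

text \<open>Freezing the time at the ends of the interval extends a function to the whole line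
  without enlarging its range, so that later bounds and measurability hold at all times.\<close>

lemma continuous_on_clamp:
  fixes x :: "real \<Rightarrow> 'a::euclidean_space"
  assumes "continuous_on {0..L} x" "0 \<le> L"
  shows "continuous_on UNIV (\<lambda>t. x (max 0 (min L t)))"
  using assms(2) by (intro continuous_on_compose2[OF assms(1)] continuous_intros) auto

lemma bounded_clamp:
  fixes x :: "real \<Rightarrow> 'a::euclidean_space"
  assumes "continuous_on {0..L} x" "0 \<le> L"
  obtains C where "\<And>t. norm (x (max 0 (min L t))) \<le> C"
proof -
  have "compact (x ` {0..L})" using assms by (intro compact_continuous_image) auto
  then obtain c where "\<forall>y\<in>x ` {0..L}. norm y \<le> c"
    using compact_imp_bounded bounded_iff by metis
  then have "norm (x (max 0 (min L t))) \<le> c" for t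
    using assms(2) by auto
  then show ?thesis using that by blast
qed

lemma matrix_mult_norm_bound:
  obtains K where "0 \<le> K" "\<And>(A::real^'n^'m) (B::real^'p^'n). norm (A ** B) \<le> norm A * norm B * K"
  using mm.nonneg_bounded by blast

lemma matrix_vector_mult_norm_bound:
  obtains K where "0 \<le> K" "\<And>(A::real^'n^'m) x. norm (A *v x) \<le> norm A * norm x * K"
  using mv.nonneg_bounded by blast

text \<open>\<open>\<Theta>\<close> is a solution of the adjoint equation rather than an inverse
  taken pointwise: both factors are then absolutely continuous, the density of their product
  cancels, and the product keeps its initial value \<open>mat 1\<close>.\<close>

proposition fundamental_pair_exists:
  fixes A :: "real \<Rightarrow> real^'n^'n"
  assumes A: "A \<in> borel_measurable borel" "\<And>t. norm (A t) \<le> C" and "0 \<le> L"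
  obtains \<Phi> \<Theta> K where "primitive_on 0 L (\<lambda>r. A r ** \<Phi> r) \<Phi>" "primitive_on 0 L (\<lambda>r. - (\<Theta> r ** A r)) \<Theta>"
    "continuous_on UNIV \<Phi>" "continuous_on UNIV \<Theta>" "\<And>t. norm (\<Phi> t) \<le> K" "\<And>t. norm (\<Theta> t) \<le> K"
    "\<And>t. \<Theta> t ** \<Phi> t = mat 1" "\<And>t. \<Phi> t ** \<Theta> t = mat 1" "\<Phi> 0 = mat 1" "\<Theta> 0 = mat 1"
proof -
  note A(1)[measurable]
  obtain K where K: "0 \<le> K" "\<And>(A::real^'n^'n) (B::real^'n^'n). norm (A ** B) \<le> norm A * norm B * K"
    using matrix_mult_norm_bound by blast
  have b1: "norm (A r ** Z) \<le> (C * K) * norm Z" for r and Z :: "real^'n^'n"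
  proof -
    have "norm (A r) * norm Z * K \<le> C * norm Z * K"
      using K(1) A(2) by (intro mult_right_mono) auto
    with K(2)[of "A r" Z] show ?thesis by (simp add: mult_ac)
  qed
  have b2: "norm (- (Z ** A r)) \<le> (C * K) * norm Z" for r and Z :: "real^'n^'n"
  proof -
    have "norm Z * norm (A r) * K \<le> norm Z * C * K"
      using K(1) A(2) by (intro mult_right_mono mult_left_mono) auto
    with K(2)[of Z "A r"] show ?thesis by (simp add: mult_ac)
  qed
  obtain \<Phi>0 where \<Phi>0: "primitive_on 0 L (\<lambda>r. A r ** \<Phi>0 r) \<Phi>0" "\<Phi>0 0 = mat 1"
  proof (rule linear_equation_solution_exists[of "\<lambda>r Z. A r ** Z" "C * K" L "mat 1"])
    show "linear (\<lambda>Z. A r ** Z)" for r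
      by (rule bounded_linear.linear[OF mm.bounded_linear_right])
  qed (use b1 in \<open>auto\<close>)
  obtain \<Theta>0 where \<Theta>0: "primitive_on 0 L (\<lambda>r. - (\<Theta>0 r ** A r)) \<Theta>0" "\<Theta>0 0 = mat 1"
  proof (rule linear_equation_solution_exists[of "\<lambda>r Z. - (Z ** A r)" "C * K" L "mat 1"])
    show "linear (\<lambda>Z. - (Z ** A r))" for r
      by (intro linear_compose_neg bounded_linear.linear[OF mm.bounded_linear_left])
  qed (use b2 in \<open>auto\<close>)
  have \<Theta>\<Phi>: "\<Theta>0 t ** \<Phi>0 t = mat 1" if t: "t \<in> {0..L}" for t
  proof -
    have "\<Theta>0 t ** \<Phi>0 t = \<Theta>0 0 ** \<Phi>0 0"
      by (rule primitive_on_zero_AE[OF primitive_on_product[OF bounded_bilinear_matrix_mult \<Theta>0(1) \<Phi>0(1)] _ t])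
        (simp add: mm.minus_left matrix_mul_assoc)
    then show ?thesis by (simp add: \<Phi>0 \<Theta>0)
  qed
  \<comment> \<open>Beyond \<open>[0, L]\<close> both matrices are frozen, which keeps them
    continuous, bounded and inverse to each other at every time.\<close>
  define c where "c = (\<lambda>t. max 0 (min L t))"
  have c: "c t \<in> {0..L}" "t \<in> {0..L} \<Longrightarrow> c t = t" for t
    using \<open>0 \<le> L\<close> by (auto simp: c_def)
  note cont = primitive_on_continuous[OF \<Phi>0(1)] primitive_on_continuous[OF \<Theta>0(1)]
  obtain K1 K2 where "norm (\<Phi>0 (c t)) \<le> K1" "norm (\<Theta>0 (c t)) \<le> K2" for t
    using bounded_clamp[OF cont(1) \<open>0 \<le> L\<close>] bounded_clamp[OF cont(2) \<open>0 \<le> L\<close>]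
    unfolding c_def by metis
  then have bd: "norm (\<Phi>0 (c t)) \<le> max K1 K2" "norm (\<Theta>0 (c t)) \<le> max K1 K2" for t
    by (auto simp: le_max_iff_disj)
  show ?thesis
  proof (rule that[of "\<lambda>t. \<Phi>0 (c t)" "\<lambda>t. \<Theta>0 (c t)" "max K1 K2"])
    show "primitive_on 0 L (\<lambda>r. A r ** \<Phi>0 (c r)) (\<lambda>t. \<Phi>0 (c t))"
      using \<Phi>0(1) by (subst primitive_on_cong[of 0 L _ \<Phi>0 _ "\<lambda>r. A r ** \<Phi>0 r"]) (auto simp: c)
    show "primitive_on 0 L (\<lambda>r. - (\<Theta>0 (c r) ** A r)) (\<lambda>t. \<Theta>0 (c t))"
      using \<Theta>0(1) by (subst primitive_on_cong[of 0 L _ \<Theta>0 _ "\<lambda>r. - (\<Theta>0 r ** A r)"]) (auto simp: c)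
    show "continuous_on UNIV (\<lambda>t. \<Phi>0 (c t))" "continuous_on UNIV (\<lambda>t. \<Theta>0 (c t))"
      unfolding c_def by (intro continuous_on_clamp cont \<open>0 \<le> L\<close>)+
    show "\<Theta>0 (c t) ** \<Phi>0 (c t) = mat 1" "\<Phi>0 (c t) ** \<Theta>0 (c t) = mat 1" for t
      using \<Theta>\<Phi>[OF c(1)] by (simp_all add: matrix_left_right_inverse)
    show "\<Phi>0 (c 0) = mat 1" "\<Theta>0 (c 0) = mat 1"
      using c(2)[of 0] \<open>0 \<le> L\<close> \<Phi>0 \<Theta>0 by auto
  qed (use bd in auto)
qed

text \<open>\<open>fundamental_matrix\<close> is a choice among solutions, so
  \<open>\<Phi> t ** \<Theta> s\<close> has to be a solution and the only one: for any solution with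
  value \<open>mat 1\<close> at \<open>s\<close>, its product with \<open>\<Theta>\<close> is
  constant. The representative \<open>A\<close> and the given \<open>A'\<close> have the same
  solutions.\<close>

lemma fundamental_matrix_eq:
  fixes A A' :: "real \<Rightarrow> real^'n^'n"
  assumes \<Phi>: "primitive_on 0 L (\<lambda>r. A r ** \<Phi> r) \<Phi>" and \<Theta>: "primitive_on 0 L (\<lambda>r. - (\<Theta> r ** A r)) \<Theta>"
    and inv: "\<And>t. \<Theta> t ** \<Phi> t = mat 1" "\<And>t. \<Phi> t ** \<Theta> t = mat 1"
    and A: "A \<in> borel_measurable borel" and A': "set_borel_measurable borel {0..L} A'"
    and eq: "AE t in lborel. t \<in> {0..L} \<longrightarrow> A t = A' t" and st: "s \<in> {0..L}" "t \<in> {0..L}"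
  shows "fundamental_matrix L A' t s = \<Phi> t ** \<Theta> s"
proof -
  have L: "0 \<le> L" using st by auto
  have mA: "set_borel_measurable lborel {0..L} A" "set_borel_measurable lborel {0..L} A'"
    using A A' by (auto simp: set_borel_measurable_def)
  have sb: "set_borel_measurable lborel {0..L} (\<lambda>r. D r ** \<Psi> r)"
    if "set_borel_measurable lborel {0..L} D" "continuous_on {0..L} \<Psi>" for D \<Psi> :: "real \<Rightarrow> real^'n^'n"
    by (rule set_borel_measurable_bilinear[OF bounded_bilinear_matrix_mult that(1)
          continuous_on_set_borel_measurable[OF that(2)]])
  define Sol where "Sol = (\<lambda>\<Psi>. caratheodory_solution 0 L (\<lambda>r Z. A' r ** Z) \<Psi> \<and> \<Psi> s = mat 1)"
  have "primitive_on 0 L (\<lambda>r. A r ** (\<Phi> r ** \<Theta> s)) (\<lambda>t. \<Phi> t ** \<Theta> s)"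
    using primitive_on_linear[OF \<Phi> mm.bounded_linear_left] by (simp add: matrix_mul_assoc)
  from primitive_on_cong_AE[OF this sb[OF mA(2) primitive_on_continuous[OF this]]]
  have "primitive_on 0 L (\<lambda>r. A' r ** (\<Phi> r ** \<Theta> s)) (\<lambda>t. \<Phi> t ** \<Theta> s)"
    using eq by (smt (verit, best) eventually_mono)
  then have "Sol (\<lambda>t. \<Phi> t ** \<Theta> s)"
    unfolding Sol_def caratheodory_solution_iff_primitive_on[OF L]
    using inv by simp
  then have "Sol (SOME \<Psi>. Sol \<Psi>)" by (rule someI[of Sol])
  moreover have "\<Psi> t = \<Phi> t ** \<Theta> s" if "Sol \<Psi>" for \<Psi>
  proof -
    have p: "primitive_on 0 L (\<lambda>r. A' r ** \<Psi> r) \<Psi>" and "\<Psi> s = mat 1"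
      using that by (auto simp: Sol_def caratheodory_solution_iff_primitive_on[OF L])
    from primitive_on_cong_AE[OF p sb[OF mA(1) primitive_on_continuous[OF p]]]
    have "primitive_on 0 L (\<lambda>r. A r ** \<Psi> r) \<Psi>"
      using eq by (smt (verit, best) eventually_mono)
    from primitive_on_product[OF bounded_bilinear_matrix_mult \<Theta> this]
    have "\<Theta> u ** \<Psi> u = \<Theta> 0 ** \<Psi> 0" if "u \<in> {0..L}" for u
      by (rule primitive_on_zero_AE[OF _ _ that]) (simp add: mm.minus_left matrix_mul_assoc)
    then have "\<Theta> t ** \<Psi> t = \<Theta> s"
      using st \<open>\<Psi> s = mat 1\<close> by (metis matrix_mul_rid)
    then show ?thesis
      by (metis inv(2) matrix_mul_assoc matrix_mul_lid)
  qed
  ultimately show ?thesis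
    unfolding fundamental_matrix_def Sol_def by blast
qed

section \<open>The Riccati equation\<close>

text \<open>The difference \<open>E\<close> of two solutions solves a linear equation with bounded
  coefficients, since the quadratic terms differ by
  \<open>P t ** S t ** E t + E t ** S t ** P' t\<close>; Gronwall finishes.\<close>

lemma riccati_unique_from_0:
  fixes S Q :: "real \<Rightarrow> real^'n^'n"
  assumes S: "\<And>t. norm (S t) \<le> C"
    and P: "primitive_on 0 b (\<lambda>t. Q t - P t ** S t ** P t) P"
    and P': "primitive_on 0 b (\<lambda>t. Q t - P' t ** S t ** P' t) P'"
    and "P 0 = P' 0" and t: "t \<in> {0..b}"
  shows "P t = P' t"
proof -
  have b: "0 \<le> b" using t by auto
  obtain K where K: "0 \<le> K" "\<And>(A::real^'n^'n) (B::real^'n^'n). norm (A ** B) \<le> norm A * norm B * K"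
    using matrix_mult_norm_bound by blast
  obtain c c' where c: "\<And>t. norm (P (max 0 (min b t))) \<le> c" "\<And>t. norm (P' (max 0 (min b t))) \<le> c'"
    using bounded_clamp[OF primitive_on_continuous[OF P] b] bounded_clamp[OF primitive_on_continuous[OF P'] b] by metis
  have c: "norm (P r) \<le> c" "norm (P' r) \<le> c'" if "r \<in> {0..b}" for r
    using c(1)[of r] c(2)[of r] that by (simp_all add: min_absorb2)
  define E where "E = (\<lambda>t. P t - P' t)"
  have E: "primitive_on 0 b (\<lambda>t. - (P t ** S t ** E t + E t ** S t ** P' t)) E"
    using primitive_on_diff_fun[OF P P']
    by (simp add: E_def mm.diff_left mm.diff_right algebra_simps)
  have n3: "norm (X ** Y ** Z) \<le> norm X * norm Y * norm Z * (K * K)" for X Y Z :: "real^'n^'n"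
  proof -
    have "norm (X ** Y ** Z) \<le> norm (X ** Y) * norm Z * K" by (rule K)
    also have "\<dots> \<le> (norm X * norm Y * K) * norm Z * K"
      using K by (intro mult_right_mono) auto
    finally show ?thesis by (simp add: mult_ac)
  qed
  have "norm (P r ** S r ** E r + E r ** S r ** P' r) \<le> (c * C * (K*K) + C * c' * (K * K)) * norm (E r)"
    if "r \<in> {0..b}" for r
  proof -
    have "norm (P r ** S r ** E r) \<le> norm (P r) * norm (S r) * norm (E r) * (K * K)" by (rule n3)
    also have "\<dots> \<le> c * C * norm (E r) * (K * K)"
      using c[OF that] S[of r] K order_trans[OF norm_ge_zero c(1)[OF that]]
      by (intro mult_right_mono mult_mono) auto
    finally have 1: "norm (P r ** S r ** E r) \<le> c * C * norm (E r) * (K * K)" .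
    have "norm (E r ** S r ** P' r) \<le> norm (E r) * norm (S r) * norm (P' r) * (K * K)" by (rule n3)
    also have "\<dots> \<le> norm (E r) * C * c' * (K * K)"
      using c[OF that] S[of r] K order_trans[OF norm_ge_zero S[of r]]
      by (intro mult_right_mono mult_mono) auto
    finally show ?thesis using 1 norm_triangle_ineq[of "P r ** S r ** E r" "E r ** S r ** P' r"]
      by (simp add: algebra_simps)
  qed
  then have "AE r in lborel. r \<in> {0..b} \<longrightarrow> norm (- (P r ** S r ** E r + E r ** S r ** P' r))
     \<le> (c * C * (K*K) + C * c' * (K * K)) * norm (E r)"
    by (intro AE_I2) (simp add: norm_minus_cancel del: minus_add_distrib)
  from primitive_on_gronwall[OF E _ this t] show ?thesis
    using assms(4) by (simp add: E_def)
qed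

text \<open>A continuous positive function on the compact product of \<open>[0, b]\<close> with the
  unit sphere has a positive minimum; homogeneity extends the bound to all vectors.\<close>

lemma invertible_uniform_inverse_bound:
  fixes x :: "real \<Rightarrow> real^'n^'n"
  assumes x: "continuous_on {0..b} x" and "0 \<le> b"
    and inj: "\<And>t v. t \<in> {0..b} \<Longrightarrow> x t *v v = 0 \<Longrightarrow> v = 0"
  obtains \<delta> where "0 < \<delta>" "\<And>t v. t \<in> {0..b} \<Longrightarrow> \<delta> * norm v \<le> norm (x t *v v)"
proof -
  let ?D = "{0..b} \<times> sphere (0::real^'n) 1"
  have c: "continuous_on ?D (\<lambda>(t, v). norm (x t *v v))"
    unfolding split_beta
    by (intro continuous_on_norm mv.continuous_on continuous_on_compose2[OF x] continuous_intros) auto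
  have "axis undefined 1 \<in> sphere (0::real^'n) 1" by (simp add: norm_axis_1)
  then have "(0, axis undefined 1) \<in> ?D" using \<open>0 \<le> b\<close> by auto
  then obtain w where w: "w \<in> ?D" "\<And>u. u \<in> ?D \<Longrightarrow> (\<lambda>(t, v). norm (x t *v v)) w \<le> (\<lambda>(t, v). norm (x t *v v)) u"
    using continuous_attains_inf[OF _ _ c] by (metis compact_Times compact_Icc compact_sphere empty_iff)
  define \<delta> where "\<delta> = (\<lambda>(t, v). norm (x t *v v)) w"
  have "0 < \<delta>" using w(1) inj by (fastforce simp: \<delta>_def)
  moreover have "\<delta> * norm v \<le> norm (x t *v v)" if "t \<in> {0..b}" for t v
  proof (cases "v = 0")
    case False
    then have "(t, (1 / norm v) *\<^sub>R v) \<in> ?D" using that by auto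
    from w(2)[OF this] have "\<delta> \<le> norm (x t *v v) / norm v"
      by (simp add: \<delta>_def mv.scaleR_right)
    then show ?thesis using False by (simp add: field_simps)
  qed (simp add: mv.zero_right)
  ultimately show ?thesis using that by blast
qed

text \<open>The lower bound for \<open>x\<close> makes the inverses uniformly bounded, and the
  resolvent identity \<open>z t - z s = z t ** (x s - x t) ** z s\<close> then estimates their
  variation by that of \<open>x\<close>.\<close>

lemma continuous_on_matrix_inv:
  fixes x :: "real \<Rightarrow> real^'n^'n"
  assumes x: "continuous_on {0..b} x" and "0 \<le> b"
    and inj: "\<And>t v. t \<in> {0..b} \<Longrightarrow> x t *v v = 0 \<Longrightarrow> v = 0"
    and xz: "\<And>t. t \<in> {0..b} \<Longrightarrow> x t ** z t = mat 1"
  shows "continuous_on {0..b} z"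
proof -
  obtain \<delta> where \<delta>: "0 < \<delta>" "\<And>t v. t \<in> {0..b} \<Longrightarrow> \<delta> * norm v \<le> norm (x t *v v)"
    using invertible_uniform_inverse_bound[OF x \<open>0 \<le> b\<close>] inj by metis
  have zx: "z t ** x t = mat 1" if "t \<in> {0..b}" for t
    using xz[OF that] by (simp add: matrix_left_right_inverse)
  define Z where "Z = (\<Sum>i\<in>(UNIV::'n set). \<Sum>j\<in>(UNIV::'n set). (1/\<delta> :: real))"
  have Z: "norm (z t) \<le> Z" if "t \<in> {0..b}" for t
  proof -
    have "norm (z t *v axis j 1) \<le> 1 / \<delta>" for j
      using \<delta>(2)[OF that, of "z t *v axis j 1"] xz[OF that] \<delta>(1)
      by (simp add: matrix_vector_mul_assoc norm_axis_1 field_simps)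
    then show ?thesis
      unfolding Z_def by (intro order_trans[OF norm_matrix_le_columns] sum_mono)
  qed
  obtain K where K: "0 \<le> K" "\<And>(A::real^'n^'n) (B::real^'n^'n). norm (A ** B) \<le> norm A * norm B * K"
    using matrix_mult_norm_bound by blast
  have "Z \<ge> 0" using order_trans[OF norm_ge_zero Z[of 0]] \<open>0 \<le> b\<close> by simp
  have lip: "norm (z t - z s) \<le> Z * Z * (K * K) * norm (x t - x s)" if "t \<in> {0..b}" "s \<in> {0..b}" for s t
  proof -
    have "z t ** (x s - x t) ** z s = z t - z s"
      using xz[OF that(2)] zx[OF that(1)]
      by (simp add: mm.diff_right mm.diff_left matrix_mul_assoc[symmetric])
    then have "norm (z t - z s) \<le> norm (z t ** (x s - x t)) * norm (z s) * K"
      using K(2)[of "z t ** (x s - x t)" "z s"] by simp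
    also have "\<dots> \<le> (norm (z t) * norm (x s - x t) * K) * norm (z s) * K"
      using K by (intro mult_right_mono) auto
    also have "\<dots> \<le> (Z * norm (x s - x t) * K) * Z * K"
      using Z[OF that(1)] Z[OF that(2)] K \<open>Z \<ge> 0\<close> by (intro mult_right_mono mult_mono) auto
    finally show ?thesis by (simp add: mult_ac norm_minus_commute)
  qed
  show ?thesis
    unfolding continuous_on_def
  proof
    fix s assume s: "s \<in> {0..b}"
    have "((\<lambda>t. Z * Z * (K * K) * norm (x t - x s)) \<longlongrightarrow> Z * Z * (K * K) * norm (x s - x s)) (at s within {0..b})"
      using x s unfolding continuous_on_def by (intro tendsto_intros) auto
    then have lim: "((\<lambda>t. Z * Z * (K * K) * norm (x t - x s)) \<longlongrightarrow> 0) (at s within {0..b})"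
      by simp
    have "\<forall>\<^sub>F t in at s within {0..b}. norm (z t - z s) \<le> Z * Z * (K * K) * norm (x t - x s)"
      using lip[OF _ s] by (auto simp: eventually_at_filter)
    from Lim_null_comparison[OF this lim]
    have "((\<lambda>t. z t - z s) \<longlongrightarrow> 0) (at s within {0..b})" .
    then show "(z \<longlongrightarrow> z s) (at s within {0..b})"
      by (simp add: LIM_zero_iff)
  qed
qed

text \<open>\<open>P\<close> is the quotient of the two blocks of the Hamiltonian flow started at
  \<open>(mat 1, G)\<close>. Linear equations do not blow up, so the only danger is a singular
  \<open>x t\<close>. If \<open>x t *v v = 0\<close>, then \<open>\<xi> r \<bullet> \<pi> r\<close>
  starts at \<open>v \<bullet> (G *v v)\<close>, which is nonnegative, has a nonnegative density and
  ends at 0; so \<open>S r *v \<pi> r\<close> vanishes almost everywhere, \<open>\<xi>\<close> stays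
  equal to \<open>v\<close>, and \<open>v = 0\<close>.\<close>

proposition riccati_exists_from_0:
  fixes S Q :: "real \<Rightarrow> real^'n^'n"
  assumes S: "S \<in> borel_measurable borel" "\<And>t. norm (S t) \<le> C" "\<And>t. S t \<in> psd_matrices"
    and Q: "Q \<in> borel_measurable borel" "\<And>t. norm (Q t) \<le> C" "\<And>t. Q t \<in> psd_matrices"
    and G: "G \<in> psd_matrices" and b: "0 \<le> b"
  obtains P where "primitive_on 0 b (\<lambda>t. Q t - P t ** S t ** P t) P" "P 0 = G"
proof -
  note S(1)[measurable] Q(1)[measurable]
  obtain K where K: "0 \<le> K" "\<And>(A::real^'n^'n) (B::real^'n^'n). norm (A ** B) \<le> norm A * norm B * K"
    using matrix_mult_norm_bound by blast
  have mb: "norm (D ** Z) \<le> C * K * norm Z" if "norm D \<le> C" for D Z :: "real^'n^'n"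
  proof -
    have "norm D * norm Z * K \<le> C * norm Z * K"
      using K(1) that by (intro mult_right_mono) auto
    with K(2)[of D Z] show ?thesis by (simp add: mult_ac)
  qed
  have CK: "0 \<le> C * K" using order_trans[OF norm_ge_zero S(2)[of 0]] K(1) by simp
  define f where "f = (\<lambda>r (w :: (real^'n^'n) \<times> (real^'n^'n)). (S r ** snd w, Q r ** fst w))"
  obtain w where w: "primitive_on 0 b (\<lambda>r. f r (w r)) w" "w 0 = (mat 1, G)"
  proof (rule linear_equation_solution_exists[of f "2 * (C * K)" b "(mat 1, G)"])
    show "linear (f r)" for r
      by (rule linearI) (auto simp: f_def mm.add_right mm.scaleR_right)
    show "(\<lambda>r. f r v) \<in> borel_measurable borel" for v
      unfolding f_def by measurable
    show "norm (f r v) \<le> 2 * (C * K) * norm v" for r v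
    proof -
      have "norm (f r v) \<le> norm (S r ** snd v) + norm (Q r ** fst v)"
        unfolding f_def by (rule norm_Pair_le)
      also have "\<dots> \<le> C * K * norm (snd v) + C * K * norm (fst v)"
        by (intro add_mono mb S Q)
      also have "\<dots> \<le> C * K * norm v + C * K * norm v"
        using CK norm_fst_le[of "fst v" "snd v"] norm_snd_le[of "snd v" "fst v"]
          by (intro add_mono mult_left_mono) auto
      finally show ?thesis by simp
    qed
  qed blast
  define x where "x = (\<lambda>t. fst (w t))"
  define p where "p = (\<lambda>t. snd (w t))"
  have x: "primitive_on 0 b (\<lambda>r. S r ** p r) x" and p: "primitive_on 0 b (\<lambda>r. Q r ** x r) p"
    using primitive_on_linear[OF w(1) bounded_linear_fst] primitive_on_linear[OF w(1) bounded_linear_snd]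
    by (simp_all add: x_def p_def f_def)
  have x0: "x 0 = mat 1" and p0: "p 0 = G"
    using w(2) by (simp_all add: x_def p_def)
  have inj: "v = 0" if t: "t \<in> {0..b}" and "x t *v v = 0" for t v
  proof -
    define \<xi> where "\<xi> = (\<lambda>r. x r *v v)"
    define \<pi> where "\<pi> = (\<lambda>r. p r *v v)"
    have \<xi>: "primitive_on 0 t (\<lambda>r. S r *v \<pi> r) \<xi>"
      using primitive_on_subinterval[OF primitive_on_linear[OF x mv.bounded_linear_left], of 0 t v] t
      by (simp add: \<xi>_def \<pi>_def matrix_vector_mul_assoc)
    have \<pi>: "primitive_on 0 t (\<lambda>r. Q r *v \<xi> r) \<pi>"
      using primitive_on_subinterval[OF primitive_on_linear[OF p mv.bounded_linear_left], of 0 t v] t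
      by (simp add: \<xi>_def \<pi>_def matrix_vector_mul_assoc)
    define e where "e = (\<lambda>r. (S r *v \<pi> r) \<bullet> \<pi> r + \<xi> r \<bullet> (Q r *v \<xi> r))"
    have e: "primitive_on 0 t e (\<lambda>r. \<xi> r \<bullet> \<pi> r)"
      using primitive_on_product[OF bounded_bilinear_inner \<xi> \<pi>] by (simp add: e_def)
    have e1: "0 \<le> (S r *v \<pi> r) \<bullet> \<pi> r" "0 \<le> \<xi> r \<bullet> (Q r *v \<xi> r)" for r
      using psd_matricesD(2)[OF S(3)] psd_matricesD(2)[OF Q(3)] by (auto simp: inner_commute)
    have "(LBINT r:{0..t}. e r) = - (\<xi> 0 \<bullet> \<pi> 0)"
      using primitive_onD[OF e, of t] t that(2) by (simp add: \<xi>_def)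
    also have "\<dots> \<le> 0"
      using psd_matricesD(2)[OF G, of v] by (simp add: \<xi>_def \<pi>_def x0 p0)
    finally have le: "(LBINT r:{0..t}. e r) \<le> 0" .
    have nn: "AE r in lborel. 0 \<le> indicator {0..t} r *\<^sub>R e r"
      using e1 by (auto simp: e_def)
    then have "(LBINT r:{0..t}. e r) = 0"
      using le unfolding set_lebesgue_integral_def
      by (intro antisym integral_nonneg_AE)
    then have "AE r in lborel. indicator {0..t} r *\<^sub>R e r = 0"
      using primitive_on_integrable[OF e] integral_nonneg_eq_0_iff_AE[OF _ nn]
      by (simp add: set_integrable_def set_lebesgue_integral_def)
    \<comment> \<open>Both summands of \<open>e\<close> are nonnegative, so each vanishes;
      semidefiniteness upgrades the vanishing form to a vanishing vector.\<close>
    then have "AE r in lborel. r \<in> {0..t} \<longrightarrow> S r *v \<pi> r = 0"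
    proof eventually_elim
      case (elim r)
      show ?case
      proof
        assume "r \<in> {0..t}"
        then have "\<pi> r \<bullet> (S r *v \<pi> r) = 0"
          using elim e1[of r] by (simp add: e_def inner_commute)
        then show "S r *v \<pi> r = 0" by (rule psd_matrix_eq_0[OF S(3)])
      qed
    qed
    from primitive_on_zero_AE[OF \<xi> this, of t] show "v = 0"
      using t that(2) by (simp add: \<xi>_def x0)
  qed
  define z where "z = (\<lambda>t. matrix_inv (x t))"
  have zx: "x t ** z t = mat 1" "z t ** x t = mat 1" if "t \<in> {0..b}" for t
  proof -
    have "invertible (x t)"
      using inj[OF that] matrix_left_invertible_ker invertible_left_inverse by blast
    then show "x t ** z t = mat 1" "z t ** x t = mat 1"
      unfolding z_def matrix_inv_def invertible_def by (metis (mono_tags, lifting) someI_ex)+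
  qed
  have cz: "continuous_on {0..b} z"
    by (rule continuous_on_matrix_inv[OF primitive_on_continuous[OF x] b inj zx(1)])
  define P where "P = (\<lambda>t. p t ** z t)"
  have cP: "continuous_on {0..b} P"
    unfolding P_def by (intro mm.continuous_on primitive_on_continuous[OF p] cz)
  define P' where "P' = (\<lambda>t. P (max 0 (min b t)))"
  have P': "P' t = P t" if "t \<in> {0..b}" for t
    using that by (simp add: P'_def min_absorb2)
  obtain c where c: "\<And>t. norm (P' t) \<le> c"
    using bounded_clamp[OF cP b] unfolding P'_def by metis
  have [measurable]: "P' \<in> borel_measurable borel"
    unfolding P'_def by (intro borel_measurable_continuous_onI continuous_on_clamp cP b)
  have SP: "norm (S r ** P' r) \<le> C * K * c" for r
    using order_trans[OF mb[OF S(2)] mult_left_mono[OF c CK]] .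
  obtain z0 where z0: "primitive_on 0 b (\<lambda>r. - (z0 r ** (S r ** P' r))) z0" "z0 0 = mat 1"
  proof (rule linear_equation_solution_exists[of "\<lambda>r Z. - (Z ** (S r ** P' r))" "C * K * c * K" b "mat 1"])
    show "linear (\<lambda>Z. - (Z ** (S r ** P' r)))" for r
      by (intro linear_compose_neg bounded_linear.linear[OF mm.bounded_linear_left])
    show "norm (- (Z ** (S r ** P' r))) \<le> C * K * c * K * norm Z" for r and Z :: "real^'n^'n"
    proof -
      have "norm (Z ** (S r ** P' r)) \<le> norm Z * norm (S r ** P' r) * K" by (rule K)
      also have "\<dots> \<le> norm Z * (C * K * c) * K"
        using SP K by (intro mult_right_mono mult_left_mono) auto
      finally show ?thesis by (simp add: mult_ac)
    qed
  qed auto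
  have "z0 t = z t" if t: "t \<in> {0..b}" for t
  proof -
    have "z0 t ** x t = z0 0 ** x 0"
    proof (rule primitive_on_zero_AE[OF primitive_on_product[OF bounded_bilinear_matrix_mult z0(1) x] _ t], rule AE_I2, rule impI)
      fix r assume r: "r \<in> {0..b}"
      have "P r ** x r = p r"
        using zx(2)[OF r] by (simp add: P_def matrix_mul_assoc[symmetric])
      then show "- (z0 r ** (S r ** P' r)) ** x r + z0 r ** (S r ** p r) = 0"
        by (simp add: P'[OF r] mm.minus_left matrix_mul_assoc[symmetric])
    qed
    then have "z0 t ** x t = mat 1" by (simp add: z0 x0)
    then show ?thesis
      using zx(1)[OF t] by (metis matrix_mul_assoc matrix_mul_lid matrix_mul_rid)
  qed
  then have z: "primitive_on 0 b (\<lambda>r. - (z r ** (S r ** P r))) z"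
    using z0(1) P' by (subst primitive_on_cong[of 0 b _ z0 _ "\<lambda>r. - (z0 r ** (S r ** P' r))"]) auto
  have "primitive_on 0 b (\<lambda>t. Q t - P t ** S t ** P t) P"
  proof (subst primitive_on_cong)
    show "primitive_on 0 b (\<lambda>r. (Q r ** x r) ** z r + p r ** - (z r ** (S r ** P r))) (\<lambda>t. p t ** z t)"
      by (rule primitive_on_product[OF bounded_bilinear_matrix_mult p z])
    show "Q t - P t ** S t ** P t = (Q t ** x t) ** z t + p t ** - (z t ** (S t ** P t))"
      if "t \<in> {0..b}" for t
      using zx(1)[OF that] by (simp add: P_def mm.minus_right matrix_mul_assoc)
        (simp add: matrix_mul_assoc[symmetric])
  qed (simp add: P_def)
  moreover have "P 0 = G"
    using zx(1)[of 0] b by (simp add: P_def p0 x0)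
  ultimately show ?thesis using that by blast
qed

text \<open>Reversing time reduces existence and uniqueness to the initial value problem. Symmetry
  follows from uniqueness: the transpose solves the same equation with the same symmetric terminal
  value.\<close>

proposition riccati_terminal_value:
  fixes S Q :: "real \<Rightarrow> real^'n^'n"
  assumes S: "S \<in> borel_measurable borel" "\<And>t. norm (S t) \<le> C" "\<And>t. S t \<in> psd_matrices"
    and Q: "Q \<in> borel_measurable borel" "\<And>t. norm (Q t) \<le> C" "\<And>t. Q t \<in> psd_matrices"
    and G: "G \<in> psd_matrices" and b: "0 \<le> b"
  obtains P where "primitive_on 0 b (\<lambda>t. P t ** S t ** P t - Q t) P" "P b = G"
    "\<And>t. t \<in> {0..b} \<Longrightarrow> transpose (P t) = P t"
    "\<And>P' t. primitive_on 0 b (\<lambda>t. P' t ** S t ** P' t - Q t) P' \<Longrightarrow> P' b = G \<Longrightarrow> t \<in> {0..b} \<Longrightarrow> P' t = P t"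
proof -
  have [measurable]: "S \<in> borel_measurable borel" "Q \<in> borel_measurable borel" by fact+
  define S' where "S' = (\<lambda>t. S (b - t))"
  define Q' where "Q' = (\<lambda>t. Q (b - t))"
  have rev: "primitive_on 0 b (\<lambda>t. Q' t - P (b - t) ** S' t ** P (b - t)) (\<lambda>t. P (b - t))"
    if "primitive_on 0 b (\<lambda>t. P t ** S t ** P t - Q t) P" for P
    using primitive_on_reflect[OF that] by (simp add: S'_def Q'_def)
  have uniq: "P' t = P t" if "primitive_on 0 b (\<lambda>t. P t ** S t ** P t - Q t) P"
    "primitive_on 0 b (\<lambda>t. P' t ** S t ** P' t - Q t) P'" "P b = P' b" "t \<in> {0..b}" for P P' t
  proof -
    have "P (b - (b - t)) = P' (b - (b - t))"
      by (rule riccati_unique_from_0[OF _ rev[OF that(1)] rev[OF that(2)], of C "b - t"])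
        (use that S(2) in \<open>auto simp: S'_def\<close>)
    then show ?thesis by simp
  qed
  obtain P0 where P0: "primitive_on 0 b (\<lambda>t. Q' t - P0 t ** S' t ** P0 t) P0" "P0 0 = G"
    by (rule riccati_exists_from_0[of S' C Q' G b]) (use S Q G b in \<open>auto simp: S'_def Q'_def\<close>)
  define P where "P = (\<lambda>t. P0 (b - t))"
  have P: "primitive_on 0 b (\<lambda>t. P t ** S t ** P t - Q t) P" "P b = G"
    using primitive_on_reflect[OF P0(1)] P0(2) by (simp_all add: P_def S'_def Q'_def)
  have "primitive_on 0 b (\<lambda>t. transpose (P t) ** S t ** transpose (P t) - Q t) (\<lambda>t. transpose (P t))"
    using primitive_on_linear[OF P(1) bounded_linear_transpose] psd_matricesD(1)[OF S(3)] psd_matricesD(1)[OF Q(3)]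
    by (simp add: transpose_diff matrix_transpose_mul matrix_mul_assoc)
  note tP = this
  have sym: "transpose (P t) = P t" if "t \<in> {0..b}" for t
    by (rule uniq[OF P(1) tP _ that]) (simp add: P psd_matricesD(1)[OF G])
  show ?thesis
  proof (rule that[OF P sym])
    show "P' t = P t" if "primitive_on 0 b (\<lambda>t. P' t ** S t ** P' t - Q t) P'" "P' b = G" "t \<in> {0..b}" for P' t
      by (rule uniq[OF P(1) that(1) _ that(3)]) (simp add: P that)
  qed
qed

section \<open>Square integrable functions\<close>

definition sq_integrable :: "'w measure \<Rightarrow> ('w \<Rightarrow> 'a::euclidean_space) \<Rightarrow> bool" where
  "sq_integrable N f \<longleftrightarrow> f \<in> borel_measurable N \<and> integrable N (\<lambda>x. (norm (f x))\<^sup>2)"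

lemma sq_integrable_measurable: "sq_integrable N f \<Longrightarrow> f \<in> borel_measurable N"
  by (simp add: sq_integrable_def)

lemma sq_integrable_iff_nn_integral:
  "sq_integrable N f \<longleftrightarrow> f \<in> borel_measurable N \<and> (\<integral>\<^sup>+x. ennreal ((norm (f x))\<^sup>2) \<partial>N) < \<infinity>"
  unfolding sq_integrable_def by (auto simp: integrable_iff_bounded)

lemma sq_integrable_bound:
  fixes f :: "'w \<Rightarrow> 'a::euclidean_space" and g :: "'w \<Rightarrow> 'b::euclidean_space"
  assumes f: "sq_integrable N f" and g: "g \<in> borel_measurable N"
    and le: "AE x in N. norm (g x) \<le> K * norm (f x)"
  shows "sq_integrable N g"
  unfolding sq_integrable_def
proof
  show "integrable N (\<lambda>x. (norm (g x))\<^sup>2)"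
  proof (rule Bochner_Integration.integrable_bound)
    show "integrable N (\<lambda>x. K\<^sup>2 * (norm (f x))\<^sup>2)"
      using f by (simp add: sq_integrable_def)
    show "AE x in N. norm ((norm (g x))\<^sup>2) \<le> norm (K\<^sup>2 * (norm (f x))\<^sup>2)"
      using le
    proof eventually_elim
      case (elim x)
      then have "(norm (g x))\<^sup>2 \<le> (K * norm (f x))\<^sup>2"
        by (intro power_mono) auto
      then show ?case by (simp add: power_mult_distrib)
    qed
  qed (use g in measurable)
qed (fact g)

lemma sq_integrable_add:
  fixes f g :: "'w \<Rightarrow> 'a::euclidean_space"
  assumes "sq_integrable N f" "sq_integrable N g"
  shows "sq_integrable N (\<lambda>x. f x + g x)"
  unfolding sq_integrable_def
proof
  have [measurable]: "f \<in> borel_measurable N" "g \<in> borel_measurable N"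
    using assms by (auto simp: sq_integrable_def)
  show "(\<lambda>x. f x + g x) \<in> borel_measurable N" by measurable
  show "integrable N (\<lambda>x. (norm (f x + g x))\<^sup>2)"
  proof (rule Bochner_Integration.integrable_bound)
    show "integrable N (\<lambda>x. 2 * (norm (f x))\<^sup>2 + 2 * (norm (g x))\<^sup>2)"
      using assms by (auto simp: sq_integrable_def)
    have "(norm (f x + g x))\<^sup>2 \<le> 2 * (norm (f x))\<^sup>2 + 2 * (norm (g x))\<^sup>2" for x
    proof -
      have "(norm (f x + g x))\<^sup>2 \<le> (norm (f x) + norm (g x))\<^sup>2"
        by (intro power_mono norm_triangle_ineq) auto
      also have "\<dots> \<le> 2 * (norm (f x))\<^sup>2 + 2 * (norm (g x))\<^sup>2"
        using sum_squares_bound[of "norm (f x)" "norm (g x)"] by (simp add: power2_sum)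
      finally show ?thesis .
    qed
    then show "AE x in N. norm ((norm (f x + g x))\<^sup>2) \<le> norm (2 * (norm (f x))\<^sup>2 + 2 * (norm (g x))\<^sup>2)"
      by (intro AE_I2) simp
  qed measurable
qed

lemma sq_integrable_bounded_linear:
  fixes f :: "'w \<Rightarrow> 'a::euclidean_space" and L :: "'a \<Rightarrow> 'b::euclidean_space"
  assumes "sq_integrable N f" "bounded_linear L"
  shows "sq_integrable N (\<lambda>x. L (f x))"
proof -
  obtain K where "\<And>x. norm (L x) \<le> norm x * K"
    using bounded_linear.bounded[OF assms(2)] by blast
  moreover have "(\<lambda>x. L (f x)) \<in> borel_measurable N"
    using assms by (intro borel_measurable_continuous_on[OF _ sq_integrable_measurable[OF assms(1)]])
      (auto intro: linear_continuous_on)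
  ultimately show ?thesis
    by (intro sq_integrable_bound[OF assms(1), of _ K]) (auto simp: mult.commute)
qed

lemma sq_integrable_scaleR: "sq_integrable N f \<Longrightarrow> sq_integrable N (\<lambda>x. c *\<^sub>R f x)"
  by (erule sq_integrable_bounded_linear) (rule bounded_linear_scaleR_right)

lemma sq_integrable_minus: "sq_integrable N f \<Longrightarrow> sq_integrable N (\<lambda>x. - f x)"
  using sq_integrable_scaleR[of N f "-1"] by simp

lemma sq_integrable_diff:
  fixes f g :: "'w \<Rightarrow> 'a::euclidean_space"
  assumes "sq_integrable N f" "sq_integrable N g"
  shows "sq_integrable N (\<lambda>x. f x - g x)"
  using sq_integrable_add[OF assms(1) sq_integrable_minus[OF assms(2)]] by simp

lemma sq_integrable_zero: "sq_integrable N (\<lambda>_. 0)"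
  by (simp add: sq_integrable_def)

lemma sq_integrable_sum:
  fixes f :: "'i \<Rightarrow> 'w \<Rightarrow> 'a::euclidean_space"
  assumes "\<And>i. i \<in> I \<Longrightarrow> sq_integrable N (f i)"
  shows "sq_integrable N (\<lambda>x. \<Sum>i\<in>I. f i x)"
  using assms
  by (induction I rule: infinite_finite_induct) (auto simp: sq_integrable_zero intro!: sq_integrable_add)

lemma sq_integrable_component:
  "sq_integrable N f \<Longrightarrow> sq_integrable N (\<lambda>x. f x \<bullet> b)"
  by (erule sq_integrable_bounded_linear) (rule bounded_linear_inner_left)

lemma integrable_bilinear_sq_integrable:
  fixes prod :: "'a::euclidean_space \<Rightarrow> 'b::euclidean_space \<Rightarrow> 'c::euclidean_space"
  assumes bil: "bounded_bilinear prod" and f: "sq_integrable N f" and g: "sq_integrable N g"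
  shows "integrable N (\<lambda>x. prod (f x) (g x))"
proof -
  interpret bounded_bilinear prod by fact
  obtain K where K: "0 \<le> K" "\<And>u v. norm (prod u v) \<le> norm u * norm v * K"
    using nonneg_bounded by blast
  show ?thesis
  proof (rule Bochner_Integration.integrable_bound)
    show "integrable N (\<lambda>x. ((norm (f x))\<^sup>2 + (norm (g x))\<^sup>2) * K)"
      using f g by (auto simp: sq_integrable_def)
    show "(\<lambda>x. prod (f x) (g x)) \<in> borel_measurable N"
      by (intro bounded_bilinear_borel_measurable[OF bil] sq_integrable_measurable f g)
    have "norm (prod (f x) (g x)) \<le> ((norm (f x))\<^sup>2 + (norm (g x))\<^sup>2) * K" for x
    proof -
      have "norm (f x) * norm (g x) \<le> (norm (f x))\<^sup>2 + (norm (g x))\<^sup>2"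
        using sum_squares_bound[of "norm (f x)" "norm (g x)"]
          mult_nonneg_nonneg[OF norm_ge_zero[of "f x"] norm_ge_zero[of "g x"]] unfolding mult.assoc
        by linarith
      then show ?thesis
        using K by (meson mult_right_mono order_trans)
    qed
    then show "AE x in N. norm (prod (f x) (g x)) \<le> norm (((norm (f x))\<^sup>2 + (norm (g x))\<^sup>2) * K)"
      using K by (intro AE_I2) simp
  qed
qed

lemmas integrable_inner_sq_integrable = integrable_bilinear_sq_integrable[OF bounded_bilinear_inner]
lemmas integrable_mult_sq_integrable = integrable_bilinear_sq_integrable[OF bounded_bilinear_mult]
lemmas integrable_scaleR_sq_integrable = integrable_bilinear_sq_integrable[OF bounded_bilinear_scaleR]

lemma (in finite_measure) sq_integrable_const: "sq_integrable M (\<lambda>_. c)"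
  by (simp add: sq_integrable_def)

lemma (in finite_measure) sq_integrable_imp_integrable:
  assumes "sq_integrable M f"
  shows "integrable M f"
  using integrable_scaleR_sq_integrable[OF sq_integrable_const[of 1] assms] by simp

lemma nn_integral_norm_add_sq:
  fixes f g :: "'w \<Rightarrow> 'a::euclidean_space"
  assumes [measurable]: "f \<in> borel_measurable N" "g \<in> borel_measurable N"
  shows "(\<integral>\<^sup>+x. ennreal ((norm (f x + g x))\<^sup>2) \<partial>N) \<le>
    2 * (\<integral>\<^sup>+x. ennreal ((norm (f x))\<^sup>2) \<partial>N) + 2 * (\<integral>\<^sup>+x. ennreal ((norm (g x))\<^sup>2) \<partial>N)"
proof -
  have "ennreal ((norm (f x + g x))\<^sup>2) \<le> 2 * ennreal ((norm (f x))\<^sup>2) + 2 * ennreal ((norm (g x))\<^sup>2)" for x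
  proof -
    have "(norm (f x + g x))\<^sup>2 \<le> (norm (f x) + norm (g x))\<^sup>2"
      by (intro power_mono norm_triangle_ineq) auto
    also have "\<dots> \<le> 2 * (norm (f x))\<^sup>2 + 2 * (norm (g x))\<^sup>2"
      using sum_squares_bound[of "norm (f x)" "norm (g x)"] by (simp add: power2_sum)
    finally have "ennreal ((norm (f x + g x))\<^sup>2) \<le> ennreal (2 * (norm (f x))\<^sup>2 + 2 * (norm (g x))\<^sup>2)"
      by (rule ennreal_leI)
    then show ?thesis by (simp add: ennreal_mult')
  qed
  then have "(\<integral>\<^sup>+x. ennreal ((norm (f x + g x))\<^sup>2) \<partial>N) \<le>
      (\<integral>\<^sup>+x. 2 * ennreal ((norm (f x))\<^sup>2) + 2 * ennreal ((norm (g x))\<^sup>2) \<partial>N)"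
    by (intro nn_integral_mono)
  then show ?thesis
    by (simp add: nn_integral_add nn_integral_cmult)
qed

lemma nn_integral_norm_diff_sq:
  fixes f g :: "'w \<Rightarrow> 'a::euclidean_space"
  assumes "f \<in> borel_measurable N" "g \<in> borel_measurable N"
  shows "(\<integral>\<^sup>+x. ennreal ((norm (f x - g x))\<^sup>2) \<partial>N) \<le>
    2 * (\<integral>\<^sup>+x. ennreal ((norm (f x))\<^sup>2) \<partial>N) + 2 * (\<integral>\<^sup>+x. ennreal ((norm (g x))\<^sup>2) \<partial>N)"
  using nn_integral_norm_add_sq[of f N "\<lambda>x. - g x"] assms by simp

section \<open>Wiener integrals of deterministic functions\<close>

locale wiener_setting =
  fixes M :: "'w measure" and F :: "real \<Rightarrow> 'w measure" and W :: "real \<Rightarrow> 'w \<Rightarrow> real"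
  assumes filtered: "filtered_prob_space M F" and wiener: "wiener_process M F W"
begin

sublocale prob_space M
  using filtered by (simp add: filtered_prob_space_def)

lemma filtration_subalgebra: "0 \<le> t \<Longrightarrow> subalgebra M (F t)"
  using filtered by (simp add: filtered_prob_space_def)

lemma filtration_space: "0 \<le> t \<Longrightarrow> space (F t) = space M"
  using filtration_subalgebra by (simp add: subalgebra_def)

lemma filtration_mono: "0 \<le> s \<Longrightarrow> s \<le> t \<Longrightarrow> subalgebra (F t) (F s)"
  using filtered filtration_space unfolding filtered_prob_space_def subalgebra_def by (metis order_trans)

lemma filtration_measurable_mono:
  "0 \<le> s \<Longrightarrow> s \<le> t \<Longrightarrow> f \<in> measurable (F s) N \<Longrightarrow> f \<in> measurable (F t) N"
  using measurable_from_subalg[OF filtration_mono] .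

lemma filtration_measurable: "0 \<le> t \<Longrightarrow> f \<in> measurable (F t) N \<Longrightarrow> f \<in> measurable M N"
  using measurable_from_subalg[OF filtration_subalgebra] .

lemma wiener_measurable_filtration: "0 \<le> s \<Longrightarrow> s \<le> t \<Longrightarrow> W s \<in> borel_measurable (F t)"
  using wiener filtration_measurable_mono[of s t "W s" borel] by (auto simp: wiener_process_def)

lemma wiener_measurable: "0 \<le> t \<Longrightarrow> W t \<in> borel_measurable M"
  using filtration_measurable[of t "W t" borel] wiener_measurable_filtration[of t t] by simp

lemma wiener_increment:
  assumes "0 \<le> s" "s \<le> t"
  shows "sq_integrable M (\<lambda>\<omega>. W t \<omega> - W s \<omega>)" "expectation (\<lambda>\<omega>. W t \<omega> - W s \<omega>) = 0"
    "expectation (\<lambda>\<omega>. (W t \<omega> - W s \<omega>)\<^sup>2) = t - s"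
proof -
  have *: "sq_integrable M (\<lambda>\<omega>. W t \<omega> - W s \<omega>) \<and> expectation (\<lambda>\<omega>. W t \<omega> - W s \<omega>) = 0 \<and>
    expectation (\<lambda>\<omega>. (W t \<omega> - W s \<omega>)\<^sup>2) = t - s"
  proof (cases "s = t")
    case True
    then show ?thesis by (simp add: sq_integrable_zero)
  next
    case False
    define D where "D = (\<lambda>\<omega>. W t \<omega> - W s \<omega>)"
    have d: "distributed M lborel D (normal_density 0 (sqrt (t - s)))" and pos: "0 < sqrt (t - s)"
      using False assms wiener by (auto simp: wiener_process_def D_def)
    have "integrable M (\<lambda>\<omega>. (D \<omega>)\<^sup>2)"
      using distributed_integrable[OF d, of "\<lambda>x. x\<^sup>2"] integrable_normal_moment[OF pos, of 0 2] by simp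
    moreover have "expectation (\<lambda>\<omega>. (D \<omega>)\<^sup>2) = t - s"
      using distributed_integral[OF d, of "\<lambda>x. x\<^sup>2"] integral_normal_moment_even[OF pos, of 0 1] assms
      by simp
    moreover have "expectation D = 0"
      using normal_distributed_expectation[OF pos d] by simp
    moreover have "D \<in> borel_measurable M"
      unfolding D_def using assms by (intro borel_measurable_diff wiener_measurable) auto
    ultimately show ?thesis by (simp add: sq_integrable_def D_def)
  qed
  then show "sq_integrable M (\<lambda>\<omega>. W t \<omega> - W s \<omega>)" "expectation (\<lambda>\<omega>. W t \<omega> - W s \<omega>) = 0"
    "expectation (\<lambda>\<omega>. (W t \<omega> - W s \<omega>)\<^sup>2) = t - s" by auto
qed

text \<open>Independence from the past enters only here, and only through this orthogonality. The
  corresponding property of Wiener integrals is obtained from it by linear combinations and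
  mean-square limits.\<close>

lemma wiener_increment_orthogonal:
  assumes "0 \<le> s" "s \<le> t" and \<xi>: "\<xi> \<in> borel_measurable (F s)" "sq_integrable M \<xi>"
  shows "expectation (\<lambda>\<omega>. (W t \<omega> - W s \<omega>) * \<xi> \<omega>) = 0"
proof (cases "s = t")
  case False
  define D where "D = (\<lambda>\<omega>. W t \<omega> - W s \<omega>)"
  have m: "D \<in> borel_measurable M" "\<xi> \<in> borel_measurable M"
    using sq_integrable_measurable[OF wiener_increment(1)[OF assms(1,2)]] \<xi>(2)
    by (auto simp: D_def sq_integrable_def)
  have "indep_set (sets (vimage_algebra (space M) D borel)) (sets (F s))"
    using wiener False assms by (auto simp: wiener_process_def D_def)
  \<comment> \<open>Independence is given for \<open>sets (F s)\<close> and passes to the smaller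
    sigma-algebra generated by \<open>\<xi>\<close>.\<close>
  moreover have "sigma_sets (space M) {\<xi> -` A \<inter> space M |A. A \<in> sets borel} \<subseteq> sets (F s)"
    using measurable_sets[OF \<xi>(1)] filtration_space[OF assms(1)]
    by (subst filtration_space[OF assms(1), symmetric], intro sets.sigma_sets_subset) auto
  ultimately have "indep_set (sigma_sets (space M) {D -` A \<inter> space M |A. A \<in> sets borel})
      (sigma_sets (space M) {\<xi> -` A \<inter> space M |A. A \<in> sets borel})"
    unfolding indep_sets2_eq by (auto simp: sets_vimage_algebra)
  then have "indep_var borel D borel \<xi>"
    using m by (simp add: indep_var_eq)
  then have "expectation (\<lambda>\<omega>. D \<omega> * \<xi> \<omega>) = expectation D * expectation \<xi>"
    by (rule indep_var_lebesgue_integral)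
      (use wiener_increment(1)[OF assms(1,2)] \<xi>(2) in \<open>auto simp: D_def intro: sq_integrable_imp_integrable\<close>)
  then show ?thesis
    using wiener_increment(2)[OF assms(1,2)] by (simp add: D_def)
qed simp

lemma wiener_covariance:
  assumes "0 \<le> s" "0 \<le> t"
  shows "expectation (\<lambda>\<omega>. (W s \<omega> - W 0 \<omega>) * (W t \<omega> - W 0 \<omega>)) = min s t"
proof -
  have le: "expectation (\<lambda>\<omega>. (W s \<omega> - W 0 \<omega>) * (W t \<omega> - W 0 \<omega>)) = s" if "0 \<le> s" "s \<le> t" for s t
  proof -
    let ?w = "\<lambda>\<omega>. W s \<omega> - W 0 \<omega>"
    have sq: "sq_integrable M ?w" "sq_integrable M (\<lambda>\<omega>. W t \<omega> - W s \<omega>)"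
      using that by (auto intro!: wiener_increment)
    have "expectation (\<lambda>\<omega>. ?w \<omega> * (W t \<omega> - W 0 \<omega>)) =
        expectation (\<lambda>\<omega>. ?w \<omega> * ?w \<omega> + (W t \<omega> - W s \<omega>) * ?w \<omega>)"
      by (intro Bochner_Integration.integral_cong) (auto simp: algebra_simps)
    also have "\<dots> = expectation (\<lambda>\<omega>. (?w \<omega>)\<^sup>2) + expectation (\<lambda>\<omega>. (W t \<omega> - W s \<omega>) * ?w \<omega>)"
      by (simp add: integrable_mult_sq_integrable[OF sq(1,1)] integrable_mult_sq_integrable[OF sq(2,1)]
          power2_eq_square)
    also have "\<dots> = s"
      using wiener_increment(3)[of 0 s] wiener_increment_orthogonal[OF that, of ?w] sq that
      by (simp add: wiener_measurable_filtration borel_measurable_diff)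
    finally show ?thesis .
  qed
  show ?thesis
    using le[of s t] le[of t s] assms by (cases "s \<le> t") (auto simp: mult.commute min_def)
qed

text \<open>Written as the integral of a product of indicators, the covariance covers every relative
  position of the two intervals, and the isometry for step functions becomes a bilinear
  expansion.\<close>

lemma wiener_increment_covariance:
  assumes "0 \<le> a" "a \<le> b" "0 \<le> c" "c \<le> d"
  shows "expectation (\<lambda>\<omega>. (W b \<omega> - W a \<omega>) * (W d \<omega> - W c \<omega>)) =
    (LBINT x. indicator {a<..b} x * indicator {c<..d} x)"
proof -
  \<comment> \<open>\<open>W 0\<close> is 0 only almost surely, hence increments from time 0 in
    place of values of \<open>W\<close>.\<close>
  define w where "w = (\<lambda>t \<omega>. W t \<omega> - W 0 \<omega>)"
  have i: "integrable M (\<lambda>\<omega>. w s \<omega> * w t \<omega>)" if "0 \<le> s" "0 \<le> t" for s t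
    unfolding w_def using that by (intro integrable_mult_sq_integrable wiener_increment) auto
  have "(\<lambda>\<omega>. (W b \<omega> - W a \<omega>) * (W d \<omega> - W c \<omega>)) =
      (\<lambda>\<omega>. w b \<omega> * w d \<omega> - w b \<omega> * w c \<omega> - w a \<omega> * w d \<omega> + w a \<omega> * w c \<omega>)"
    by (auto simp: w_def algebra_simps)
  then have "expectation (\<lambda>\<omega>. (W b \<omega> - W a \<omega>) * (W d \<omega> - W c \<omega>)) =
      min b d - min b c - min a d + min a c"
    using assms i wiener_covariance by (simp add: w_def)
  moreover have "(LBINT x. indicator {a<..b} x * indicator {c<..d} x) =
      (LBINT x. indicator {max a c<..min b d} x :: real)"
    by (intro Bochner_Integration.integral_cong) (auto simp: indicator_def)
  then have "(LBINT x. indicator {a<..b} x * indicator {c<..d} x) = max 0 (min b d - max a c)"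
    by (auto simp: max_def)
  ultimately show ?thesis using assms by (auto simp: min_def max_def)
qed

end

lemma step_function_measurable [measurable]:
  fixes c :: "nat \<Rightarrow> 'a::euclidean_space"
  shows "step_function k p c \<in> borel_measurable borel"
  unfolding step_function_def by measurable

lemma sq_integrable_indicator_Ioc:
  "sq_integrable lborel (indicator {a<..b::real} :: real \<Rightarrow> real)"
proof -
  have "(norm (indicator {a<..b} x :: real))\<^sup>2 = indicator {a<..b} x" for x
    by (simp add: indicator_def)
  moreover have "integrable lborel (indicator {a<..b} :: real \<Rightarrow> real)"
    by (rule integrable_real_indicator) (cases "a \<le> b"; simp)+
  ultimately show ?thesis by (simp add: sq_integrable_def)
qed

lemma sq_integrable_step_function:
  fixes c :: "nat \<Rightarrow> 'a::euclidean_space"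
  shows "sq_integrable lborel (step_function k p c)"
  unfolding step_function_def
  by (intro sq_integrable_sum sq_integrable_bounded_linear[OF sq_integrable_indicator_Ioc]
      bounded_linear_scaleR_left)

definition partition_upto :: "nat \<Rightarrow> (nat \<Rightarrow> real) \<Rightarrow> real \<Rightarrow> bool" where
  "partition_upto k p t \<longleftrightarrow> mono_on {..k} p \<and> p ` {..k} \<subseteq> {0..t}"

lemma partition_uptoD:
  assumes "partition_upto k p t" "i < k"
  shows "0 \<le> p i" "p i \<le> p (Suc i)" "p i \<le> t" "p (Suc i) \<le> t"
proof -
  have "p i \<in> {0..t}" "p (Suc i) \<in> {0..t}"
    using assms by (auto simp: partition_upto_def image_subset_iff)
  then show "0 \<le> p i" "p i \<le> t" "p (Suc i) \<le> t" by auto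
  show "p i \<le> p (Suc i)"
    using assms by (auto simp: partition_upto_def intro!: mono_onD[of "{..k}" p])
qed

lemma partition_upto_min:
  assumes "partition_upto k p t" "0 \<le> s"
  shows "partition_upto k (\<lambda>i. min s (p i)) s"
  using assms by (auto simp: partition_upto_def mono_on_def intro: min.mono min.coboundedI2)

text \<open>Stopping at time \<open>s\<close> moves the nodes instead of dropping cells: cells
  beyond \<open>s\<close> collapse to empty intervals, and the coefficients keep their
  numbering.\<close>

lemma step_function_min:
  "step_function k (\<lambda>i. min s (p i)) c r = indicator {..s} r *\<^sub>R step_function k p c r"
  unfolding step_function_def scaleR_sum_right by (intro sum.cong) (auto simp: indicator_def)

lemma step_function_eq_0:
  assumes "partition_upto k p t" "r \<notin> {0..t}"
  shows "step_function k p c r = 0"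
  unfolding step_function_def
proof (intro sum.neutral ballI)
  fix i assume "i \<in> {..<k}"
  then have "r \<notin> {p i<..p (Suc i)}"
    using partition_uptoD[OF assms(1), of i] assms(2) by auto
  then show "indicator {p i<..p (Suc i)} r *\<^sub>R c i = 0" by simp
qed

section \<open>Step integrals and their mean-square limits\<close>

context wiener_setting
begin

lemma sq_integrable_step_integral:
  fixes c :: "nat \<Rightarrow> 'a::euclidean_space"
  assumes "partition_upto k p t"
  shows "sq_integrable M (step_integral W k p c)"
proof -
  have "sq_integrable M (\<lambda>\<omega>. (W (p (Suc i)) \<omega> - W (p i) \<omega>) *\<^sub>R c i)" if "i < k" for i
    using partition_uptoD[OF assms that]
    by (intro sq_integrable_bounded_linear[OF wiener_increment(1)] bounded_linear_scaleR_left) auto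
  then show ?thesis
    unfolding step_integral_def by (intro sq_integrable_sum) auto
qed

lemma integral_double_sum:
  fixes g :: "nat \<Rightarrow> nat \<Rightarrow> 'b \<Rightarrow> real"
  assumes "\<And>i j. i < k \<Longrightarrow> j < l \<Longrightarrow> integrable N (g i j)"
  shows "(LINT x|N. (\<Sum>i<k. \<Sum>j<l. g i j x * a i j)) = (\<Sum>i<k. \<Sum>j<l. integral\<^sup>L N (g i j) * a i j)"
proof -
  have i: "integrable N (\<lambda>x. g i j x * a i j)" if "i \<in> {..<k}" "j \<in> {..<l}" for i j
    using assms[of i j] that by auto
  have "(LINT x|N. (\<Sum>i<k. \<Sum>j<l. g i j x * a i j)) = (\<Sum>i<k. LINT x|N. (\<Sum>j<l. g i j x * a i j))"
    by (intro Bochner_Integration.integral_sum Bochner_Integration.integrable_sum i)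
  also have "\<dots> = (\<Sum>i<k. \<Sum>j<l. LINT x|N. g i j x * a i j)"
    by (intro sum.cong refl Bochner_Integration.integral_sum i)
  finally show ?thesis by simp
qed

text \<open>Both sides are expanded over pairs of cells, one from each partition, which avoids
  passing to a common refinement.\<close>

lemma step_integral_covariance:
  fixes c c' :: "nat \<Rightarrow> 'a::euclidean_space"
  assumes p: "partition_upto k p t" and p': "partition_upto k' p' t'"
  shows "expectation (\<lambda>\<omega>. step_integral W k p c \<omega> \<bullet> step_integral W k' p' c' \<omega>) =
    (LBINT s. step_function k p c s \<bullet> step_function k' p' c' s)"
proof -
  have i: "integrable M (\<lambda>\<omega>. (W (p (Suc i)) \<omega> - W (p i) \<omega>) * (W (p' (Suc j)) \<omega> - W (p' j) \<omega>))"
    if "i < k" "j < k'" for i j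
    using partition_uptoD[OF p that(1)] partition_uptoD[OF p' that(2)]
    by (intro integrable_mult_sq_integrable wiener_increment) auto
  have i': "integrable lborel (\<lambda>s. indicator {a<..b} s * indicator {c<..d} s :: real)" for a b c d :: real
    by (intro integrable_mult_sq_integrable sq_integrable_indicator_Ioc)
  have inner_sums: "(\<Sum>i<k. u i) \<bullet> (\<Sum>j<k'. v j) = (\<Sum>i<k. \<Sum>j<k'. u i \<bullet> v j)" for u v :: "nat \<Rightarrow> 'a"
    unfolding inner_sum_left by (simp add: inner_sum_right)
  have "expectation (\<lambda>\<omega>. step_integral W k p c \<omega> \<bullet> step_integral W k' p' c' \<omega>) =
      expectation (\<lambda>\<omega>. \<Sum>i<k. \<Sum>j<k'. (W (p (Suc i)) \<omega> - W (p i) \<omega>) * (W (p' (Suc j)) \<omega> - W (p' j) \<omega>) * (c i \<bullet> c' j))"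
    unfolding step_integral_def inner_sums
    by (intro Bochner_Integration.integral_cong refl sum.cong) (auto simp: sum_distrib_left mult_ac)
  also have "\<dots> = (\<Sum>i<k. \<Sum>j<k'. expectation (\<lambda>\<omega>. (W (p (Suc i)) \<omega> - W (p i) \<omega>) * (W (p' (Suc j)) \<omega> - W (p' j) \<omega>)) * (c i \<bullet> c' j))"
    by (rule integral_double_sum[OF i])
  also have "\<dots> = (\<Sum>i<k. \<Sum>j<k'. (LBINT s. indicator {p i<..p (Suc i)} s * indicator {p' j<..p' (Suc j)} s) * (c i \<bullet> c' j))"
    using partition_uptoD[OF p] partition_uptoD[OF p']
    by (intro sum.cong refl arg_cong2[where f="(*)"] wiener_increment_covariance) auto
  also have "\<dots> = (LBINT s. \<Sum>i<k. \<Sum>j<k'. indicator {p i<..p (Suc i)} s * indicator {p' j<..p' (Suc j)} s * (c i \<bullet> c' j))"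
    by (rule integral_double_sum[OF i', symmetric])
  also have "\<dots> = (LBINT s. step_function k p c s \<bullet> step_function k' p' c' s)"
    unfolding step_function_def inner_sums
    by (intro Bochner_Integration.integral_cong refl sum.cong) (auto simp: sum_distrib_left mult_ac)
  finally show ?thesis .
qed

proposition step_integral_isometry:
  fixes c c' :: "nat \<Rightarrow> 'a::euclidean_space"
  assumes p: "partition_upto k p t" and p': "partition_upto k' p' t'"
  shows "(\<integral>\<^sup>+\<omega>. ennreal ((norm (step_integral W k p c \<omega> - step_integral W k' p' c' \<omega>))\<^sup>2) \<partial>M) =
    (\<integral>\<^sup>+s. ennreal ((norm (step_function k p c s - step_function k' p' c' s))\<^sup>2) \<partial>lborel)"
proof -
  let ?I = "step_integral W k p c" and ?I' = "step_integral W k' p' c'"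
  let ?f = "step_function k p c" and ?f' = "step_function k' p' c'"
  have n: "(norm (u - v))\<^sup>2 = u \<bullet> u - 2 * (u \<bullet> v) + v \<bullet> v" for u v :: 'a
    by (simp add: power2_norm_eq_inner inner_diff_left inner_diff_right inner_commute)
  have sq: "sq_integrable M ?I" "sq_integrable M ?I'"
    using p p' by (auto intro: sq_integrable_step_integral)
  have sqf: "sq_integrable lborel ?f" "sq_integrable lborel ?f'"
    by (rule sq_integrable_step_function)+
  have "expectation (\<lambda>\<omega>. (norm (?I \<omega> - ?I' \<omega>))\<^sup>2) =
      expectation (\<lambda>\<omega>. ?I \<omega> \<bullet> ?I \<omega>) - 2 * expectation (\<lambda>\<omega>. ?I \<omega> \<bullet> ?I' \<omega>) + expectation (\<lambda>\<omega>. ?I' \<omega> \<bullet> ?I' \<omega>)"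
    unfolding n using sq by (simp add: integrable_inner_sq_integrable)
  also have "\<dots> = (LBINT s. ?f s \<bullet> ?f s) - 2 * (LBINT s. ?f s \<bullet> ?f' s) + (LBINT s. ?f' s \<bullet> ?f' s)"
    using p p' by (simp add: step_integral_covariance)
  also have "\<dots> = (LBINT s. (norm (?f s - ?f' s))\<^sup>2)"
    unfolding n using sqf by (simp add: integrable_inner_sq_integrable)
  finally have "expectation (\<lambda>\<omega>. (norm (?I \<omega> - ?I' \<omega>))\<^sup>2) = (LBINT s. (norm (?f s - ?f' s))\<^sup>2)" .
  then show ?thesis
    using sq_integrable_diff[OF sq] sq_integrable_diff[OF sqf]
    by (simp add: nn_integral_eq_integral sq_integrable_def)
qed

text \<open>Node by node, \<open>W a - W (min s a)\<close> equals \<open>W (max s a) - W s\<close>,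
  an increment that starts at \<open>s\<close>. So the part of the integral after \<open>s\<close>
  is a combination of variables orthogonal to \<open>\<xi>\<close>.\<close>

lemma step_integral_orthogonal:
  fixes c :: "nat \<Rightarrow> 'a::euclidean_space"
  assumes p: "partition_upto k p t" and "0 \<le> s" and \<xi>: "\<xi> \<in> borel_measurable (F s)" "sq_integrable M \<xi>"
  shows "expectation (\<lambda>\<omega>. \<xi> \<omega> *\<^sub>R (step_integral W k p c \<omega> - step_integral W k (\<lambda>i. min s (p i)) c \<omega>)) = 0"
proof -
  define D where "D = (\<lambda>a \<omega>. W (max s a) \<omega> - W s \<omega>)"
  have D: "sq_integrable M (D a)" "expectation (\<lambda>\<omega>. D a \<omega> * \<xi> \<omega>) = 0" for a
    unfolding D_def using \<open>0 \<le> s\<close> \<xi> by (auto intro: wiener_increment wiener_increment_orthogonal)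
  have *: "W a \<omega> - W (min s a) \<omega> = D a \<omega>" for a \<omega>
    by (simp add: D_def max_def min_def)
  have "\<xi> \<omega> *\<^sub>R (step_integral W k p c \<omega> - step_integral W k (\<lambda>i. min s (p i)) c \<omega>) =
      (\<Sum>i<k. (D (p (Suc i)) \<omega> * \<xi> \<omega> - D (p i) \<omega> * \<xi> \<omega>) *\<^sub>R c i)" for \<omega>
    unfolding step_integral_def sum_subtractf[symmetric] scaleR_sum_right *[symmetric]
    by (intro sum.cong refl) (simp add: algebra_simps)
  moreover have "integrable M (\<lambda>\<omega>. D a \<omega> * \<xi> \<omega>)" for a
    using D(1) \<xi>(2) by (rule integrable_mult_sq_integrable)
  ultimately show ?thesis
    by (simp add: Bochner_Integration.integral_sum D(2))
qed

text \<open>By Cauchy-Schwarz the square of \<open>norm c\<close> is at most the second moment of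
  \<open>\<xi>\<close> times that of \<open>R j\<close>, and the latter tends to 0.\<close>

lemma orthogonal_limit:
  fixes R :: "nat \<Rightarrow> 'w \<Rightarrow> 'a::euclidean_space"
  assumes \<xi>: "sq_integrable M \<xi>" and R: "\<And>j. sq_integrable M (R j)"
    and c: "\<And>j. expectation (\<lambda>\<omega>. \<xi> \<omega> *\<^sub>R R j \<omega>) = c"
    and lim: "(\<lambda>j. \<integral>\<^sup>+\<omega>. ennreal ((norm (R j \<omega>))\<^sup>2) \<partial>M) \<longlonglongrightarrow> 0"
  shows "c = 0"
proof (rule ccontr)
  assume "c \<noteq> 0"
  define A where "A = (\<integral>\<^sup>+\<omega>. ennreal ((norm (\<xi> \<omega>))\<^sup>2) \<partial>M)"
  have [measurable]: "\<xi> \<in> borel_measurable M" "R j \<in> borel_measurable M" for j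
    using \<xi> R by (auto simp: sq_integrable_def)
  have "ennreal ((norm c)\<^sup>2) \<le> A * (\<integral>\<^sup>+\<omega>. ennreal ((norm (R j \<omega>))\<^sup>2) \<partial>M)" for j
  proof -
    have "ennreal (norm c) \<le> (\<integral>\<^sup>+\<omega>. ennreal (norm (\<xi> \<omega> *\<^sub>R R j \<omega>)) \<partial>M)"
      using integral_norm_bound_ennreal[OF integrable_scaleR_sq_integrable[OF \<xi> R[of j]]]
      by (simp add: c)
    also have "\<dots> = (\<integral>\<^sup>+\<omega>. ennreal (norm (\<xi> \<omega>)) * ennreal (norm (R j \<omega>)) \<partial>M)"
      by (simp add: ennreal_mult)
    finally have "(ennreal (norm c))\<^sup>2 \<le> (\<integral>\<^sup>+\<omega>. ennreal (norm (\<xi> \<omega>)) * ennreal (norm (R j \<omega>)) \<partial>M)\<^sup>2"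
      by (intro power_mono) auto
    also have "\<dots> \<le> (\<integral>\<^sup>+\<omega>. (ennreal (norm (\<xi> \<omega>)))\<^sup>2 \<partial>M) * (\<integral>\<^sup>+\<omega>. (ennreal (norm (R j \<omega>)))\<^sup>2 \<partial>M)"
      by (rule Cauchy_Schwarz_nn_integral) measurable
    finally show ?thesis by (simp add: A_def ennreal_power)
  qed
  moreover have "(\<lambda>j. A * (\<integral>\<^sup>+\<omega>. ennreal ((norm (R j \<omega>))\<^sup>2) \<partial>M)) \<longlonglongrightarrow> A * 0"
    using \<xi> unfolding sq_integrable_iff_nn_integral A_def
    by (intro ennreal_tendsto_cmult lim) simp
  ultimately have "ennreal ((norm c)\<^sup>2) \<le> 0"
    by (intro LIMSEQ_le_const) auto
  then show False using \<open>c \<noteq> 0\<close> by simp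
qed

lemma is_wiener_integral_cong_AE:
  assumes "AE s in lborel. s \<in> {0..t} \<longrightarrow> \<sigma> s = \<sigma>' s"
  shows "is_wiener_integral M W t \<sigma> Z \<longleftrightarrow> is_wiener_integral M W t \<sigma>' Z"
proof -
  have "(\<integral>\<^sup>+s\<in>{0..t}. ennreal ((norm (\<phi> s - \<sigma> s))\<^sup>2) \<partial>lborel) =
      (\<integral>\<^sup>+s\<in>{0..t}. ennreal ((norm (\<phi> s - \<sigma>' s))\<^sup>2) \<partial>lborel)" for \<phi>
    by (rule nn_integral_cong_AE) (use assms in \<open>auto elim!: eventually_mono simp: indicator_def\<close>)
  then show ?thesis by (simp add: is_wiener_integral_def)
qed

lemma is_wiener_integral_cong:
  assumes "is_wiener_integral M W t \<sigma> Z" "Z' \<in> borel_measurable M" "AE \<omega> in M. Z \<omega> = Z' \<omega>"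
  shows "is_wiener_integral M W t \<sigma> Z'"
proof -
  have "(\<integral>\<^sup>+\<omega>. ennreal ((norm (I \<omega> - Z \<omega>))\<^sup>2) \<partial>M) = (\<integral>\<^sup>+\<omega>. ennreal ((norm (I \<omega> - Z' \<omega>))\<^sup>2) \<partial>M)" for I
    by (rule nn_integral_cong_AE) (use assms(3) in \<open>auto elim!: eventually_mono\<close>)
  then show ?thesis
    using assms(1,2) by (simp add: is_wiener_integral_def)
qed

text \<open>The isometry compares step functions over the whole line, so the error on
  \<open>[0, t]\<close> is rewritten with the integrand cut to zero outside; step functions vanish
  there anyway.\<close>

lemma is_wiener_integralE:
  assumes "is_wiener_integral M W t \<sigma> Z"
  obtains k p c where "\<And>j. partition_upto (k j) (p j) t"
    "(\<lambda>j. \<integral>\<^sup>+s. ennreal ((norm (step_function (k j) (p j) (c j) s - indicator {0..t} s *\<^sub>R \<sigma> s))\<^sup>2) \<partial>lborel) \<longlonglongrightarrow> 0"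
    "(\<lambda>j. \<integral>\<^sup>+\<omega>. ennreal ((norm (step_integral W (k j) (p j) (c j) \<omega> - Z \<omega>))\<^sup>2) \<partial>M) \<longlonglongrightarrow> 0"
    "Z \<in> borel_measurable M"
proof -
  obtain k p c where *: "\<And>j. partition_upto (k j) (p j) t"
    "(\<lambda>j. \<integral>\<^sup>+s\<in>{0..t}. ennreal ((norm (step_function (k j) (p j) (c j) s - \<sigma> s))\<^sup>2) \<partial>lborel) \<longlonglongrightarrow> 0"
    "(\<lambda>j. \<integral>\<^sup>+\<omega>. ennreal ((norm (step_integral W (k j) (p j) (c j) \<omega> - Z \<omega>))\<^sup>2) \<partial>M) \<longlonglongrightarrow> 0"
    using assms unfolding is_wiener_integral_def partition_upto_def by blast
  have "(\<integral>\<^sup>+s\<in>{0..t}. ennreal ((norm (step_function (k j) (p j) (c j) s - \<sigma> s))\<^sup>2) \<partial>lborel) =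
      (\<integral>\<^sup>+s. ennreal ((norm (step_function (k j) (p j) (c j) s - indicator {0..t} s *\<^sub>R \<sigma> s))\<^sup>2) \<partial>lborel)" for j
  proof (intro nn_integral_cong)
    fix s
    show "ennreal ((norm (step_function (k j) (p j) (c j) s - \<sigma> s))\<^sup>2) * indicator {0..t} s =
      ennreal ((norm (step_function (k j) (p j) (c j) s - indicator {0..t} s *\<^sub>R \<sigma> s))\<^sup>2)"
      using step_function_eq_0[OF *(1)[of j], of s "c j"] by (cases "s \<in> {0..t}") auto
  qed
  then show ?thesis
    using that[of k p c] * assms by (simp add: is_wiener_integral_def)
qed

text \<open>One approximation with both errors below 1 is enough: using |a + b|^2 <= 2 |a|^2 + 2
  |b|^2 twice gives the constant 2 (2 + 2 C^2 t) + 2. What matters is a bound uniform on bounded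
  time intervals, not the exact value of the isometry.\<close>

lemma wiener_integral_second_moment:
  fixes \<sigma> :: "real \<Rightarrow> 'a::euclidean_space"
  assumes Z: "is_wiener_integral M W t \<sigma> Z" and \<sigma>: "\<sigma> \<in> borel_measurable borel" "\<And>s. norm (\<sigma> s) \<le> C"
    and t: "0 \<le> t"
  shows "sq_integrable M Z" "expectation (\<lambda>\<omega>. (norm (Z \<omega>))\<^sup>2) \<le> 6 + 4 * C\<^sup>2 * t"
proof -
  note \<sigma>(1)[measurable]
  obtain k p c where p: "\<And>j. partition_upto (k j) (p j) t"
    and f: "(\<lambda>j. \<integral>\<^sup>+s. ennreal ((norm (step_function (k j) (p j) (c j) s - indicator {0..t} s *\<^sub>R \<sigma> s))\<^sup>2) \<partial>lborel) \<longlonglongrightarrow> 0"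
    and I: "(\<lambda>j. \<integral>\<^sup>+\<omega>. ennreal ((norm (step_integral W (k j) (p j) (c j) \<omega> - Z \<omega>))\<^sup>2) \<partial>M) \<longlonglongrightarrow> 0"
    and [measurable]: "Z \<in> borel_measurable M"
    by (rule is_wiener_integralE[OF Z], rule that)
  have "\<forall>\<^sub>F j in sequentially. (\<integral>\<^sup>+s. ennreal ((norm (step_function (k j) (p j) (c j) s - indicator {0..t} s *\<^sub>R \<sigma> s))\<^sup>2) \<partial>lborel) < 1 \<and>
     (\<integral>\<^sup>+\<omega>. ennreal ((norm (step_integral W (k j) (p j) (c j) \<omega> - Z \<omega>))\<^sup>2) \<partial>M) < 1"
    by (intro eventually_conj order_tendstoD[OF f] order_tendstoD[OF I]) auto
  then obtain j where j: "(\<integral>\<^sup>+s. ennreal ((norm (step_function (k j) (p j) (c j) s - indicator {0..t} s *\<^sub>R \<sigma> s))\<^sup>2) \<partial>lborel) < 1"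
     "(\<integral>\<^sup>+\<omega>. ennreal ((norm (step_integral W (k j) (p j) (c j) \<omega> - Z \<omega>))\<^sup>2) \<partial>M) < 1"
    by (auto dest: eventually_happens)
  let ?I = "step_integral W (k j) (p j) (c j)" and ?f = "step_function (k j) (p j) (c j)"
  have [measurable]: "?I \<in> borel_measurable M"
    by (rule sq_integrable_measurable[OF sq_integrable_step_integral[OF p]])
  have "(\<integral>\<^sup>+s. ennreal ((norm (indicator {0..t} s *\<^sub>R \<sigma> s))\<^sup>2) \<partial>lborel) \<le>
      (\<integral>\<^sup>+s. ennreal (C\<^sup>2) * indicator {0..t} s \<partial>lborel)"
    using \<sigma>(2) by (intro nn_integral_mono) (auto simp: indicator_def intro!: ennreal_leI power_mono)
  also have "\<dots> = ennreal (C\<^sup>2 * t)"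
    using t by (simp add: nn_integral_cmult_indicator ennreal_mult)
  finally have \<sigma>b: "(\<integral>\<^sup>+s. ennreal ((norm (indicator {0..t} s *\<^sub>R \<sigma> s))\<^sup>2) \<partial>lborel) \<le> ennreal (C\<^sup>2 * t)" .
  have "(\<integral>\<^sup>+s. ennreal ((norm (?f s))\<^sup>2) \<partial>lborel) =
      (\<integral>\<^sup>+s. ennreal ((norm ((?f s - indicator {0..t} s *\<^sub>R \<sigma> s) + indicator {0..t} s *\<^sub>R \<sigma> s))\<^sup>2) \<partial>lborel)"
    by simp
  also have "\<dots> \<le> 2 * (\<integral>\<^sup>+s. ennreal ((norm (?f s - indicator {0..t} s *\<^sub>R \<sigma> s))\<^sup>2) \<partial>lborel) +
      2 * (\<integral>\<^sup>+s. ennreal ((norm (indicator {0..t} s *\<^sub>R \<sigma> s))\<^sup>2) \<partial>lborel)"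
    by (rule nn_integral_norm_add_sq) measurable
  also have "\<dots> \<le> 2 * 1 + 2 * ennreal (C\<^sup>2 * t)"
    using j \<sigma>b by (intro add_mono mult_left_mono) auto
  finally have fb: "(\<integral>\<^sup>+s. ennreal ((norm (?f s))\<^sup>2) \<partial>lborel) \<le> 2 * 1 + 2 * ennreal (C\<^sup>2 * t)" .
  \<comment> \<open>The isometry against the step function with no cells gives the norm of a single
    integral.\<close>
  have iso: "(\<integral>\<^sup>+\<omega>. ennreal ((norm (?I \<omega>))\<^sup>2) \<partial>M) = (\<integral>\<^sup>+s. ennreal ((norm (?f s))\<^sup>2) \<partial>lborel)"
    using step_integral_isometry[OF p[of j], of 0 "\<lambda>_. 0" t "c j" "c j"] t
    by (simp add: step_integral_def[of W 0] step_function_def[of 0] partition_upto_def mono_on_def)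
  have "(\<integral>\<^sup>+\<omega>. ennreal ((norm (Z \<omega>))\<^sup>2) \<partial>M) = (\<integral>\<^sup>+\<omega>. ennreal ((norm (?I \<omega> - (?I \<omega> - Z \<omega>)))\<^sup>2) \<partial>M)"
    by simp
  also have "\<dots> \<le> 2 * (\<integral>\<^sup>+\<omega>. ennreal ((norm (?I \<omega>))\<^sup>2) \<partial>M) + 2 * (\<integral>\<^sup>+\<omega>. ennreal ((norm (?I \<omega> - Z \<omega>))\<^sup>2) \<partial>M)"
    by (rule nn_integral_norm_diff_sq) measurable
  also have "\<dots> \<le> 2 * (2 * 1 + 2 * ennreal (C\<^sup>2 * t)) + 2 * 1"
    unfolding iso using j fb by (intro add_mono mult_left_mono) auto
  also have "\<dots> = ennreal (6 + 4 * C\<^sup>2 * t)"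
    using t by (simp add: distrib_left ennreal_plus[symmetric] ennreal_numeral[symmetric] ennreal_mult[symmetric] mult.assoc
        del: ennreal_plus ennreal_numeral)
  finally have le: "(\<integral>\<^sup>+\<omega>. ennreal ((norm (Z \<omega>))\<^sup>2) \<partial>M) \<le> ennreal (6 + 4 * C\<^sup>2 * t)" .
  then show "sq_integrable M Z"
    unfolding sq_integrable_iff_nn_integral by (auto intro: le_less_trans)
  then have "ennreal (expectation (\<lambda>\<omega>. (norm (Z \<omega>))\<^sup>2)) \<le> ennreal (6 + 4 * C\<^sup>2 * t)"
    using le by (simp add: nn_integral_eq_integral sq_integrable_def)
  then show "expectation (\<lambda>\<omega>. (norm (Z \<omega>))\<^sup>2) \<le> 6 + 4 * C\<^sup>2 * t"
    using t by (subst (asm) ennreal_le_iff) auto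
qed

text \<open>The approximations of \<open>Zt\<close> and \<open>Zs\<close> are unrelated. Those of
  \<open>Zt\<close> are therefore stopped at \<open>s\<close>, giving \<open>I2\<close>, and
  compared with those of \<open>Zs\<close>, called \<open>I3\<close>, by the isometry. For
  \<open>I1 - I2\<close> the orthogonality is exact before any limit.\<close>

proposition wiener_integral_orthogonal:
  fixes \<sigma> :: "real \<Rightarrow> 'a::euclidean_space"
  assumes Zt: "is_wiener_integral M W t \<sigma> Zt" and Zs: "is_wiener_integral M W s \<sigma> Zs"
    and \<sigma>: "\<sigma> \<in> borel_measurable borel" "\<And>s. norm (\<sigma> s) \<le> C"
    and st: "0 \<le> s" "s \<le> t" and \<xi>: "\<xi> \<in> borel_measurable (F s)" "sq_integrable M \<xi>"
  shows "expectation (\<lambda>\<omega>. \<xi> \<omega> *\<^sub>R (Zt \<omega> - Zs \<omega>)) = 0"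
proof -
  note \<sigma>(1)[measurable]
  obtain k p c where p: "\<And>j. partition_upto (k j) (p j) t"
    and f: "(\<lambda>j. \<integral>\<^sup>+r. ennreal ((norm (step_function (k j) (p j) (c j) r - indicator {0..t} r *\<^sub>R \<sigma> r))\<^sup>2) \<partial>lborel) \<longlonglongrightarrow> 0"
    and I: "(\<lambda>j. \<integral>\<^sup>+\<omega>. ennreal ((norm (step_integral W (k j) (p j) (c j) \<omega> - Zt \<omega>))\<^sup>2) \<partial>M) \<longlonglongrightarrow> 0"
    and [measurable]: "Zt \<in> borel_measurable M"
    by (rule is_wiener_integralE[OF Zt], rule that)
  obtain l q d where q: "\<And>j. partition_upto (l j) (q j) s"
    and g: "(\<lambda>j. \<integral>\<^sup>+r. ennreal ((norm (step_function (l j) (q j) (d j) r - indicator {0..s} r *\<^sub>R \<sigma> r))\<^sup>2) \<partial>lborel) \<longlonglongrightarrow> 0"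
    and J: "(\<lambda>j. \<integral>\<^sup>+\<omega>. ennreal ((norm (step_integral W (l j) (q j) (d j) \<omega> - Zs \<omega>))\<^sup>2) \<partial>M) \<longlonglongrightarrow> 0"
    and [measurable]: "Zs \<in> borel_measurable M"
    by (rule is_wiener_integralE[OF Zs], rule that)
  define f1 where "f1 = (\<lambda>j. step_function (k j) (p j) (c j))"
  define f2 where "f2 = (\<lambda>j. step_function (k j) (\<lambda>i. min s (p j i)) (c j))"
  define f3 where "f3 = (\<lambda>j. step_function (l j) (q j) (d j))"
  define I1 where "I1 = (\<lambda>j. step_integral W (k j) (p j) (c j))"
  define I2 where "I2 = (\<lambda>j. step_integral W (k j) (\<lambda>i. min s (p j i)) (c j))"
  define I3 where "I3 = (\<lambda>j. step_integral W (l j) (q j) (d j))"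
  have p2: "partition_upto (k j) (\<lambda>i. min s (p j i)) s" for j
    using partition_upto_min[OF p st(1)] .
  have sq: "sq_integrable M (I1 j)" "sq_integrable M (I2 j)" "sq_integrable M (I3 j)" "sq_integrable M Zt" "sq_integrable M Zs" for j
    unfolding I1_def I2_def I3_def
    using sq_integrable_step_integral[OF p] sq_integrable_step_integral[OF q] sq_integrable_step_integral[OF p2]
      wiener_integral_second_moment(1)[OF Zt \<sigma>] wiener_integral_second_moment(1)[OF Zs \<sigma>] st
    by simp_all
  have [measurable]: "I1 j \<in> borel_measurable M" "I2 j \<in> borel_measurable M" "I3 j \<in> borel_measurable M"
    "f1 j \<in> borel_measurable borel" "f2 j \<in> borel_measurable borel" "f3 j \<in> borel_measurable borel" for j
    using sq by (auto simp: sq_integrable_def f1_def f2_def f3_def)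
  have f2: "(\<integral>\<^sup>+r. ennreal ((norm (f2 j r - indicator {0..s} r *\<^sub>R \<sigma> r))\<^sup>2) \<partial>lborel) \<le>
      (\<integral>\<^sup>+r. ennreal ((norm (f1 j r - indicator {0..t} r *\<^sub>R \<sigma> r))\<^sup>2) \<partial>lborel)" for j
    unfolding f2_def f1_def step_function_min using st
    by (intro nn_integral_mono) (auto simp: indicator_def step_function_eq_0[OF p])
  have I23: "(\<integral>\<^sup>+\<omega>. ennreal ((norm (I2 j \<omega> - I3 j \<omega>))\<^sup>2) \<partial>M) \<le>
      2 * (\<integral>\<^sup>+r. ennreal ((norm (f1 j r - indicator {0..t} r *\<^sub>R \<sigma> r))\<^sup>2) \<partial>lborel) +
      2 * (\<integral>\<^sup>+r. ennreal ((norm (f3 j r - indicator {0..s} r *\<^sub>R \<sigma> r))\<^sup>2) \<partial>lborel)" for j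
  proof -
    have "(\<integral>\<^sup>+\<omega>. ennreal ((norm (I2 j \<omega> - I3 j \<omega>))\<^sup>2) \<partial>M) = (\<integral>\<^sup>+r. ennreal ((norm (f2 j r - f3 j r))\<^sup>2) \<partial>lborel)"
      unfolding I2_def I3_def f2_def f3_def by (rule step_integral_isometry[OF p2 q])
    also have "\<dots> = (\<integral>\<^sup>+r. ennreal ((norm ((f2 j r - indicator {0..s} r *\<^sub>R \<sigma> r) - (f3 j r - indicator {0..s} r *\<^sub>R \<sigma> r)))\<^sup>2) \<partial>lborel)"
      by simp
    also have "\<dots> \<le> 2 * (\<integral>\<^sup>+r. ennreal ((norm (f2 j r - indicator {0..s} r *\<^sub>R \<sigma> r))\<^sup>2) \<partial>lborel) +
      2 * (\<integral>\<^sup>+r. ennreal ((norm (f3 j r - indicator {0..s} r *\<^sub>R \<sigma> r))\<^sup>2) \<partial>lborel)"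
      by (rule nn_integral_norm_diff_sq) measurable
    also have "\<dots> \<le> 2 * (\<integral>\<^sup>+r. ennreal ((norm (f1 j r - indicator {0..t} r *\<^sub>R \<sigma> r))\<^sup>2) \<partial>lborel) +
      2 * (\<integral>\<^sup>+r. ennreal ((norm (f3 j r - indicator {0..s} r *\<^sub>R \<sigma> r))\<^sup>2) \<partial>lborel)"
      using f2 by (intro add_right_mono mult_left_mono) auto
    finally show ?thesis .
  qed
  \<comment> \<open>\<open>R j\<close> is the error of \<open>I1 j - I2 j\<close> as an
    approximation of \<open>Zt - Zs\<close>, arranged so that each bracket tends to 0 in mean
    square.\<close>
  define R where "R = (\<lambda>j \<omega>. ((I2 j \<omega> - I3 j \<omega>) + (I3 j \<omega> - Zs \<omega>)) - (I1 j \<omega> - Zt \<omega>))"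
  have R_sq: "sq_integrable M (R j)" for j
    unfolding R_def using sq by (intro sq_integrable_diff sq_integrable_add)
  have R_exp: "expectation (\<lambda>\<omega>. \<xi> \<omega> *\<^sub>R R j \<omega>) = expectation (\<lambda>\<omega>. \<xi> \<omega> *\<^sub>R (Zt \<omega> - Zs \<omega>))" for j
  proof -
    have "(\<lambda>\<omega>. \<xi> \<omega> *\<^sub>R R j \<omega>) = (\<lambda>\<omega>. \<xi> \<omega> *\<^sub>R (Zt \<omega> - Zs \<omega>) - \<xi> \<omega> *\<^sub>R (I1 j \<omega> - I2 j \<omega>))"
      by (auto simp: R_def algebra_simps)
    moreover have "expectation (\<lambda>\<omega>. \<xi> \<omega> *\<^sub>R (I1 j \<omega> - I2 j \<omega>)) = 0"
      unfolding I1_def I2_def by (rule step_integral_orthogonal[OF p st(1) \<xi>])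
    ultimately show ?thesis
      using sq by (simp add: integrable_scaleR_sq_integrable \<xi>(2) sq_integrable_diff)
  qed
  define B where "B = (\<lambda>j. 2 * (2 * (2 * (\<integral>\<^sup>+r. ennreal ((norm (f1 j r - indicator {0..t} r *\<^sub>R \<sigma> r))\<^sup>2) \<partial>lborel) +
      2 * (\<integral>\<^sup>+r. ennreal ((norm (f3 j r - indicator {0..s} r *\<^sub>R \<sigma> r))\<^sup>2) \<partial>lborel)) +
      2 * (\<integral>\<^sup>+\<omega>. ennreal ((norm (I3 j \<omega> - Zs \<omega>))\<^sup>2) \<partial>M)) +
      2 * (\<integral>\<^sup>+\<omega>. ennreal ((norm (I1 j \<omega> - Zt \<omega>))\<^sup>2) \<partial>M))"
  have le: "(\<integral>\<^sup>+\<omega>. ennreal ((norm (R j \<omega>))\<^sup>2) \<partial>M) \<le> B j" for j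
  proof -
    have "(\<integral>\<^sup>+\<omega>. ennreal ((norm (R j \<omega>))\<^sup>2) \<partial>M) \<le>
      2 * (\<integral>\<^sup>+\<omega>. ennreal ((norm ((I2 j \<omega> - I3 j \<omega>) + (I3 j \<omega> - Zs \<omega>)))\<^sup>2) \<partial>M) +
      2 * (\<integral>\<^sup>+\<omega>. ennreal ((norm (I1 j \<omega> - Zt \<omega>))\<^sup>2) \<partial>M)"
      unfolding R_def by (rule nn_integral_norm_diff_sq) measurable
    also have "\<dots> \<le> 2 * (2 * (\<integral>\<^sup>+\<omega>. ennreal ((norm (I2 j \<omega> - I3 j \<omega>))\<^sup>2) \<partial>M) +
      2 * (\<integral>\<^sup>+\<omega>. ennreal ((norm (I3 j \<omega> - Zs \<omega>))\<^sup>2) \<partial>M)) +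
      2 * (\<integral>\<^sup>+\<omega>. ennreal ((norm (I1 j \<omega> - Zt \<omega>))\<^sup>2) \<partial>M)"
      by (intro add_right_mono mult_left_mono nn_integral_norm_add_sq) auto
    also have "\<dots> \<le> B j"
      unfolding B_def by (intro add_right_mono mult_left_mono I23) auto
    finally show ?thesis .
  qed
  have "B \<longlonglongrightarrow> 2 * (2 * (2 * 0 + 2 * 0) + 2 * 0) + 2 * 0"
    unfolding B_def f1_def f3_def I3_def I1_def
    by (intro tendsto_add ennreal_tendsto_cmult f g I J) auto
  then have "B \<longlonglongrightarrow> 0" by simp
  note B0 = this
  have "(\<lambda>j. \<integral>\<^sup>+\<omega>. ennreal ((norm (R j \<omega>))\<^sup>2) \<partial>M) \<longlonglongrightarrow> 0"
    by (rule tendsto_sandwich[OF _ _ tendsto_const B0]) (use le in auto)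
  from orthogonal_limit[OF \<xi>(2) R_sq R_exp this] show ?thesis .
qed

end

section \<open>Square integrable processes\<close>

abbreviation time_measure :: "real \<Rightarrow> real measure" where
  "time_measure T \<equiv> restrict_space lborel {0..T}"

lemma finite_measure_time: "finite_measure (time_measure T)"
  by (rule finite_measureI) (simp add: emeasure_restrict_space space_restrict_space
      emeasure_lborel_Icc_eq)

lemma integral_time_measure:
  fixes f :: "real \<Rightarrow> 'a::euclidean_space"
  shows "integral\<^sup>L (time_measure T) f = (LBINT t:{0..T}. f t)"
  by (simp add: integral_restrict_space set_lebesgue_integral_def)

lemma integrable_time_measure:
  fixes f :: "real \<Rightarrow> 'a::euclidean_space"
  shows "integrable (time_measure T) f \<longleftrightarrow> set_integrable lborel {0..T} f"
  by (simp add: set_integrable_def integrable_restrict_space)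

lemma AE_time_measure:
  "(AE t in time_measure T. Q t) \<longleftrightarrow> (AE t in lborel. t \<in> {0..T} \<longrightarrow> Q t)"
  by (simp add: AE_restrict_space_iff)

text \<open>Measurability is asked on the whole time axis, so that shifts and integrals with moving
  limits stay within the class. Processes given only on \<open>[0, T]\<close> are first cut to zero
  outside.\<close>

definition joint_measurable :: "'w measure \<Rightarrow> (real \<Rightarrow> 'w \<Rightarrow> 'a::euclidean_space) \<Rightarrow> bool" where
  "joint_measurable M V \<longleftrightarrow> (\<lambda>(t, \<omega>). V t \<omega>) \<in> borel_measurable (borel \<Otimes>\<^sub>M M)"

definition l2_process :: "'w measure \<Rightarrow> real \<Rightarrow> (real \<Rightarrow> 'w \<Rightarrow> 'a::euclidean_space) \<Rightarrow> bool" where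
  "l2_process M T V \<longleftrightarrow> joint_measurable M V \<and>
     (\<integral>\<^sup>+\<omega>. (\<integral>\<^sup>+t\<in>{0..T}. ennreal ((norm (V t \<omega>))\<^sup>2) \<partial>lborel) \<partial>M) < \<infinity>"

text \<open>The bound is uniform in time, so that the process has a square integrable value at every time.\<close>

definition uniform_l2_process :: "'w measure \<Rightarrow> real \<Rightarrow> (real \<Rightarrow> 'w \<Rightarrow> 'a::euclidean_space) \<Rightarrow> bool" where
  "uniform_l2_process M T V \<longleftrightarrow> joint_measurable M V \<and>
     (\<exists>C<\<infinity>. \<forall>t\<in>{0..T}. (\<integral>\<^sup>+\<omega>. ennreal ((norm (V t \<omega>))\<^sup>2) \<partial>M) \<le> C)"

lemma joint_measurable_section:
  assumes "joint_measurable M V"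
  shows "V t \<in> borel_measurable M"
  using measurable_compose[OF measurable_Pair1' assms[unfolded joint_measurable_def], of t] by simp

lemma joint_measurable_path:
  assumes "joint_measurable M V" "\<omega> \<in> space M"
  shows "(\<lambda>t. V t \<omega>) \<in> borel_measurable borel"
  using measurable_compose[OF measurable_Pair2'[OF assms(2)] assms(1)[unfolded joint_measurable_def]] by simp

lemma joint_measurable_lborel:
  "joint_measurable M V \<Longrightarrow> (\<lambda>(t, \<omega>). V t \<omega>) \<in> borel_measurable (lborel \<Otimes>\<^sub>M M)"
  unfolding joint_measurable_def by (simp cong: measurable_cong_sets sets_pair_measure_cong)

lemma joint_measurable_restrict:
  assumes "joint_measurable M V"
  shows "(\<lambda>(t, \<omega>). V t \<omega>) \<in> borel_measurable (time_measure T \<Otimes>\<^sub>M M)"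
proof -
  have "(\<lambda>w. (fst w, snd w)) \<in> time_measure T \<Otimes>\<^sub>M M \<rightarrow>\<^sub>M borel \<Otimes>\<^sub>M M"
    by (intro measurable_Pair measurable_compose[OF measurable_fst] measurable_snd
       measurable_restrict_space1) simp
  from measurable_compose[OF this assms[unfolded joint_measurable_def]] show ?thesis
    by (simp add: split_beta)
qed

lemma joint_measurable_bilinear:
  fixes prod :: "'a::euclidean_space \<Rightarrow> 'b::euclidean_space \<Rightarrow> 'c::euclidean_space"
  assumes "bounded_bilinear prod" "joint_measurable M U" "joint_measurable M V"
  shows "joint_measurable M (\<lambda>t \<omega>. prod (U t \<omega>) (V t \<omega>))"
  using bounded_bilinear_borel_measurable[OF assms(1)] assms(2,3)
  unfolding joint_measurable_def split_beta by blast

lemma joint_measurable_deterministic: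
  assumes "k \<in> borel_measurable borel"
  shows "joint_measurable M (\<lambda>t \<omega>. k t)"
  unfolding joint_measurable_def using assms by measurable

lemma joint_measurable_random:
  assumes "\<xi> \<in> borel_measurable M"
  shows "joint_measurable M (\<lambda>t \<omega>. \<xi> \<omega>)"
  unfolding joint_measurable_def using assms by measurable

lemma joint_measurable_add:
  "joint_measurable M U \<Longrightarrow> joint_measurable M V \<Longrightarrow> joint_measurable M (\<lambda>t \<omega>. U t \<omega> + V t \<omega>)"
  unfolding joint_measurable_def split_beta by (rule borel_measurable_add)

lemma joint_measurable_diff:
  "joint_measurable M U \<Longrightarrow> joint_measurable M V \<Longrightarrow> joint_measurable M (\<lambda>t \<omega>. U t \<omega> - V t \<omega>)"
  unfolding joint_measurable_def split_beta by (rule borel_measurable_diff)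

lemma joint_measurable_matrix:
  fixes k :: "real \<Rightarrow> real^'n^'m"
  assumes "k \<in> borel_measurable borel" "joint_measurable M V"
  shows "joint_measurable M (\<lambda>t \<omega>. k t *v V t \<omega>)"
  by (rule joint_measurable_bilinear[OF bounded_bilinear_matrix_vector_mult
        joint_measurable_deterministic[OF assms(1)] assms(2)])

lemma joint_measurable_shift:
  assumes "joint_measurable M V"
  shows "joint_measurable M (\<lambda>t \<omega>. V (t + h) \<omega>)"
proof -
  have "(\<lambda>w. (fst w + h, snd w)) \<in> borel \<Otimes>\<^sub>M M \<rightarrow>\<^sub>M borel \<Otimes>\<^sub>M M"
    by measurable
  from measurable_compose[OF this assms[unfolded joint_measurable_def]] show ?thesis
    by (simp add: split_beta joint_measurable_def)
qed

text \<open>Any sigma-finite space is allowed, so that the result can also be used over a single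
  sigma-algebra of the filtration, where it yields adaptedness.\<close>

lemma joint_measurable_integral_between:
  assumes "sigma_finite_measure M" "joint_measurable M V"
    and [measurable]: "a \<in> borel_measurable borel" "b \<in> borel_measurable borel"
  shows "joint_measurable M (\<lambda>t \<omega>. LBINT s:{a t..b t}. V s \<omega>)"
proof -
  have [measurable]: "(\<lambda>w. V (fst w) (snd w)) \<in> borel_measurable (borel \<Otimes>\<^sub>M M)"
    using assms(2) unfolding joint_measurable_def split_beta .
  have "(\<lambda>(w, s). indicator {a (fst w)..b (fst w)} s *\<^sub>R V s (snd w)) \<in> borel_measurable ((borel \<Otimes>\<^sub>M M) \<Otimes>\<^sub>M lborel)"
  proof -
    have "(\<lambda>w. V (fst (snd w, snd (fst w))) (snd (snd w, snd (fst w)))) \<in> borel_measurable ((borel \<Otimes>\<^sub>M M) \<Otimes>\<^sub>M lborel)"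
      by (rule measurable_compose[of "\<lambda>w. (snd w, snd (fst w))" _ "borel \<Otimes>\<^sub>M M"]) measurable
    then have [measurable]: "(\<lambda>w. V (snd w) (snd (fst w))) \<in> borel_measurable ((borel \<Otimes>\<^sub>M M) \<Otimes>\<^sub>M lborel)"
      by simp
    have "(\<lambda>w. if a (fst (fst w)) \<le> snd w \<and> snd w \<le> b (fst (fst w)) then V (snd w) (snd (fst w)) else 0)
        \<in> borel_measurable ((borel \<Otimes>\<^sub>M M) \<Otimes>\<^sub>M lborel)"
      by measurable
    also have "(\<lambda>w. if a (fst (fst w)) \<le> snd w \<and> snd w \<le> b (fst (fst w)) then V (snd w) (snd (fst w)) else 0) =
      (\<lambda>(w, s). indicator {a (fst w)..b (fst w)} s *\<^sub>R V s (snd w))"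
      by (auto simp: fun_eq_iff indicator_def)
    finally show ?thesis .
  qed
  from sigma_finite_measure.borel_measurable_lebesgue_integral[OF sigma_finite_lborel this]
  show ?thesis
    by (simp add: joint_measurable_def set_lebesgue_integral_def split_beta)
qed

lemma joint_measurable_integral:
  assumes "sigma_finite_measure M" "joint_measurable M V"
  shows "joint_measurable M (\<lambda>t \<omega>. LBINT s:{0..t}. V s \<omega>)"
  by (rule joint_measurable_integral_between[OF assms borel_measurable_const measurable_ident_sets]) (rule refl)

section \<open>Moment bounds and Fubini for square integrable processes\<close>

context prob_space
begin

lemma pair_sigma_finite_time: "pair_sigma_finite (time_measure T) M"
proof -
  interpret t: finite_measure "time_measure T" by (rule finite_measure_time)
  show ?thesis ..
qed

lemma nn_integral_process_swap:
  assumes "joint_measurable M V"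
  shows "(\<integral>\<^sup>+\<omega>. (\<integral>\<^sup>+t\<in>{0..T}. ennreal ((norm (V t \<omega>))\<^sup>2) \<partial>lborel) \<partial>M) =
    (\<integral>\<^sup>+w. ennreal ((norm (case w of (t, \<omega>) \<Rightarrow> V t \<omega>))\<^sup>2) \<partial>(time_measure T \<Otimes>\<^sub>M M))"
    "(\<integral>\<^sup>+\<omega>. (\<integral>\<^sup>+t\<in>{0..T}. ennreal ((norm (V t \<omega>))\<^sup>2) \<partial>lborel) \<partial>M) =
    (\<integral>\<^sup>+t\<in>{0..T}. (\<integral>\<^sup>+\<omega>. ennreal ((norm (V t \<omega>))\<^sup>2) \<partial>M) \<partial>lborel)"
proof -
  interpret P: pair_sigma_finite "time_measure T" M by (rule pair_sigma_finite_time)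
  have m: "(\<lambda>w. ennreal ((norm (case w of (t, \<omega>) \<Rightarrow> V t \<omega>))\<^sup>2)) \<in> borel_measurable (time_measure T \<Otimes>\<^sub>M M)"
    using joint_measurable_restrict[OF assms] by measurable
  have r: "(\<integral>\<^sup>+t\<in>{0..T}. f t \<partial>lborel) = (\<integral>\<^sup>+t. f t \<partial>time_measure T)" for f
    by (simp add: nn_integral_restrict_space)
  show "(\<integral>\<^sup>+\<omega>. (\<integral>\<^sup>+t\<in>{0..T}. ennreal ((norm (V t \<omega>))\<^sup>2) \<partial>lborel) \<partial>M) =
    (\<integral>\<^sup>+w. ennreal ((norm (case w of (t, \<omega>) \<Rightarrow> V t \<omega>))\<^sup>2) \<partial>(time_measure T \<Otimes>\<^sub>M M))"
    unfolding r using P.nn_integral_snd[OF m] by simp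
  then show "(\<integral>\<^sup>+\<omega>. (\<integral>\<^sup>+t\<in>{0..T}. ennreal ((norm (V t \<omega>))\<^sup>2) \<partial>lborel) \<partial>M) =
    (\<integral>\<^sup>+t\<in>{0..T}. (\<integral>\<^sup>+\<omega>. ennreal ((norm (V t \<omega>))\<^sup>2) \<partial>M) \<partial>lborel)"
    unfolding r using nn_integral_fst[OF m] by simp
qed

lemma l2_process_sq_integrable:
  assumes "l2_process M T V"
  shows "sq_integrable (time_measure T \<Otimes>\<^sub>M M) (\<lambda>(t, \<omega>). V t \<omega>)"
  using assms joint_measurable_restrict nn_integral_process_swap(1)[of V T]
  by (auto simp: l2_process_def sq_integrable_iff_nn_integral)

lemma l2_process_iff_sq_integrable:
  assumes "joint_measurable M V"
  shows "l2_process M T V \<longleftrightarrow> sq_integrable (time_measure T \<Otimes>\<^sub>M M) (\<lambda>(t, \<omega>). V t \<omega>)"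
  using assms joint_measurable_restrict nn_integral_process_swap(1)[of V T]
  by (auto simp: l2_process_def sq_integrable_iff_nn_integral)

lemma uniform_l2_process_l2:
  assumes "uniform_l2_process M T V"
  shows "l2_process M T V"
proof -
  obtain C where C: "C < \<infinity>" "\<And>t. t \<in> {0..T} \<Longrightarrow> (\<integral>\<^sup>+\<omega>. ennreal ((norm (V t \<omega>))\<^sup>2) \<partial>M) \<le> C"
    and m: "joint_measurable M V"
    using assms by (auto simp: uniform_l2_process_def)
  have "(\<integral>\<^sup>+t\<in>{0..T}. (\<integral>\<^sup>+\<omega>. ennreal ((norm (V t \<omega>))\<^sup>2) \<partial>M) \<partial>lborel) \<le> (\<integral>\<^sup>+t. C * indicator {0..T} t \<partial>lborel)"
    using C(2) by (intro nn_integral_mono) (auto simp: indicator_def)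
  also have "\<dots> < \<infinity>"
    using C(1) by (simp add: nn_integral_cmult_indicator emeasure_lborel_Icc_eq ennreal_mult_less_top)
  finally show ?thesis
    using m nn_integral_process_swap(2)[OF m] by (simp add: l2_process_def)
qed

lemma uniform_l2_process_section:
  assumes "uniform_l2_process M T V" "t \<in> {0..T}"
  shows "sq_integrable M (V t)"
  using assms unfolding uniform_l2_process_def sq_integrable_iff_nn_integral
  by (auto intro: joint_measurable_section le_less_trans)

lemma l2_process_section_AE:
  assumes "l2_process M T V"
  shows "AE t in lborel. t \<in> {0..T} \<longrightarrow> sq_integrable M (V t)"
proof -
  interpret P: pair_sigma_finite "time_measure T" M by (rule pair_sigma_finite_time)
  have "integrable (time_measure T \<Otimes>\<^sub>M M) (\<lambda>(t, \<omega>). (norm (V t \<omega>))\<^sup>2)"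
    using l2_process_sq_integrable[OF assms] by (simp add: sq_integrable_def case_prod_unfold)
  from P.AE_integrable_fst[OF this]
  have "AE t in time_measure T. integrable M (\<lambda>\<omega>. (norm (V t \<omega>))\<^sup>2)" .
  then show ?thesis
    using assms joint_measurable_section unfolding AE_time_measure
    by (auto simp: sq_integrable_def l2_process_def elim!: eventually_mono)
qed

lemma l2_process_path_integrable:
  fixes V :: "real \<Rightarrow> 'a \<Rightarrow> 'b::euclidean_space"
  assumes "l2_process M T V"
  shows "AE \<omega> in M. set_integrable lborel {0..T} (\<lambda>t. V t \<omega>)"
proof -
  interpret P: pair_sigma_finite "time_measure T" M by (rule pair_sigma_finite_time)
  interpret t: finite_measure "time_measure T" by (rule finite_measure_time)
  have "integrable (time_measure T \<Otimes>\<^sub>M M) (\<lambda>(t, \<omega>). (norm (V t \<omega>))\<^sup>2)"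
    using l2_process_sq_integrable[OF assms] by (simp add: sq_integrable_def case_prod_unfold)
  from P.AE_integrable_snd[OF this]
  have "AE \<omega> in M. integrable (time_measure T) (\<lambda>t. (norm (V t \<omega>))\<^sup>2)" .
  with AE_space show ?thesis
  proof eventually_elim
    case (elim \<omega>)
    have "(\<lambda>t. V t \<omega>) \<in> borel_measurable (time_measure T)"
    proof -
      have "joint_measurable M V" using assms by (simp add: l2_process_def)
      from joint_measurable_path[OF this elim(1)]
      have "(\<lambda>t. V t \<omega>) \<in> borel_measurable lborel" by simp
      then show ?thesis by (rule measurable_restrict_space1)
    qed
    then have "sq_integrable (time_measure T) (\<lambda>t. V t \<omega>)"
      unfolding sq_integrable_def using elim(2) by blast
    from t.sq_integrable_imp_integrable[OF this] show ?case
      unfolding integrable_time_measure .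
  qed
qed

lemma l2_process_diff:
  fixes U V :: "real \<Rightarrow> 'a \<Rightarrow> 'b::euclidean_space"
  assumes "l2_process M T U" "l2_process M T V"
  shows "l2_process M T (\<lambda>t \<omega>. U t \<omega> - V t \<omega>)"
proof -
  have m: "joint_measurable M U" "joint_measurable M V"
    using assms by (auto simp: l2_process_def)
  show ?thesis
    using assms sq_integrable_diff[of "time_measure T \<Otimes>\<^sub>M M" "\<lambda>(t, \<omega>). U t \<omega>" "\<lambda>(t, \<omega>). V t \<omega>"]
    unfolding l2_process_iff_sq_integrable[OF m(1)] l2_process_iff_sq_integrable[OF m(2)]
      l2_process_iff_sq_integrable[OF joint_measurable_diff[OF m]]
    by (simp add: case_prod_unfold)
qed

lemma l2_process_matrix:
  fixes k :: "real \<Rightarrow> real^'n^'m" and V :: "real \<Rightarrow> 'a \<Rightarrow> real^'n"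
  assumes k: "k \<in> borel_measurable borel" "\<And>t. norm (k t) \<le> C" and V: "l2_process M T V"
  shows "l2_process M T (\<lambda>t \<omega>. k t *v V t \<omega>)"
proof -
  obtain K where K: "0 \<le> K" "\<And>(A::real^'n^'m) x. norm (A *v x) \<le> norm A * norm x * K"
    using matrix_vector_mult_norm_bound by blast
  have m: "joint_measurable M V" using V by (simp add: l2_process_def)
  have "norm (k t *v V t \<omega>) \<le> C * K * norm (V t \<omega>)" for t \<omega>
  proof -
    have "norm (k t) * norm (V t \<omega>) * K \<le> C * norm (V t \<omega>) * K"
      using k K by (intro mult_right_mono) auto
    with K(2)[of "k t" "V t \<omega>"] show ?thesis by (simp add: mult_ac)
  qed
  then show ?thesis
    unfolding l2_process_iff_sq_integrable[OF joint_measurable_matrix[OF k(1) m]]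
    by (intro sq_integrable_bound[OF l2_process_sq_integrable[OF V], of _ "C * K"]
        joint_measurable_restrict joint_measurable_matrix[OF k(1) m]) auto
qed

lemma uniform_l2_process_add:
  fixes U V :: "real \<Rightarrow> 'a \<Rightarrow> 'b::euclidean_space"
  assumes "uniform_l2_process M T U" "uniform_l2_process M T V"
  shows "uniform_l2_process M T (\<lambda>t \<omega>. U t \<omega> + V t \<omega>)"
proof -
  obtain C D where C: "C < \<infinity>" "\<And>t. t \<in> {0..T} \<Longrightarrow> (\<integral>\<^sup>+\<omega>. ennreal ((norm (U t \<omega>))\<^sup>2) \<partial>M) \<le> C"
    and D: "D < \<infinity>" "\<And>t. t \<in> {0..T} \<Longrightarrow> (\<integral>\<^sup>+\<omega>. ennreal ((norm (V t \<omega>))\<^sup>2) \<partial>M) \<le> D"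
    using assms by (auto simp: uniform_l2_process_def)
  have m: "joint_measurable M U" "joint_measurable M V"
    using assms by (auto simp: uniform_l2_process_def)
  have "(\<integral>\<^sup>+\<omega>. ennreal ((norm (U t \<omega> + V t \<omega>))\<^sup>2) \<partial>M) \<le> 2 * C + 2 * D" if "t \<in> {0..T}" for t
    by (intro order_trans[OF nn_integral_norm_add_sq] add_mono mult_left_mono C D that
        joint_measurable_section m) auto
  moreover have "2 * C + 2 * D < \<infinity>"
    using C D by (simp add: ennreal_mult_less_top)
  ultimately show ?thesis
    using joint_measurable_add[OF m] unfolding uniform_l2_process_def by blast
qed

lemma uniform_l2_process_matrix:
  fixes k :: "real \<Rightarrow> real^'n^'m" and V :: "real \<Rightarrow> 'a \<Rightarrow> real^'n"
  assumes k: "k \<in> borel_measurable borel" "\<And>t. norm (k t) \<le> C" and V: "uniform_l2_process M T V"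
  shows "uniform_l2_process M T (\<lambda>t \<omega>. k t *v V t \<omega>)"
proof -
  obtain K where K: "0 \<le> K" "\<And>(A::real^'n^'m) x. norm (A *v x) \<le> norm A * norm x * K"
    using matrix_vector_mult_norm_bound by blast
  obtain D where D: "D < \<infinity>" "\<And>t. t \<in> {0..T} \<Longrightarrow> (\<integral>\<^sup>+\<omega>. ennreal ((norm (V t \<omega>))\<^sup>2) \<partial>M) \<le> D"
    and m: "joint_measurable M V"
    using V by (auto simp: uniform_l2_process_def)
  have le: "ennreal ((norm (k t *v V t \<omega>))\<^sup>2) \<le> ennreal ((C * K)\<^sup>2) * ennreal ((norm (V t \<omega>))\<^sup>2)" for t \<omega>
  proof -
    have "norm (k t) * norm (V t \<omega>) * K \<le> C * norm (V t \<omega>) * K"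
      using k K by (intro mult_right_mono) auto
    with K(2)[of "k t" "V t \<omega>"] have "norm (k t *v V t \<omega>) \<le> C * K * norm (V t \<omega>)"
      by (simp add: mult_ac)
    then have "(norm (k t *v V t \<omega>))\<^sup>2 \<le> (C * K)\<^sup>2 * (norm (V t \<omega>))\<^sup>2"
      unfolding power_mult_distrib[symmetric] by (intro power_mono) (auto simp: mult_ac)
    then show ?thesis by (simp add: ennreal_mult[symmetric] ennreal_leI)
  qed
  have "(\<integral>\<^sup>+\<omega>. ennreal ((norm (k t *v V t \<omega>))\<^sup>2) \<partial>M) \<le> ennreal ((C * K)\<^sup>2) * D" if "t \<in> {0..T}" for t
  proof -
    have "(\<integral>\<^sup>+\<omega>. ennreal ((norm (k t *v V t \<omega>))\<^sup>2) \<partial>M) \<le> (\<integral>\<^sup>+\<omega>. ennreal ((C * K)\<^sup>2) * ennreal ((norm (V t \<omega>))\<^sup>2) \<partial>M)"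
      by (intro nn_integral_mono le)
    also have "\<dots> = ennreal ((C * K)\<^sup>2) * (\<integral>\<^sup>+\<omega>. ennreal ((norm (V t \<omega>))\<^sup>2) \<partial>M)"
      using joint_measurable_section[OF m, of t] by (intro nn_integral_cmult) measurable
    also have "\<dots> \<le> ennreal ((C * K)\<^sup>2) * D"
      by (intro mult_left_mono D that) auto
    finally show ?thesis .
  qed
  moreover have "ennreal ((C * K)\<^sup>2) * D < \<infinity>"
    using D(1) by (simp add: ennreal_mult_less_top)
  ultimately show ?thesis
    using joint_measurable_matrix[OF k(1) m] unfolding uniform_l2_process_def by blast
qed

text \<open>Cauchy-Schwarz in time: the square of the integral over \<open>[0, t]\<close> is at most
  \<open>T\<close> times the integral of the squares over \<open>[0, T]\<close>, a bound free of
  \<open>t\<close>.\<close>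

lemma uniform_l2_process_integral:
  fixes V :: "real \<Rightarrow> 'a \<Rightarrow> 'b::euclidean_space"
  assumes V: "l2_process M T V" and "0 \<le> T"
  shows "uniform_l2_process M T (\<lambda>t \<omega>. LBINT s:{0..t}. V s \<omega>)"
proof -
  have m: "joint_measurable M V" using V by (simp add: l2_process_def)
  let ?I = "\<lambda>t \<omega>. LBINT s:{0..t}. V s \<omega>"
  let ?B = "\<integral>\<^sup>+\<omega>. (\<integral>\<^sup>+s\<in>{0..T}. ennreal ((norm (V s \<omega>))\<^sup>2) \<partial>lborel) \<partial>M"
  have mI: "joint_measurable M ?I"
    by (rule joint_measurable_integral[OF _ m]) unfold_locales
  have le: "ennreal ((norm (?I t \<omega>))\<^sup>2) \<le> ennreal T * (\<integral>\<^sup>+s\<in>{0..T}. ennreal ((norm (V s \<omega>))\<^sup>2) \<partial>lborel)"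
    if "\<omega> \<in> space M" "t \<in> {0..T}" for t \<omega>
  proof (cases "set_integrable lborel {0..t} (\<lambda>s. V s \<omega>)")
    case True
    have [measurable]: "(\<lambda>s. V s \<omega>) \<in> borel_measurable borel"
      by (rule joint_measurable_path[OF m that(1)])
    have "ennreal (norm (?I t \<omega>)) \<le> (\<integral>\<^sup>+s. ennreal (norm (indicator {0..t} s *\<^sub>R V s \<omega>)) \<partial>lborel)"
      using integral_norm_bound_ennreal[OF True[unfolded set_integrable_def]]
      by (simp add: set_lebesgue_integral_def)
    also have "\<dots> \<le> (\<integral>\<^sup>+s. (ennreal (norm (V s \<omega>)) * indicator {0..T} s) * indicator {0..T} s \<partial>lborel)"
      using that by (intro nn_integral_mono) (auto simp: indicator_def)
    finally have "(ennreal (norm (?I t \<omega>)))\<^sup>2 \<le> (\<integral>\<^sup>+s. (ennreal (norm (V s \<omega>)) * indicator {0..T} s) * indicator {0..T} s \<partial>lborel)\<^sup>2"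
      by (intro power_mono) auto
    also have "\<dots> \<le> (\<integral>\<^sup>+s. (ennreal (norm (V s \<omega>)) * indicator {0..T} s)\<^sup>2 \<partial>lborel) * (\<integral>\<^sup>+s. (indicator {0..T} s)\<^sup>2 \<partial>lborel)"
      by (rule Cauchy_Schwarz_nn_integral) measurable
    also have "(\<integral>\<^sup>+s. (ennreal (norm (V s \<omega>)) * indicator {0..T} s)\<^sup>2 \<partial>lborel) =
        (\<integral>\<^sup>+s\<in>{0..T}. ennreal ((norm (V s \<omega>))\<^sup>2) \<partial>lborel)"
      by (intro nn_integral_cong) (auto simp: indicator_def ennreal_power)
    also have "(\<integral>\<^sup>+s. (indicator {0..T} s)\<^sup>2 \<partial>lborel) = (\<integral>\<^sup>+s. indicator {0..T} s \<partial>lborel)"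
      by (intro nn_integral_cong) (auto simp: indicator_def)
    also have "\<dots> = ennreal T" using \<open>0 \<le> T\<close> by simp
    finally show ?thesis by (simp add: ennreal_power mult.commute)
  next
    \<comment> \<open>On a path that is not integrable the integral has the default value 0, and the
      bound is trivial.\<close>
    case False
    then show ?thesis
      by (simp add: set_lebesgue_integral_def set_integrable_def not_integrable_integral_eq)
  qed
  have "(\<integral>\<^sup>+\<omega>. ennreal ((norm (?I t \<omega>))\<^sup>2) \<partial>M) \<le> ennreal T * ?B" if "t \<in> {0..T}" for t
  proof -
    have "(\<integral>\<^sup>+\<omega>. ennreal ((norm (?I t \<omega>))\<^sup>2) \<partial>M) \<le>
        (\<integral>\<^sup>+\<omega>. ennreal T * (\<integral>\<^sup>+s\<in>{0..T}. ennreal ((norm (V s \<omega>))\<^sup>2) \<partial>lborel) \<partial>M)"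
      by (intro nn_integral_mono le that)
    also have "\<dots> = ennreal T * ?B"
    proof (rule nn_integral_cmult)
      have "(\<lambda>(\<omega>, s). ennreal ((norm (V s \<omega>))\<^sup>2) * indicator {0..T} s) \<in> borel_measurable (M \<Otimes>\<^sub>M lborel)"
        using measurable_compose[OF measurable_pair_swap' joint_measurable_lborel[OF m]]
        unfolding split_beta by simp
      from lborel.borel_measurable_nn_integral[OF this]
      show "(\<lambda>\<omega>. \<integral>\<^sup>+s\<in>{0..T}. ennreal ((norm (V s \<omega>))\<^sup>2) \<partial>lborel) \<in> borel_measurable M" .
    qed
    finally show ?thesis .
  qed
  moreover have "ennreal T * ?B < \<infinity>"
    using V by (simp add: l2_process_def ennreal_mult_less_top)
  ultimately show ?thesis
    using mI unfolding uniform_l2_process_def by blast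
qed

lemma l2_process_mono:
  assumes "l2_process M T V" "t \<le> T"
  shows "l2_process M t V"
proof -
  have "(\<integral>\<^sup>+\<omega>. (\<integral>\<^sup>+s\<in>{0..t}. ennreal ((norm (V s \<omega>))\<^sup>2) \<partial>lborel) \<partial>M) \<le>
    (\<integral>\<^sup>+\<omega>. (\<integral>\<^sup>+s\<in>{0..T}. ennreal ((norm (V s \<omega>))\<^sup>2) \<partial>lborel) \<partial>M)"
    using assms(2) by (intro nn_integral_mono) (auto simp: indicator_def)
  then show ?thesis using assms(1) by (auto simp: l2_process_def)
qed

lemma integrable_bilinear_process:
  fixes prod :: "'b::euclidean_space \<Rightarrow> 'c::euclidean_space \<Rightarrow> 'd::euclidean_space"
  assumes bil: "bounded_bilinear prod" and U: "l2_process M T U" and V: "l2_process M T V"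
  shows "integrable (time_measure T \<Otimes>\<^sub>M M) (\<lambda>(t, \<omega>). prod (U t \<omega>) (V t \<omega>))"
  using integrable_bilinear_sq_integrable[OF bil l2_process_sq_integrable[OF U] l2_process_sq_integrable[OF V]]
  by (simp add: case_prod_unfold)

lemma process_Fubini:
  fixes f :: "real \<Rightarrow> 'a \<Rightarrow> 'b::euclidean_space"
  assumes "integrable (time_measure T \<Otimes>\<^sub>M M) (\<lambda>(t, \<omega>). f t \<omega>)"
  shows "set_integrable lborel {0..T} (\<lambda>t. expectation (f t))"
    "expectation (\<lambda>\<omega>. LBINT t:{0..T}. f t \<omega>) = integral\<^sup>L (time_measure T \<Otimes>\<^sub>M M) (\<lambda>(t, \<omega>). f t \<omega>)"
    "(LBINT t:{0..T}. expectation (f t)) = integral\<^sup>L (time_measure T \<Otimes>\<^sub>M M) (\<lambda>(t, \<omega>). f t \<omega>)"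
    "AE \<omega> in M. set_integrable lborel {0..T} (\<lambda>t. f t \<omega>)"
    "AE t in lborel. t \<in> {0..T} \<longrightarrow> integrable M (f t)"
    "integrable M (\<lambda>\<omega>. LBINT t:{0..T}. f t \<omega>)"
proof -
  interpret P: pair_sigma_finite "time_measure T" M by (rule pair_sigma_finite_time)
  show "set_integrable lborel {0..T} (\<lambda>t. expectation (f t))"
    using P.integrable_fst[OF assms] by (simp add: integrable_time_measure)
  show "expectation (\<lambda>\<omega>. LBINT t:{0..T}. f t \<omega>) = integral\<^sup>L (time_measure T \<Otimes>\<^sub>M M) (\<lambda>(t, \<omega>). f t \<omega>)"
    using P.integral_snd[OF assms] by (simp add: integral_time_measure)
  show "(LBINT t:{0..T}. expectation (f t)) = integral\<^sup>L (time_measure T \<Otimes>\<^sub>M M) (\<lambda>(t, \<omega>). f t \<omega>)"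
    using P.integral_fst[OF assms] by (simp add: integral_time_measure)
  show "AE \<omega> in M. set_integrable lborel {0..T} (\<lambda>t. f t \<omega>)"
    using P.AE_integrable_snd[OF assms] by (simp add: integrable_time_measure)
  show "AE t in lborel. t \<in> {0..T} \<longrightarrow> integrable M (f t)"
    using P.AE_integrable_fst[OF assms] by (simp add: AE_time_measure)
  show "integrable M (\<lambda>\<omega>. LBINT t:{0..T}. f t \<omega>)"
    using P.integrable_snd[OF assms] by (simp add: integral_time_measure)
qed

lemma l2_process_random:
  assumes "sq_integrable M \<xi>"
  shows "l2_process M T (\<lambda>t \<omega>. \<xi> \<omega>)"
proof (rule uniform_l2_process_l2)
  have "joint_measurable M (\<lambda>t. \<xi>)" "(\<integral>\<^sup>+\<omega>. ennreal ((norm (\<xi> \<omega>))\<^sup>2) \<partial>M) < \<infinity>"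
    using assms joint_measurable_random[of \<xi> M] by (auto simp: sq_integrable_iff_nn_integral)
  then show "uniform_l2_process M T (\<lambda>t \<omega>. \<xi> \<omega>)"
    unfolding uniform_l2_process_def by blast
qed

lemma expectation_bilinear_integral:
  fixes prod :: "'b::euclidean_space \<Rightarrow> 'c::euclidean_space \<Rightarrow> 'd::euclidean_space"
  assumes bil: "bounded_bilinear prod" and \<xi>: "sq_integrable M \<xi>" and V: "l2_process M T V"
    and t: "t \<in> {0..T}"
  shows "set_integrable lborel {0..t} (\<lambda>s. expectation (\<lambda>\<omega>. prod (\<xi> \<omega>) (V s \<omega>)))"
    "expectation (\<lambda>\<omega>. prod (\<xi> \<omega>) (LBINT s:{0..t}. V s \<omega>)) =
      (LBINT s:{0..t}. expectation (\<lambda>\<omega>. prod (\<xi> \<omega>) (V s \<omega>)))"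
proof -
  interpret B: bounded_bilinear prod by fact
  have Vt: "l2_process M t V" using l2_process_mono[OF V] t by simp
  have m: "joint_measurable M V" using V by (simp add: l2_process_def)
  note i = integrable_bilinear_process[OF bil l2_process_random[OF \<xi>] Vt]
  show "set_integrable lborel {0..t} (\<lambda>s. expectation (\<lambda>\<omega>. prod (\<xi> \<omega>) (V s \<omega>)))"
    by (rule process_Fubini(1)[OF i])
  have mi: "joint_measurable M (\<lambda>t \<omega>. LBINT s:{0..t}. V s \<omega>)" 
    by (rule joint_measurable_integral[OF _ m]) unfold_locales
  have mi': "joint_measurable M (\<lambda>t \<omega>. LBINT s:{0..t}. prod (\<xi> \<omega>) (V s \<omega>))"
    by (rule joint_measurable_integral, unfold_locales,
       rule joint_measurable_bilinear[OF bil joint_measurable_random[OF sq_integrable_measurable[OF \<xi>]] m])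
  have "expectation (\<lambda>\<omega>. prod (\<xi> \<omega>) (LBINT s:{0..t}. V s \<omega>)) =
      expectation (\<lambda>\<omega>. LBINT s:{0..t}. prod (\<xi> \<omega>) (V s \<omega>))"
  proof (rule integral_cong_AE)
    show "(\<lambda>\<omega>. prod (\<xi> \<omega>) (LBINT s:{0..t}. V s \<omega>)) \<in> borel_measurable M"
      by (rule bounded_bilinear_borel_measurable[OF bil sq_integrable_measurable[OF \<xi>] joint_measurable_section[OF mi]])
    show "(\<lambda>\<omega>. LBINT s:{0..t}. prod (\<xi> \<omega>) (V s \<omega>)) \<in> borel_measurable M"
      by (rule joint_measurable_section[OF mi'])
    show "AE \<omega> in M. prod (\<xi> \<omega>) (LBINT s:{0..t}. V s \<omega>) = (LBINT s:{0..t}. prod (\<xi> \<omega>) (V s \<omega>))"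
      using l2_process_path_integrable[OF Vt]
    proof eventually_elim
      case (elim \<omega>)
      show ?case
        using integral_bounded_linear[OF B.bounded_linear_right elim[unfolded set_integrable_def], of "\<xi> \<omega>"]
        by (simp add: set_lebesgue_integral_def B.scaleR_right)
    qed
  qed
  then show "expectation (\<lambda>\<omega>. prod (\<xi> \<omega>) (LBINT s:{0..t}. V s \<omega>)) =
      (LBINT s:{0..t}. expectation (\<lambda>\<omega>. prod (\<xi> \<omega>) (V s \<omega>)))"
    using process_Fubini(2,3)[OF i] by simp
qed

end

lemma set_integral_Icc_self:
  fixes g :: "real \<Rightarrow> 'a::euclidean_space"
  shows "(LBINT s:{a..a}. g s) = 0"
  using interval_integral_Icc[of a a g] by simp

section \<open>The variational equation\<close>

definition outer :: "real^'n \<Rightarrow> real^'m \<Rightarrow> real^'m^'n" where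
  "outer a b = (\<chi> i j. a $ i * b $ j)"

lemma bounded_bilinear_outer: "bounded_bilinear (outer :: real^'n \<Rightarrow> real^'m \<Rightarrow> real^'m^'n)"
  unfolding bilinear_conv_bounded_bilinear[symmetric] bilinear_def
  by (auto intro!: linearI simp: vec_eq_iff outer_def algebra_simps)

interpretation outer: bounded_bilinear "outer :: real^'n \<Rightarrow> real^'m \<Rightarrow> real^'m^'n"
  by (rule bounded_bilinear_outer)

text \<open>The inner product of matrices is the Frobenius one, so every expected bilinear form is a
  linear functional of the expected outer product. This is what allows the Riccati matrix to be
  paired with moments.\<close>

lemma inner_matrix_outer: "S \<bullet> outer a b = a \<bullet> (S *v b)"
  by (simp add: inner_vec_def outer_def matrix_vector_mult_def sum_distrib_left mult_ac)

lemma outer_matrix_right: "outer a (S *v b) = outer a b ** transpose S"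
  by (simp add: vec_eq_iff outer_def matrix_vector_mult_def matrix_matrix_mult_def transpose_def
      sum_distrib_left mult_ac)

lemma bounded_bilinear_inner_matrix:
  fixes S :: "real^'m^'n"
  shows "bounded_bilinear (\<lambda>a b. a \<bullet> (S *v b))"
proof -
  have "bounded_linear (\<lambda>b. S *v b)" by (rule mv.bounded_linear_right)
  from bounded_bilinear.comp[OF bounded_bilinear_inner bounded_linear_ident this]
  show ?thesis .
qed

section \<open>Moment matrices along the Riccati equation\<close>

context prob_space
begin

lemma integrable_quadratic_process:
  fixes k :: "real \<Rightarrow> real^'m^'n" and U :: "real \<Rightarrow> 'a \<Rightarrow> real^'n" and V :: "real \<Rightarrow> 'a \<Rightarrow> real^'m"
  assumes "k \<in> borel_measurable borel" "\<And>t. norm (k t) \<le> C" "l2_process M T U" "l2_process M T V"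
  shows "integrable (time_measure T \<Otimes>\<^sub>M M) (\<lambda>(t, \<omega>). U t \<omega> \<bullet> (k t *v V t \<omega>))"
  by (rule integrable_bilinear_process[OF bounded_bilinear_inner assms(3) l2_process_matrix[OF assms(1,2,4)]])

lemma expectation_inner_matrix:
  fixes S :: "real^'m^'n"
  assumes "sq_integrable M f" "sq_integrable M g"
  shows "expectation (\<lambda>\<omega>. f \<omega> \<bullet> (S *v g \<omega>)) = S \<bullet> expectation (\<lambda>\<omega>. outer (f \<omega>) (g \<omega>))"
  using integral_bounded_linear[OF bounded_linear_inner_right[of S]
      integrable_bilinear_sq_integrable[OF bounded_bilinear_outer assms]]
  by (simp add: inner_matrix_outer)

lemma expectation_outer_matrix_right:
  fixes S :: "real^'m^'k"
  assumes "sq_integrable M f" "sq_integrable M g"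
  shows "expectation (\<lambda>\<omega>. outer (f \<omega>) (S *v g \<omega>)) = expectation (\<lambda>\<omega>. outer (f \<omega>) (g \<omega>)) ** transpose S"
  using integral_bounded_linear[OF mm.bounded_linear_left[of "transpose S"]
      integrable_bilinear_sq_integrable[OF bounded_bilinear_outer assms]]
  by (simp add: outer_matrix_right)

text \<open>\<open>\<xi>\<close> stands for the noise at a fixed later time. Paired with
  \<open>D q\<close> it may be replaced by \<open>\<zeta> q\<close>, so a moment with a frozen first
  factor becomes an integral of simultaneous moments, hence absolutely continuous in
  \<open>t\<close>.\<close>

lemma expectation_outer_integral_constant:
  fixes \<beta> :: "real \<Rightarrow> real^'m^'n" and D :: "real \<Rightarrow> 'a \<Rightarrow> real^'m" and \<xi> :: "'a \<Rightarrow> real^'n"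
    and \<zeta> :: "real \<Rightarrow> 'a \<Rightarrow> real^'n"
  assumes \<beta>: "\<beta> \<in> borel_measurable borel" "\<And>t. norm (\<beta> t) \<le> C"
    and D: "l2_process M T D" and \<zeta>: "uniform_l2_process M T \<zeta>" and \<xi>: "sq_integrable M \<xi>" and t: "t \<in> {0..T}"
    and orth: "AE q in lborel. q \<in> {0..t} \<longrightarrow>
      expectation (\<lambda>\<omega>. outer (\<xi> \<omega>) (D q \<omega>)) = expectation (\<lambda>\<omega>. outer (\<zeta> q \<omega>) (D q \<omega>))"
  shows "expectation (\<lambda>\<omega>. outer (\<xi> \<omega>) (LBINT s:{0..t}. \<beta> s *v D s \<omega>)) =
    (LBINT s:{0..t}. expectation (\<lambda>\<omega>. outer (\<zeta> s \<omega>) (\<beta> s *v D s \<omega>)))"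
proof -
  have V: "l2_process M T (\<lambda>s \<omega>. \<beta> s *v D s \<omega>)" by (rule l2_process_matrix[OF \<beta> D])
  have i: "set_integrable lborel {0..t} (\<lambda>s. expectation (\<lambda>\<omega>. outer (\<xi> \<omega>) (\<beta> s *v D s \<omega>)))"
    by (rule expectation_bilinear_integral(1)[OF bounded_bilinear_outer \<xi> V t])
  have i': "set_integrable lborel {0..t} (\<lambda>s. expectation (\<lambda>\<omega>. outer (\<zeta> s \<omega>) (\<beta> s *v D s \<omega>)))"
    by (rule process_Fubini(1)[OF integrable_bilinear_process[OF bounded_bilinear_outer
        l2_process_mono[OF uniform_l2_process_l2[OF \<zeta>]] l2_process_mono[OF V]]]) (use t in auto)
  have "expectation (\<lambda>\<omega>. outer (\<xi> \<omega>) (LBINT s:{0..t}. \<beta> s *v D s \<omega>)) =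
      (LBINT s:{0..t}. expectation (\<lambda>\<omega>. outer (\<xi> \<omega>) (\<beta> s *v D s \<omega>)))"
    by (rule expectation_bilinear_integral(2)[OF bounded_bilinear_outer \<xi> V t])
  also have "\<dots> = (LBINT s:{0..t}. expectation (\<lambda>\<omega>. outer (\<zeta> s \<omega>) (\<beta> s *v D s \<omega>)))"
    unfolding set_lebesgue_integral_def
  proof (rule integral_cong_AE)
    show "(\<lambda>s. indicat_real {0..t} s *\<^sub>R expectation (\<lambda>\<omega>. outer (\<xi> \<omega>) (\<beta> s *v D s \<omega>))) \<in> borel_measurable lborel"
      "(\<lambda>s. indicat_real {0..t} s *\<^sub>R expectation (\<lambda>\<omega>. outer (\<zeta> s \<omega>) (\<beta> s *v D s \<omega>))) \<in> borel_measurable lborel"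
      using i i' unfolding set_integrable_def by (auto dest: borel_measurable_integrable)
    show "AE s in lborel. indicat_real {0..t} s *\<^sub>R expectation (\<lambda>\<omega>. outer (\<xi> \<omega>) (\<beta> s *v D s \<omega>)) =
      indicat_real {0..t} s *\<^sub>R expectation (\<lambda>\<omega>. outer (\<zeta> s \<omega>) (\<beta> s *v D s \<omega>))"
      using orth l2_process_section_AE[OF D]
    proof eventually_elim
      case (elim s)
      show ?case
      proof (cases "s \<in> {0..t}")
        case True
        then have "s \<in> {0..T}" using t by auto
        then show ?thesis
          using elim True \<xi> uniform_l2_process_section[OF \<zeta>, of s]
          by (simp add: expectation_outer_matrix_right)
      qed simp
    qed
  qed
  finally show ?thesis .
qed

text \<open>The density of the pairing of \<open>P\<close> with the moment matrix \<open>e\<close>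
  collapses: the quadratic Riccati term cancels the contribution of \<open>U\<close>, and the
  contribution of \<open>D\<close> becomes minus the \<open>R\<close>-term by the feedback law. What
  is left is minus the running cross terms, and the terminal condition turns the value at
  \<open>T\<close> into the \<open>G\<close>-term. The noise contributes no derivative of its own,
  as its moments with each \<open>D q\<close> are constant in time from \<open>q\<close> on.\<close>

proposition riccati_cross_term:
  fixes \<beta> :: "real \<Rightarrow> real^'m^'n" and R :: "real \<Rightarrow> real^'m^'m" and Q P :: "real \<Rightarrow> real^'n^'n"
    and G :: "real^'n^'n" and U D :: "real \<Rightarrow> 'a \<Rightarrow> real^'m" and z :: "real \<Rightarrow> 'a \<Rightarrow> real^'n"
  defines "c \<equiv> \<lambda>t \<omega>. LBINT s:{0..t}. \<beta> s *v U s \<omega>" and "u \<equiv> \<lambda>t \<omega>. LBINT s:{0..t}. \<beta> s *v D s \<omega>"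
  assumes T: "0 \<le> T"
    and \<beta>: "\<beta> \<in> borel_measurable borel" "\<And>t. norm (\<beta> t) \<le> C"
    and R: "R \<in> borel_measurable borel" "\<And>t. norm (R t) \<le> C" "\<And>t. R t \<in> pd_matrices"
    and Q: "Q \<in> borel_measurable borel" "\<And>t. norm (Q t) \<le> C"
    and P: "primitive_on 0 T (\<lambda>t. P t ** (\<beta> t ** matrix_inv (R t) ** transpose (\<beta> t)) ** P t - Q t) P"
      "P T = G" "\<And>t. t \<in> {0..T} \<Longrightarrow> transpose (P t) = P t"
    and z: "uniform_l2_process M T z" and U: "l2_process M T U" and D: "l2_process M T D"
    and orth: "AE q in lborel. q \<in> {0..T} \<longrightarrow> (\<forall>t\<in>{q..T}.
      expectation (\<lambda>\<omega>. outer (z t \<omega>) (D q \<omega>)) = expectation (\<lambda>\<omega>. outer (z q \<omega>) (D q \<omega>)))"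
    and feedback: "AE t in lborel. t \<in> {0..T} \<longrightarrow> (AE \<omega> in M.
      U t \<omega> = - ((matrix_inv (R t) ** transpose (\<beta> t) ** P t) *v (z t \<omega> + c t \<omega>)))"
  shows "integral\<^sup>L (time_measure T \<Otimes>\<^sub>M M) (\<lambda>(t, \<omega>). (z t \<omega> + c t \<omega>) \<bullet> (Q t *v u t \<omega>)) +
     expectation (\<lambda>\<omega>. (z T \<omega> + c T \<omega>) \<bullet> (G *v u T \<omega>)) +
     integral\<^sup>L (time_measure T \<Otimes>\<^sub>M M) (\<lambda>(t, \<omega>). U t \<omega> \<bullet> (R t *v D t \<omega>)) = 0"
proof -
  have \<beta>U: "l2_process M T (\<lambda>s \<omega>. \<beta> s *v U s \<omega>)" and \<beta>D: "l2_process M T (\<lambda>s \<omega>. \<beta> s *v D s \<omega>)"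
    using l2_process_matrix[OF \<beta> U] l2_process_matrix[OF \<beta> D] .
  have cu: "uniform_l2_process M T c" and uu: "uniform_l2_process M T u"
    unfolding c_def u_def using uniform_l2_process_integral[OF \<beta>U T] uniform_l2_process_integral[OF \<beta>D T] .
  define y where "y = (\<lambda>t \<omega>. z t \<omega> + c t \<omega>)"
  have yu: "uniform_l2_process M T y"
    unfolding y_def by (rule uniform_l2_process_add[OF z cu])
  note l2 = uniform_l2_process_l2[OF z] uniform_l2_process_l2[OF cu] uniform_l2_process_l2[OF uu]
    uniform_l2_process_l2[OF yu]
  note sec = uniform_l2_process_section[OF z] uniform_l2_process_section[OF cu]
    uniform_l2_process_section[OF uu] uniform_l2_process_section[OF yu]
  let ?E = "\<lambda>f g t. expectation (\<lambda>\<omega>. outer (f t \<omega>) (g t \<omega>))"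
  define e where "e = (\<lambda>t. ?E y u t)"
  define e' where "e' = (\<lambda>t. ?E (\<lambda>t \<omega>. \<beta> t *v U t \<omega>) u t + ?E y (\<lambda>t \<omega>. \<beta> t *v D t \<omega>) t)"
  note iEb = process_Fubini[OF integrable_bilinear_process[OF bounded_bilinear_outer]]
  have i1: "set_integrable lborel {0..T} (?E (\<lambda>t \<omega>. \<beta> t *v U t \<omega>) u)"
    and i2: "set_integrable lborel {0..T} (?E c (\<lambda>t \<omega>. \<beta> t *v D t \<omega>))"
    and i3: "set_integrable lborel {0..T} (?E z (\<lambda>t \<omega>. \<beta> t *v D t \<omega>))"
    by (rule iEb(1)[OF \<beta>U l2(3)], rule iEb(1)[OF l2(2) \<beta>D], rule iEb(1)[OF l2(1) \<beta>D])
  \<comment> \<open>Splitting \<open>y\<close> into \<open>c\<close> and \<open>z\<close> is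
    possible only where \<open>\<beta> t *v D t \<omega>\<close> is square integrable in
    \<open>\<omega>\<close>, that is for almost every \<open>t\<close>.\<close>
  have e'_AE: "AE t in lborel. t \<in> {0..T} \<longrightarrow>
     e' t = ?E (\<lambda>t \<omega>. \<beta> t *v U t \<omega>) u t + ?E c (\<lambda>t \<omega>. \<beta> t *v D t \<omega>) t + ?E z (\<lambda>t \<omega>. \<beta> t *v D t \<omega>) t"
    using l2_process_section_AE[OF \<beta>D]
  proof eventually_elim
    case (elim t)
    show ?case
    proof
      assume t: "t \<in> {0..T}"
      then have "integrable M (\<lambda>\<omega>. outer (z t \<omega>) (\<beta> t *v D t \<omega>))" "integrable M (\<lambda>\<omega>. outer (c t \<omega>) (\<beta> t *v D t \<omega>))"
        using elim sec by (auto intro: integrable_bilinear_sq_integrable[OF bounded_bilinear_outer])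
      then show "e' t = ?E (\<lambda>t \<omega>. \<beta> t *v U t \<omega>) u t + ?E c (\<lambda>t \<omega>. \<beta> t *v D t \<omega>) t + ?E z (\<lambda>t \<omega>. \<beta> t *v D t \<omega>) t"
        by (simp add: e'_def y_def outer.add_left)
    qed
  qed
  \<comment> \<open>The part with \<open>c\<close> is the pathwise product rule under the
    expectation; the part with \<open>z\<close>, whose paths need not be absolutely continuous, uses
    orthogonality instead.\<close>
  have e0: "e t = (LBINT s:{0..t}. ?E (\<lambda>t \<omega>. \<beta> t *v U t \<omega>) u s + ?E c (\<lambda>t \<omega>. \<beta> t *v D t \<omega>) s + ?E z (\<lambda>t \<omega>. \<beta> t *v D t \<omega>) s)"
    if t: "t \<in> {0..T}" for t
  proof -
    have tT: "t \<le> T" using t by simp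
    have cuE: "expectation (\<lambda>\<omega>. outer (c t \<omega>) (u t \<omega>)) =
       expectation (\<lambda>\<omega>. LBINT s:{0..t}. outer (\<beta> s *v U s \<omega>) (u s \<omega>) + outer (c s \<omega>) (\<beta> s *v D s \<omega>))"
    proof (rule integral_cong_AE)
      have "AE \<omega> in M. set_integrable lborel {0..T} (\<lambda>s. \<beta> s *v U s \<omega>)"
        "AE \<omega> in M. set_integrable lborel {0..T} (\<lambda>s. \<beta> s *v D s \<omega>)"
        by (rule l2_process_path_integrable[OF \<beta>U] l2_process_path_integrable[OF \<beta>D])+
      then show "AE \<omega> in M. outer (c t \<omega>) (u t \<omega>) =
        (LBINT s:{0..t}. outer (\<beta> s *v U s \<omega>) (u s \<omega>) + outer (c s \<omega>) (\<beta> s *v D s \<omega>))"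
      proof eventually_elim
        case (elim \<omega>)
        have "c 0 \<omega> = 0" 
          using interval_integral_Icc[of 0 0 "\<lambda>s. \<beta> s *v U s \<omega>"] by (simp add: c_def)
        moreover have "primitive_on 0 T (\<lambda>s. \<beta> s *v U s \<omega>) (\<lambda>t. c t \<omega>)"
          "primitive_on 0 T (\<lambda>s. \<beta> s *v D s \<omega>) (\<lambda>t. u t \<omega>)"
          using primitive_on_set_integral[OF elim(1), of 0] primitive_on_set_integral[OF elim(2), of 0]
          by (simp_all add: c_def u_def)
        from primitive_onD[OF primitive_on_product[OF bounded_bilinear_outer this] t]
        have "outer (c t \<omega>) (u t \<omega>) = outer (c 0 \<omega>) (u 0 \<omega>) +
          (LBINT s:{0..t}. outer (\<beta> s *v U s \<omega>) (u s \<omega>) + outer (c s \<omega>) (\<beta> s *v D s \<omega>))" .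
        ultimately show ?case by (simp add: outer.zero_left)
      qed
      show "(\<lambda>\<omega>. outer (c t \<omega>) (u t \<omega>)) \<in> borel_measurable M"
        using sec t by (intro bounded_bilinear_borel_measurable[OF bounded_bilinear_outer] sq_integrable_measurable)
      have "integrable (time_measure t \<Otimes>\<^sub>M M)
         (\<lambda>(s, \<omega>). outer (\<beta> s *v U s \<omega>) (u s \<omega>) + outer (c s \<omega>) (\<beta> s *v D s \<omega>))"
        using Bochner_Integration.integrable_add[OF
            integrable_bilinear_process[OF bounded_bilinear_outer l2_process_mono[OF \<beta>U tT] l2_process_mono[OF l2(3) tT]]
            integrable_bilinear_process[OF bounded_bilinear_outer l2_process_mono[OF l2(2) tT] l2_process_mono[OF \<beta>D tT]]]
        by (simp add: case_prod_unfold)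
      from process_Fubini(6)[OF this]
      show "(\<lambda>\<omega>. LBINT s:{0..t}. outer (\<beta> s *v U s \<omega>) (u s \<omega>) + outer (c s \<omega>) (\<beta> s *v D s \<omega>)) \<in> borel_measurable M"
        by (rule borel_measurable_integrable)
    qed
    note j1 = integrable_bilinear_process[OF bounded_bilinear_outer l2_process_mono[OF \<beta>U tT] l2_process_mono[OF l2(3) tT]]
    note j2 = integrable_bilinear_process[OF bounded_bilinear_outer l2_process_mono[OF l2(2) tT] l2_process_mono[OF \<beta>D tT]]
    have j12: "integrable (time_measure t \<Otimes>\<^sub>M M)
         (\<lambda>(s, \<omega>). outer (\<beta> s *v U s \<omega>) (u s \<omega>) + outer (c s \<omega>) (\<beta> s *v D s \<omega>))"
      using Bochner_Integration.integrable_add[OF j1 j2] by (simp add: case_prod_unfold)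
    have "expectation (\<lambda>\<omega>. outer (c t \<omega>) (u t \<omega>)) =
      integral\<^sup>L (time_measure t \<Otimes>\<^sub>M M) (\<lambda>(s, \<omega>). outer (\<beta> s *v U s \<omega>) (u s \<omega>)) +
      integral\<^sup>L (time_measure t \<Otimes>\<^sub>M M) (\<lambda>(s, \<omega>). outer (c s \<omega>) (\<beta> s *v D s \<omega>))"
      unfolding cuE process_Fubini(2)[OF j12]
      using Bochner_Integration.integral_add[OF j1 j2] by (simp add: case_prod_unfold)
    also have "\<dots> = (LBINT s:{0..t}. ?E (\<lambda>t \<omega>. \<beta> t *v U t \<omega>) u s) + (LBINT s:{0..t}. ?E c (\<lambda>t \<omega>. \<beta> t *v D t \<omega>) s)"
      using process_Fubini(3)[OF j1] process_Fubini(3)[OF j2] by simp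
    finally have 1: "expectation (\<lambda>\<omega>. outer (c t \<omega>) (u t \<omega>)) =
      (LBINT s:{0..t}. ?E (\<lambda>t \<omega>. \<beta> t *v U t \<omega>) u s) + (LBINT s:{0..t}. ?E c (\<lambda>t \<omega>. \<beta> t *v D t \<omega>) s)" .
    have 2: "expectation (\<lambda>\<omega>. outer (z t \<omega>) (u t \<omega>)) = (LBINT s:{0..t}. ?E z (\<lambda>t \<omega>. \<beta> t *v D t \<omega>) s)"
      unfolding u_def
    proof (rule expectation_outer_integral_constant[OF \<beta> D z sec(1)[OF t] t])
      show "AE q in lborel. q \<in> {0..t} \<longrightarrow>
         expectation (\<lambda>\<omega>. outer (z t \<omega>) (D q \<omega>)) = expectation (\<lambda>\<omega>. outer (z q \<omega>) (D q \<omega>))"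
        using orth
      proof (rule eventually_mono)
        fix q
        assume "q \<in> {0..T} \<longrightarrow> (\<forall>t\<in>{q..T}.
          expectation (\<lambda>\<omega>. outer (z t \<omega>) (D q \<omega>)) = expectation (\<lambda>\<omega>. outer (z q \<omega>) (D q \<omega>)))"
        moreover have "q \<in> {0..T}" "t \<in> {q..T}" if "q \<in> {0..t}" using that t by auto
        ultimately show "q \<in> {0..t} \<longrightarrow>
           expectation (\<lambda>\<omega>. outer (z t \<omega>) (D q \<omega>)) = expectation (\<lambda>\<omega>. outer (z q \<omega>) (D q \<omega>))"
          by blast
      qed
    qed
    have "e t = expectation (\<lambda>\<omega>. outer (z t \<omega>) (u t \<omega>)) + expectation (\<lambda>\<omega>. outer (c t \<omega>) (u t \<omega>))"
      using sec t by (simp add: e_def y_def outer.add_left integrable_bilinear_sq_integrable[OF bounded_bilinear_outer])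
    moreover have "set_integrable lborel {0..t} (?E (\<lambda>t \<omega>. \<beta> t *v U t \<omega>) u)"
      "set_integrable lborel {0..t} (?E c (\<lambda>t \<omega>. \<beta> t *v D t \<omega>))"
      "set_integrable lborel {0..t} (?E z (\<lambda>t \<omega>. \<beta> t *v D t \<omega>))"
      using i1 i2 i3 tT by (auto elim!: set_integrable_subset)
    ultimately show ?thesis
      unfolding 1 2 by (simp add: set_integral_add)
  qed
  have "e 0 = 0"
    using e0[of 0] T by (simp only: set_integral_Icc_self atLeastAtMost_iff order.refl simp_thms)
  have "primitive_on 0 T (\<lambda>s. ?E (\<lambda>t \<omega>. \<beta> t *v U t \<omega>) u s + ?E c (\<lambda>t \<omega>. \<beta> t *v D t \<omega>) s + ?E z (\<lambda>t \<omega>. \<beta> t *v D t \<omega>) s) e"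
  proof (rule primitive_onI)
    show "set_integrable lborel {0..T} (\<lambda>s. ?E (\<lambda>t \<omega>. \<beta> t *v U t \<omega>) u s + ?E c (\<lambda>t \<omega>. \<beta> t *v D t \<omega>) s + ?E z (\<lambda>t \<omega>. \<beta> t *v D t \<omega>) s)"
      by (intro set_integral_add i1 i2 i3)
  qed (simp only: e0 \<open>e 0 = 0\<close> add_0_left)
  from primitive_on_product[OF bounded_bilinear_inner P(1) this]
  have pe: "primitive_on 0 T (\<lambda>t. (P t ** (\<beta> t ** matrix_inv (R t) ** transpose (\<beta> t)) ** P t - Q t) \<bullet> e t +
     P t \<bullet> (?E (\<lambda>t \<omega>. \<beta> t *v U t \<omega>) u t + ?E c (\<lambda>t \<omega>. \<beta> t *v D t \<omega>) t + ?E z (\<lambda>t \<omega>. \<beta> t *v D t \<omega>) t))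
     (\<lambda>t. P t \<bullet> e t)" .
  note jQ = integrable_quadratic_process[OF Q l2(4) l2(3)]
  note jR = integrable_quadratic_process[OF R(1,2) U D]
  let ?q = "\<lambda>t. expectation (\<lambda>\<omega>. y t \<omega> \<bullet> (Q t *v u t \<omega>))"
  let ?r = "\<lambda>t. expectation (\<lambda>\<omega>. U t \<omega> \<bullet> (R t *v D t \<omega>))"
  have iq: "set_integrable lborel {0..T} ?q" and ir: "set_integrable lborel {0..T} ?r"
    by (rule process_Fubini(1)[OF jQ], rule process_Fubini(1)[OF jR])
  \<comment> \<open>The Riccati equation and the feedback law enter here: they reduce the density of
    the pairing to the two running cross terms.\<close>
  have "primitive_on 0 T (\<lambda>t. - ?q t - ?r t) (\<lambda>t. P t \<bullet> e t)"
  proof (rule primitive_on_cong_AE[OF pe])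
    have "set_integrable lborel {0..T} (\<lambda>t. - ?q t - ?r t)"
      using Bochner_Integration.integrable_diff[OF integrable_minus[OF iq[unfolded set_integrable_def]] ir[unfolded set_integrable_def]]
      by (simp add: set_integrable_def right_diff_distrib)
    then show "set_borel_measurable lborel {0..T} (\<lambda>t. - ?q t - ?r t)"
      unfolding set_borel_measurable_def set_integrable_def by (rule borel_measurable_integrable)
    show "AE t in lborel. t \<in> {0..T} \<longrightarrow> (P t ** (\<beta> t ** matrix_inv (R t) ** transpose (\<beta> t)) ** P t - Q t) \<bullet> e t +
     P t \<bullet> (?E (\<lambda>t \<omega>. \<beta> t *v U t \<omega>) u t + ?E c (\<lambda>t \<omega>. \<beta> t *v D t \<omega>) t + ?E z (\<lambda>t \<omega>. \<beta> t *v D t \<omega>) t) = - ?q t - ?r t"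
      using e'_AE feedback l2_process_section_AE[OF U] l2_process_section_AE[OF D]
        l2_process_section_AE[OF \<beta>U] l2_process_section_AE[OF \<beta>D]
    proof eventually_elim
      case (elim t)
      show ?case
      proof
        assume t: "t \<in> {0..T}"
        let ?S = "P t ** (\<beta> t ** matrix_inv (R t) ** transpose (\<beta> t)) ** P t"
        have sq: "sq_integrable M (U t)" "sq_integrable M (D t)" "sq_integrable M (\<lambda>\<omega>. \<beta> t *v U t \<omega>)"
          "sq_integrable M (\<lambda>\<omega>. \<beta> t *v D t \<omega>)" "sq_integrable M (y t)" "sq_integrable M (u t)"
          using elim sec t by auto
        have ii: "integrable M (\<lambda>\<omega>. f \<omega> \<bullet> (S *v g \<omega>))" if "sq_integrable M f" "sq_integrable M g"
          for f :: "'a \<Rightarrow> real^'k" and g :: "'a \<Rightarrow> real^'l" and S :: "real^'l^'k"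
          by (rule integrable_bilinear_sq_integrable[OF bounded_bilinear_inner_matrix that])
        have "(?S - Q t) \<bullet> e t + P t \<bullet> e' t =
            ?S \<bullet> e t - Q t \<bullet> e t + P t \<bullet> ?E (\<lambda>t \<omega>. \<beta> t *v U t \<omega>) u t + P t \<bullet> ?E y (\<lambda>t \<omega>. \<beta> t *v D t \<omega>) t"
          by (simp add: inner_diff_left inner_add_right e'_def)
        also have "\<dots> = expectation (\<lambda>\<omega>. y t \<omega> \<bullet> (?S *v u t \<omega>)) - ?q t +
           expectation (\<lambda>\<omega>. (\<beta> t *v U t \<omega>) \<bullet> (P t *v u t \<omega>)) + expectation (\<lambda>\<omega>. y t \<omega> \<bullet> (P t *v (\<beta> t *v D t \<omega>)))"
          using sq by (simp add: e_def expectation_inner_matrix)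
        also have "\<dots> = expectation (\<lambda>\<omega>. y t \<omega> \<bullet> (?S *v u t \<omega>) + (\<beta> t *v U t \<omega>) \<bullet> (P t *v u t \<omega>) +
            y t \<omega> \<bullet> (P t *v (\<beta> t *v D t \<omega>))) - ?q t"
          using sq by (simp add: ii)
        also have "expectation (\<lambda>\<omega>. y t \<omega> \<bullet> (?S *v u t \<omega>) + (\<beta> t *v U t \<omega>) \<bullet> (P t *v u t \<omega>) +
            y t \<omega> \<bullet> (P t *v (\<beta> t *v D t \<omega>))) = expectation (\<lambda>\<omega>. - (U t \<omega> \<bullet> (R t *v D t \<omega>)))"
        proof (rule integral_cong_AE)
          show "(\<lambda>\<omega>. y t \<omega> \<bullet> (?S *v u t \<omega>) + (\<beta> t *v U t \<omega>) \<bullet> (P t *v u t \<omega>) +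
            y t \<omega> \<bullet> (P t *v (\<beta> t *v D t \<omega>))) \<in> borel_measurable M"
            using sq by (intro borel_measurable_integrable Bochner_Integration.integrable_add ii)
          show "(\<lambda>\<omega>. - (U t \<omega> \<bullet> (R t *v D t \<omega>))) \<in> borel_measurable M"
            using sq by (intro borel_measurable_integrable integrable_minus ii)
          have "AE \<omega> in M. U t \<omega> = - ((matrix_inv (R t) ** transpose (\<beta> t) ** P t) *v y t \<omega>)"
            using elim(2) t by (simp add: y_def)
          then show "AE \<omega> in M. y t \<omega> \<bullet> (?S *v u t \<omega>) + (\<beta> t *v U t \<omega>) \<bullet> (P t *v u t \<omega>) +
            y t \<omega> \<bullet> (P t *v (\<beta> t *v D t \<omega>)) = - (U t \<omega> \<bullet> (R t *v D t \<omega>))"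
          proof eventually_elim
            case (elim \<omega>)
            note Ri = pd_matrix_invertible[OF R(3)[of t]]
            have RT: "transpose (R t) = R t" using R(3)[of t] by (simp add: pd_matrices_def)
            have S: "transpose ?S = ?S"
              using P(3)[OF t] Ri(3) by (simp add: matrix_transpose_mul matrix_mul_assoc)
            \<comment> \<open>The feedback makes this term the negative of the quadratic Riccati
              term.\<close>
            have 1: "\<beta> t *v U t \<omega> = - ((\<beta> t ** matrix_inv (R t) ** transpose (\<beta> t) ** P t) *v y t \<omega>)"
              unfolding elim by (simp add: mv.minus_right matrix_vector_mul_assoc matrix_mul_assoc)
            have "(\<beta> t *v U t \<omega>) \<bullet> (P t *v u t \<omega>) = (P t *v (\<beta> t *v U t \<omega>)) \<bullet> u t \<omega>"
              by (rule symmetric_matrix_inner[OF P(3)[OF t]])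
            also have "\<dots> = - ((?S *v y t \<omega>) \<bullet> u t \<omega>)"
              unfolding 1 by (simp add: mv.minus_right matrix_vector_mul_assoc matrix_mul_assoc)
            also have "\<dots> = - (y t \<omega> \<bullet> (?S *v u t \<omega>))"
              by (simp add: symmetric_matrix_inner[OF S])
            finally have a: "(\<beta> t *v U t \<omega>) \<bullet> (P t *v u t \<omega>) = - (y t \<omega> \<bullet> (?S *v u t \<omega>))" .
            \<comment> \<open>Multiplying the feedback law by \<open>R t\<close> removes the inverse
              and identifies the term with \<open>D\<close>.\<close>
            have "R t *v U t \<omega> = - ((transpose (\<beta> t) ** P t) *v y t \<omega>)"
              unfolding elim by (simp add: mv.minus_right matrix_vector_mul_assoc matrix_mul_assoc Ri)
            then have "U t \<omega> \<bullet> (R t *v D t \<omega>) = - ((transpose (\<beta> t) *v (P t *v y t \<omega>)) \<bullet> D t \<omega>)"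
              by (simp add: symmetric_matrix_inner[OF RT] matrix_vector_mul_assoc)
            also have "\<dots> = - ((P t *v y t \<omega>) \<bullet> (\<beta> t *v D t \<omega>))"
              by (simp add: matrix_inner_transpose[of _ "\<beta> t"])
            also have "\<dots> = - (y t \<omega> \<bullet> (P t *v (\<beta> t *v D t \<omega>)))"
              by (simp add: symmetric_matrix_inner[OF P(3)[OF t]])
            finally show ?case using a by simp
          qed
        qed
        also have "\<dots> - ?q t = - ?q t - ?r t"
          by simp
        finally show "(?S - Q t) \<bullet> e t +
          P t \<bullet> (?E (\<lambda>t \<omega>. \<beta> t *v U t \<omega>) u t + ?E c (\<lambda>t \<omega>. \<beta> t *v D t \<omega>) t + ?E z (\<lambda>t \<omega>. \<beta> t *v D t \<omega>) t) = - ?q t - ?r t"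
          using elim(1) t by simp
      qed
    qed
  qed
  from primitive_onD[OF this, of T]
  have "G \<bullet> e T = (LBINT t:{0..T}. - ?q t - ?r t)"
    using T \<open>e 0 = 0\<close> P(2) by simp
  also have "\<dots> = - (LBINT t:{0..T}. ?q t) - (LBINT t:{0..T}. ?r t)"
    using iq ir by (simp add: set_lebesgue_integral_def set_integrable_def right_diff_distrib)
  also have "G \<bullet> e T = expectation (\<lambda>\<omega>. y T \<omega> \<bullet> (G *v u T \<omega>))"
    using sec T by (simp add: e_def expectation_inner_matrix)
  finally show ?thesis
    using process_Fubini(3)[OF jQ] process_Fubini(3)[OF jR] by (simp add: y_def)
qed

end

section \<open>Expansion of the quadratic cost around the feedback control\<close>

context prob_space
begin

lemma integral_quadratic_expand:
  fixes S :: "'c \<Rightarrow> real^'n^'n" and x u :: "'c \<Rightarrow> real^'n"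
  assumes S: "\<And>w. transpose (S w) = S w"
    and i: "integrable N (\<lambda>w. x w \<bullet> (S w *v x w))" "integrable N (\<lambda>w. x w \<bullet> (S w *v u w))"
      "integrable N (\<lambda>w. u w \<bullet> (S w *v u w))"
  shows "(LINT w|N. (x w + u w) \<bullet> (S w *v (x w + u w))) =
    (LINT w|N. x w \<bullet> (S w *v x w)) + 2 * (LINT w|N. x w \<bullet> (S w *v u w)) + (LINT w|N. u w \<bullet> (S w *v u w))"
proof -
  have "(x w + u w) \<bullet> (S w *v (x w + u w)) =
      x w \<bullet> (S w *v x w) + 2 * (x w \<bullet> (S w *v u w)) + u w \<bullet> (S w *v u w)" for w
    using symmetric_matrix_inner[OF S, of "u w" w "x w"]
    by (simp add: mv.add_right inner_add_left inner_add_right inner_commute)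
  then show ?thesis using i by simp
qed

text \<open>\<open>\<zeta> + c\<close> enters the cost, \<open>z + c\<close> the feedback. Their
  mixed moments with \<open>u\<close> coincide, because both \<open>\<zeta> t\<close> and
  \<open>z t\<close> may be replaced by \<open>z q\<close> when paired with \<open>D q\<close>. So
  the first-order term of the expansion is the vanishing cross term, and the remainder is a sum of
  nonnegative forms, definite in \<open>D\<close> through \<open>R\<close>.\<close>

proposition lq_comparison:
  fixes \<beta> :: "real \<Rightarrow> real^'m^'n" and R :: "real \<Rightarrow> real^'m^'m" and Q P :: "real \<Rightarrow> real^'n^'n"
    and T C :: real and G :: "real^'n^'n" and U D :: "real \<Rightarrow> 'a \<Rightarrow> real^'m" and z \<zeta> :: "real \<Rightarrow> 'a \<Rightarrow> real^'n"
  defines "c \<equiv> \<lambda>t \<omega>. LBINT s:{0..t}. \<beta> s *v U s \<omega>" and "u \<equiv> \<lambda>t \<omega>. LBINT s:{0..t}. \<beta> s *v D s \<omega>"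
  defines "J \<equiv> \<lambda>x V. integral\<^sup>L (time_measure T \<Otimes>\<^sub>M M) (\<lambda>(t, \<omega>). x t \<omega> \<bullet> (Q t *v x t \<omega>)) +
     expectation (\<lambda>\<omega>. x T \<omega> \<bullet> (G *v x T \<omega>)) +
     integral\<^sup>L (time_measure T \<Otimes>\<^sub>M M) (\<lambda>(t, \<omega>). V t \<omega> \<bullet> (R t *v V t \<omega>))"
  assumes T: "0 \<le> T"
    and \<beta>: "\<beta> \<in> borel_measurable borel" "\<And>t. norm (\<beta> t) \<le> C"
    and R: "R \<in> borel_measurable borel" "\<And>t. norm (R t) \<le> C" "\<And>t. R t \<in> pd_matrices"
    and Q: "Q \<in> borel_measurable borel" "\<And>t. norm (Q t) \<le> C" "\<And>t. Q t \<in> psd_matrices"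
    and G: "G \<in> psd_matrices"
    and P: "primitive_on 0 T (\<lambda>t. P t ** (\<beta> t ** matrix_inv (R t) ** transpose (\<beta> t)) ** P t - Q t) P"
      "P T = G" "\<And>t. t \<in> {0..T} \<Longrightarrow> transpose (P t) = P t"
    and z: "uniform_l2_process M T z" and \<zeta>: "uniform_l2_process M T \<zeta>"
    and U: "l2_process M T U" and D: "l2_process M T D"
    and orth: "AE q in lborel. q \<in> {0..T} \<longrightarrow> (\<forall>t\<in>{q..T}.
      expectation (\<lambda>\<omega>. outer (z t \<omega>) (D q \<omega>)) = expectation (\<lambda>\<omega>. outer (z q \<omega>) (D q \<omega>)) \<and>
      expectation (\<lambda>\<omega>. outer (\<zeta> t \<omega>) (D q \<omega>)) = expectation (\<lambda>\<omega>. outer (z q \<omega>) (D q \<omega>)))"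
    and feedback: "AE t in lborel. t \<in> {0..T} \<longrightarrow> (AE \<omega> in M.
      U t \<omega> = - ((matrix_inv (R t) ** transpose (\<beta> t) ** P t) *v (z t \<omega> + c t \<omega>)))"
  shows "J (\<lambda>t \<omega>. \<zeta> t \<omega> + c t \<omega>) U \<le> J (\<lambda>t \<omega>. (\<zeta> t \<omega> + c t \<omega>) + u t \<omega>) (\<lambda>t \<omega>. U t \<omega> + D t \<omega>)"
    "J (\<lambda>t \<omega>. (\<zeta> t \<omega> + c t \<omega>) + u t \<omega>) (\<lambda>t \<omega>. U t \<omega> + D t \<omega>) \<le> J (\<lambda>t \<omega>. \<zeta> t \<omega> + c t \<omega>) U \<Longrightarrow>
      AE w in time_measure T \<Otimes>\<^sub>M M. (case w of (t, \<omega>) \<Rightarrow> D t \<omega> = 0)"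
proof -
  let ?\<Lambda> = "time_measure T \<Otimes>\<^sub>M M"
  have \<beta>U: "l2_process M T (\<lambda>s \<omega>. \<beta> s *v U s \<omega>)" and \<beta>D: "l2_process M T (\<lambda>s \<omega>. \<beta> s *v D s \<omega>)"
    using l2_process_matrix[OF \<beta> U] l2_process_matrix[OF \<beta> D] .
  have cu: "uniform_l2_process M T c" and uu: "uniform_l2_process M T u"
    unfolding c_def u_def using uniform_l2_process_integral[OF \<beta>U T] uniform_l2_process_integral[OF \<beta>D T] .
  define x where "x = (\<lambda>t \<omega>. \<zeta> t \<omega> + c t \<omega>)"
  define y where "y = (\<lambda>t \<omega>. z t \<omega> + c t \<omega>)"
  have xu: "uniform_l2_process M T x" and yu: "uniform_l2_process M T y"
    unfolding x_def y_def by (rule uniform_l2_process_add[OF \<zeta> cu] uniform_l2_process_add[OF z cu])+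
  note l2 = uniform_l2_process_l2[OF xu] uniform_l2_process_l2[OF yu] uniform_l2_process_l2[OF uu]
  note sec = uniform_l2_process_section[OF z] uniform_l2_process_section[OF \<zeta>]
    uniform_l2_process_section[OF xu] uniform_l2_process_section[OF yu] uniform_l2_process_section[OF uu]
  have QT: "transpose (Q t) = Q t" "0 \<le> v \<bullet> (Q t *v v)" for t v
    using psd_matricesD[OF Q(3)] by auto
  have GT: "transpose G = G" "0 \<le> v \<bullet> (G *v v)" for v
    using psd_matricesD[OF G] by auto
  have RT: "transpose (R t) = R t" "v \<noteq> 0 \<Longrightarrow> 0 < v \<bullet> (R t *v v)" for t v
    using R(3)[of t] by (auto simp: pd_matrices_def)
  have R0: "0 \<le> v \<bullet> (R t *v v)" for t v
    using RT(2)[of v t] by (cases "v = 0") auto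
  have same: "expectation (\<lambda>\<omega>. x t \<omega> \<bullet> (S *v u t \<omega>)) = expectation (\<lambda>\<omega>. y t \<omega> \<bullet> (S *v u t \<omega>))"
    if t: "t \<in> {0..T}" for t S
  proof -
    have sub: "q \<in> {0..T}" "t \<in> {q..T}" if "q \<in> {0..t}" for q using that t by auto
    have "expectation (\<lambda>\<omega>. outer (\<zeta> t \<omega>) (u t \<omega>)) = expectation (\<lambda>\<omega>. outer (z t \<omega>) (u t \<omega>))"
      unfolding u_def
    proof (rule trans[OF _ sym])
      show "expectation (\<lambda>\<omega>. outer (\<zeta> t \<omega>) (LBINT s:{0..t}. \<beta> s *v D s \<omega>)) =
         (LBINT s:{0..t}. expectation (\<lambda>\<omega>. outer (z s \<omega>) (\<beta> s *v D s \<omega>)))"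
        by (rule expectation_outer_integral_constant[OF \<beta> D z sec(2)[OF t] t])
          (rule eventually_mono[OF orth], use sub in blast)
      show "expectation (\<lambda>\<omega>. outer (z t \<omega>) (LBINT s:{0..t}. \<beta> s *v D s \<omega>)) =
         (LBINT s:{0..t}. expectation (\<lambda>\<omega>. outer (z s \<omega>) (\<beta> s *v D s \<omega>)))"
        by (rule expectation_outer_integral_constant[OF \<beta> D z sec(1)[OF t] t])
          (rule eventually_mono[OF orth], use sub in blast)
    qed
    then have "expectation (\<lambda>\<omega>. outer (x t \<omega>) (u t \<omega>)) = expectation (\<lambda>\<omega>. outer (y t \<omega>) (u t \<omega>))"
      using sec[OF t] uniform_l2_process_section[OF cu t]
      by (simp add: x_def y_def outer.add_left integrable_bilinear_sq_integrable[OF bounded_bilinear_outer])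
    then show ?thesis
      using sec[OF t] by (simp add: expectation_inner_matrix)
  qed
  have orth': "AE q in lborel. q \<in> {0..T} \<longrightarrow> (\<forall>t\<in>{q..T}.
      expectation (\<lambda>\<omega>. outer (z t \<omega>) (D q \<omega>)) = expectation (\<lambda>\<omega>. outer (z q \<omega>) (D q \<omega>)))"
    by (rule eventually_mono[OF orth]) blast
  note qi = integrable_quadratic_process[OF Q(1,2)]
  have "integral\<^sup>L ?\<Lambda> (\<lambda>(t, \<omega>). x t \<omega> \<bullet> (Q t *v u t \<omega>)) = integral\<^sup>L ?\<Lambda> (\<lambda>(t, \<omega>). y t \<omega> \<bullet> (Q t *v u t \<omega>))"
    unfolding process_Fubini(3)[OF qi[OF l2(1,3)], symmetric] process_Fubini(3)[OF qi[OF l2(2,3)], symmetric]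
    by (intro set_lebesgue_integral_cong) (auto simp: same)
  with riccati_cross_term[OF T \<beta> R Q(1,2) P z U D orth' feedback[unfolded c_def]]
  have cross: "integral\<^sup>L ?\<Lambda> (\<lambda>(t, \<omega>). x t \<omega> \<bullet> (Q t *v u t \<omega>)) + expectation (\<lambda>\<omega>. x T \<omega> \<bullet> (G *v u T \<omega>)) +
      integral\<^sup>L ?\<Lambda> (\<lambda>(t, \<omega>). U t \<omega> \<bullet> (R t *v D t \<omega>)) = 0"
    using same[of T G] T by (simp add: y_def c_def u_def)
  have e1: "integral\<^sup>L ?\<Lambda> (\<lambda>(t, \<omega>). (x t \<omega> + u t \<omega>) \<bullet> (Q t *v (x t \<omega> + u t \<omega>))) =
      integral\<^sup>L ?\<Lambda> (\<lambda>(t, \<omega>). x t \<omega> \<bullet> (Q t *v x t \<omega>)) + 2 * integral\<^sup>L ?\<Lambda> (\<lambda>(t, \<omega>). x t \<omega> \<bullet> (Q t *v u t \<omega>)) +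
      integral\<^sup>L ?\<Lambda> (\<lambda>(t, \<omega>). u t \<omega> \<bullet> (Q t *v u t \<omega>))"
    using integral_quadratic_expand[of "\<lambda>w. Q (fst w)" ?\<Lambda> "\<lambda>w. x (fst w) (snd w)" "\<lambda>w. u (fst w) (snd w)"]
      QT qi[OF l2(1,1)] qi[OF l2(1,3)] qi[OF l2(3,3)] by (simp add: case_prod_unfold)
  note ri = integrable_quadratic_process[OF R(1,2)]
  have e2: "integral\<^sup>L ?\<Lambda> (\<lambda>(t, \<omega>). (U t \<omega> + D t \<omega>) \<bullet> (R t *v (U t \<omega> + D t \<omega>))) =
      integral\<^sup>L ?\<Lambda> (\<lambda>(t, \<omega>). U t \<omega> \<bullet> (R t *v U t \<omega>)) + 2 * integral\<^sup>L ?\<Lambda> (\<lambda>(t, \<omega>). U t \<omega> \<bullet> (R t *v D t \<omega>)) +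
      integral\<^sup>L ?\<Lambda> (\<lambda>(t, \<omega>). D t \<omega> \<bullet> (R t *v D t \<omega>))"
    using integral_quadratic_expand[of "\<lambda>w. R (fst w)" ?\<Lambda> "\<lambda>w. U (fst w) (snd w)" "\<lambda>w. D (fst w) (snd w)"]
      RT ri[OF U U] ri[OF U D] ri[OF D D] by (simp add: case_prod_unfold)
  have gi: "integrable M (\<lambda>\<omega>. f \<omega> \<bullet> (G *v g \<omega>))" if "sq_integrable M f" "sq_integrable M g" for f g
    by (rule integrable_bilinear_sq_integrable[OF bounded_bilinear_inner_matrix that])
  have e3: "expectation (\<lambda>\<omega>. (x T \<omega> + u T \<omega>) \<bullet> (G *v (x T \<omega> + u T \<omega>))) =
      expectation (\<lambda>\<omega>. x T \<omega> \<bullet> (G *v x T \<omega>)) + 2 * expectation (\<lambda>\<omega>. x T \<omega> \<bullet> (G *v u T \<omega>)) +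
      expectation (\<lambda>\<omega>. u T \<omega> \<bullet> (G *v u T \<omega>))"
    using sec T by (intro integral_quadratic_expand GT gi) auto
  have J: "J (\<lambda>t \<omega>. x t \<omega> + u t \<omega>) (\<lambda>t \<omega>. U t \<omega> + D t \<omega>) = J x U +
      (integral\<^sup>L ?\<Lambda> (\<lambda>(t, \<omega>). u t \<omega> \<bullet> (Q t *v u t \<omega>)) + expectation (\<lambda>\<omega>. u T \<omega> \<bullet> (G *v u T \<omega>)) +
      integral\<^sup>L ?\<Lambda> (\<lambda>(t, \<omega>). D t \<omega> \<bullet> (R t *v D t \<omega>)))"
    unfolding J_def using cross e1 e2 e3 by simp
  have n1: "0 \<le> integral\<^sup>L ?\<Lambda> (\<lambda>(t, \<omega>). u t \<omega> \<bullet> (Q t *v u t \<omega>))"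
    by (intro integral_nonneg_AE AE_I2) (auto simp: QT)
  have n2: "0 \<le> expectation (\<lambda>\<omega>. u T \<omega> \<bullet> (G *v u T \<omega>))"
    by (intro integral_nonneg_AE AE_I2) (auto simp: GT)
  have n3: "AE w in ?\<Lambda>. 0 \<le> (case w of (t, \<omega>) \<Rightarrow> D t \<omega> \<bullet> (R t *v D t \<omega>))"
    by (intro AE_I2) (auto simp: R0)
  then have n3': "0 \<le> integral\<^sup>L ?\<Lambda> (\<lambda>(t, \<omega>). D t \<omega> \<bullet> (R t *v D t \<omega>))"
    by (rule integral_nonneg_AE)
  show "J (\<lambda>t \<omega>. \<zeta> t \<omega> + c t \<omega>) U \<le> J (\<lambda>t \<omega>. (\<zeta> t \<omega> + c t \<omega>) + u t \<omega>) (\<lambda>t \<omega>. U t \<omega> + D t \<omega>)"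
    using J n1 n2 n3' unfolding x_def by linarith
  assume "J (\<lambda>t \<omega>. (\<zeta> t \<omega> + c t \<omega>) + u t \<omega>) (\<lambda>t \<omega>. U t \<omega> + D t \<omega>) \<le> J (\<lambda>t \<omega>. \<zeta> t \<omega> + c t \<omega>) U"
  then have "integral\<^sup>L ?\<Lambda> (\<lambda>(t, \<omega>). D t \<omega> \<bullet> (R t *v D t \<omega>)) = 0"
    using J n1 n2 n3' unfolding x_def by linarith
  \<comment> \<open>The \<open>R\<close>-form of \<open>D\<close> is nonnegative with integral 0,
    hence zero almost everywhere; definiteness then gives \<open>D t \<omega> = 0\<close>.\<close>
  then have "AE w in ?\<Lambda>. (case w of (t, \<omega>) \<Rightarrow> D t \<omega> \<bullet> (R t *v D t \<omega>)) = 0"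
    using integral_nonneg_eq_0_iff_AE[OF ri[OF D D] n3] by simp
  then show "AE w in ?\<Lambda>. (case w of (t, \<omega>) \<Rightarrow> D t \<omega> = 0)"
  proof eventually_elim
    case (elim w)
    obtain t \<omega> where "w = (t, \<omega>)" by (cases w)
    then show ?case using elim RT(2)[of "D t \<omega>" t] by auto
  qed
qed

end

section \<open>Uniqueness of Wiener integrals\<close>

context wiener_setting
begin

text \<open>Both approximating sequences converge to the same integrand, so by the isometry their
  step integrals approach each other, and the mean-square distance of the limits is squeezed to
  0.\<close>

lemma wiener_integral_unique:
  fixes \<sigma> :: "real \<Rightarrow> 'b::euclidean_space"
  assumes Z: "is_wiener_integral M W t \<sigma> Z" and Z': "is_wiener_integral M W t \<sigma> Z'"
    and \<sigma>: "\<sigma> \<in> borel_measurable borel"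
  shows "AE \<omega> in M. Z \<omega> = Z' \<omega>"
proof -
  note \<sigma>[measurable]
  obtain k p c where p: "\<And>j. partition_upto (k j) (p j) t"
    and f: "(\<lambda>j. \<integral>\<^sup>+r. ennreal ((norm (step_function (k j) (p j) (c j) r - indicator {0..t} r *\<^sub>R \<sigma> r))\<^sup>2) \<partial>lborel) \<longlonglongrightarrow> 0"
    and I: "(\<lambda>j. \<integral>\<^sup>+\<omega>. ennreal ((norm (step_integral W (k j) (p j) (c j) \<omega> - Z \<omega>))\<^sup>2) \<partial>M) \<longlonglongrightarrow> 0"
    and [measurable]: "Z \<in> borel_measurable M"
    by (rule is_wiener_integralE[OF Z], rule that)
  obtain l q d where q: "\<And>j. partition_upto (l j) (q j) t"
    and g: "(\<lambda>j. \<integral>\<^sup>+r. ennreal ((norm (step_function (l j) (q j) (d j) r - indicator {0..t} r *\<^sub>R \<sigma> r))\<^sup>2) \<partial>lborel) \<longlonglongrightarrow> 0"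
    and J: "(\<lambda>j. \<integral>\<^sup>+\<omega>. ennreal ((norm (step_integral W (l j) (q j) (d j) \<omega> - Z' \<omega>))\<^sup>2) \<partial>M) \<longlonglongrightarrow> 0"
    and [measurable]: "Z' \<in> borel_measurable M"
    by (rule is_wiener_integralE[OF Z'], rule that)
  define f1 where "f1 = (\<lambda>j. step_function (k j) (p j) (c j))"
  define f2 where "f2 = (\<lambda>j. step_function (l j) (q j) (d j))"
  define I1 where "I1 = (\<lambda>j. step_integral W (k j) (p j) (c j))"
  define I2 where "I2 = (\<lambda>j. step_integral W (l j) (q j) (d j))"
  have [measurable]: "I1 j \<in> borel_measurable M" "I2 j \<in> borel_measurable M"
    "f1 j \<in> borel_measurable borel" "f2 j \<in> borel_measurable borel" for j
    unfolding f1_def f2_def I1_def I2_def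
    by (rule sq_integrable_measurable[OF sq_integrable_step_integral[OF p]]
        sq_integrable_measurable[OF sq_integrable_step_integral[OF q]] step_function_measurable)+
  define b where "b = (\<lambda>j. 2 * (2 * (\<integral>\<^sup>+\<omega>. ennreal ((norm (I1 j \<omega> - Z \<omega>))\<^sup>2) \<partial>M) +
      2 * (\<integral>\<^sup>+\<omega>. ennreal ((norm (I2 j \<omega> - Z' \<omega>))\<^sup>2) \<partial>M)) +
      2 * (2 * (\<integral>\<^sup>+r. ennreal ((norm (f1 j r - indicator {0..t} r *\<^sub>R \<sigma> r))\<^sup>2) \<partial>lborel) +
      2 * (\<integral>\<^sup>+r. ennreal ((norm (f2 j r - indicator {0..t} r *\<^sub>R \<sigma> r))\<^sup>2) \<partial>lborel)))"
  have "(\<integral>\<^sup>+\<omega>. ennreal ((norm (Z \<omega> - Z' \<omega>))\<^sup>2) \<partial>M) \<le> b j" for j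
  proof -
    have "(\<integral>\<^sup>+\<omega>. ennreal ((norm (I1 j \<omega> - I2 j \<omega>))\<^sup>2) \<partial>M) = (\<integral>\<^sup>+r. ennreal ((norm (f1 j r - f2 j r))\<^sup>2) \<partial>lborel)"
      unfolding I1_def I2_def f1_def f2_def by (rule step_integral_isometry[OF p q])
    also have "\<dots> = (\<integral>\<^sup>+r. ennreal ((norm ((f1 j r - indicator {0..t} r *\<^sub>R \<sigma> r) - (f2 j r - indicator {0..t} r *\<^sub>R \<sigma> r)))\<^sup>2) \<partial>lborel)"
      by simp
    also have "\<dots> \<le> 2 * (\<integral>\<^sup>+r. ennreal ((norm (f1 j r - indicator {0..t} r *\<^sub>R \<sigma> r))\<^sup>2) \<partial>lborel) +
      2 * (\<integral>\<^sup>+r. ennreal ((norm (f2 j r - indicator {0..t} r *\<^sub>R \<sigma> r))\<^sup>2) \<partial>lborel)"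
      by (rule nn_integral_norm_diff_sq) measurable
    finally have i: "(\<integral>\<^sup>+\<omega>. ennreal ((norm (I1 j \<omega> - I2 j \<omega>))\<^sup>2) \<partial>M) \<le>
      2 * (\<integral>\<^sup>+r. ennreal ((norm (f1 j r - indicator {0..t} r *\<^sub>R \<sigma> r))\<^sup>2) \<partial>lborel) +
      2 * (\<integral>\<^sup>+r. ennreal ((norm (f2 j r - indicator {0..t} r *\<^sub>R \<sigma> r))\<^sup>2) \<partial>lborel)" .
    have "(\<integral>\<^sup>+\<omega>. ennreal ((norm (Z \<omega> - Z' \<omega>))\<^sup>2) \<partial>M) =
        (\<integral>\<^sup>+\<omega>. ennreal ((norm (((I1 j \<omega> - Z \<omega>) - (I2 j \<omega> - Z' \<omega>)) - (I1 j \<omega> - I2 j \<omega>)))\<^sup>2) \<partial>M)"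
      by (intro nn_integral_cong) (simp add: norm_minus_commute)
    also have "\<dots> \<le> 2 * (\<integral>\<^sup>+\<omega>. ennreal ((norm ((I1 j \<omega> - Z \<omega>) - (I2 j \<omega> - Z' \<omega>)))\<^sup>2) \<partial>M) +
        2 * (\<integral>\<^sup>+\<omega>. ennreal ((norm (I1 j \<omega> - I2 j \<omega>))\<^sup>2) \<partial>M)"
      by (rule nn_integral_norm_diff_sq) measurable
    also have "\<dots> \<le> b j"
      unfolding b_def by (intro add_mono mult_left_mono nn_integral_norm_diff_sq i) auto
    finally show ?thesis .
  qed
  moreover have "b \<longlonglongrightarrow> 2 * (2 * 0 + 2 * 0) + 2 * (2 * 0 + 2 * 0)"
    unfolding b_def f1_def f2_def I1_def I2_def
    by (intro tendsto_add ennreal_tendsto_cmult f g I J) auto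
  ultimately have "(\<integral>\<^sup>+\<omega>. ennreal ((norm (Z \<omega> - Z' \<omega>))\<^sup>2) \<partial>M) \<le> 0"
    by (intro LIMSEQ_le_const) auto
  then have "(\<integral>\<^sup>+\<omega>. ennreal ((norm (Z \<omega> - Z' \<omega>))\<^sup>2) \<partial>M) = 0" by simp
  then have "AE \<omega> in M. ennreal ((norm (Z \<omega> - Z' \<omega>))\<^sup>2) = 0"
    by (subst (asm) nn_integral_0_iff_AE) auto
  then show ?thesis by eventually_elim simp
qed

end

section \<open>The delayed system\<close>

text \<open>The assumptions on a process concern \<open>[0, T]\<close>. Cutting it to zero outside
  makes it measurable on the whole time axis and agrees with the convention that the control
  vanishes before time 0.\<close>

definition truncate_time :: "real \<Rightarrow> (real \<Rightarrow> 'w \<Rightarrow> 'a::zero) \<Rightarrow> real \<Rightarrow> 'w \<Rightarrow> 'a" where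
  "truncate_time T V t \<omega> = (if t \<in> {0..T} then V t \<omega> else 0)"

lemma joint_measurable_truncate:
  assumes "measurable_process N T V" "0 \<le> T"
  shows "joint_measurable N (truncate_time T V)"
proof -
  \<comment> \<open>Time is first clamped into \<open>[0, T]\<close>, so that the map lands in the
    restricted space on which \<open>V\<close> is measurable.\<close>
  have "(\<lambda>w. (max 0 (min T (fst w)), snd w)) \<in> borel \<Otimes>\<^sub>M N \<rightarrow>\<^sub>M restrict_space borel {0..T} \<Otimes>\<^sub>M N"
    using assms(2) by (intro measurable_Pair measurable_restrict_space2) auto
  from measurable_compose[OF this assms(1)[unfolded measurable_process_def]]
  have [measurable]: "(\<lambda>w. V (max 0 (min T (fst w))) (snd w)) \<in> borel_measurable (borel \<Otimes>\<^sub>M N)"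
    by simp
  have "(\<lambda>w. if 0 \<le> fst w \<and> fst w \<le> T then V (max 0 (min T (fst w))) (snd w) else 0) \<in> borel_measurable (borel \<Otimes>\<^sub>M N)"
    by measurable
  also have "(\<lambda>w. if 0 \<le> fst w \<and> fst w \<le> T then V (max 0 (min T (fst w))) (snd w) else 0) =
    (\<lambda>(t, \<omega>). truncate_time T V t \<omega>)"
    by (auto simp: truncate_time_def fun_eq_iff min_absorb2)
  finally show ?thesis by (simp add: joint_measurable_def)
qed

lemma measurable_process_joint:
  assumes "joint_measurable N V" "\<And>t \<omega>. t \<in> {0..T} \<Longrightarrow> \<omega> \<in> space N \<Longrightarrow> V t \<omega> = V' t \<omega>"
  shows "measurable_process N T V'"
proof -
  have "(\<lambda>w. (fst w, snd w)) \<in> restrict_space borel {0..T} \<Otimes>\<^sub>M N \<rightarrow>\<^sub>M borel \<Otimes>\<^sub>M N"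
    by (intro measurable_Pair measurable_compose[OF measurable_fst] measurable_snd
       measurable_restrict_space1) simp
  from measurable_compose[OF this assms(1)[unfolded joint_measurable_def]]
  have "(\<lambda>w. V (fst w) (snd w)) \<in> borel_measurable (restrict_space borel {0..T} \<Otimes>\<^sub>M N)"
    by simp
  also have "?this \<longleftrightarrow> (\<lambda>(t, \<omega>). V' t \<omega>) \<in> borel_measurable (restrict_space borel {0..T} \<Otimes>\<^sub>M N)"
    by (rule measurable_cong) (auto simp: space_pair_measure space_restrict_space assms(2))
  finally show ?thesis by (simp add: measurable_process_def)
qed

lemma L2_adapted_l2_process:
  assumes "L2_adapted M F T U" "0 \<le> T"
  shows "l2_process M T (truncate_time T U)"
proof -
  have "(\<integral>\<^sup>+t\<in>{0..T}. ennreal ((norm (truncate_time T U t \<omega>))\<^sup>2) \<partial>lborel) =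
    (\<integral>\<^sup>+t\<in>{0..T}. ennreal ((norm (U t \<omega>))\<^sup>2) \<partial>lborel)" for \<omega>
    by (intro nn_integral_cong) (auto simp: truncate_time_def indicator_def)
  then show ?thesis
    using assms joint_measurable_truncate[of M T U] by (simp add: L2_adapted_def l2_process_def)
qed

lemma set_integrable_matrix:
  fixes k :: "real \<Rightarrow> real^'n^'m" and f :: "real \<Rightarrow> real^'n"
  assumes k: "k \<in> borel_measurable borel" "\<And>t. norm (k t) \<le> C" and f: "set_integrable lborel I f"
  shows "set_integrable lborel I (\<lambda>s. k s *v f s)"
proof -
  obtain K where K: "0 \<le> K" "\<And>(A::real^'n^'m) x. norm (A *v x) \<le> norm A * norm x * K"
    using matrix_vector_mult_norm_bound by blast
  have fm: "(\<lambda>s. indicator I s *\<^sub>R f s) \<in> borel_measurable lborel"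
    using f unfolding set_integrable_def by (rule borel_measurable_integrable)
  have e: "indicator I s *\<^sub>R (k s *v f s) = k s *v (indicator I s *\<^sub>R f s)" for s
    by (simp add: mv.scaleR_right)
  show ?thesis
    unfolding set_integrable_def e
  proof (rule Bochner_Integration.integrable_bound)
    show "integrable lborel (\<lambda>s. (C * K) *\<^sub>R norm (indicator I s *\<^sub>R f s))"
      using f unfolding set_integrable_def by (intro integrable_scaleR_right integrable_norm)
    show "(\<lambda>s. k s *v (indicator I s *\<^sub>R f s)) \<in> borel_measurable lborel"
      using k(1) fm by (intro borel_measurable_matrix_vector_mult) auto
    have "norm (k s *v v) \<le> C * K * norm v" for s v
    proof -
      have "norm (k s) * norm v * K \<le> C * norm v * K"
        using k K by (intro mult_right_mono) auto
      with K(2)[of "k s" v] show ?thesis by (simp add: mult_ac)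
    qed
    then have "norm (k s *v v) \<le> norm ((C * K) *\<^sub>R norm v)" for s v
      unfolding real_norm_def real_scaleR_def by (rule order_trans[OF _ abs_ge_self])
    then show "AE s in lborel. norm (k s *v (indicator I s *\<^sub>R f s)) \<le> norm ((C * K) *\<^sub>R norm (indicator I s *\<^sub>R f s))"
      by (intro AE_I2)
  qed
qed

lemma set_integral_cong_AE_Icc:
  fixes f g :: "real \<Rightarrow> 'a::euclidean_space"
  assumes "set_borel_measurable lborel {a..b} f" "set_borel_measurable lborel {a..b} g"
    "AE s in lborel. s \<in> {a..b} \<longrightarrow> f s = g s"
  shows "(LBINT s:{a..b}. f s) = (LBINT s:{a..b}. g s)"
    "set_integrable lborel {a..b} f \<longleftrightarrow> set_integrable lborel {a..b} g"
proof -
  have ae: "AE s in lborel. indicator {a..b} s *\<^sub>R f s = indicator {a..b} s *\<^sub>R g s"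
    using assms(3) by eventually_elim (auto simp: indicator_def)
  note m = assms(1,2)[unfolded set_borel_measurable_def]
  show "(LBINT s:{a..b}. f s) = (LBINT s:{a..b}. g s)"
    unfolding set_lebesgue_integral_def by (rule integral_cong_AE[OF m ae])
  show "set_integrable lborel {a..b} f \<longleftrightarrow> set_integrable lborel {a..b} g"
    unfolding set_integrable_def by (rule integrable_cong_AE[OF m ae])
qed

lemmas set_integral_singleton = set_integral_Icc_self[simplified atLeastAtMost_singleton]

lemma matrix_bound_mult:
  assumes "\<And>t. norm ((k::real \<Rightarrow> real^'n^'m) t) \<le> C" "\<And>t. norm ((l::real \<Rightarrow> real^'p^'n) t) \<le> D"
  obtains E where "\<And>s t. norm (k s ** l t) \<le> E"
proof -
  obtain K where K: "0 \<le> K" "\<And>(A::real^'n^'m) (B::real^'p^'n). norm (A ** B) \<le> norm A * norm B * K"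
    using matrix_mult_norm_bound by blast
  have "norm (k s ** l t) \<le> C * D * K" for s t
  proof -
    have "norm (k s) * norm (l t) * K \<le> C * D * K"
      using assms K order_trans[OF norm_ge_zero assms(1)] by (intro mult_right_mono mult_mono) auto
    with K(2) show ?thesis by (meson order_trans)
  qed
  then show ?thesis using that by blast
qed

text \<open>\<open>A0\<close>, \<open>B0\<close> and \<open>\<sigma>0\<close> are the given
  coefficients, \<open>A\<close>, \<open>B\<close> and \<open>\<sigma>\<close> bounded Borel
  representatives of them, all under one constant \<open>C\<close>. Statements about solutions refer
  to the former, computations use the latter.\<close>

locale delay_system = wiener_setting M F W
  for M :: "'w measure" and F :: "real \<Rightarrow> 'w measure" and W :: "real \<Rightarrow> 'w \<Rightarrow> real" +
  fixes T h C :: real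
    and A A0 :: "real \<Rightarrow> real^'n^'n" and B B0 :: "real \<Rightarrow> real^'m^'n" and \<sigma> \<sigma>0 :: "real \<Rightarrow> real^'n"
    and \<Phi> \<Theta> :: "real \<Rightarrow> real^'n^'n"
  assumes times: "0 < h" "h < T"
    and A: "A \<in> borel_measurable borel" "\<And>t. norm (A t) \<le> C"
      "AE t in lborel. t \<in> {0..T + h} \<longrightarrow> A t = A0 t" "set_borel_measurable borel {0..T + h} A0"
    and B: "B \<in> borel_measurable borel" "\<And>t. norm (B t) \<le> C"
      "AE t in lborel. t \<in> {0..T + h} \<longrightarrow> B t = B0 t" "set_borel_measurable borel {0..T + h} B0"
    and \<sigma>: "\<sigma> \<in> borel_measurable borel" "\<And>t. norm (\<sigma> t) \<le> C"
      "AE t in lborel. t \<in> {0..T} \<longrightarrow> \<sigma> t = \<sigma>0 t"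
    and \<Phi>: "primitive_on 0 (T + h) (\<lambda>r. A r ** \<Phi> r) \<Phi>" "continuous_on UNIV \<Phi>" "\<And>t. norm (\<Phi> t) \<le> C"
    and \<Theta>: "primitive_on 0 (T + h) (\<lambda>r. - (\<Theta> r ** A r)) \<Theta>" "continuous_on UNIV \<Theta>" "\<And>t. norm (\<Theta> t) \<le> C"
    and inverse: "\<And>t. \<Theta> t ** \<Phi> t = mat 1" "\<And>t. \<Phi> t ** \<Theta> t = mat 1"
    and initial: "\<Phi> 0 = mat 1" "\<Theta> 0 = mat 1"
begin

lemma T_nonneg: "0 \<le> T" using times by simp

lemma \<Phi>_measurable [measurable]: "\<Phi> \<in> borel_measurable borel"
  and \<Theta>_measurable [measurable]: "\<Theta> \<in> borel_measurable borel"
  using \<Phi>(2) \<Theta>(2) by (auto intro: borel_measurable_continuous_onI)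

lemmas [measurable] = A(1) B(1) \<sigma>(1)

lemma \<Phi>_T: "primitive_on 0 T (\<lambda>r. A r ** \<Phi> r) \<Phi>" and \<Theta>_T: "primitive_on 0 T (\<lambda>r. - (\<Theta> r ** A r)) \<Theta>"
  using primitive_on_subinterval[OF \<Phi>(1)] primitive_on_subinterval[OF \<Theta>(1)] times by auto

text \<open>In the coordinates \<open>\<Theta>(t) X(t)\<close> the drift \<open>A\<close> disappears and \<open>\<beta>\<close> is the control matrix, acting
  at time \<open>t + h\<close>.\<close>

definition \<beta> :: "real \<Rightarrow> real^'m^'n" where
  "\<beta> t = \<Theta> (t + h) ** B (t + h)"

lemma \<beta>_measurable [measurable]: "\<beta> \<in> borel_measurable borel"
  unfolding \<beta>_def by measurable

lemma \<beta>_bounded: obtains E where "\<And>t. norm (\<beta> t) \<le> E"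
proof -
  obtain E where "\<And>s t. norm (\<Theta> s ** B t) \<le> E"
    using matrix_bound_mult[of \<Theta> C B C, OF \<Theta>(3) B(2)] by blast
  then show ?thesis by (intro that[of E]) (simp add: \<beta>_def)
qed

lemma \<Theta>A_bounded: obtains E where "\<And>t. norm (\<Theta> t ** A t) \<le> E"
  using matrix_bound_mult[OF \<Theta>(3) A(2)] by metis

lemma fundamental_matrix:
  assumes "s \<in> {0..T + h}" "t \<in> {0..T + h}"
  shows "fundamental_matrix (T + h) A0 t s = \<Phi> t ** \<Theta> s"
  by (rule fundamental_matrix_eq[OF \<Phi>(1) \<Theta>(1) inverse A(1,4,3) assms])

lemma AE_shift:
  assumes "AE t in lborel. t \<in> {a + h..b + h} \<longrightarrow> S t"
  shows "AE t in lborel. t \<in> {a..b} \<longrightarrow> S (t + h)"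
proof -
  have "AE t in distr lborel borel ((+) h). t \<in> {a + h..b + h} \<longrightarrow> S t"
    unfolding lborel_distr_plus by (rule assms)
  then have "AE t in lborel. h + t \<in> {a + h..b + h} \<longrightarrow> S (h + t)"
    by (rule AE_distrD[rotated]) simp
  then show ?thesis by eventually_elim (auto simp: add.commute)
qed

lemma B_bar_eq: "AE s in lborel. s \<in> {0..T} \<longrightarrow> B_bar T h A0 B0 s = \<Phi> s ** \<beta> s"
proof -
  have "AE t in lborel. t \<in> {0 + h..T + h} \<longrightarrow> B t = B0 t"
    using B(3) by eventually_elim (use times in auto)
  from AE_shift[OF this] show ?thesis
  proof eventually_elim
    case (elim s)
    then show ?case
      using times by (auto simp: B_bar_def \<beta>_def fundamental_matrix matrix_mul_assoc)
  qed
qed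

subsection \<open>Sample paths\<close>

definition control_path :: "(real \<Rightarrow> real^'m) \<Rightarrow> real \<Rightarrow> real^'n" where
  "control_path u t = (LBINT s:{0..t}. \<beta> s *v u s)"

text \<open>This is the integral of \<open>\<Theta>\<close> against \<open>Z\<close>, integrated by
  parts with the density \<open>- \<Theta> A\<close> of \<open>\<Theta>\<close>. It makes sense for
  each continuous path, so a stochastic integral of \<open>\<Theta> \<sigma>\<close> is never
  formed.\<close>

definition noise_path :: "(real \<Rightarrow> real^'n) \<Rightarrow> real \<Rightarrow> real^'n" where
  "noise_path Z t = \<Theta> t *v Z t + (LBINT s:{0..t}. (\<Theta> s ** A s) *v Z s)"

lemma control_path_nonpos: "t \<le> 0 \<Longrightarrow> control_path u t = 0"
  using set_integral_Icc_self[of 0 "\<lambda>s. \<beta> s *v u s"]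
  by (cases "t = 0") (auto simp: control_path_def set_lebesgue_integral_def)

text \<open>The primitive is extended to the left of 0, where \<open>u\<close> vanishes, so that the
  delayed argument \<open>t - h\<close> stays in its domain for every \<open>t\<close> in
  \<open>[0, T]\<close>.\<close>

lemma control_path_primitive:
  assumes u: "set_integrable lborel {0..T} u" "\<And>s. s \<notin> {0..T} \<Longrightarrow> u s = 0"
  shows "primitive_on (-h) T (\<lambda>s. \<beta> s *v u s) (control_path u)"
proof -
  obtain E where E: "\<And>t. norm (\<beta> t) \<le> E" by (rule \<beta>_bounded) blast
  have i: "set_integrable lborel {0..T} (\<lambda>s. \<beta> s *v u s)"
    by (rule set_integrable_matrix[OF \<beta>_measurable E u(1)])
  have e: "indicator {-h..t} s *\<^sub>R (\<beta> s *v u s) = indicator {0..t} s *\<^sub>R (\<beta> s *v u s)" for s t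
    using u(2)[of s] times by (auto simp: indicator_def mv.zero_right)
  show ?thesis
  proof (rule primitive_onI)
    show "set_integrable lborel {- h..T} (\<lambda>s. \<beta> s *v u s)"
      using i unfolding set_integrable_def e .
    show "control_path u t = control_path u (-h) + (LBINT s:{-h..t}. \<beta> s *v u s)" for t
      using control_path_nonpos[of "-h" u] times
      by (simp add: set_lebesgue_integral_def e) (simp add: control_path_def set_lebesgue_integral_def)
  qed
qed

lemma control_path_primitive_0:
  assumes "set_integrable lborel {0..T} u" "\<And>s. s \<notin> {0..T} \<Longrightarrow> u s = 0"
  shows "primitive_on 0 T (\<lambda>s. \<beta> s *v u s) (control_path u)"
  using primitive_on_subinterval[OF control_path_primitive[OF assms], of 0 T] times by simp

lemma control_path_delayed_primitive:
  assumes "set_integrable lborel {0..T} u" "\<And>s. s \<notin> {0..T} \<Longrightarrow> u s = 0"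
  shows "primitive_on 0 T (\<lambda>t. \<beta> (t - h) *v u (t - h)) (\<lambda>t. control_path u (t - h))"
  using primitive_on_subinterval[OF primitive_on_shift[OF control_path_primitive[OF assms], of h], of 0 T] times
  by simp

lemma noise_integral_primitive:
  assumes "continuous_on {0..T} Z"
  shows "primitive_on 0 T (\<lambda>s. (\<Theta> s ** A s) *v Z s) (\<lambda>t. LBINT s:{0..t}. (\<Theta> s ** A s) *v Z s)"
proof -
  obtain E where E: "\<And>t. norm (\<Theta> t ** A t) \<le> E" by (rule \<Theta>A_bounded) blast
  have "set_integrable lborel {0..T} (\<lambda>s. (\<Theta> s ** A s) *v Z s)"
    by (rule set_integrable_matrix[OF _ E borel_integrable_atLeastAtMost'[OF assms]]) measurable
  from primitive_on_set_integral[OF this, of 0] show ?thesis by simp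
qed

text \<open>\<open>Y\<close> itself need not be absolutely continuous, but its difference to the
  driving path is. The input \<open>k\<close> is left general: the state uses the delayed control
  path, the Artstein transform the undelayed one.\<close>

lemma path_equation_solution:
  assumes Z: "continuous_on {0..T} Z" and k: "primitive_on 0 T g k" "k 0 = 0"
    and Y: "\<And>t. t \<in> {0..T} \<Longrightarrow> Y t = \<Phi> t *v (noise_path Z t + k t)"
  shows "primitive_on 0 T (\<lambda>t. A t *v Y t + \<Phi> t *v g t) (\<lambda>t. Y t - Z t)"
proof -
  define q where "q = (\<lambda>t. (LBINT s:{0..t}. (\<Theta> s ** A s) *v Z s) + k t)"
  have q: "primitive_on 0 T (\<lambda>t. (\<Theta> t ** A t) *v Z t + g t) q"
    unfolding q_def by (rule primitive_on_add[OF noise_integral_primitive[OF Z] k(1)])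
  have Yq: "Y t = Z t + \<Phi> t *v q t" if "t \<in> {0..T}" for t
    by (simp add: Y[OF that] q_def noise_path_def mv.add_right matrix_vector_mul_assoc inverse add.assoc)
  have "primitive_on 0 T (\<lambda>t. (A t ** \<Phi> t) *v q t + \<Phi> t *v ((\<Theta> t ** A t) *v Z t + g t)) (\<lambda>t. \<Phi> t *v q t)"
    by (rule primitive_on_product[OF bounded_bilinear_matrix_vector_mult \<Phi>_T q])
  also have "?this \<longleftrightarrow> ?thesis"
  proof (rule primitive_on_cong)
    fix t assume t: "t \<in> {0..T}"
    show "\<Phi> t *v q t = Y t - Z t" using Yq[OF t] by simp
    show "(A t ** \<Phi> t) *v q t + \<Phi> t *v ((\<Theta> t ** A t) *v Z t + g t) = A t *v Y t + \<Phi> t *v g t"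
      unfolding Yq[OF t]
      by (simp add: mv.add_right matrix_vector_mul_assoc matrix_mul_assoc inverse)
  qed
  finally show ?thesis .
qed

text \<open>In the coordinates \<open>\<Theta> (X - Z)\<close> the drift \<open>A\<close> acts only
  on the given \<open>Z\<close>, so the difference to the candidate \<open>q\<close> has density 0,
  and it starts at 0.\<close>

lemma path_equation_unique:
  assumes Z: "continuous_on {0..T} Z" and u: "set_integrable lborel {0..T} u" "\<And>s. s \<notin> {0..T} \<Longrightarrow> u s = 0"
    and X: "primitive_on 0 T (\<lambda>t. A t *v X t + B t *v u (t - h)) (\<lambda>t. X t - Z t)" "X 0 = Z 0"
    and t: "t \<in> {0..T}"
  shows "X t = \<Phi> t *v (noise_path Z t + control_path u (t - h))"
proof -
  define q where "q = (\<lambda>t. (LBINT s:{0..t}. (\<Theta> s ** A s) *v Z s) + control_path u (t - h))"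
  have q: "primitive_on 0 T (\<lambda>t. (\<Theta> t ** A t) *v Z t + \<beta> (t - h) *v u (t - h)) q"
    unfolding q_def by (rule primitive_on_add[OF noise_integral_primitive[OF Z] control_path_delayed_primitive[OF u]])
  have "primitive_on 0 T (\<lambda>t. - (\<Theta> t ** A t) *v (X t - Z t) + \<Theta> t *v (A t *v X t + B t *v u (t - h)))
      (\<lambda>t. \<Theta> t *v (X t - Z t))"
    by (rule primitive_on_product[OF bounded_bilinear_matrix_vector_mult \<Theta>_T X(1)])
  from primitive_on_diff_fun[OF this q]
  have "\<Theta> t *v (X t - Z t) - q t = \<Theta> 0 *v (X 0 - Z 0) - q 0"
    by (rule primitive_on_zero_AE[OF _ _ t])
      (simp add: mv.minus_left mv.diff_right mv.add_right matrix_vector_mul_assoc \<beta>_def)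
  also have "\<dots> = 0"
    using X(2) times control_path_nonpos[of "-h" u] by (simp add: q_def mv.zero_right set_integral_Icc_self set_integral_singleton)
  finally have "\<Theta> t *v (X t - Z t) = q t" by simp
  then have "\<Phi> t *v (\<Theta> t *v (X t - Z t)) = \<Phi> t *v q t" by simp
  then have "X t - Z t = \<Phi> t *v q t" by (simp add: matrix_vector_mul_assoc inverse)
  then have "X t = Z t + \<Phi> t *v q t" by (simp add: algebra_simps)
  then show ?thesis
    by (simp add: q_def noise_path_def mv.add_right matrix_vector_mul_assoc inverse add.assoc)
qed

text \<open>The kernel factors as \<open>\<Phi> t ** \<Theta> (s + h) ** B0 (s + h)\<close>, so
  \<open>\<Phi> t\<close> comes out of the integral and \<open>\<beta>\<close> remains under
  it.\<close>

lemma artstein_eq: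
  assumes U: "\<And>s. s \<in> {-h..<0} \<Longrightarrow> U s \<omega> = 0" "(\<lambda>s. truncate_time T U s \<omega>) \<in> borel_measurable borel"
    and t: "t \<in> {0..T}"
  shows "artstein T h A0 B0 U X t \<omega> = X t \<omega> + \<Phi> t *v (LBINT s:{t-h..t}. \<beta> s *v truncate_time T U s \<omega>)"
proof -
  define u where "u = (\<lambda>s. truncate_time T U s \<omega>)"
  have u: "U s \<omega> = u s" if "s \<in> {t-h..t}" for s
    using U(1)[of s] that t times by (auto simp: u_def truncate_time_def)
  note U(2)[folded u_def, measurable]
  have B0m: "(\<lambda>s. indicator {0..T + h} (s + h) *\<^sub>R B0 (s + h)) \<in> borel_measurable borel"
    using measurable_compose[of "\<lambda>s. s + h" borel borel, OF _ B(4)[unfolded set_borel_measurable_def]] by simp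
  have in_range: "s + h \<in> {0..T + h}" "t \<in> {0..T + h}" if "s \<in> {t-h..t}" for s
    using that t times by auto
  have *: "indicator {t-h..t} s *\<^sub>R ((fundamental_matrix (T + h) A0 t (s + h) ** B0 (s + h)) *v U s \<omega>) =
      indicator {t-h..t} s *\<^sub>R ((\<Phi> t ** \<Theta> (s + h) ** (indicator {0..T + h} (s + h) *\<^sub>R B0 (s + h))) *v u s)" for s
    using in_range[of s] by (cases "s \<in> {t-h..t}") (auto simp: fundamental_matrix u)
  have "(LBINT s=ereal (t - h)..ereal t. (fundamental_matrix (T + h) A0 t (s + h) ** B0 (s + h)) *v U s \<omega>) =
      (LBINT s:{t-h..t}. (fundamental_matrix (T + h) A0 t (s + h) ** B0 (s + h)) *v U s \<omega>)"
    using times by (intro interval_integral_Icc) auto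
  also have "\<dots> = (LBINT s:{t-h..t}. \<Phi> t *v (\<beta> s *v u s))"
  proof (rule set_integral_cong_AE_Icc)
    show "set_borel_measurable lborel {t - h..t} (\<lambda>s. \<Phi> t *v (\<beta> s *v u s))"
      unfolding set_borel_measurable_def by measurable
    note B0m[measurable]
    show "set_borel_measurable lborel {t - h..t} (\<lambda>s. (fundamental_matrix (T + h) A0 t (s + h) ** B0 (s + h)) *v U s \<omega>)"
      unfolding set_borel_measurable_def * by measurable
    have "AE s in lborel. s \<in> {t - h + h..t + h} \<longrightarrow> B s = B0 s"
      using B(3) by eventually_elim (use t in auto)
    from AE_shift[OF this]
    show "AE s in lborel. s \<in> {t - h..t} \<longrightarrow>
       (fundamental_matrix (T + h) A0 t (s + h) ** B0 (s + h)) *v U s \<omega> = \<Phi> t *v (\<beta> s *v u s)"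
    proof eventually_elim
      case (elim s)
      show ?case
      proof
        assume s: "s \<in> {t - h..t}"
        show "(fundamental_matrix (T + h) A0 t (s + h) ** B0 (s + h)) *v U s \<omega> = \<Phi> t *v (\<beta> s *v u s)"
          using elim s by (simp add: fundamental_matrix[OF in_range[OF s]] u[OF s] \<beta>_def matrix_vector_mul_assoc matrix_mul_assoc)
      qed
    qed
  qed
  \<comment> \<open>An invertible linear map commutes with the integral even on a path that is not
    integrable, where both sides have the default value 0.\<close>
  also have "\<dots> = \<Phi> t *v (LBINT s:{t-h..t}. \<beta> s *v u s)"
    using integral_bounded_linear'[of "\<lambda>v. \<Phi> t *v v" "\<lambda>v. \<Theta> t *v v" lborel "\<lambda>s. indicator {t-h..t} s *\<^sub>R (\<beta> s *v u s)"]
    by (simp add: mv.bounded_linear_right matrix_vector_mul_assoc inverse set_lebesgue_integral_def mv.scaleR_right)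
  finally show ?thesis by (simp add: artstein_def u_def)
qed

lemma control_path_diff:
  assumes u: "set_integrable lborel {0..T} u" "\<And>s. s \<notin> {0..T} \<Longrightarrow> u s = 0" and t: "t \<in> {0..T}"
  shows "(LBINT s:{t-h..t}. \<beta> s *v u s) = control_path u t - control_path u (t - h)"
  using primitive_on_diff[OF control_path_primitive[OF u], of "t - h" t] times t by simp

subsection \<open>From the stochastic equation to sample paths\<close>

abbreviation state_drift :: "(real \<Rightarrow> 'w \<Rightarrow> real^'m) \<Rightarrow> (real \<Rightarrow> 'w \<Rightarrow> real^'n) \<Rightarrow> real \<Rightarrow> 'w \<Rightarrow> real^'n" where
  "state_drift U X t \<omega> \<equiv> A0 t *v X t \<omega> + B0 t *v U (t - h) \<omega>"

text \<open>The drift rebuilt from representatives and truncated processes, which makes it jointly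
  measurable on the whole axis; on \<open>[0, T]\<close> it agrees with \<open>state_drift\<close>
  at almost every time along each path.\<close>

definition drift :: "(real \<Rightarrow> 'w \<Rightarrow> real^'m) \<Rightarrow> (real \<Rightarrow> 'w \<Rightarrow> real^'n) \<Rightarrow> real \<Rightarrow> 'w \<Rightarrow> real^'n" where
  "drift U X t \<omega> = A t *v truncate_time T X t \<omega> + B t *v truncate_time T U (t - h) \<omega>"

lemma joint_measurable_drift:
  assumes "measurable_process M T U" "measurable_process M T X"
  shows "joint_measurable M (drift U X)"
proof -
  note j = joint_measurable_truncate[OF _ T_nonneg]
  have "joint_measurable M (\<lambda>t. truncate_time T U (t - h))"
    using joint_measurable_shift[OF j[OF assms(1)], of "-h"] by simp
  then show ?thesis
    unfolding drift_def
    by (intro joint_measurable_add joint_measurable_matrix A(1) B(1) j[OF assms(2)])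
qed

lemma state_drift_eq:
  assumes U: "measurable_process M T U" "\<And>s. s \<in> {-h..<0} \<Longrightarrow> U s \<omega> = 0" and X: "measurable_process M T X"
    and \<omega>: "\<omega> \<in> space M" and t: "t \<in> {0..T}"
  shows "(LBINT s=ereal 0..ereal t. state_drift U X s \<omega>) = (LBINT s:{0..t}. drift U X s \<omega>)"
    "set_integrable lborel {0..t} (\<lambda>s. state_drift U X s \<omega>) \<longleftrightarrow> set_integrable lborel {0..t} (\<lambda>s. drift U X s \<omega>)"
    "set_borel_measurable lborel {0..t} (\<lambda>s. state_drift U X s \<omega>)"
    "AE s in lborel. s \<in> {0..t} \<longrightarrow> state_drift U X s \<omega> = A s *v X s \<omega> + B s *v truncate_time T U (s - h) \<omega>"
proof -
  define x where "x = (\<lambda>s. truncate_time T X s \<omega>)"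
  define u where "u = (\<lambda>s. truncate_time T U s \<omega>)"
  have [measurable]: "x \<in> borel_measurable borel" "u \<in> borel_measurable borel"
    unfolding x_def u_def
    by (rule joint_measurable_path[OF joint_measurable_truncate[OF _ T_nonneg] \<omega>], fact)+
  have xu: "X s \<omega> = x s" "U (s - h) \<omega> = u (s - h)" if "s \<in> {0..t}" for s
    using that t U(2)[of "s - h"] times by (auto simp: x_def u_def truncate_time_def)
  have [measurable]: "(\<lambda>s. indicator {0..T + h} s *\<^sub>R A0 s) \<in> borel_measurable borel"
    "(\<lambda>s. indicator {0..T + h} s *\<^sub>R B0 s) \<in> borel_measurable borel"
    using A(4) B(4) by (simp_all add: set_borel_measurable_def)
  have *: "indicator {0..t} s *\<^sub>R state_drift U X s \<omega> = indicator {0..t} s *\<^sub>R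
     ((indicator {0..T + h} s *\<^sub>R A0 s) *v x s + (indicator {0..T + h} s *\<^sub>R B0 s) *v u (s - h))" for s
    using xu[of s] t times by (cases "s \<in> {0..t}") auto
  show m: "set_borel_measurable lborel {0..t} (\<lambda>s. state_drift U X s \<omega>)"
    unfolding set_borel_measurable_def * by measurable
  have "(\<lambda>s. drift U X s \<omega>) \<in> borel_measurable borel"
    by (rule joint_measurable_path[OF joint_measurable_drift[OF U(1) X] \<omega>])
  then have m': "set_borel_measurable lborel {0..t} (\<lambda>s. drift U X s \<omega>)"
    unfolding set_borel_measurable_def by measurable
  show ae': "AE s in lborel. s \<in> {0..t} \<longrightarrow> state_drift U X s \<omega> = A s *v X s \<omega> + B s *v truncate_time T U (s - h) \<omega>"
    using A(3) B(3)
  proof eventually_elim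
    case (elim s)
    show ?case
    proof
      assume s: "s \<in> {0..t}"
      then have "s \<in> {0..T + h}" using t times by auto
      then show "state_drift U X s \<omega> = A s *v X s \<omega> + B s *v truncate_time T U (s - h) \<omega>"
        using elim xu(2)[OF s] by (simp add: u_def)
    qed
  qed
  then have ae: "AE s in lborel. s \<in> {0..t} \<longrightarrow> state_drift U X s \<omega> = drift U X s \<omega>"
    by eventually_elim (use t in \<open>auto simp: drift_def truncate_time_def\<close>)
  show "set_integrable lborel {0..t} (\<lambda>s. state_drift U X s \<omega>) \<longleftrightarrow> set_integrable lborel {0..t} (\<lambda>s. drift U X s \<omega>)"
    by (rule set_integral_cong_AE_Icc(2)[OF m m' ae])
  show "(LBINT s=ereal 0..ereal t. state_drift U X s \<omega>) = (LBINT s:{0..t}. drift U X s \<omega>)"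
    using set_integral_cong_AE_Icc(1)[OF m m' ae] t by (simp add: interval_integral_Icc)
qed

definition state_noise :: "(real \<Rightarrow> 'w \<Rightarrow> real^'m) \<Rightarrow> (real \<Rightarrow> 'w \<Rightarrow> real^'n) \<Rightarrow> real \<Rightarrow> 'w \<Rightarrow> real^'n" where
  "state_noise U X = truncate_time T (\<lambda>t \<omega>. X t \<omega> - (LBINT s:{0..t}. drift U X s \<omega>))"

text \<open>A property instead of a fixed process: the noise read off from any admissible state has
  it, so has the one constructed later, and uniqueness identifies them all.\<close>

definition wiener_noise :: "(real \<Rightarrow> 'w \<Rightarrow> real^'n) \<Rightarrow> bool" where
  "wiener_noise Z \<longleftrightarrow> joint_measurable M Z \<and> (\<forall>t\<in>{0..T}. is_wiener_integral M W t \<sigma> (Z t)) \<and>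
     (AE \<omega> in M. continuous_on {0..T} (\<lambda>t. Z t \<omega>) \<and> Z 0 \<omega> = 0)"

lemma is_wiener_integral_\<sigma>:
  "t \<in> {0..T} \<Longrightarrow> is_wiener_integral M W t \<sigma>0 Z \<longleftrightarrow> is_wiener_integral M W t \<sigma> Z"
  by (rule is_wiener_integral_cong_AE) (use \<sigma>(3) in \<open>auto elim!: eventually_mono\<close>)

lemma admissible_l2_process: "admissible M F W T h A0 B0 \<sigma>0 U X \<Longrightarrow> l2_process M T (truncate_time T U)"
  using L2_adapted_l2_process[OF _ T_nonneg] by (auto simp: admissible_def)

lemma control_path_integrable:
  assumes "l2_process M T (truncate_time T U)"
  shows "AE \<omega> in M. set_integrable lborel {0..T} (\<lambda>s. truncate_time T U s \<omega>)"
  by (rule l2_process_path_integrable[OF assms])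

text \<open>The noise is recovered as the state minus its integrated drift and inherits continuity
  from the state. The equation is then solved on each path, so a single null set serves all
  times.\<close>

proposition admissible_state_formula:
  assumes adm: "admissible M F W T h A0 B0 \<sigma>0 U X"
  shows "wiener_noise (state_noise U X)"
    "AE \<omega> in M. \<forall>t\<in>{0..T}. X t \<omega> = \<Phi> t *v (noise_path (\<lambda>s. state_noise U X s \<omega>) t +
       control_path (\<lambda>s. truncate_time T U s \<omega>) (t - h))"
proof -
  have U: "measurable_process M T U" "\<And>s \<omega>. s \<in> {-h..<0} \<Longrightarrow> U s \<omega> = 0"
    and X: "measurable_process M T X" and sde: "solves_sde M W T (\<lambda>t \<omega>. state_drift U X t \<omega>) \<sigma>0 X"
    using adm by (auto simp: admissible_def L2_adapted_def solves_sde_def)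
  note jd = joint_measurable_drift[OF U(1) X]
  let ?N = "\<lambda>t \<omega>. X t \<omega> - (LBINT s:{0..t}. drift U X s \<omega>)"
  have jI: "joint_measurable M (\<lambda>t \<omega>. LBINT s:{0..t}. drift U X s \<omega>)"
    by (rule joint_measurable_integral[OF _ jd]) unfold_locales
  have jZ: "joint_measurable M (state_noise U X)"
  proof -
    have "joint_measurable M (\<lambda>t \<omega>. truncate_time T X t \<omega> - (LBINT s:{0..t}. drift U X s \<omega>))"
      by (rule joint_measurable_diff[OF joint_measurable_truncate[OF X T_nonneg] jI])
    then have "measurable_process M T ?N"
      by (rule measurable_process_joint) (simp add: truncate_time_def)
    then show ?thesis unfolding state_noise_def by (rule joint_measurable_truncate[OF _ T_nonneg])
  qed
  have wi: "is_wiener_integral M W t \<sigma> (state_noise U X t)" if t: "t \<in> {0..T}" for t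
  proof -
    have "is_wiener_integral M W t \<sigma> (\<lambda>\<omega>. X t \<omega> - (LBINT s=ereal 0..ereal t. state_drift U X s \<omega>))"
      using sde t unfolding solves_sde_def is_wiener_integral_\<sigma>[OF t, symmetric] by blast
    then show ?thesis
    proof (rule is_wiener_integral_cong)
      show "state_noise U X t \<in> borel_measurable M" by (rule joint_measurable_section[OF jZ])
      show "AE \<omega> in M. X t \<omega> - (LBINT s=ereal 0..ereal t. state_drift U X s \<omega>) = state_noise U X t \<omega>"
        using state_drift_eq(1)[OF U X _ t] t by (intro AE_I2) (simp add: state_noise_def truncate_time_def)
    qed
  qed
  have good: "AE \<omega> in M. continuous_on {0..T} (\<lambda>t. X t \<omega>) \<and> X 0 \<omega> = 0 \<and>
     set_integrable lborel {0..T} (\<lambda>s. drift U X s \<omega>)"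
  proof -
    have "AE \<omega> in M. continuous_on {0..T} (\<lambda>t. X t \<omega>)" "AE \<omega> in M. X 0 \<omega> = 0"
      "AE \<omega> in M. set_integrable lborel {0..T} (\<lambda>s. state_drift U X s \<omega>)"
      using sde by (auto simp: solves_sde_def)
    with AE_space show ?thesis
      by eventually_elim (use state_drift_eq(2)[OF U X, of _ T] T_nonneg in auto)
  qed
  then have Zc: "AE \<omega> in M. continuous_on {0..T} (\<lambda>t. state_noise U X t \<omega>) \<and> state_noise U X 0 \<omega> = 0"
  proof eventually_elim
    case (elim \<omega>)
    have "continuous_on {0..T} (\<lambda>t. ?N t \<omega>)"
      using elim by (intro continuous_on_diff continuous_on_set_integral_Icc) auto
    then have "continuous_on {0..T} (\<lambda>t. state_noise U X t \<omega>)"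
      by (rule continuous_on_eq) (simp add: state_noise_def truncate_time_def)
    then show ?case
      using elim T_nonneg by (simp add: state_noise_def truncate_time_def set_integral_Icc_self set_integral_singleton)
  qed
  show "wiener_noise (state_noise U X)"
    using jZ wi Zc by (simp add: wiener_noise_def)
  show "AE \<omega> in M. \<forall>t\<in>{0..T}. X t \<omega> = \<Phi> t *v (noise_path (\<lambda>s. state_noise U X s \<omega>) t +
       control_path (\<lambda>s. truncate_time T U s \<omega>) (t - h))"
    using good Zc control_path_integrable[OF admissible_l2_process[OF adm]]
  proof eventually_elim
    case (elim \<omega>)
    have "primitive_on 0 T (\<lambda>s. drift U X s \<omega>) (\<lambda>t. LBINT s:{0..t}. drift U X s \<omega>)"
      using primitive_on_set_integral[of 0 T "\<lambda>s. drift U X s \<omega>" 0] elim by simp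
    also have "?this \<longleftrightarrow> primitive_on 0 T (\<lambda>t. A t *v X t \<omega> + B t *v truncate_time T U (t - h) \<omega>)
       (\<lambda>t. X t \<omega> - state_noise U X t \<omega>)"
      by (rule primitive_on_cong) (auto simp: drift_def state_noise_def truncate_time_def)
    finally have p: "primitive_on 0 T (\<lambda>t. A t *v X t \<omega> + B t *v truncate_time T U (t - h) \<omega>)
       (\<lambda>t. X t \<omega> - state_noise U X t \<omega>)" .
    show ?case
    proof
      fix t assume t: "t \<in> {0..T}"
      show "X t \<omega> = \<Phi> t *v (noise_path (\<lambda>s. state_noise U X s \<omega>) t +
         control_path (\<lambda>s. truncate_time T U s \<omega>) (t - h))"
      proof (rule path_equation_unique[OF _ _ _ p _ t])
        show "truncate_time T U s \<omega> = 0" if "s \<notin> {0..T}" for s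
          unfolding truncate_time_def using that by (rule if_not_P)
      qed (use elim in auto)
    qed
  qed
qed

text \<open>The converse direction. It is general in the input \<open>k \<omega>\<close> and its
  density \<open>g \<omega>\<close>, so that it covers the closed-loop state as well as the Artstein
  transform.\<close>

lemma solves_sdeI:
  assumes Z: "wiener_noise Z" and Y: "measurable_process M T Y"
    and b: "\<And>t. t \<in> {0..T} \<Longrightarrow> (\<lambda>\<omega>. LBINT s=ereal 0..ereal t. b s \<omega>) \<in> borel_measurable M"
    and path: "AE \<omega> in M. primitive_on 0 T (g \<omega>) (k \<omega>) \<and> k \<omega> 0 = 0 \<and>
      (\<forall>t\<in>{0..T}. Y t \<omega> = \<Phi> t *v (noise_path (\<lambda>s. Z s \<omega>) t + k \<omega> t)) \<and>
      set_borel_measurable lborel {0..T} (\<lambda>s. b s \<omega>) \<and>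
      (AE s in lborel. s \<in> {0..T} \<longrightarrow> b s \<omega> = A s *v Y s \<omega> + \<Phi> s *v g \<omega> s)"
  shows "solves_sde M W T b \<sigma>0 Y"
proof -
  have good: "AE \<omega> in M. continuous_on {0..T} (\<lambda>t. Z t \<omega>) \<and> Z 0 \<omega> = 0 \<and>
     primitive_on 0 T (\<lambda>s. b s \<omega>) (\<lambda>t. Y t \<omega> - Z t \<omega>) \<and> Y 0 \<omega> = 0"
    using path Z[unfolded wiener_noise_def, THEN conjunct2, THEN conjunct2]
  proof eventually_elim
    case (elim \<omega>)
    have "primitive_on 0 T (\<lambda>t. A t *v Y t \<omega> + \<Phi> t *v g \<omega> t) (\<lambda>t. Y t \<omega> - Z t \<omega>)"
      using elim by (intro path_equation_solution) auto
    then have "primitive_on 0 T (\<lambda>s. b s \<omega>) (\<lambda>t. Y t \<omega> - Z t \<omega>)"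
      by (rule primitive_on_cong_AE) (use elim in \<open>auto elim: eventually_mono\<close>)
    moreover have "Y 0 \<omega> = 0"
      using elim T_nonneg by (simp add: noise_path_def set_integral_singleton mv.zero_right)
    ultimately show ?case using elim by blast
  qed
  show ?thesis
    unfolding solves_sde_def
  proof (intro conjI ballI Y)
    show "AE \<omega> in M. continuous_on {0..T} (\<lambda>t. Y t \<omega>)"
      using good
    proof eventually_elim
      case (elim \<omega>)
      have "continuous_on {0..T} (\<lambda>t. Y t \<omega> - Z t \<omega>)"
        using elim by (intro primitive_on_continuous[of 0 T "\<lambda>s. b s \<omega>"]) blast
      then have "continuous_on {0..T} (\<lambda>t. (Y t \<omega> - Z t \<omega>) + Z t \<omega>)"
        using elim by (intro continuous_on_add) auto
      then show ?case by simp
    qed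
    show "AE \<omega> in M. Y 0 \<omega> = 0" using good by eventually_elim blast
    show "AE \<omega> in M. set_integrable lborel {0..T} (\<lambda>s. b s \<omega>)"
      using good by eventually_elim (blast dest: primitive_on_integrable)
    fix t assume t: "t \<in> {0..T}"
    have "is_wiener_integral M W t \<sigma>0 (Z t)"
      using Z t is_wiener_integral_\<sigma>[OF t] by (simp add: wiener_noise_def)
    then show "is_wiener_integral M W t \<sigma>0 (\<lambda>\<omega>. Y t \<omega> - (LBINT s=ereal 0..ereal t. b s \<omega>))"
    proof (rule is_wiener_integral_cong)
      have "Y t \<in> borel_measurable M"
      proof -
        have "truncate_time T Y t \<in> borel_measurable M"
          by (rule joint_measurable_section[OF joint_measurable_truncate[OF Y T_nonneg]])
        then show ?thesis using t by (simp add: truncate_time_def[abs_def])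
      qed
      then show "(\<lambda>\<omega>. Y t \<omega> - (LBINT s=ereal 0..ereal t. b s \<omega>)) \<in> borel_measurable M"
        using b[OF t] by (rule borel_measurable_diff)
      show "AE \<omega> in M. Z t \<omega> = Y t \<omega> - (LBINT s=ereal 0..ereal t. b s \<omega>)"
        using good
      proof eventually_elim
        case (elim \<omega>)
        then have "Y t \<omega> - Z t \<omega> = (Y 0 \<omega> - Z 0 \<omega>) + (LBINT s:{0..t}. b s \<omega>)"
          by (intro primitive_onD[OF _ t]) blast
        then show ?case using elim t by (simp add: interval_integral_Icc algebra_simps)
      qed
    qed
  qed
qed

end

section \<open>Outer products and measurability of matrix functions\<close>

lemma outer_matrix_left: "outer (S *v a) b = S ** outer a b"
  by (simp add: vec_eq_iff outer_def matrix_vector_mult_def matrix_matrix_mult_def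
      sum_distrib_left sum_distrib_right mult_ac)

lemma outer_sum_axis: "outer a b = (\<Sum>j\<in>UNIV. outer (b $ j *\<^sub>R a) (axis j 1))"
  by (simp add: vec_eq_iff outer_def axis_def mult_delta_right sum.delta')

lemma det_borel_measurable:
  fixes f :: "'a \<Rightarrow> real^'n^'n"
  assumes "\<And>i j. (\<lambda>x. f x $ i $ j) \<in> borel_measurable N"
  shows "(\<lambda>x. det (f x)) \<in> borel_measurable N"
  unfolding det_def using assms
  by (intro borel_measurable_sum borel_measurable_times borel_measurable_const borel_measurable_prod)

lemma borel_measurable_matrixI:
  fixes f :: "'a \<Rightarrow> real^'n^'m"
  assumes "\<And>i j. (\<lambda>x. f x $ i $ j) \<in> borel_measurable N"
  shows "f \<in> borel_measurable N"
proof -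
  have "(\<lambda>x. f x \<bullet> axis i (axis j 1)) \<in> borel_measurable N" for i j
    using assms by (simp add: inner_axis)
  then show ?thesis
    by (subst borel_measurable_euclidean_space) (auto simp: Basis_vec_def)
qed

lemma borel_measurable_matrix_entry:
  fixes f :: "'a \<Rightarrow> real^'n^'m"
  assumes "f \<in> borel_measurable N"
  shows "(\<lambda>x. f x $ i $ j) \<in> borel_measurable N"
proof -
  have "(\<lambda>x. f x \<bullet> axis i (axis j 1)) \<in> borel_measurable N"
    using assms by measurable
  then show ?thesis by (simp add: inner_axis)
qed

text \<open>Cramer's rule: each entry of the inverse is a quotient of determinants, which are
  polynomials in the entries.\<close>

lemma borel_measurable_matrix_inv:
  fixes f :: "'a \<Rightarrow> real^'n^'n"
  assumes f: "f \<in> borel_measurable N" and inv: "\<And>x. f x ** matrix_inv (f x) = mat 1"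
  shows "(\<lambda>x. matrix_inv (f x)) \<in> borel_measurable N"
proof (rule borel_measurable_matrixI)
  fix k j
  have "matrix_inv (f x) $ k $ j = det (\<chi> i l. if l = k then axis j 1 $ i else f x $ i $ l) / det (f x)" for x
  proof -
    have "det (f x) * det (matrix_inv (f x)) = 1"
      using inv[of x] by (metis det_I det_mul)
    then have d: "det (f x) \<noteq> 0" by auto
    have "f x *v (matrix_inv (f x) *v axis j 1) = axis j 1"
      by (simp add: matrix_vector_mul_assoc inv)
    then have "matrix_inv (f x) *v axis j 1 = (\<chi> k. det (\<chi> i l. if l = k then axis j 1 $ i else f x $ i $ l) / det (f x))"
      using cramer[OF d] by blast
    moreover have "(matrix_inv (f x) *v axis j 1) $ k = matrix_inv (f x) $ k $ j"
      by (simp add: matrix_vector_mult_basis column_def)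
    ultimately show ?thesis by simp
  qed
  moreover have "(\<lambda>x. det (\<chi> i l. if l = k then axis j 1 $ i else f x $ i $ l)) \<in> borel_measurable N"
    by (rule det_borel_measurable) (use borel_measurable_matrix_entry[OF f] in simp)
  moreover have "(\<lambda>x. det (f x)) \<in> borel_measurable N"
    by (rule det_borel_measurable[OF borel_measurable_matrix_entry[OF f]])
  ultimately show "(\<lambda>x. matrix_inv (f x) $ k $ j) \<in> borel_measurable N"
    by simp
qed

context wiener_setting
begin

text \<open>Scalar orthogonality is applied to each coordinate of \<open>\<xi>\<close>, and
  \<open>outer_sum_axis\<close> reassembles the matrix.\<close>

lemma wiener_integral_outer_orthogonal:
  fixes \<sigma> :: "real \<Rightarrow> real^'n" and \<xi> :: "'w \<Rightarrow> real^'m"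
  assumes Zt: "is_wiener_integral M W t \<sigma> Zt" and Zs: "is_wiener_integral M W s \<sigma> Zs"
    and \<sigma>: "\<sigma> \<in> borel_measurable borel" "\<And>s. norm (\<sigma> s) \<le> C"
    and st: "0 \<le> s" "s \<le> t" and \<xi>: "\<xi> \<in> borel_measurable (F s)" "sq_integrable M \<xi>"
  shows "expectation (\<lambda>\<omega>. outer (Zt \<omega>) (\<xi> \<omega>)) = expectation (\<lambda>\<omega>. outer (Zs \<omega>) (\<xi> \<omega>))"
proof -
  have t0: "0 \<le> t" using st by simp
  have sq: "sq_integrable M Zt" "sq_integrable M Zs"
    using wiener_integral_second_moment(1)[OF Zt \<sigma> t0] wiener_integral_second_moment(1)[OF Zs \<sigma> st(1)] .
  define D where "D = (\<lambda>\<omega>. Zt \<omega> - Zs \<omega>)"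
  have D: "sq_integrable M D" unfolding D_def by (rule sq_integrable_diff[OF sq])
  have \<xi>j: "sq_integrable M (\<lambda>\<omega>. \<xi> \<omega> $ j)" "(\<lambda>\<omega>. \<xi> \<omega> $ j) \<in> borel_measurable (F s)" for j
  proof -
    show "sq_integrable M (\<lambda>\<omega>. \<xi> \<omega> $ j)"
      using sq_integrable_component[OF \<xi>(2), of "axis j 1"] by (simp add: inner_axis)
    have "(\<lambda>\<omega>. \<xi> \<omega> \<bullet> axis j 1) \<in> borel_measurable (F s)"
      using \<xi>(1) by measurable
    then show "(\<lambda>\<omega>. \<xi> \<omega> $ j) \<in> borel_measurable (F s)" by (simp add: inner_axis)
  qed
  have i: "integrable M (\<lambda>\<omega>. \<xi> \<omega> $ j *\<^sub>R D \<omega>)" for j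
    by (rule integrable_scaleR_sq_integrable[OF \<xi>j(1) D])
  have "expectation (\<lambda>\<omega>. outer (D \<omega>) (\<xi> \<omega>)) = expectation (\<lambda>\<omega>. \<Sum>j\<in>UNIV. outer (\<xi> \<omega> $ j *\<^sub>R D \<omega>) (axis j 1))"
    by (subst outer_sum_axis) simp
  also have "\<dots> = (\<Sum>j\<in>UNIV. expectation (\<lambda>\<omega>. outer (\<xi> \<omega> $ j *\<^sub>R D \<omega>) (axis j 1)))"
    by (intro Bochner_Integration.integral_sum integrable_bounded_linear[OF outer.bounded_linear_left] i)
  also have "\<dots> = (\<Sum>j\<in>UNIV. outer (expectation (\<lambda>\<omega>. \<xi> \<omega> $ j *\<^sub>R D \<omega>)) (axis j 1))"
    by (intro sum.cong refl integral_bounded_linear[OF outer.bounded_linear_left] i)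
  also have "\<dots> = 0"
    using wiener_integral_orthogonal[OF Zt Zs \<sigma> st \<xi>j(2,1)] by (simp add: D_def outer.zero_left)
  finally show ?thesis
    using integrable_bilinear_sq_integrable[OF bounded_bilinear_outer sq(1) \<xi>(2)]
      integrable_bilinear_sq_integrable[OF bounded_bilinear_outer sq(2) \<xi>(2)]
    by (simp add: D_def outer.diff_left)
qed

end

section \<open>Noise, state and Artstein transform of the delayed system\<close>

context delay_system
begin

definition noise :: "(real \<Rightarrow> 'w \<Rightarrow> real^'n) \<Rightarrow> real \<Rightarrow> 'w \<Rightarrow> real^'n" where
  "noise Z t \<omega> = noise_path (\<lambda>s. Z s \<omega>) t"

definition control :: "(real \<Rightarrow> 'w \<Rightarrow> real^'m) \<Rightarrow> real \<Rightarrow> 'w \<Rightarrow> real^'n" where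
  "control U t \<omega> = control_path (\<lambda>s. truncate_time T U s \<omega>) t"

lemma control_eq: "control U = (\<lambda>t \<omega>. LBINT s:{0..t}. \<beta> s *v truncate_time T U s \<omega>)"
  by (simp add: fun_eq_iff control_def control_path_def)

lemma uniform_l2_wiener_noise:
  assumes "wiener_noise Z"
  shows "uniform_l2_process M T Z"
proof -
  have "(\<integral>\<^sup>+\<omega>. ennreal ((norm (Z t \<omega>))\<^sup>2) \<partial>M) \<le> ennreal (6 + 4 * C\<^sup>2 * T)" if t: "t \<in> {0..T}" for t
  proof -
    have w: "is_wiener_integral M W t \<sigma> (Z t)" and "0 \<le> t" using assms t by (auto simp: wiener_noise_def)
    note m = wiener_integral_second_moment[OF w \<sigma>(1,2) this(2)]
    have "(\<integral>\<^sup>+\<omega>. ennreal ((norm (Z t \<omega>))\<^sup>2) \<partial>M) = ennreal (expectation (\<lambda>\<omega>. (norm (Z t \<omega>))\<^sup>2))"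
      using m(1) by (simp add: nn_integral_eq_integral sq_integrable_def)
    also have "\<dots> \<le> ennreal (6 + 4 * C\<^sup>2 * T)"
      using m(2) t mult_left_mono[of t T "4 * C\<^sup>2"] by (intro ennreal_leI) auto
    finally show ?thesis .
  qed
  moreover have "ennreal (6 + 4 * C\<^sup>2 * T) < \<infinity>" by simp
  ultimately show ?thesis
    using assms unfolding uniform_l2_process_def wiener_noise_def by blast
qed

lemma uniform_l2_noise:
  assumes "wiener_noise Z"
  shows "uniform_l2_process M T (noise Z)"
proof -
  obtain E where E: "\<And>t. norm (\<Theta> t ** A t) \<le> E" by (rule \<Theta>A_bounded) blast
  note Z = uniform_l2_wiener_noise[OF assms]
  have "(\<lambda>t. \<Theta> t ** A t) \<in> borel_measurable borel" by measurable
  from uniform_l2_process_integral[OF l2_process_matrix[OF this E uniform_l2_process_l2[OF Z]] T_nonneg]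
    uniform_l2_process_matrix[OF \<Theta>_measurable \<Theta>(3) Z]
  show ?thesis
    unfolding noise_def noise_path_def by (intro uniform_l2_process_add)
qed

text \<open>\<open>noise Z\<close> is defined pathwise, so its orthogonality is derived from that of
  \<open>Z\<close>: the moments \<open>\<mu> r\<close> of \<open>Z r\<close> with
  \<open>\<xi>\<close> are constant for \<open>r \<ge> q\<close>, and for constant moments the
  variation of \<open>\<Theta>\<close> cancels that of the integral.\<close>

lemma noise_orthogonal:
  fixes \<xi> :: "'w \<Rightarrow> real^'k"
  assumes Z: "wiener_noise Z" and q: "0 \<le> q" "q \<le> t" "t \<le> T"
    and \<xi>: "\<xi> \<in> borel_measurable (F q)" "sq_integrable M \<xi>"
  shows "expectation (\<lambda>\<omega>. outer (noise Z t \<omega>) (\<xi> \<omega>)) = expectation (\<lambda>\<omega>. outer (noise Z q \<omega>) (\<xi> \<omega>))"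
proof -
  obtain E where E: "\<And>t. norm (\<Theta> t ** A t) \<le> E" by (rule \<Theta>A_bounded) blast
  note Zu = uniform_l2_wiener_noise[OF Z]
  have AZ: "l2_process M T (\<lambda>s \<omega>. (\<Theta> s ** A s) *v Z s \<omega>)"
    by (rule l2_process_matrix[OF _ E uniform_l2_process_l2[OF Zu]]) measurable
  note IZ = uniform_l2_process_section[OF uniform_l2_process_integral[OF AZ T_nonneg]]
  note Zs = uniform_l2_process_section[OF Zu]
  define \<mu> where "\<mu> = (\<lambda>r. expectation (\<lambda>\<omega>. outer (Z r \<omega>) (\<xi> \<omega>)))"
  note flip = bounded_bilinear.flip[OF bounded_bilinear_outer]
  have left: "expectation (\<lambda>\<omega>. outer (S *v Z r \<omega>) (\<xi> \<omega>)) = S ** \<mu> r" if "r \<in> {0..T}" for S r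
    using integral_bounded_linear[OF mm.bounded_linear_right
        integrable_bilinear_sq_integrable[OF bounded_bilinear_outer Zs[OF that] \<xi>(2)], of S]
    by (simp add: outer_matrix_left \<mu>_def)
  have formula: "expectation (\<lambda>\<omega>. outer (noise Z r \<omega>) (\<xi> \<omega>)) = \<Theta> r ** \<mu> r + (LBINT s:{0..r}. (\<Theta> s ** A s) ** \<mu> s)"
    and int: "set_integrable lborel {0..r} (\<lambda>s. (\<Theta> s ** A s) ** \<mu> s)" if r: "r \<in> {0..T}" for r
  proof -
    have e: "expectation (\<lambda>\<omega>. outer ((\<Theta> s ** A s) *v Z s \<omega>) (\<xi> \<omega>)) = (\<Theta> s ** A s) ** \<mu> s" if "s \<in> {0..r}" for s
      using left[of s] that r by auto
    have "set_integrable lborel {0..r} (\<lambda>s. expectation (\<lambda>\<omega>. outer ((\<Theta> s ** A s) *v Z s \<omega>) (\<xi> \<omega>)))"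
      by (rule expectation_bilinear_integral(1)[OF flip \<xi>(2) AZ r])
    also have "?this \<longleftrightarrow> set_integrable lborel {0..r} (\<lambda>s. (\<Theta> s ** A s) ** \<mu> s)"
      by (rule set_integrable_cong) (auto simp: e)
    finally show "set_integrable lborel {0..r} (\<lambda>s. (\<Theta> s ** A s) ** \<mu> s)" .
    have i: "integrable M (\<lambda>\<omega>. outer (\<Theta> r *v Z r \<omega>) (\<xi> \<omega>))"
      "integrable M (\<lambda>\<omega>. outer (LBINT s:{0..r}. (\<Theta> s ** A s) *v Z s \<omega>) (\<xi> \<omega>))"
      by (intro integrable_bilinear_sq_integrable[OF bounded_bilinear_outer] IZ[OF r] \<xi>(2)
          sq_integrable_bounded_linear[OF Zs[OF r]] mv.bounded_linear_right)+
    have "expectation (\<lambda>\<omega>. outer (noise Z r \<omega>) (\<xi> \<omega>)) = expectation (\<lambda>\<omega>. outer (\<Theta> r *v Z r \<omega>) (\<xi> \<omega>)) +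
        expectation (\<lambda>\<omega>. outer (LBINT s:{0..r}. (\<Theta> s ** A s) *v Z s \<omega>) (\<xi> \<omega>))"
      using i by (simp add: noise_def noise_path_def outer.add_left)
    also have "expectation (\<lambda>\<omega>. outer (LBINT s:{0..r}. (\<Theta> s ** A s) *v Z s \<omega>) (\<xi> \<omega>)) =
        (LBINT s:{0..r}. expectation (\<lambda>\<omega>. outer ((\<Theta> s ** A s) *v Z s \<omega>) (\<xi> \<omega>)))"
      by (rule expectation_bilinear_integral(2)[OF flip \<xi>(2) AZ r])
    also have "\<dots> = (LBINT s:{0..r}. (\<Theta> s ** A s) ** \<mu> s)"
      by (rule set_lebesgue_integral_cong) (auto simp: e)
    finally show "expectation (\<lambda>\<omega>. outer (noise Z r \<omega>) (\<xi> \<omega>)) = \<Theta> r ** \<mu> r + (LBINT s:{0..r}. (\<Theta> s ** A s) ** \<mu> s)"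
      by (simp add: left[OF r])
  qed
  have \<mu>: "\<mu> r = \<mu> q" if "r \<in> {q..T}" for r
  proof -
    have "r \<in> {0..T}" "q \<in> {0..T}" using that q by auto
    then have "is_wiener_integral M W r \<sigma> (Z r)" "is_wiener_integral M W q \<sigma> (Z q)"
      using Z unfolding wiener_noise_def by blast+
    then show ?thesis
      unfolding \<mu>_def using that q(1) \<xi> by (intro wiener_integral_outer_orthogonal[OF _ _ \<sigma>(1,2)]) auto
  qed
  have T: "T \<in> {0..T}" using T_nonneg by simp
  \<comment> \<open>\<open>\<mu> q\<close> is frozen in the first term: nothing is known about the
    regularity of \<open>\<mu>\<close> before \<open>q\<close>, whereas
    \<open>\<Theta> r ** \<mu> q\<close> is absolutely continuous throughout. From \<open>q\<close>
    on this is the moment of \<open>noise Z r\<close>.\<close>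
  have "primitive_on 0 T (\<lambda>r. - (\<Theta> r ** A r) ** \<mu> q + (\<Theta> r ** A r) ** \<mu> r)
      (\<lambda>r. \<Theta> r ** \<mu> q + (0 + (LBINT s:{0..r}. (\<Theta> s ** A s) ** \<mu> s)))"
    by (intro primitive_on_add primitive_on_linear[OF \<Theta>_T mm.bounded_linear_left]
        primitive_on_set_integral int[OF T])
  from primitive_on_subinterval[OF this, of q T] q
  have p: "primitive_on q T (\<lambda>r. - (\<Theta> r ** A r) ** \<mu> q + (\<Theta> r ** A r) ** \<mu> r)
      (\<lambda>r. \<Theta> r ** \<mu> q + (0 + (LBINT s:{0..r}. (\<Theta> s ** A s) ** \<mu> s)))"
    by simp
  have "\<Theta> t ** \<mu> q + (0 + (LBINT s:{0..t}. (\<Theta> s ** A s) ** \<mu> s)) =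
      \<Theta> q ** \<mu> q + (0 + (LBINT s:{0..q}. (\<Theta> s ** A s) ** \<mu> s))"
  proof (rule primitive_on_zero_AE[OF p])
    show "AE r in lborel. r \<in> {q..T} \<longrightarrow> - (\<Theta> r ** A r) ** \<mu> q + (\<Theta> r ** A r) ** \<mu> r = 0"
    proof (intro AE_I2 impI)
      fix r assume "r \<in> {q..T}"
      then show "- (\<Theta> r ** A r) ** \<mu> q + (\<Theta> r ** A r) ** \<mu> r = 0"
        unfolding \<mu>[OF \<open>r \<in> {q..T}\<close>] by (simp only: mm.minus_left left_minus)
    qed
  qed (use q in auto)
  moreover have "t \<in> {0..T}" "q \<in> {0..T}" "\<mu> t = \<mu> q" using q \<mu>[of t] by auto
  ultimately show ?thesis
    by (simp only: formula add_0_left)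
qed

lemma uniform_l2_shift:
  assumes "uniform_l2_process M T V"
  shows "uniform_l2_process M (T - h) (\<lambda>t. V (t + h))"
proof -
  obtain D where "D < \<infinity>" "\<And>t. t \<in> {0..T} \<Longrightarrow> (\<integral>\<^sup>+\<omega>. ennreal ((norm (V t \<omega>))\<^sup>2) \<partial>M) \<le> D" "joint_measurable M V"
    using assms by (auto simp: uniform_l2_process_def)
  moreover have "t + h \<in> {0..T}" if "t \<in> {0..T - h}" for t using that times by auto
  ultimately show ?thesis
    using joint_measurable_shift[of M V h] unfolding uniform_l2_process_def by metis
qed

lemma uniform_l2_mono:
  assumes "uniform_l2_process M T V" "T' \<le> T"
  shows "uniform_l2_process M T' V"
proof -
  obtain D where D: "D < \<infinity>" "\<And>t. t \<in> {0..T} \<Longrightarrow> (\<integral>\<^sup>+\<omega>. ennreal ((norm (V t \<omega>))\<^sup>2) \<partial>M) \<le> D" "joint_measurable M V"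
    using assms by (auto simp: uniform_l2_process_def)
  have "\<forall>t\<in>{0..T'}. (\<integral>\<^sup>+\<omega>. ennreal ((norm (V t \<omega>))\<^sup>2) \<partial>M) \<le> D"
    using D(2) assms(2) by auto
  with D(1,3) show ?thesis
    unfolding uniform_l2_process_def by blast
qed

text \<open>Wiener integrals agree almost surely at each rational time, and continuity carries this
  to all times outside one null set. This is why the noise does not depend on the control.\<close>

lemma wiener_noise_unique:
  assumes Z: "wiener_noise Z" and Z': "wiener_noise Z'"
  shows "AE \<omega> in M. \<forall>t\<in>{0..T}. Z t \<omega> = Z' t \<omega>"
proof -
  define I where "I = {0..T} \<inter> \<rat>"
  have "countable I" unfolding I_def using countable_rat by blast
  have "AE \<omega> in M. \<forall>t\<in>I. Z t \<omega> = Z' t \<omega>"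
    unfolding AE_ball_countable[OF \<open>countable I\<close>]
  proof
    fix t assume "t \<in> I"
    then show "AE \<omega> in M. Z t \<omega> = Z' t \<omega>"
      using Z Z' unfolding I_def wiener_noise_def
      by (intro wiener_integral_unique[OF _ _ \<sigma>(1)]) auto
  qed
  with Z[unfolded wiener_noise_def, THEN conjunct2, THEN conjunct2] Z'[unfolded wiener_noise_def, THEN conjunct2, THEN conjunct2]
  show ?thesis
  proof eventually_elim
    case (elim \<omega>)
    show ?case
    proof
      fix t assume t: "t \<in> {0..T}"
      \<comment> \<open>The open interval is taken because intersecting an open set with a dense one
        does not change its closure.\<close>
      have cl: "closure ({0<..<T} \<inter> \<rat>) = {0..T}"
      proof -
        have "closure ({0<..<T} \<inter> \<rat>) = closure ({0<..<T} :: real set)"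
          by (rule closure_open_Int_superset) (simp_all add: Rats_closure_real)
        then show ?thesis using times by simp
      qed
      have "Z t \<omega> - Z' t \<omega> = 0"
      proof (rule continuous_constant_on_closure[of "{0<..<T} \<inter> \<rat>"])
        show "continuous_on (closure ({0<..<T} \<inter> \<rat>)) (\<lambda>t. Z t \<omega> - Z' t \<omega>)"
          unfolding cl using elim by (intro continuous_on_diff) auto
        show "t \<in> closure ({0<..<T} \<inter> \<rat>)" unfolding cl by (rule t)
        show "Z s \<omega> - Z' s \<omega> = 0" if "s \<in> {0<..<T} \<inter> \<rat>" for s
          using elim that by (auto simp: I_def)
      qed
      then show "Z t \<omega> = Z' t \<omega>" by simp
    qed
  qed
qed

lemma joint_measurable_artstein:
  assumes U: "measurable_process N T U" "\<And>s \<omega>. s \<in> {-h..<0} \<Longrightarrow> U s \<omega> = 0"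
    and X: "measurable_process N T X" and N: "sigma_finite_measure N"
  shows "measurable_process N T (artstein T h A0 B0 U X)"
proof -
  have "joint_measurable N (\<lambda>t \<omega>. truncate_time T X t \<omega> + \<Phi> t *v (LBINT s:{t-h..t}. \<beta> s *v truncate_time T U s \<omega>))"
    by (intro joint_measurable_add joint_measurable_matrix joint_measurable_integral_between N
        joint_measurable_truncate U X T_nonneg) measurable
  then show ?thesis
  proof (rule measurable_process_joint)
    fix t \<omega> assume t: "t \<in> {0..T}" and "\<omega> \<in> space N"
    have "(\<lambda>s. truncate_time T U s \<omega>) \<in> borel_measurable borel"
      by (rule joint_measurable_path[OF joint_measurable_truncate[OF U(1) T_nonneg] \<open>\<omega> \<in> space N\<close>])
    from artstein_eq[OF U(2) this t, of X] t
    show "truncate_time T X t \<omega> + \<Phi> t *v (LBINT s:{t-h..t}. \<beta> s *v truncate_time T U s \<omega>) =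
      artstein T h A0 B0 U X t \<omega>"
      by (simp add: truncate_time_def[of T X])
  qed
qed

lemma artstein_formula:
  assumes U: "measurable_process M T U" "\<And>s \<omega>. s \<in> {-h..<0} \<Longrightarrow> U s \<omega> = 0" "l2_process M T (truncate_time T U)"
    and X: "AE \<omega> in M. \<forall>t\<in>{0..T}. X t \<omega> = \<Phi> t *v (noise Z t \<omega> + control U (t - h) \<omega>)"
  shows "AE \<omega> in M. \<forall>t\<in>{0..T}. artstein T h A0 B0 U X t \<omega> = \<Phi> t *v (noise Z t \<omega> + control U t \<omega>)"
  using X control_path_integrable[OF U(3)] AE_space
proof eventually_elim
  case (elim \<omega>)
  show ?case
  proof
    fix t assume t: "t \<in> {0..T}"
    have "(\<lambda>s. truncate_time T U s \<omega>) \<in> borel_measurable borel"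
      by (rule joint_measurable_path[OF joint_measurable_truncate[OF U(1) T_nonneg] elim(3)])
    from artstein_eq[OF U(2) this t, of X]
    have "artstein T h A0 B0 U X t \<omega> = X t \<omega> + \<Phi> t *v (control U t \<omega> - control U (t - h) \<omega>)"
      unfolding control_def
      by (subst control_path_diff[symmetric, OF elim(2) _ t]) (auto simp: truncate_time_def)
    then show "artstein T h A0 B0 U X t \<omega> = \<Phi> t *v (noise Z t \<omega> + control U t \<omega>)"
      using elim(1) t by (simp add: mv.add_right mv.diff_right)
  qed
qed

lemma B_bar_measurable: "set_borel_measurable lborel {0..T} (B_bar T h A0 B0)"
proof -
  have [measurable]: "(\<lambda>s. indicator {0..T + h} (s + h) *\<^sub>R B0 (s + h)) \<in> borel_measurable borel"
    using measurable_compose[of "\<lambda>s. s + h" borel borel, OF _ B(4)[unfolded set_borel_measurable_def]] by simp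
  have eq: "indicator {0..T} s *\<^sub>R B_bar T h A0 B0 s =
     indicator {0..T} s *\<^sub>R (\<Phi> s ** \<Theta> (s + h) ** (indicator {0..T + h} (s + h) *\<^sub>R B0 (s + h)))" for s
  proof (cases "s \<in> {0..T}")
    case True
    then have "s \<in> {0..T + h}" "s + h \<in> {0..T + h}" using times by auto
    then show ?thesis by (simp add: B_bar_def fundamental_matrix)
  qed simp
  show ?thesis
    unfolding set_borel_measurable_def eq by measurable
qed

text \<open>The transform replaces the delayed control path by the undelayed one, so
  \<open>solves_sdeI\<close> applies with input \<open>control U\<close>; multiplied by
  \<open>\<Phi>\<close>, its density is \<open>B_bar\<close> applied to the control.\<close>

proposition artstein_solves_sde:
  assumes Z: "wiener_noise Z" and U: "measurable_process M T U" "\<And>s \<omega>. s \<in> {-h..<0} \<Longrightarrow> U s \<omega> = 0"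
    "l2_process M T (truncate_time T U)" and X: "measurable_process M T X"
    and XZ: "AE \<omega> in M. \<forall>t\<in>{0..T}. X t \<omega> = \<Phi> t *v (noise Z t \<omega> + control U (t - h) \<omega>)"
  shows "solves_sde M W T (\<lambda>t \<omega>. A0 t *v artstein T h A0 B0 U X t \<omega> + B_bar T h A0 B0 t *v U t \<omega>) \<sigma>0
            (artstein T h A0 B0 U X)"
proof -
  define Y where "Y = artstein T h A0 B0 U X"
  define b where "b = (\<lambda>t \<omega>. A0 t *v Y t \<omega> + B_bar T h A0 B0 t *v U t \<omega>)"
  have Ym: "measurable_process M T Y"
    unfolding Y_def by (rule joint_measurable_artstein[OF U(1,2) X]) unfold_locales
  note j = joint_measurable_truncate[OF Ym T_nonneg] joint_measurable_truncate[OF U(1) T_nonneg]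
  define b' where "b' = (\<lambda>t \<omega>. A t *v truncate_time T Y t \<omega> + (\<Phi> t ** \<beta> t) *v truncate_time T U t \<omega>)"
  have jb': "joint_measurable M b'"
    unfolding b'_def by (intro joint_measurable_add joint_measurable_matrix j A(1)) measurable
  have bm: "set_borel_measurable lborel {0..t} (\<lambda>s. b s \<omega>)" and
    be: "AE s in lborel. s \<in> {0..t} \<longrightarrow> b s \<omega> = A s *v Y s \<omega> + \<Phi> s *v (\<beta> s *v truncate_time T U s \<omega>)" and
    bI: "(LBINT s=ereal 0..ereal t. b s \<omega>) = (LBINT s:{0..t}. b' s \<omega>)"
    if \<omega>: "\<omega> \<in> space M" and t: "t \<in> {0..T}" for t \<omega>
  proof -
    note [measurable] = joint_measurable_path[OF j(1) \<omega>] joint_measurable_path[OF j(2) \<omega>]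
      joint_measurable_path[OF jb' \<omega>]
    have [measurable]: "(\<lambda>s. indicator {0..T + h} s *\<^sub>R A0 s) \<in> borel_measurable borel"
      "(\<lambda>s. indicator {0..T} s *\<^sub>R B_bar T h A0 B0 s) \<in> borel_measurable borel"
      using A(4) B_bar_measurable by (simp_all add: set_borel_measurable_def)
    have eq: "indicator {0..t} s *\<^sub>R b s \<omega> = indicator {0..t} s *\<^sub>R
       ((indicator {0..T + h} s *\<^sub>R A0 s) *v truncate_time T Y s \<omega> +
        (indicator {0..T} s *\<^sub>R B_bar T h A0 B0 s) *v truncate_time T U s \<omega>)" for s
      using t times by (cases "s \<in> {0..t}") (auto simp: b_def truncate_time_def)
    show m: "set_borel_measurable lborel {0..t} (\<lambda>s. b s \<omega>)"
      unfolding set_borel_measurable_def eq by measurable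
    show e: "AE s in lborel. s \<in> {0..t} \<longrightarrow> b s \<omega> = A s *v Y s \<omega> + \<Phi> s *v (\<beta> s *v truncate_time T U s \<omega>)"
      using A(3) B_bar_eq
    proof eventually_elim
      case (elim s)
      show ?case
      proof
        assume "s \<in> {0..t}"
        then have "s \<in> {0..T}" "s \<in> {0..T + h}" using t times by auto
        then show "b s \<omega> = A s *v Y s \<omega> + \<Phi> s *v (\<beta> s *v truncate_time T U s \<omega>)"
          using elim by (simp add: b_def truncate_time_def matrix_vector_mul_assoc)
      qed
    qed
    have m': "set_borel_measurable lborel {0..t} (\<lambda>s. b' s \<omega>)"
      unfolding set_borel_measurable_def by measurable
    have "AE s in lborel. s \<in> {0..t} \<longrightarrow> b s \<omega> = b' s \<omega>"
      using e by eventually_elim (use t in \<open>auto simp: b'_def truncate_time_def matrix_vector_mul_assoc\<close>)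
    from set_integral_cong_AE_Icc(1)[OF m m' this]
    show "(LBINT s=ereal 0..ereal t. b s \<omega>) = (LBINT s:{0..t}. b' s \<omega>)"
      using t by (simp add: interval_integral_Icc)
  qed
  have T: "T \<in> {0..T}" using T_nonneg by simp
  have af: "AE \<omega> in M. \<forall>t\<in>{0..T}. Y t \<omega> = \<Phi> t *v (noise Z t \<omega> + control U t \<omega>)"
    unfolding Y_def by (rule artstein_formula[OF U(1) _ U(3) XZ]) (rule U(2))
  have "solves_sde M W T b \<sigma>0 Y"
  proof (rule solves_sdeI[OF Z Ym])
    fix t assume t: "t \<in> {0..T}"
    have "joint_measurable M (\<lambda>t \<omega>. LBINT s:{0..t}. b' s \<omega>)"
      by (rule joint_measurable_integral[OF _ jb']) unfold_locales
    from joint_measurable_section[OF this, of t]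
    show "(\<lambda>\<omega>. LBINT s=ereal 0..ereal t. b s \<omega>) \<in> borel_measurable M"
      using bI[OF _ t] by (simp cong: measurable_cong)
  next
    show "AE \<omega> in M. primitive_on 0 T ((\<lambda>\<omega> s. \<beta> s *v truncate_time T U s \<omega>) \<omega>)
        ((\<lambda>\<omega> t. control U t \<omega>) \<omega>) \<and> (\<lambda>\<omega> t. control U t \<omega>) \<omega> 0 = 0 \<and>
      (\<forall>t\<in>{0..T}. Y t \<omega> = \<Phi> t *v (noise_path (\<lambda>s. Z s \<omega>) t + (\<lambda>\<omega> t. control U t \<omega>) \<omega> t)) \<and>
      set_borel_measurable lborel {0..T} (\<lambda>s. b s \<omega>) \<and>
      (AE s in lborel. s \<in> {0..T} \<longrightarrow> b s \<omega> = A s *v Y s \<omega> + \<Phi> s *v (\<lambda>\<omega> s. \<beta> s *v truncate_time T U s \<omega>) \<omega> s)"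
      using af control_path_integrable[OF U(3)] AE_space
    proof eventually_elim
      case (elim \<omega>)
      have "primitive_on 0 T (\<lambda>s. \<beta> s *v truncate_time T U s \<omega>) (\<lambda>t. control U t \<omega>)"
        unfolding control_def
        by (rule control_path_primitive_0[OF elim(2)]) (auto simp: truncate_time_def)
      moreover have "control U 0 \<omega> = 0"
        unfolding control_def by (rule control_path_nonpos) simp
      ultimately show ?case
        using elim(1) bm[OF elim(3) T] be[OF elim(3) T] by (simp add: noise_def)
    qed
  qed
  then show ?thesis unfolding b_def Y_def .
qed

end

lemma set_integral_shift:
  fixes f :: "real \<Rightarrow> 'a::euclidean_space"
  shows "(LBINT t:{h..b}. f t) = (LBINT t:{0..b - h}. f (t + h))"
proof -
  have "indicator {h..b} (h + t) = (indicator {0..b - h} t :: real)" for t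
    by (auto simp: indicator_def)
  then show ?thesis
    using lborel_integral_real_affine[of 1 "\<lambda>t. indicator {h..b} t *\<^sub>R f t" h]
    by (simp add: set_lebesgue_integral_def add.commute)
qed

locale lq_system = delay_system M F W T h C A A0 B B0 \<sigma> \<sigma>0 \<Phi> \<Theta>
  for M :: "'w measure" and F :: "real \<Rightarrow> 'w measure" and W :: "real \<Rightarrow> 'w \<Rightarrow> real"
    and T h C :: real and A A0 :: "real \<Rightarrow> real^'n^'n" and B B0 :: "real \<Rightarrow> real^'m^'n"
    and \<sigma> \<sigma>0 :: "real \<Rightarrow> real^'n" and \<Phi> \<Theta> :: "real \<Rightarrow> real^'n^'n" +
  fixes Q Q0 :: "real \<Rightarrow> real^'n^'n" and R R0 :: "real \<Rightarrow> real^'m^'m" and G :: "real^'n^'n"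
  assumes Q: "Q \<in> borel_measurable borel" "\<And>t. norm (Q t) \<le> C" "\<And>t. Q t \<in> psd_matrices"
      "AE t in lborel. t \<in> {0..T} \<longrightarrow> Q t = Q0 t" "set_borel_measurable borel {0..T} Q0"
    and R: "R \<in> borel_measurable borel" "\<And>t. norm (R t) \<le> C" "\<And>t. R t \<in> pd_matrices"
      "AE t in lborel. t \<in> {0..T} \<longrightarrow> R t = R0 t" "set_borel_measurable borel {0..T} R0"
    and G: "G \<in> psd_matrices"
begin

text \<open>Weight of the state at time \<open>t + h\<close> in the coordinates
  \<open>\<Theta> X\<close>, indexed by \<open>t\<close> because that state contains the control
  path at time \<open>t\<close>. Conjugation with \<open>\<Theta> t\<close> gives back
  \<open>Q_bar\<close> for almost every \<open>t\<close> in \<open>[0, T - h]\<close>.\<close>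

definition Q_tilde :: "real \<Rightarrow> real^'n^'n" where
  "Q_tilde t = transpose (\<Phi> (t + h)) ** Q (t + h) ** \<Phi> (t + h)"

definition G_tilde :: "real^'n^'n" where
  "G_tilde = transpose (\<Phi> T) ** G ** \<Phi> T"

definition S :: "real \<Rightarrow> real^'n^'n" where
  "S t = \<beta> t ** matrix_inv (R t) ** transpose (\<beta> t)"

lemmas [measurable] = Q(1) R(1)

lemma Q_tilde_psd: "Q_tilde t \<in> psd_matrices"
  unfolding Q_tilde_def by (rule psd_matrices_congruence[OF Q(3)])

lemma G_tilde_psd: "G_tilde \<in> psd_matrices"
  unfolding G_tilde_def by (rule psd_matrices_congruence[OF G])

lemma S_psd: "S t \<in> psd_matrices"
  using psd_matrices_congruence[OF pd_matrix_invertible(4)[OF R(3)[of t]], of "transpose (\<beta> t)"]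
  by (simp add: S_def)

lemma Q_tilde_measurable [measurable]: "Q_tilde \<in> borel_measurable borel"
  unfolding Q_tilde_def by measurable

lemma R_inv_measurable [measurable]: "(\<lambda>t. matrix_inv (R t)) \<in> borel_measurable borel"
  by (rule borel_measurable_matrix_inv[OF R(1)]) (rule pd_matrix_invertible(2)[OF R(3)])

lemma S_measurable [measurable]: "S \<in> borel_measurable borel"
  unfolding S_def by measurable

lemma Q_tilde_bounded: obtains E where "\<And>t. norm (Q_tilde t) \<le> E"
proof -
  obtain K where K: "\<And>X::real^'n^'n. norm (transpose X) \<le> norm X * K" "0 \<le> K"
    using bounded_linear.nonneg_bounded[OF bounded_linear_transpose] by blast
  have "norm (transpose (\<Phi> t)) \<le> C * K" for t
    using K \<Phi>(3)[of t] by (meson mult_right_mono order_trans)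
  from matrix_bound_mult[of "\<lambda>t. transpose (\<Phi> t)" "C * K" Q C, OF this Q(2)]
  obtain E where E: "\<And>s t. norm (transpose (\<Phi> s) ** Q t) \<le> E" by blast
  have "norm (transpose (\<Phi> (t + h)) ** Q (t + h)) \<le> E" for t by (rule E)
  from matrix_bound_mult[of "\<lambda>t. transpose (\<Phi> (t + h)) ** Q (t + h)" E \<Phi> C, OF this \<Phi>(3)]
  obtain E' where "\<And>s t. norm (transpose (\<Phi> (s + h)) ** Q (s + h) ** \<Phi> t) \<le> E'" by blast
  then show ?thesis by (intro that[of E']) (simp add: Q_tilde_def)
qed

subsection \<open>The Riccati equation in the new coordinates\<close>

lemma flow_cancel:
  "X ** \<Phi> t ** \<Theta> t = X" "Y ** \<Theta> t ** \<Phi> t = Y"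
  "Y ** transpose (\<Phi> t) ** transpose (\<Theta> t) = Y" "X ** transpose (\<Theta> t) ** transpose (\<Phi> t) = X"
  "transpose (\<Phi> t) ** transpose (\<Theta> t) = mat 1" "transpose (\<Theta> t) ** transpose (\<Phi> t) = mat 1"
  by (simp_all add: matrix_mul_assoc[symmetric] inverse matrix_transpose_mul[symmetric] transpose_mat)

abbreviation riccati_rhs :: "real \<Rightarrow> real^'n^'n \<Rightarrow> real^'n^'n" where
  "riccati_rhs t p \<equiv> - (transpose (A0 t) ** p) - p ** A0 t - Q_bar T h A0 Q0 t +
       p ** B_bar T h A0 B0 t ** matrix_inv (R0 t) ** transpose (B_bar T h A0 B0 t) ** p"

lemma Q_bar_eq:
  "t \<in> {0..T - h} \<Longrightarrow> Q_bar T h A0 Q0 t =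
    transpose (\<Theta> t) ** (transpose (\<Phi> (t + h)) ** Q0 (t + h) ** \<Phi> (t + h)) ** \<Theta> t"
  using times by (simp add: Q_bar_def fundamental_matrix matrix_transpose_mul matrix_mul_assoc)

lemma riccati_rhs_AE:
  "AE t in lborel. t \<in> {0..T - h} \<longrightarrow> (\<forall>p. riccati_rhs t p =
    - (transpose (A t) ** p) - p ** A t - transpose (\<Theta> t) ** Q_tilde t ** \<Theta> t +
    p ** \<Phi> t ** S t ** transpose (\<Phi> t) ** p)"
proof -
  have "AE t in lborel. t \<in> {0 + h..(T - h) + h} \<longrightarrow> Q t = Q0 t"
    using Q(4) by eventually_elim (use times in auto)
  from AE_shift[OF this] A(3) B_bar_eq R(4) show ?thesis
  proof eventually_elim
    case (elim t)
    show ?case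
    proof (intro impI allI)
      fix p assume t: "t \<in> {0..T - h}"
      then have "t \<in> {0..T + h}" "t \<in> {0..T}" using times by auto
      with elim t have e: "Q (t + h) = Q0 (t + h)" "A t = A0 t" "B_bar T h A0 B0 t = \<Phi> t ** \<beta> t" "R t = R0 t"
        by blast+
      show "riccati_rhs t p = - (transpose (A t) ** p) - p ** A t - transpose (\<Theta> t) ** Q_tilde t ** \<Theta> t +
        p ** \<Phi> t ** S t ** transpose (\<Phi> t) ** p"
        unfolding Q_bar_eq[OF t] e(3) Q_tilde_def S_def e(1) e(2) e(4)
        by (simp add: matrix_transpose_mul matrix_mul_assoc)
    qed
  qed
qed

text \<open>Conjugation with the flow removes the linear terms: the densities of
  \<open>\<Phi>\<close> and of its transpose contribute \<open>A\<close> on the right and its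
  transpose on the left, which cancels them and leaves the purely quadratic equation.\<close>

lemma riccati_to_tilde:
  assumes "riccati_solution T h A0 B0 Q0 G R0 P"
  defines "P' \<equiv> \<lambda>t. transpose (\<Phi> t) ** P t ** \<Phi> t"
  shows "primitive_on 0 (T - h) (\<lambda>t. P' t ** S t ** P' t - Q_tilde t) P'" "P' (T - h) = G_tilde"
proof -
  have Th: "0 \<le> T - h" using times by simp
  have P: "primitive_on 0 (T - h) (\<lambda>t. riccati_rhs t (P t)) P" and PT: "P (T - h) = G_bar T h A0 G"
    using assms(1) by (simp_all add: riccati_solution_def caratheodory_solution_iff_primitive_on[OF Th])
  have \<Phi>1: "primitive_on 0 (T - h) (\<lambda>r. A r ** \<Phi> r) \<Phi>"
    using primitive_on_subinterval[OF \<Phi>_T, of 0 "T - h"] times by simp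
  have d: "primitive_on 0 (T - h) (\<lambda>t. (transpose (A t ** \<Phi> t) ** P t + transpose (\<Phi> t) ** riccati_rhs t (P t)) ** \<Phi> t +
      (transpose (\<Phi> t) ** P t) ** (A t ** \<Phi> t)) P'"
    unfolding P'_def
    by (intro primitive_on_product[OF bounded_bilinear_matrix_mult] P \<Phi>1
        primitive_on_linear[OF \<Phi>1 bounded_linear_transpose])
  show "primitive_on 0 (T - h) (\<lambda>t. P' t ** S t ** P' t - Q_tilde t) P'"
  proof (rule primitive_on_cong_AE[OF d])
    have [measurable]: "(\<lambda>t. indicator {0..T - h} t *\<^sub>R P' t) \<in> borel_measurable borel"
      using continuous_on_set_borel_measurable[OF primitive_on_continuous[OF d]]
      by (simp add: set_borel_measurable_def)
    have e: "indicator {0..T - h} t *\<^sub>R (P' t ** S t ** P' t - Q_tilde t) =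
      (indicator {0..T - h} t *\<^sub>R P' t) ** S t ** (indicator {0..T - h} t *\<^sub>R P' t) - indicator {0..T - h} t *\<^sub>R Q_tilde t" for t
      by (simp add: indicator_def mm.zero_left)
    show "set_borel_measurable lborel {0..T - h} (\<lambda>t. P' t ** S t ** P' t - Q_tilde t)"
      unfolding set_borel_measurable_def e by measurable
    show "AE t in lborel. t \<in> {0..T - h} \<longrightarrow> (transpose (A t ** \<Phi> t) ** P t + transpose (\<Phi> t) ** riccati_rhs t (P t)) ** \<Phi> t +
      (transpose (\<Phi> t) ** P t) ** (A t ** \<Phi> t) = P' t ** S t ** P' t - Q_tilde t"
      using riccati_rhs_AE
    proof eventually_elim
      case (elim t)
      show ?case
      proof
        assume "t \<in> {0..T - h}"
        with elim have e: "riccati_rhs t (P t) = - (transpose (A t) ** P t) - P t ** A t - transpose (\<Theta> t) ** Q_tilde t ** \<Theta> t +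
          P t ** \<Phi> t ** S t ** transpose (\<Phi> t) ** P t" by blast
        show "(transpose (A t ** \<Phi> t) ** P t + transpose (\<Phi> t) ** riccati_rhs t (P t)) ** \<Phi> t +
          (transpose (\<Phi> t) ** P t) ** (A t ** \<Phi> t) = P' t ** S t ** P' t - Q_tilde t"
          unfolding e
          by (simp add: P'_def mm.add_left mm.add_right mm.diff_left mm.diff_right mm.minus_left mm.minus_right
              matrix_transpose_mul matrix_mul_assoc flow_cancel)
      qed
    qed
  qed
  \<comment> \<open>\<open>G_bar\<close> is built from the flow between \<open>T - h\<close> and
    \<open>T\<close>, so the factors at \<open>T - h\<close> cancel and only \<open>\<Phi> T\<close>
    is left.\<close>
  have "fundamental_matrix (T + h) A0 T (T - h) = \<Phi> T ** \<Theta> (T - h)"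
    using times by (subst fundamental_matrix) auto
  then show "P' (T - h) = G_tilde"
    by (simp add: P'_def PT G_bar_def G_tilde_def matrix_transpose_mul matrix_mul_assoc flow_cancel)
qed

text \<open>The reverse conjugation. To qualify as a solution, the right-hand side formed with the
  given coefficients must itself be measurable; the assumption on \<open>R0\<close> provides this
  for the inverse.\<close>

lemma riccati_from_tilde:
  assumes P': "primitive_on 0 (T - h) (\<lambda>t. P' t ** S t ** P' t - Q_tilde t) P'" "P' (T - h) = G_tilde"
    and R0: "set_borel_measurable borel {0..T} (\<lambda>t. matrix_inv (R0 t))"
  shows "riccati_solution T h A0 B0 Q0 G R0 (\<lambda>t. transpose (\<Theta> t) ** P' t ** \<Theta> t)"
proof -
  have Th: "0 \<le> T - h" using times by simp
  define P where "P = (\<lambda>t. transpose (\<Theta> t) ** P' t ** \<Theta> t)"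
  have \<Theta>1: "primitive_on 0 (T - h) (\<lambda>r. - (\<Theta> r ** A r)) \<Theta>"
    using primitive_on_subinterval[OF \<Theta>_T, of 0 "T - h"] times by simp
  have d: "primitive_on 0 (T - h) (\<lambda>t. (transpose (- (\<Theta> t ** A t)) ** P' t + transpose (\<Theta> t) ** (P' t ** S t ** P' t - Q_tilde t)) ** \<Theta> t +
      (transpose (\<Theta> t) ** P' t) ** (- (\<Theta> t ** A t))) P"
    unfolding P_def
    by (intro primitive_on_product[OF bounded_bilinear_matrix_mult] P' \<Theta>1
        primitive_on_linear[OF \<Theta>1 bounded_linear_transpose])
  have "primitive_on 0 (T - h) (\<lambda>t. riccati_rhs t (P t)) P"
  proof (rule primitive_on_cong_AE[OF d])
    let ?I = "\<lambda>t. indicator {0..T - h} t :: real"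
    have sub: "set_borel_measurable borel {0..T - h} f \<Longrightarrow> (\<lambda>t. ?I t *\<^sub>R f t) \<in> borel_measurable borel"
      for f :: "real \<Rightarrow> real^'k^'l"
      by (simp add: set_borel_measurable_def)
    have [measurable]: "(\<lambda>t. ?I t *\<^sub>R P t) \<in> borel_measurable borel"
      using continuous_on_set_borel_measurable[OF primitive_on_continuous[OF d]]
      by (simp add: set_borel_measurable_def)
    have [measurable]: "(\<lambda>t. ?I t *\<^sub>R A0 t) \<in> borel_measurable borel"
      by (intro sub set_borel_measurable_subset[OF A(4)]) (use times in auto)
    have [measurable]: "(\<lambda>t. ?I t *\<^sub>R matrix_inv (R0 t)) \<in> borel_measurable borel"
      by (intro sub set_borel_measurable_subset[OF R0]) (use times in auto)
    have Bm: "set_borel_measurable borel {0..T} (B_bar T h A0 B0)"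
      using B_bar_measurable by (simp add: set_borel_measurable_def)
    have [measurable]: "(\<lambda>t. ?I t *\<^sub>R B_bar T h A0 B0 t) \<in> borel_measurable borel"
      by (intro sub set_borel_measurable_subset[OF Bm]) (use times in auto)
    have [measurable]: "(\<lambda>t. indicator {0..T} (t + h) *\<^sub>R Q0 (t + h)) \<in> borel_measurable borel"
      using measurable_compose[of "\<lambda>s. s + h" borel borel, OF _ Q(5)[unfolded set_borel_measurable_def]] by simp
    have Qe: "?I t *\<^sub>R Q_bar T h A0 Q0 t = ?I t *\<^sub>R (transpose (\<Theta> t) ** (transpose (\<Phi> (t + h)) **
       (indicator {0..T} (t + h) *\<^sub>R Q0 (t + h)) ** \<Phi> (t + h)) ** \<Theta> t)" for t
      using times by (cases "t \<in> {0..T - h}") (auto simp: Q_bar_eq)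
    have [measurable]: "(\<lambda>t. ?I t *\<^sub>R Q_bar T h A0 Q0 t) \<in> borel_measurable borel"
      unfolding Qe by measurable
    have e: "?I t *\<^sub>R riccati_rhs t (P t) =
       - (transpose (?I t *\<^sub>R A0 t) ** (?I t *\<^sub>R P t)) - (?I t *\<^sub>R P t) ** (?I t *\<^sub>R A0 t) - ?I t *\<^sub>R Q_bar T h A0 Q0 t +
       (?I t *\<^sub>R P t) ** (?I t *\<^sub>R B_bar T h A0 B0 t) ** (?I t *\<^sub>R matrix_inv (R0 t)) **
       transpose (?I t *\<^sub>R B_bar T h A0 B0 t) ** (?I t *\<^sub>R P t)" for t
      by (simp add: indicator_def mm.zero_left mm.zero_right)
    show "set_borel_measurable lborel {0..T - h} (\<lambda>t. riccati_rhs t (P t))"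
      unfolding set_borel_measurable_def e by measurable
    show "AE t in lborel. t \<in> {0..T - h} \<longrightarrow> (transpose (- (\<Theta> t ** A t)) ** P' t + transpose (\<Theta> t) ** (P' t ** S t ** P' t - Q_tilde t)) ** \<Theta> t +
      (transpose (\<Theta> t) ** P' t) ** (- (\<Theta> t ** A t)) = riccati_rhs t (P t)"
      using riccati_rhs_AE
    proof eventually_elim
      case (elim t)
      show ?case
      proof
        assume "t \<in> {0..T - h}"
        with elim have e: "riccati_rhs t (P t) = - (transpose (A t) ** P t) - P t ** A t - transpose (\<Theta> t) ** Q_tilde t ** \<Theta> t +
          P t ** \<Phi> t ** S t ** transpose (\<Phi> t) ** P t" by blast
        show "(transpose (- (\<Theta> t ** A t)) ** P' t + transpose (\<Theta> t) ** (P' t ** S t ** P' t - Q_tilde t)) ** \<Theta> t +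
          (transpose (\<Theta> t) ** P' t) ** (- (\<Theta> t ** A t)) = riccati_rhs t (P t)"
          unfolding e
          by (simp add: P_def transpose_minus mm.add_left mm.add_right mm.diff_left mm.diff_right mm.minus_left mm.minus_right
              matrix_transpose_mul matrix_mul_assoc flow_cancel)
      qed
    qed
  qed
  moreover have "\<Phi> T ** \<Theta> (T - h) = fundamental_matrix (T + h) A0 T (T - h)"
    using times by (subst fundamental_matrix) auto
  then have "P (T - h) = G_bar T h A0 G"
    by (simp add: P_def P'(2) G_bar_def G_tilde_def matrix_transpose_mul matrix_mul_assoc flip: \<open>\<Phi> T ** \<Theta> (T - h) = _\<close>)
  ultimately show ?thesis
    by (simp add: P_def riccati_solution_def caratheodory_solution_iff_primitive_on[OF Th])
qed

subsection \<open>The cost in the new coordinates\<close>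

definition tilde_cost :: "(real \<Rightarrow> 'w \<Rightarrow> real^'n) \<Rightarrow> (real \<Rightarrow> 'w \<Rightarrow> real^'m) \<Rightarrow> real" where
  "tilde_cost x V = integral\<^sup>L (time_measure (T - h) \<Otimes>\<^sub>M M) (\<lambda>(t, \<omega>). x t \<omega> \<bullet> (Q_tilde t *v x t \<omega>)) +
     expectation (\<lambda>\<omega>. x (T - h) \<omega> \<bullet> (G_tilde *v x (T - h) \<omega>)) +
     integral\<^sup>L (time_measure (T - h) \<Otimes>\<^sub>M M) (\<lambda>(t, \<omega>). V t \<omega> \<bullet> (R t *v V t \<omega>))"

lemma joint_measurable_quadratic:
  fixes k :: "real \<Rightarrow> real^'k^'k"
  assumes "k \<in> borel_measurable borel" "joint_measurable N V"
  shows "joint_measurable N (\<lambda>t \<omega>. V t \<omega> \<bullet> (k t *v V t \<omega>))"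
  by (intro joint_measurable_bilinear[OF bounded_bilinear_inner] joint_measurable_matrix assms)

lemma weighted_path_integral_eq:
  fixes k k0 :: "real \<Rightarrow> real^'k^'k"
  assumes k: "k \<in> borel_measurable borel" "AE t in lborel. t \<in> {0..T} \<longrightarrow> k t = k0 t" "set_borel_measurable borel {0..T} k0"
    and V: "measurable_process M T V" and \<omega>: "\<omega> \<in> space M" and ab: "0 \<le> a" "a \<le> b" "b \<le> T"
  shows "(LBINT t=ereal a..ereal b. V t \<omega> \<bullet> (k0 t *v V t \<omega>)) =
    (LBINT t:{a..b}. truncate_time T V t \<omega> \<bullet> (k t *v truncate_time T V t \<omega>))"
proof -
  note jV = joint_measurable_truncate[OF V T_nonneg]
  note [measurable] = joint_measurable_path[OF jV \<omega>] k(1)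
  have [measurable]: "(\<lambda>t. indicator {0..T} t *\<^sub>R k0 t) \<in> borel_measurable borel"
    using k(3) by (simp add: set_borel_measurable_def)
  have e: "indicator {a..b} t *\<^sub>R (V t \<omega> \<bullet> (k0 t *v V t \<omega>)) = indicator {a..b} t *\<^sub>R
     (truncate_time T V t \<omega> \<bullet> ((indicator {0..T} t *\<^sub>R k0 t) *v truncate_time T V t \<omega>))" for t
    using ab by (cases "t \<in> {a..b}") (auto simp: truncate_time_def)
  have "(LBINT t:{a..b}. V t \<omega> \<bullet> (k0 t *v V t \<omega>)) =
    (LBINT t:{a..b}. truncate_time T V t \<omega> \<bullet> (k t *v truncate_time T V t \<omega>))"
  proof (rule set_integral_cong_AE_Icc)
    show "set_borel_measurable lborel {a..b} (\<lambda>t. V t \<omega> \<bullet> (k0 t *v V t \<omega>))"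
      unfolding set_borel_measurable_def e by measurable
    show "set_borel_measurable lborel {a..b} (\<lambda>t. truncate_time T V t \<omega> \<bullet> (k t *v truncate_time T V t \<omega>))"
      unfolding set_borel_measurable_def by measurable
    show "AE t in lborel. t \<in> {a..b} \<longrightarrow> V t \<omega> \<bullet> (k0 t *v V t \<omega>) = truncate_time T V t \<omega> \<bullet> (k t *v truncate_time T V t \<omega>)"
      using k(2) by eventually_elim (use ab in \<open>auto simp: truncate_time_def\<close>)
  qed
  then show ?thesis using ab by (simp add: interval_integral_Icc)
qed

lemma uniform_l2_control:
  assumes "l2_process M T (truncate_time T U)"
  shows "uniform_l2_process M T (control U)"
proof -
  obtain E where E: "\<And>t. norm (\<beta> t) \<le> E" by (rule \<beta>_bounded) blast
  show ?thesis
    unfolding control_eq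
    by (rule uniform_l2_process_integral[OF l2_process_matrix[OF \<beta>_measurable E assms] T_nonneg])
qed

text \<open>Shifting the running cost from \<open>[h, T]\<close> to \<open>[0, T - h]\<close> aligns
  the delayed control with the control cost. The control path \<open>k\<close> is a parameter, so
  that one formula serves \<open>U\<close> and a competitor written as a perturbation of
  \<open>U\<close>.\<close>

proposition cost_formula:
  assumes Z: "wiener_noise Z" and U: "measurable_process M T U" "l2_process M T (truncate_time T U)"
    and X: "measurable_process M T X" and k: "uniform_l2_process M (T - h) k"
    and XZ: "AE \<omega> in M. \<forall>t\<in>{0..T}. X t \<omega> = \<Phi> t *v (noise Z t \<omega> + k (t - h) \<omega>)"
  shows "cost M T h Q0 G R0 U X = tilde_cost (\<lambda>t \<omega>. noise Z (t + h) \<omega> + k t \<omega>) (truncate_time T U)"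
proof -
  let ?x = "\<lambda>t \<omega>. noise Z (t + h) \<omega> + k t \<omega>"
  obtain E where E: "\<And>t. norm (Q_tilde t) \<le> E" by (rule Q_tilde_bounded) blast
  have Th: "0 \<le> T - h" using times by simp
  have xu: "uniform_l2_process M (T - h) ?x"
    by (intro uniform_l2_process_add uniform_l2_shift[OF uniform_l2_noise[OF Z]] k)
  have U1: "l2_process M (T - h) (truncate_time T U)"
    by (rule l2_process_mono[OF U(2)]) (use times in auto)
  have jX: "joint_measurable M (truncate_time T X)" by (rule joint_measurable_truncate[OF X T_nonneg])
  have XT: "X T \<in> borel_measurable M"
    using joint_measurable_section[OF jX, of T] T_nonneg by (simp add: truncate_time_def[abs_def])
  note qi = integrable_quadratic_process[OF Q_tilde_measurable E uniform_l2_process_l2[OF xu] uniform_l2_process_l2[OF xu]]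
  note ri = integrable_quadratic_process[OF R(1,2) U1 U1]
  let ?Xq = "\<lambda>\<omega>. LBINT t:{h..T}. truncate_time T X t \<omega> \<bullet> (Q t *v truncate_time T X t \<omega>)"
  have Xq: "(LBINT t=ereal h..ereal T. X t \<omega> \<bullet> (Q0 t *v X t \<omega>)) = ?Xq \<omega>" if "\<omega> \<in> space M" for \<omega>
    using times by (intro weighted_path_integral_eq[OF Q(1,4,5) X that]) auto
  have Xqm: "?Xq \<in> borel_measurable M"
  proof -
    have "joint_measurable M (\<lambda>t \<omega>. LBINT t:{h..T}. truncate_time T X t \<omega> \<bullet> (Q t *v truncate_time T X t \<omega>))"
      by (rule joint_measurable_integral_between[OF _ joint_measurable_quadratic[OF Q(1) jX]]) (unfold_locales, auto)
    from joint_measurable_section[OF this] show ?thesis .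
  qed
  have AEx: "AE \<omega> in M. ?Xq \<omega> = (LBINT t:{0..T - h}. ?x t \<omega> \<bullet> (Q_tilde t *v ?x t \<omega>)) \<and>
     X T \<omega> \<bullet> (G *v X T \<omega>) = ?x (T - h) \<omega> \<bullet> (G_tilde *v ?x (T - h) \<omega>)"
    using XZ
  proof eventually_elim
    case (elim \<omega>)
    have conj: "(V *v v) \<bullet> (K *v (V *v v)) = v \<bullet> ((transpose V ** K ** V) *v v)" for V K :: "real^'n^'n" and v
      using matrix_inner_transpose[of v "transpose V" "K *v (V *v v)"]
      by (simp add: matrix_vector_mul_assoc matrix_mul_assoc)
    have "?Xq \<omega> = (LBINT t:{0..T - h}. truncate_time T X (t + h) \<omega> \<bullet> (Q (t + h) *v truncate_time T X (t + h) \<omega>))"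
      by (rule set_integral_shift)
    also have "\<dots> = (LBINT t:{0..T - h}. ?x t \<omega> \<bullet> (Q_tilde t *v ?x t \<omega>))"
    proof (rule set_lebesgue_integral_cong)
      show "\<forall>t. t \<in> {0..T - h} \<longrightarrow> truncate_time T X (t + h) \<omega> \<bullet> (Q (t + h) *v truncate_time T X (t + h) \<omega>) =
        ?x t \<omega> \<bullet> (Q_tilde t *v ?x t \<omega>)"
      proof (intro allI impI)
        fix t assume "t \<in> {0..T - h}"
        then have th: "t + h \<in> {0..T}" using times by auto
        then have "truncate_time T X (t + h) \<omega> = \<Phi> (t + h) *v ?x t \<omega>"
          using elim by (simp add: truncate_time_def)
        then show "truncate_time T X (t + h) \<omega> \<bullet> (Q (t + h) *v truncate_time T X (t + h) \<omega>) = ?x t \<omega> \<bullet> (Q_tilde t *v ?x t \<omega>)"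
          by (simp only: conj Q_tilde_def)
      qed
    qed simp
    finally have 1: "?Xq \<omega> = (LBINT t:{0..T - h}. ?x t \<omega> \<bullet> (Q_tilde t *v ?x t \<omega>))" .
    have "X T \<omega> = \<Phi> T *v ?x (T - h) \<omega>"
      using elim T_nonneg by simp
    then have "X T \<omega> \<bullet> (G *v X T \<omega>) = ?x (T - h) \<omega> \<bullet> (G_tilde *v ?x (T - h) \<omega>)"
      by (simp only: conj G_tilde_def)
    with 1 show ?case by blast
  qed
  have xT: "integrable M (\<lambda>\<omega>. ?x (T - h) \<omega> \<bullet> (G_tilde *v ?x (T - h) \<omega>))"
    by (intro integrable_bilinear_sq_integrable[OF bounded_bilinear_inner_matrix]
        uniform_l2_process_section[OF xu]) (use Th in auto)
  have "expectation (\<lambda>\<omega>. (LBINT t=ereal h..ereal T. X t \<omega> \<bullet> (Q0 t *v X t \<omega>)) + X T \<omega> \<bullet> (G *v X T \<omega>)) =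
      expectation (\<lambda>\<omega>. ?Xq \<omega> + X T \<omega> \<bullet> (G *v X T \<omega>))"
    by (intro Bochner_Integration.integral_cong refl) (simp only: Xq)
  also have "\<dots> = expectation (\<lambda>\<omega>. (LBINT t:{0..T - h}. ?x t \<omega> \<bullet> (Q_tilde t *v ?x t \<omega>)) +
      ?x (T - h) \<omega> \<bullet> (G_tilde *v ?x (T - h) \<omega>))"
  proof (rule integral_cong_AE)
    show "(\<lambda>\<omega>. ?Xq \<omega> + X T \<omega> \<bullet> (G *v X T \<omega>)) \<in> borel_measurable M"
      by (intro borel_measurable_add Xqm bounded_bilinear_borel_measurable[OF bounded_bilinear_inner_matrix] XT)
    show "(\<lambda>\<omega>. (LBINT t:{0..T - h}. ?x t \<omega> \<bullet> (Q_tilde t *v ?x t \<omega>)) + ?x (T - h) \<omega> \<bullet> (G_tilde *v ?x (T - h) \<omega>)) \<in> borel_measurable M"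
      by (intro borel_measurable_add borel_measurable_integrable[OF process_Fubini(6)[OF qi]] borel_measurable_integrable[OF xT])
    show "AE \<omega> in M. ?Xq \<omega> + X T \<omega> \<bullet> (G *v X T \<omega>) =
      (LBINT t:{0..T - h}. ?x t \<omega> \<bullet> (Q_tilde t *v ?x t \<omega>)) + ?x (T - h) \<omega> \<bullet> (G_tilde *v ?x (T - h) \<omega>)"
      using AEx by eventually_elim simp
  qed
  also have "\<dots> = expectation (\<lambda>\<omega>. LBINT t:{0..T - h}. ?x t \<omega> \<bullet> (Q_tilde t *v ?x t \<omega>)) +
      expectation (\<lambda>\<omega>. ?x (T - h) \<omega> \<bullet> (G_tilde *v ?x (T - h) \<omega>))"
    by (rule Bochner_Integration.integral_add[OF process_Fubini(6)[OF qi] xT])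
  also have "expectation (\<lambda>\<omega>. LBINT t:{0..T - h}. ?x t \<omega> \<bullet> (Q_tilde t *v ?x t \<omega>)) =
      integral\<^sup>L (time_measure (T - h) \<Otimes>\<^sub>M M) (\<lambda>(t, \<omega>). ?x t \<omega> \<bullet> (Q_tilde t *v ?x t \<omega>))"
    by (rule process_Fubini(2)[OF qi])
  finally have 1: "expectation (\<lambda>\<omega>. (LBINT t=ereal h..ereal T. X t \<omega> \<bullet> (Q0 t *v X t \<omega>)) + X T \<omega> \<bullet> (G *v X T \<omega>)) =
    integral\<^sup>L (time_measure (T - h) \<Otimes>\<^sub>M M) (\<lambda>(t, \<omega>). ?x t \<omega> \<bullet> (Q_tilde t *v ?x t \<omega>)) +
    expectation (\<lambda>\<omega>. ?x (T - h) \<omega> \<bullet> (G_tilde *v ?x (T - h) \<omega>))" .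
  have "expectation (\<lambda>\<omega>. LBINT t=ereal 0..ereal (T - h). U t \<omega> \<bullet> (R0 t *v U t \<omega>)) =
      expectation (\<lambda>\<omega>. LBINT t:{0..T - h}. truncate_time T U t \<omega> \<bullet> (R t *v truncate_time T U t \<omega>))"
    using times by (intro Bochner_Integration.integral_cong refl weighted_path_integral_eq[OF R(1,4,5) U(1)]) auto
  also have "\<dots> = integral\<^sup>L (time_measure (T - h) \<Otimes>\<^sub>M M) (\<lambda>(t, \<omega>). truncate_time T U t \<omega> \<bullet> (R t *v truncate_time T U t \<omega>))"
    by (rule process_Fubini(2)[OF ri])
  finally show ?thesis
    unfolding cost_def tilde_cost_def 1 by simp
qed

end

section \<open>Optimality and uniqueness of the feedback control\<close>

context lq_system
begin

lemma noise_cong: "(\<And>s. s \<in> {0..t} \<Longrightarrow> Z s \<omega> = Z' s \<omega>) \<Longrightarrow> 0 \<le> t \<Longrightarrow> noise Z t \<omega> = noise Z' t \<omega>"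
  unfolding noise_def noise_path_def
  by (intro arg_cong2[where f="(+)"] set_lebesgue_integral_cong) auto

lemma AE_time_product:
  assumes "AE w in time_measure b \<Otimes>\<^sub>M M. (case w of (t, \<omega>) \<Rightarrow> D t \<omega> = 0)" "joint_measurable M D"
  shows "AE w in lborel \<Otimes>\<^sub>M M. (case w of (t, \<omega>) \<Rightarrow> t \<in> {0..b} \<longrightarrow> D t \<omega> = 0)"
proof -
  interpret L: pair_sigma_finite "lborel :: real measure" M ..
  interpret P: pair_sigma_finite "time_measure b" M by (rule pair_sigma_finite_time)
  have "AE t in time_measure b. AE \<omega> in M. D t \<omega> = 0"
    using P.AE_pair[OF assms(1)] by simp
  then have ae: "AE t in lborel. AE \<omega> in M. t \<in> {0..b} \<longrightarrow> D t \<omega> = 0"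
    unfolding AE_time_measure by eventually_elim auto
  have [measurable]: "(\<lambda>w. D (fst w) (snd w)) \<in> borel_measurable (lborel \<Otimes>\<^sub>M M)"
    using joint_measurable_lborel[OF assms(2)] by (simp add: case_prod_unfold)
  have "{w \<in> space (lborel \<Otimes>\<^sub>M M). (0 \<le> fst w \<and> fst w \<le> b) \<longrightarrow> D (fst w) (snd w) = 0} \<in> sets (lborel \<Otimes>\<^sub>M M)"
    by measurable
  from L.AE_pair_measure[OF this] ae show ?thesis
    by (simp add: case_prod_unfold)
qed

text \<open>Every competitor is a perturbation of \<open>U\<close> by some \<open>D\<close>. By
  uniqueness of the noise both states are driven by the same \<open>Z\<close>, so only the control
  paths differ, and the comparison applies on \<open>[0, T - h]\<close> with the noise at
  \<open>t + h\<close> in the cost and at \<open>t\<close> in the feedback.\<close>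

proposition feedback_optimal:
  assumes P: "riccati_solution T h A0 B0 Q0 G R0 P" "\<And>t. t \<in> {0..T - h} \<Longrightarrow> transpose (P t) = P t"
    and adm: "admissible M F W T h A0 B0 \<sigma>0 U X" and fb: "feedback_law M T h A0 B0 R0 P U X"
  shows "optimal M F W T h A0 B0 \<sigma>0 Q0 G R0 U X"
    "optimal M F W T h A0 B0 \<sigma>0 Q0 G R0 U' X' \<Longrightarrow>
      AE (t, \<omega>) in lborel \<Otimes>\<^sub>M M. t \<in> {0..T - h} \<longrightarrow> U' t \<omega> = U t \<omega>"
    "solves_sde M W T (\<lambda>t \<omega>. A0 t *v artstein T h A0 B0 U X t \<omega> + B_bar T h A0 B0 t *v U t \<omega>) \<sigma>0
      (artstein T h A0 B0 U X)"
proof -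
  have Th: "0 \<le> T - h" using times by simp
  have U: "measurable_process M T U" "\<And>s \<omega>. s \<in> {-h..<0} \<Longrightarrow> U s \<omega> = 0" and X: "measurable_process M T X"
    and Ua: "adapted_on F T U"
    using adm by (auto simp: admissible_def L2_adapted_def solves_sde_def)
  note Ul = admissible_l2_process[OF adm]
  define Z where "Z = state_noise U X"
  have Z: "wiener_noise Z" unfolding Z_def by (rule admissible_state_formula(1)[OF adm])
  have XZ: "AE \<omega> in M. \<forall>t\<in>{0..T}. X t \<omega> = \<Phi> t *v (noise Z t \<omega> + control U (t - h) \<omega>)"
    using admissible_state_formula(2)[OF adm] by (simp add: Z_def noise_def control_def)
  show "solves_sde M W T (\<lambda>t \<omega>. A0 t *v artstein T h A0 B0 U X t \<omega> + B_bar T h A0 B0 t *v U t \<omega>) \<sigma>0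
      (artstein T h A0 B0 U X)"
    by (rule artstein_solves_sde[OF Z U(1) _ Ul X XZ]) (rule U(2))
  define P' where "P' = (\<lambda>t. transpose (\<Phi> t) ** P t ** \<Phi> t)"
  have P': "primitive_on 0 (T - h) (\<lambda>t. P' t ** (\<beta> t ** matrix_inv (R t) ** transpose (\<beta> t)) ** P' t - Q_tilde t) P'"
    "P' (T - h) = G_tilde" "\<And>t. t \<in> {0..T - h} \<Longrightarrow> transpose (P' t) = P' t"
    using riccati_to_tilde[OF P(1)] P(2)
    by (simp_all add: P'_def S_def matrix_transpose_mul matrix_mul_assoc)
  obtain E1 E2 where E12: "\<And>t. norm (\<beta> t) \<le> E1" "\<And>t. norm (Q_tilde t) \<le> E2"
    by (rule \<beta>_bounded, rule Q_tilde_bounded, blast)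
  \<comment> \<open>The comparison works with a single bound for all coefficient functions.\<close>
  define E where "E = max C (max E1 E2)"
  have E: "norm (\<beta> t) \<le> E" "norm (Q_tilde t) \<le> E" "norm (R t) \<le> E" for t
    using E12[of t] R(2)[of t] by (auto simp: E_def le_max_iff_disj)
  have af: "AE \<omega> in M. \<forall>t\<in>{0..T}. artstein T h A0 B0 U X t \<omega> = \<Phi> t *v (noise Z t \<omega> + control U t \<omega>)"
    by (rule artstein_formula[OF U(1) _ Ul XZ]) (rule U(2))
  \<comment> \<open>The factors \<open>\<Phi> t\<close> from \<open>B_bar\<close> and from the
    Artstein transform combine with \<open>P t\<close> to \<open>P' t\<close>, so the given law is
    the feedback of the transformed Riccati solution.\<close>
  have feedback: "AE t in lborel. t \<in> {0..T - h} \<longrightarrow> (AE \<omega> in M. truncate_time T U t \<omega> =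
      - ((matrix_inv (R t) ** transpose (\<beta> t) ** P' t) *v (noise Z t \<omega> + (LBINT s:{0..t}. \<beta> s *v truncate_time T U s \<omega>))))"
  proof -
    interpret L: pair_sigma_finite "lborel :: real measure" M ..
    have "AE t in lborel. AE \<omega> in M. t \<in> {0..T - h} \<longrightarrow>
      U t \<omega> = - ((matrix_inv (R0 t) ** transpose (B_bar T h A0 B0 t) ** P t) *v artstein T h A0 B0 U X t \<omega>)"
      using L.AE_pair[OF fb[unfolded feedback_law_def]] by simp
    with B_bar_eq R(4) show ?thesis
    proof eventually_elim
      case (elim t)
      show ?case
      proof
        assume t: "t \<in> {0..T - h}"
        then have tT: "t \<in> {0..T}" using times by auto
        from elim(3) af show "AE \<omega> in M. truncate_time T U t \<omega> =
          - ((matrix_inv (R t) ** transpose (\<beta> t) ** P' t) *v (noise Z t \<omega> + (LBINT s:{0..t}. \<beta> s *v truncate_time T U s \<omega>)))"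
        proof eventually_elim
          case (elim \<omega>)
          have "B_bar T h A0 B0 t = \<Phi> t ** \<beta> t" "R t = R0 t"
            using \<open>t \<in> {0..T} \<longrightarrow> B_bar T h A0 B0 t = \<Phi> t ** \<beta> t\<close> \<open>t \<in> {0..T} \<longrightarrow> R t = R0 t\<close> tT by blast+
          moreover have "artstein T h A0 B0 U X t \<omega> = \<Phi> t *v (noise Z t \<omega> + control U t \<omega>)"
            using elim(2) tT by blast
          moreover have "truncate_time T U t \<omega> = U t \<omega>"
            using tT by (simp add: truncate_time_def)
          ultimately show ?case
            using elim(1) t
            by (simp add: P'_def matrix_vector_mul_assoc matrix_transpose_mul matrix_mul_assoc control_eq)
        qed
      qed
    qed
  qed
  have main: "cost M T h Q0 G R0 U X \<le> cost M T h Q0 G R0 V Y \<and>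
      (cost M T h Q0 G R0 V Y \<le> cost M T h Q0 G R0 U X \<longrightarrow>
        (AE (t, \<omega>) in lborel \<Otimes>\<^sub>M M. t \<in> {0..T - h} \<longrightarrow> V t \<omega> = U t \<omega>))"
    if adm': "admissible M F W T h A0 B0 \<sigma>0 V Y" for V Y
  proof -
    have V: "measurable_process M T V" and Y: "measurable_process M T Y" and Va: "adapted_on F T V"
      using adm' by (auto simp: admissible_def L2_adapted_def solves_sde_def)
    note Vl = admissible_l2_process[OF adm']
    define D where "D = (\<lambda>t \<omega>. truncate_time T V t \<omega> - truncate_time T U t \<omega>)"
    have Dl: "l2_process M T D" unfolding D_def by (rule l2_process_diff[OF Vl Ul])
    define u where "u = (\<lambda>t \<omega>. LBINT s:{0..t}. \<beta> s *v D s \<omega>)"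
    note \<beta>D = l2_process_matrix[OF \<beta>_measurable E(1) Dl]
    have uu: "uniform_l2_process M T u"
      unfolding u_def by (rule uniform_l2_process_integral[OF \<beta>D T_nonneg])
    have YZ: "AE \<omega> in M. \<forall>t\<in>{0..T}. Y t \<omega> = \<Phi> t *v (noise Z t \<omega> + (control U (t - h) \<omega> + u (t - h) \<omega>))"
      using admissible_state_formula(2)[OF adm'] wiener_noise_unique[OF Z admissible_state_formula(1)[OF adm']]
        l2_process_path_integrable[OF l2_process_matrix[OF \<beta>_measurable E(1) Ul]]
        l2_process_path_integrable[OF \<beta>D]
    proof eventually_elim
      case (elim \<omega>)
      show ?case
      proof
        fix t assume t: "t \<in> {0..T}"
        have n: "noise_path (\<lambda>s. state_noise V Y s \<omega>) t = noise Z t \<omega>"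
          using noise_cong[of t Z \<omega> "state_noise V Y"] elim(2) t by (simp add: noise_def)
        have sub: "{0..t - h} \<subseteq> {0..T}" using t times by auto
        have "control_path (\<lambda>s. truncate_time T V s \<omega>) (t - h) =
            (LBINT s:{0..t - h}. \<beta> s *v truncate_time T U s \<omega> + \<beta> s *v D s \<omega>)"
          by (simp add: control_path_def D_def mv.add_right[symmetric])
        also have "\<dots> = control U (t - h) \<omega> + u (t - h) \<omega>"
          unfolding control_eq u_def
          by (intro set_integral_add set_integrable_subset[OF elim(3) _ sub] set_integrable_subset[OF elim(4) _ sub]) auto
        finally show "Y t \<omega> = \<Phi> t *v (noise Z t \<omega> + (control U (t - h) \<omega> + u (t - h) \<omega>))"
          using elim(1) t n by simp
      qed
    qed
    \<comment> \<open>Both controls are adapted, so \<open>D q\<close> is known at time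
      \<open>q\<close>; a single value is square integrable for almost every \<open>q\<close>
      only.\<close>
    have orth: "AE q in lborel. q \<in> {0..T - h} \<longrightarrow> (\<forall>t\<in>{q..T - h}.
      expectation (\<lambda>\<omega>. outer (noise Z t \<omega>) (D q \<omega>)) = expectation (\<lambda>\<omega>. outer (noise Z q \<omega>) (D q \<omega>)) \<and>
      expectation (\<lambda>\<omega>. outer (noise Z (t + h) \<omega>) (D q \<omega>)) = expectation (\<lambda>\<omega>. outer (noise Z q \<omega>) (D q \<omega>)))"
      using l2_process_section_AE[OF Dl]
    proof eventually_elim
      case (elim q)
      show ?case
      proof (intro impI ballI)
        fix t assume q: "q \<in> {0..T - h}" and t: "t \<in> {q..T - h}"
        have "q \<in> {0..T}" using q times by auto
        then have "D q \<in> borel_measurable (F q)" "sq_integrable M (D q)"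
          using Ua Va elim by (auto simp: D_def truncate_time_def adapted_on_def intro: borel_measurable_diff)
        then show "expectation (\<lambda>\<omega>. outer (noise Z t \<omega>) (D q \<omega>)) = expectation (\<lambda>\<omega>. outer (noise Z q \<omega>) (D q \<omega>)) \<and>
          expectation (\<lambda>\<omega>. outer (noise Z (t + h) \<omega>) (D q \<omega>)) = expectation (\<lambda>\<omega>. outer (noise Z q \<omega>) (D q \<omega>))"
          using q t times by (intro conjI noise_orthogonal[OF Z]) auto
      qed
    qed
    have Tle: "T - h \<le> T" using times by simp
    note cmp = lq_comparison[OF Th \<beta>_measurable E(1) R(1) E(3) R(3) Q_tilde_measurable E(2) Q_tilde_psd G_tilde_psd
        P' uniform_l2_mono[OF uniform_l2_noise[OF Z] Tle] uniform_l2_shift[OF uniform_l2_noise[OF Z]]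
        l2_process_mono[OF Ul Tle] l2_process_mono[OF Dl Tle] orth feedback]
    note C = tilde_cost_def control_eq u_def
    have cu: "uniform_l2_process M (T - h) (control U)"
      by (rule uniform_l2_mono[OF uniform_l2_control[OF Ul] Tle])
    have c1: "cost M T h Q0 G R0 U X = tilde_cost (\<lambda>t \<omega>. noise Z (t + h) \<omega> + control U t \<omega>) (truncate_time T U)"
      by (rule cost_formula[OF Z U(1) Ul X cu XZ])
    have c2: "cost M T h Q0 G R0 V Y = tilde_cost (\<lambda>t \<omega>. noise Z (t + h) \<omega> + (control U t \<omega> + u t \<omega>)) (truncate_time T V)"
      by (rule cost_formula[OF Z V Vl Y uniform_l2_process_add[OF cu uniform_l2_mono[OF uu Tle]] YZ])
    have VD: "truncate_time T V = (\<lambda>t \<omega>. truncate_time T U t \<omega> + D t \<omega>)"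
      by (simp add: D_def fun_eq_iff)
    have "cost M T h Q0 G R0 U X \<le> cost M T h Q0 G R0 V Y"
      unfolding c1 c2 VD C using cmp(1) by (simp only: add.assoc)
    moreover have "AE (t, \<omega>) in lborel \<Otimes>\<^sub>M M. t \<in> {0..T - h} \<longrightarrow> V t \<omega> = U t \<omega>"
      if "cost M T h Q0 G R0 V Y \<le> cost M T h Q0 G R0 U X"
    proof -
      have "AE w in time_measure (T - h) \<Otimes>\<^sub>M M. (case w of (t, \<omega>) \<Rightarrow> D t \<omega> = 0)"
      proof (rule cmp(2), goal_cases)
        case 1
        then show ?case .
      next
        case 2
        show ?case
          using that unfolding c1 c2 VD C by (simp only: add.assoc)
      qed
      from AE_time_product[OF this] Dl
      have "AE w in lborel \<Otimes>\<^sub>M M. (case w of (t, \<omega>) \<Rightarrow> t \<in> {0..T - h} \<longrightarrow> D t \<omega> = 0)"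
        by (simp add: l2_process_def)
      then show ?thesis
        by eventually_elim (use Tle in \<open>auto simp: D_def truncate_time_def\<close>)
    qed
    ultimately show ?thesis by blast
  qed
  show opt: "optimal M F W T h A0 B0 \<sigma>0 Q0 G R0 U X"
    unfolding optimal_def using adm main by blast
  assume "optimal M F W T h A0 B0 \<sigma>0 Q0 G R0 U' X'"
  then show "AE (t, \<omega>) in lborel \<Otimes>\<^sub>M M. t \<in> {0..T - h} \<longrightarrow> U' t \<omega> = U t \<omega>"
    using main[of U' X'] adm unfolding optimal_def by blast
qed

end

section \<open>Continuous adapted Wiener integrals\<close>

text \<open>Continuous functions converging to \<open>\<sigma>\<close> almost everywhere need not be
  bounded. Projecting their values onto the ball of radius \<open>C\<close> keeps them continuous,
  leaves the limit unchanged and makes dominated convergence available.\<close>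

lemma continuous_L2_approximation:
  fixes \<sigma> :: "real \<Rightarrow> 'a::euclidean_space"
  assumes \<sigma>: "\<sigma> \<in> borel_measurable borel" "\<And>t. norm (\<sigma> t) \<le> C" and T: "0 \<le> T"
  obtains g where "\<And>n. continuous_on UNIV (g n)"
    "(\<lambda>n. \<integral>\<^sup>+s. ennreal ((norm (indicator {0..T} s *\<^sub>R (g n s - \<sigma> s)))\<^sup>2) \<partial>lborel) \<longlonglongrightarrow> 0"
proof -
  have C0: "0 \<le> C" using order_trans[OF norm_ge_zero \<sigma>(2)] .
  have "\<sigma> \<in> borel_measurable (lebesgue_on UNIV)"
    by (rule measurable_restrict_space1[OF measurable_completion]) (use \<sigma>(1) in simp)
  then have "\<sigma> measurable_on UNIV"
    by (subst measurable_on_iff_borel_measurable) auto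
  then obtain N f where N: "negligible N" and "\<forall>n. continuous_on UNIV (f n)"
    "\<forall>x. x \<notin> N \<longrightarrow> (\<lambda>n. f n x) \<longlonglongrightarrow> \<sigma> x"
    unfolding measurable_on_def by auto
  then have f: "\<And>n. continuous_on UNIV (f n)" and lim: "\<And>x. x \<notin> N \<Longrightarrow> (\<lambda>n. f n x) \<longlonglongrightarrow> \<sigma> x"
    by auto
  define p where "p = closest_point (cball (0::'a) C)"
  define g where "g = (\<lambda>n x. p (f n x))"
  have cp: "continuous_on UNIV p"
    unfolding p_def by (rule continuous_on_closest_point) (use C0 in auto)
  have gc: "continuous_on UNIV (g n)" for n
    unfolding g_def by (rule continuous_on_compose2[OF cp f]) auto
  have gb: "norm (g n x) \<le> C" for n x
    using closest_point_in_set[of "cball (0::'a) C" "f n x"] C0 by (auto simp: g_def p_def)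
  have gl: "(\<lambda>n. g n x) \<longlonglongrightarrow> \<sigma> x" if "x \<notin> N" for x
  proof -
    have "isCont p (\<sigma> x)" using cp by (simp add: continuous_on_eq_continuous_at)
    then have "(\<lambda>n. p (f n x)) \<longlonglongrightarrow> p (\<sigma> x)"
      by (rule isCont_tendsto_compose[OF _ lim[OF that]])
    moreover have "p (\<sigma> x) = \<sigma> x"
      unfolding p_def by (rule closest_point_self) (use \<sigma>(2) in auto)
    ultimately show ?thesis by (simp add: g_def)
  qed
  have aeN: "AE x in lborel. x \<notin> N"
    using AE_not_in[of N lebesgue] N by (simp add: negligible_iff_null_sets AE_completion_iff)
  have [measurable]: "\<sigma> \<in> borel_measurable borel" "\<And>n. g n \<in> borel_measurable borel"
    using \<sigma>(1) gc by (auto intro: borel_measurable_continuous_onI)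
  define w where "w = (\<lambda>x. ennreal (4 * C\<^sup>2) * indicator {0..T} x)"
  have "(\<lambda>n. \<integral>\<^sup>+s. ennreal ((norm (indicator {0..T} s *\<^sub>R (g n s - \<sigma> s)))\<^sup>2) \<partial>lborel)
      \<longlonglongrightarrow> (\<integral>\<^sup>+s. 0 \<partial>(lborel :: real measure))"
  proof (rule nn_integral_dominated_convergence[where w = w])
    show "(\<integral>\<^sup>+x. w x \<partial>lborel) < \<infinity>"
      unfolding w_def using T by (simp add: nn_integral_cmult_indicator ennreal_mult_less_top)
    have "ennreal ((norm (indicator {0..T} s *\<^sub>R (g n s - \<sigma> s)))\<^sup>2) \<le> w s" for n s
    proof (cases "s \<in> {0..T}")
      case True
      have "norm (g n s - \<sigma> s) \<le> 2 * C"
        using norm_triangle_ineq4[of "g n s" "\<sigma> s"] gb[of n s] \<sigma>(2)[of s] by linarith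
      then have "(norm (g n s - \<sigma> s))\<^sup>2 \<le> (2 * C)\<^sup>2" by (intro power_mono) auto
      then show ?thesis using True by (simp add: w_def power_mult_distrib ennreal_leI)
    qed (simp add: w_def)
    then show "AE x in lborel. ennreal ((norm (indicat_real {0..T} x *\<^sub>R (g n x - \<sigma> x)))\<^sup>2) \<le> w x" for n
      by simp
    show "AE x in lborel. (\<lambda>n. ennreal ((norm (indicat_real {0..T} x *\<^sub>R (g n x - \<sigma> x)))\<^sup>2)) \<longlonglongrightarrow> 0"
      using aeN
    proof eventually_elim
      case (elim x)
      have "(\<lambda>n. (norm (indicat_real {0..T} x *\<^sub>R (g n x - \<sigma> x)))\<^sup>2) \<longlonglongrightarrow>
          (norm (indicat_real {0..T} x *\<^sub>R (\<sigma> x - \<sigma> x)))\<^sup>2"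
        by (intro tendsto_intros gl elim)
      then show ?case
        using tendsto_ennrealI by fastforce
    qed
  qed (auto simp: w_def)
  then show ?thesis using that[of g] gc by simp
qed

lemma step_function_L2_approximation:
  fixes \<sigma> :: "real \<Rightarrow> 'a::euclidean_space"
  assumes \<sigma>: "\<sigma> \<in> borel_measurable borel" "\<And>t. norm (\<sigma> t) \<le> C" and T: "0 < T" and e: "0 < e"
  obtains k p c where "partition_upto k p T"
    "(\<integral>\<^sup>+s. ennreal ((norm (step_function k p c s - indicator {0..T} s *\<^sub>R \<sigma> s))\<^sup>2) \<partial>lborel) < ennreal e"
proof -
  obtain g where g: "\<And>n. continuous_on UNIV (g n)"
    "(\<lambda>n. \<integral>\<^sup>+s. ennreal ((norm (indicator {0..T} s *\<^sub>R (g n s - \<sigma> s)))\<^sup>2) \<partial>lborel) \<longlonglongrightarrow> 0"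
    by (rule continuous_L2_approximation[OF \<sigma> less_imp_le[OF T]], rule that)
  from order_tendstoD(2)[OF g(2), of "ennreal (e / 4)"] e
  obtain n where n: "(\<integral>\<^sup>+s. ennreal ((norm (indicator {0..T} s *\<^sub>R (g n s - \<sigma> s)))\<^sup>2) \<partial>lborel) < ennreal (e / 4)"
    by (auto dest: eventually_happens)
  define f where "f = g n"
  have [measurable]: "f \<in> borel_measurable borel" "\<sigma> \<in> borel_measurable borel"
    using g(1) \<sigma>(1) by (auto simp: f_def intro: borel_measurable_continuous_onI)
  \<comment> \<open>The grid error contributes \<open>\<delta>\<^sup>2 * T = e / 8\<close>; with the
    error \<open>e / 4\<close> of the continuous approximation and the factor 2 from the square of a
    sum, the total stays at \<open>3 * e / 4\<close>.\<close>
  define \<delta> where "\<delta> = sqrt (e / (8 * T))"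
  have \<delta>: "0 < \<delta>" "\<delta>\<^sup>2 * T = e / 8" using e T by (auto simp: \<delta>_def field_simps)
  have "uniformly_continuous_on {0..T} f"
    using g(1)[of n] by (intro compact_uniformly_continuous) (auto simp: f_def intro: continuous_on_subset)
  then obtain d where d: "0 < d" "\<And>x y. x \<in> {0..T} \<Longrightarrow> y \<in> {0..T} \<Longrightarrow> dist y x < d \<Longrightarrow> dist (f y) (f x) < \<delta>"
    using \<delta>(1) unfolding uniformly_continuous_on_def by metis
  obtain k :: nat where k: "T / d < real k" using reals_Archimedean2 by blast
  have "0 < T / d" using T d by simp
  then have k0: "0 < k" using k by (metis less_trans of_nat_0_less_iff)
  define p where "p = (\<lambda>i. real i * (T / real k))"
  define c where "c = (\<lambda>i. f (p i))"
  have step: "T / real k < d" using k k0 d by (simp add: field_simps)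
  have part: "partition_upto k p T"
    using T k0 by (auto simp: partition_upto_def p_def mono_on_def field_simps)
  have close: "norm (step_function k p c s - f s) \<le> \<delta>" if s: "0 < s" "s \<le> T" for s
  proof -
    \<comment> \<open>Cells are open on the left, hence the ceiling minus one: a node belongs to the
      cell that ends there.\<close>
    define i where "i = nat (\<lceil>s / (T / real k)\<rceil> - 1)"
    have sp: "0 < s / (T / real k)" using s T k0 by simp
    have ci: "real i = of_int \<lceil>s / (T / real k)\<rceil> - 1"
      using sp by (simp add: i_def)
    have up: "s / (T / real k) \<le> real i + 1" and lo: "real i < s / (T / real k)"
      unfolding ci by linarith+
    have Tk: "0 < T / real k" using T k0 by simp
    have si: "p i < s" "s \<le> p (Suc i)"
      using mult_right_mono[OF up less_imp_le[OF Tk]] mult_strict_right_mono[OF lo Tk] T k0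
      by (simp_all add: p_def add.commute)
    have ik: "i < k"
    proof -
      have "s / (T / real k) \<le> real k" using s T k0 by (simp add: field_simps)
      then show ?thesis using lo by linarith
    qed
    have uniq: "s \<in> {p j<..p (Suc j)} \<longleftrightarrow> j = i" for j
    proof
      assume a: "s \<in> {p j<..p (Suc j)}"
      then have "real j * (T / real k) < real (Suc i) * (T / real k)" "real i * (T / real k) < real (Suc j) * (T / real k)"
        using si by (auto simp: p_def)
      then have "real j < real (Suc i)" "real i < real (Suc j)"
        using mult_right_less_imp_less[OF _ less_imp_le[OF Tk]] by blast+
      then have "j < Suc i" "i < Suc j" by (simp_all only: of_nat_less_iff)
      then show "j = i" by simp
    qed (use si in auto)
    have "step_function k p c s = (\<Sum>j<k. if j = i then c j else 0)"
      unfolding step_function_def by (intro sum.cong) (auto simp: indicator_def uniq simp del: greaterThanAtMost_iff)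
    also have "\<dots> = c i" using ik by simp
    finally have "step_function k p c s = f (p i)" by (simp add: c_def)
    moreover have "dist (p i) s < d"
    proof -
      have "p (Suc i) - p i = T / real k" by (simp add: p_def algebra_simps add_divide_distrib)
      then show ?thesis using si step by (simp add: dist_real_def)
    qed
    moreover have "p i \<in> {0..T}" using si s T by (auto simp: p_def)
    ultimately show ?thesis
      using d(2)[of s "p i"] s by (simp add: dist_norm less_imp_le)
  qed
  have "(\<integral>\<^sup>+s. ennreal ((norm (step_function k p c s - indicator {0..T} s *\<^sub>R f s))\<^sup>2) \<partial>lborel) \<le>
      (\<integral>\<^sup>+s. ennreal (\<delta>\<^sup>2) * indicator {0..T} s \<partial>lborel)"
  proof (rule nn_integral_mono_AE)
    show "AE s in lborel. ennreal ((norm (step_function k p c s - indicat_real {0..T} s *\<^sub>R f s))\<^sup>2) \<le> ennreal (\<delta>\<^sup>2) * indicator {0..T} s"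
      using AE_lborel_singleton[of "0::real"]
    proof eventually_elim
      case (elim s)
      show ?case
      proof (cases "s \<in> {0..T}")
        case True
        then have "(norm (step_function k p c s - f s))\<^sup>2 \<le> \<delta>\<^sup>2"
          using elim close[of s] by (intro power_mono) auto
        then show ?thesis using True by (simp add: ennreal_leI)
      qed (use step_function_eq_0[OF part] in simp)
    qed
  qed
  also have "\<dots> = ennreal (\<delta>\<^sup>2 * T)"
    using T by (simp add: nn_integral_cmult_indicator ennreal_mult)
  finally have 1: "(\<integral>\<^sup>+s. ennreal ((norm (step_function k p c s - indicator {0..T} s *\<^sub>R f s))\<^sup>2) \<partial>lborel) \<le> ennreal (e / 8)"
    by (simp add: \<delta>)
  have "(\<integral>\<^sup>+s. ennreal ((norm (step_function k p c s - indicator {0..T} s *\<^sub>R \<sigma> s))\<^sup>2) \<partial>lborel) =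
     (\<integral>\<^sup>+s. ennreal ((norm ((step_function k p c s - indicator {0..T} s *\<^sub>R f s) + indicator {0..T} s *\<^sub>R (f s - \<sigma> s)))\<^sup>2) \<partial>lborel)"
    by (simp add: algebra_simps)
  also have "\<dots> \<le> 2 * (\<integral>\<^sup>+s. ennreal ((norm (step_function k p c s - indicator {0..T} s *\<^sub>R f s))\<^sup>2) \<partial>lborel) +
     2 * (\<integral>\<^sup>+s. ennreal ((norm (indicator {0..T} s *\<^sub>R (f s - \<sigma> s)))\<^sup>2) \<partial>lborel)"
    by (rule nn_integral_norm_add_sq) measurable
  also have "\<dots> \<le> 2 * ennreal (e / 8) + 2 * ennreal (e / 4)"
    using 1 n unfolding f_def[symmetric] by (intro add_mono mult_left_mono) auto
  also have "\<dots> = ennreal (3 * e / 4)"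
    using e by (simp add: ennreal_plus[symmetric] ennreal_mult[symmetric] ennreal_numeral[symmetric] del: ennreal_plus ennreal_numeral)
  also have "\<dots> < ennreal e" using e by (simp add: ennreal_less_iff)
  finally show ?thesis using part that by blast
qed

section \<open>Maximal inequality, continuous Wiener integrals and progressive versions\<close>

context wiener_setting
begin

text \<open>Kolmogorov's inequality from orthogonality alone. The event is split by the first index
  at which the level is exceeded; on each part the later increment is orthogonal to the value
  reached, so passing to index \<open>n\<close> can only increase the second moment there.\<close>

lemma maximal_inequality:
  fixes X :: "nat \<Rightarrow> 'w \<Rightarrow> 'b::euclidean_space" and \<tau> :: "nat \<Rightarrow> real"
  assumes \<tau>: "\<And>i. 0 \<le> \<tau> i" and X: "\<And>i. X i \<in> borel_measurable (F (\<tau> i))" "\<And>i. sq_integrable M (X i)"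
    and \<tau>mono: "\<And>i j. i \<le> j \<Longrightarrow> \<tau> i \<le> \<tau> j"
    and orth: "\<And>i n \<xi>. i \<le> n \<Longrightarrow> \<xi> \<in> borel_measurable (F (\<tau> i)) \<Longrightarrow> sq_integrable M \<xi> \<Longrightarrow>
      expectation (\<lambda>\<omega>. \<xi> \<omega> *\<^sub>R (X n \<omega> - X i \<omega>)) = 0" and e: "0 < e"
  shows "e\<^sup>2 * prob {\<omega>\<in>space M. \<exists>i\<le>n. e < norm (X i \<omega>)} \<le> expectation (\<lambda>\<omega>. (norm (X n \<omega>))\<^sup>2)"
proof -
  define A where "A = (\<lambda>i. {\<omega>\<in>space M. e < norm (X i \<omega>) \<and> (\<forall>j<i. norm (X j \<omega>) \<le> e)})"
  have Xm: "X j \<in> borel_measurable (F (\<tau> i))" if "j \<le> i" for i j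
    by (rule filtration_measurable_mono[OF \<tau> \<tau>mono[OF that] X(1)])
  have AF: "A i \<in> sets (F (\<tau> i))" for i
  proof -
    have [measurable]: "X j \<in> borel_measurable (F (\<tau> i))" if "j \<le> i" for j using Xm[OF that] .
    have "{\<omega>\<in>space (F (\<tau> i)). e < norm (X i \<omega>)} \<inter> (\<Inter>j\<in>{..<i}. {\<omega>\<in>space (F (\<tau> i)). norm (X j \<omega>) \<le> e}) \<in> sets (F (\<tau> i))"
      if "0 < i"
      using that by (intro sets.Int sets.finite_INT) (auto intro!: borel_measurable_less borel_measurable_le borel_measurable_norm Xm)
    moreover have "{\<omega>\<in>space (F (\<tau> i)). e < norm (X i \<omega>)} \<in> sets (F (\<tau> i))"
      by measurable
    moreover have "A i = (if i = 0 then {\<omega>\<in>space (F (\<tau> i)). e < norm (X i \<omega>)} else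
      {\<omega>\<in>space (F (\<tau> i)). e < norm (X i \<omega>)} \<inter> (\<Inter>j\<in>{..<i}. {\<omega>\<in>space (F (\<tau> i)). norm (X j \<omega>) \<le> e}))"
      using filtration_space[OF \<tau>] by (auto simp: A_def)
    ultimately show ?thesis by (cases "i = 0") auto
  qed
  then have AM [measurable]: "A i \<in> sets M" for i
    using filtration_subalgebra[OF \<tau>] by (auto simp: subalgebra_def)
  have disj: "disjoint_family_on A {..n}"
    unfolding disjoint_family_on_def A_def by (auto, metis linorder_neqE_nat not_less)
  have un: "{\<omega>\<in>space M. \<exists>i\<le>n. e < norm (X i \<omega>)} = (\<Union>i\<in>{..n}. A i)"
  proof (rule set_eqI, rule iffI)
    fix \<omega> assume "\<omega> \<in> {\<omega>\<in>space M. \<exists>i\<le>n. e < norm (X i \<omega>)}"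
    then obtain i where i: "i \<le> n" "e < norm (X i \<omega>)" "\<omega> \<in> space M" by blast
    define l where "l = (LEAST i. e < norm (X i \<omega>))"
    have "e < norm (X l \<omega>)" "l \<le> i" unfolding l_def using i(2) by (auto intro: LeastI Least_le)
    moreover have "norm (X j \<omega>) \<le> e" if "j < l" for j
      using not_less_Least[OF that[unfolded l_def]] by simp
    ultimately show "\<omega> \<in> (\<Union>i\<in>{..n}. A i)" using i by (auto simp: A_def intro!: bexI[of _ l])
  qed (auto simp: A_def)
  have X_n: "e\<^sup>2 * prob (A i) \<le> expectation (\<lambda>\<omega>. indicator (A i) \<omega> * (norm (X n \<omega>))\<^sup>2)" if i: "i \<le> n" for i
  proof -
    let ?\<xi> = "\<lambda>\<omega>. indicator (A i) \<omega> *\<^sub>R X i \<omega>"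
    have \<xi>F: "?\<xi> \<in> borel_measurable (F (\<tau> i))"
      using AF[of i] X(1)[of i] by (intro borel_measurable_scaleR borel_measurable_indicator)
    have \<xi>: "sq_integrable M ?\<xi>"
      by (rule sq_integrable_bound[OF X(2)[of i], of _ 1], rule filtration_measurable[OF \<tau> \<xi>F])
        (auto simp: indicator_def)
    have D: "sq_integrable M (\<lambda>\<omega>. X n \<omega> - X i \<omega>)" by (intro sq_integrable_diff X(2))
    have ib: "integrable M (\<lambda>\<omega>. (?\<xi> \<omega> \<bullet> b) *\<^sub>R (X n \<omega> - X i \<omega>))" for b
      by (rule integrable_scaleR_sq_integrable[OF sq_integrable_component[OF \<xi>] D])
    \<comment> \<open>Orthogonality is available for scalar test variables, so the inner product is
      expanded in coordinates.\<close>
    have "?\<xi> \<omega> \<bullet> (X n \<omega> - X i \<omega>) = (\<Sum>b\<in>Basis. ((?\<xi> \<omega> \<bullet> b) *\<^sub>R (X n \<omega> - X i \<omega>)) \<bullet> b)" for \<omega>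
      by (subst euclidean_inner) simp
    then have "expectation (\<lambda>\<omega>. ?\<xi> \<omega> \<bullet> (X n \<omega> - X i \<omega>)) =
        expectation (\<lambda>\<omega>. \<Sum>b\<in>Basis. ((?\<xi> \<omega> \<bullet> b) *\<^sub>R (X n \<omega> - X i \<omega>)) \<bullet> b)"
      by (simp only:)
    also have "\<dots> = (\<Sum>b\<in>Basis. expectation (\<lambda>\<omega>. ((?\<xi> \<omega> \<bullet> b) *\<^sub>R (X n \<omega> - X i \<omega>)) \<bullet> b))"
      by (intro Bochner_Integration.integral_sum integrable_inner_left ib)
    also have "\<dots> = (\<Sum>b\<in>Basis. expectation (\<lambda>\<omega>. (?\<xi> \<omega> \<bullet> b) *\<^sub>R (X n \<omega> - X i \<omega>)) \<bullet> b)"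
      by (intro sum.cong refl integral_inner_left ib)
    also have "\<dots> = 0"
    proof (intro sum.neutral ballI)
      fix b :: 'b
      have "(\<lambda>\<omega>. ?\<xi> \<omega> \<bullet> b) \<in> borel_measurable (F (\<tau> i))"
        using \<xi>F by (intro borel_measurable_inner) auto
      from orth[OF i this sq_integrable_component[OF \<xi>]]
      show "expectation (\<lambda>\<omega>. (?\<xi> \<omega> \<bullet> b) *\<^sub>R (X n \<omega> - X i \<omega>)) \<bullet> b = 0" by simp
    qed
    finally have o: "expectation (\<lambda>\<omega>. ?\<xi> \<omega> \<bullet> (X n \<omega> - X i \<omega>)) = 0" .
    have ii: "integrable M (\<lambda>\<omega>. ?\<xi> \<omega> \<bullet> (X n \<omega> - X i \<omega>))"
      by (rule integrable_inner_sq_integrable[OF \<xi> D])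
    have in2: "integrable M (\<lambda>\<omega>. indicator (A i) \<omega> * (norm (X n \<omega>))\<^sup>2)"
      using integrable_mult_indicator[OF AM[of i], of "\<lambda>\<omega>. (norm (X n \<omega>))\<^sup>2"] X(2)[of n]
      by (simp add: sq_integrable_def)
    have "e\<^sup>2 * prob (A i) = expectation (\<lambda>\<omega>. e\<^sup>2 * indicator (A i) \<omega>)"
      by simp
    also have "\<dots> \<le> expectation (\<lambda>\<omega>. indicator (A i) \<omega> * (norm (X n \<omega>))\<^sup>2 - 2 * (?\<xi> \<omega> \<bullet> (X n \<omega> - X i \<omega>)))"
    proof (rule integral_mono)
      show "integrable M (\<lambda>\<omega>. e\<^sup>2 * indicator (A i) \<omega>)"
        by (intro integrable_mult_right integrable_real_indicator AM) (simp add: less_top[symmetric])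
      show "integrable M (\<lambda>\<omega>. indicator (A i) \<omega> * (norm (X n \<omega>))\<^sup>2 - 2 * (?\<xi> \<omega> \<bullet> (X n \<omega> - X i \<omega>)))"
        using in2 ii by simp
      fix \<omega> assume "\<omega> \<in> space M"
      \<comment> \<open>Subtracting the mixed term, whose expectation is 0, completes the square and
        leaves at least the squared norm at the first passage.\<close>
      have n: "(norm v)\<^sup>2 - 2 * (u \<bullet> (v - u)) = (norm u)\<^sup>2 + (norm (v - u))\<^sup>2" for u v :: 'b
        by (simp add: power2_norm_eq_inner inner_diff_left inner_diff_right inner_commute)
      have "\<omega> \<in> A i \<Longrightarrow> e\<^sup>2 \<le> (norm (X i \<omega>))\<^sup>2"
        using e by (intro power_mono) (auto simp: A_def)
      then have "\<omega> \<in> A i \<Longrightarrow> e\<^sup>2 \<le> (norm (X i \<omega>))\<^sup>2 + (norm (X n \<omega> - X i \<omega>))\<^sup>2"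
        by (meson add_increasing2 zero_le_power2)
      then show "e\<^sup>2 * indicator (A i) \<omega> \<le> indicator (A i) \<omega> * (norm (X n \<omega>))\<^sup>2 - 2 * (?\<xi> \<omega> \<bullet> (X n \<omega> - X i \<omega>))"
        using n[of "X n \<omega>" "X i \<omega>"] by (auto simp: indicator_def)
    qed
    also have "\<dots> = expectation (\<lambda>\<omega>. indicator (A i) \<omega> * (norm (X n \<omega>))\<^sup>2)"
      using in2 ii o by simp
    finally show ?thesis .
  qed
  have in3: "integrable M (\<lambda>\<omega>. indicator (A i) \<omega> * (norm (X n \<omega>))\<^sup>2)" for i
    using integrable_mult_indicator[OF AM[of i], of "\<lambda>\<omega>. (norm (X n \<omega>))\<^sup>2"] X(2)[of n]
    by (simp add: sq_integrable_def)
  have "e\<^sup>2 * prob (\<Union>i\<in>{..n}. A i) = (\<Sum>i\<le>n. e\<^sup>2 * prob (A i))"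
    using disj by (subst finite_measure_finite_Union) (auto simp: sum_distrib_left)
  also have "\<dots> \<le> (\<Sum>i\<le>n. expectation (\<lambda>\<omega>. indicator (A i) \<omega> * (norm (X n \<omega>))\<^sup>2))"
    by (intro sum_mono X_n) auto
  also have "\<dots> = expectation (\<lambda>\<omega>. \<Sum>i\<le>n. indicator (A i) \<omega> * (norm (X n \<omega>))\<^sup>2)"
    by (rule Bochner_Integration.integral_sum[symmetric]) (rule in3)
  also have "\<dots> \<le> expectation (\<lambda>\<omega>. (norm (X n \<omega>))\<^sup>2)"
  proof (rule integral_mono)
    show "integrable M (\<lambda>\<omega>. \<Sum>i\<le>n. indicator (A i) \<omega> * (norm (X n \<omega>))\<^sup>2)"
      by (intro Bochner_Integration.integrable_sum in3)
    show "integrable M (\<lambda>\<omega>. (norm (X n \<omega>))\<^sup>2)" using X(2)[of n] by (simp add: sq_integrable_def)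
    fix \<omega>
    have "(\<Sum>i\<le>n. indicator (A i) \<omega> :: real) = indicator (\<Union>i\<in>{..n}. A i) \<omega>"
      by (rule indicator_UN_disjoint[symmetric]) (use disj in auto)
    then have "(\<Sum>i\<le>n. indicator (A i) \<omega> * (norm (X n \<omega>))\<^sup>2) = indicator (\<Union>i\<in>{..n}. A i) \<omega> * (norm (X n \<omega>))\<^sup>2"
      by (simp add: sum_distrib_right[symmetric])
    also have "\<dots> \<le> 1 * (norm (X n \<omega>))\<^sup>2"
      by (intro mult_right_mono) (auto simp: indicator_def)
    finally show "(\<Sum>i\<le>n. indicator (A i) \<omega> * (norm (X n \<omega>))\<^sup>2) \<le> (norm (X n \<omega>))\<^sup>2" by simp
  qed
  finally show ?thesis unfolding un .
qed

abbreviation running_integral :: "nat \<Rightarrow> (nat \<Rightarrow> real) \<Rightarrow> (nat \<Rightarrow> 'b::real_vector) \<Rightarrow> real \<Rightarrow> 'w \<Rightarrow> 'b" where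
  "running_integral k p c t \<equiv> step_integral W k (\<lambda>i. min t (p i)) c"

lemma running_integral_measurable:
  fixes c :: "nat \<Rightarrow> 'b::euclidean_space"
  assumes p: "partition_upto k p T" and t: "0 \<le> t"
  shows "running_integral k p c t \<in> borel_measurable (F t)"
proof -
  have "W (min t (p i)) \<in> borel_measurable (F t)" if "i \<le> k" for i
  proof (rule wiener_measurable_filtration)
    show "0 \<le> min t (p i)" using p t that by (auto simp: partition_upto_def)
  qed simp
  then show ?thesis
    unfolding step_integral_def
    by (intro borel_measurable_sum borel_measurable_scaleR borel_measurable_diff borel_measurable_const) auto
qed

lemma running_integral_continuous:
  fixes c :: "nat \<Rightarrow> 'b::euclidean_space"
  assumes p: "partition_upto k p T"
  shows "AE \<omega> in M. continuous_on {0..} (\<lambda>t. running_integral k p c t \<omega>)"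
proof -
  have "AE \<omega> in M. continuous_on {0..} (\<lambda>t. W t \<omega>)"
    using wiener by (simp add: wiener_process_def)
  then show ?thesis
  proof eventually_elim
    case (elim \<omega>)
    have "continuous_on {0..} (\<lambda>t. W (min t (p i)) \<omega>)" if "i \<le> k" for i
      using p that
      by (intro continuous_on_compose2[OF elim] continuous_intros) (auto simp: partition_upto_def)
    then show ?case
      unfolding step_integral_def
      by (intro continuous_intros) auto
  qed
qed

lemma running_integral_0:
  assumes "partition_upto k p T"
  shows "running_integral k p c 0 \<omega> = 0"
proof -
  have "min 0 (p i) = 0" if "i \<le> k" for i
    using assms that by (auto simp: partition_upto_def)
  then show ?thesis by (simp add: step_integral_def)
qed

lemma running_integral_orthogonal:
  fixes c :: "nat \<Rightarrow> 'b::euclidean_space"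
  assumes p: "partition_upto k p T" and st: "0 \<le> s" "s \<le> t"
    and \<xi>: "\<xi> \<in> borel_measurable (F s)" "sq_integrable M \<xi>"
  shows "expectation (\<lambda>\<omega>. \<xi> \<omega> *\<^sub>R (running_integral k p c t \<omega> - running_integral k p c s \<omega>)) = 0"
proof -
  have "(\<lambda>i. min s (min t (p i))) = (\<lambda>i. min s (p i))" using st by (auto simp: fun_eq_iff)
  then show ?thesis
    using step_integral_orthogonal[OF partition_upto_min[OF p order_trans[OF st]] st(1) \<xi>, of c] by simp
qed

lemma running_integral_isometry:
  fixes c c' :: "nat \<Rightarrow> 'b::euclidean_space"
  assumes p: "partition_upto k p T" and p': "partition_upto k' p' T" and t: "0 \<le> t"
  shows "(\<integral>\<^sup>+\<omega>. ennreal ((norm (running_integral k p c t \<omega> - running_integral k' p' c' t \<omega>))\<^sup>2) \<partial>M) \<le>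
    (\<integral>\<^sup>+s. ennreal ((norm (step_function k p c s - step_function k' p' c' s))\<^sup>2) \<partial>lborel)"
  unfolding step_integral_isometry[OF partition_upto_min[OF p t] partition_upto_min[OF p' t]]
    step_function_min scaleR_diff_right[symmetric]
  by (intro nn_integral_mono) (auto simp: indicator_def)

text \<open>Rounding \<open>t\<close> down on the grid with step \<open>T / 2 ^ m\<close> gives
  points tending to \<open>t\<close>, so a bound at all dyadic fractions of \<open>T\<close>
  survives in the limit.\<close>

lemma dense_dyadic:
  assumes T: "0 < T" and t: "t \<in> {0..T}" and f: "continuous_on {0..T} f"
    and le: "\<And>m i. i \<le> 2 ^ m \<Longrightarrow> norm (f (real i * T / 2 ^ m)) \<le> e"
  shows "norm (f t :: 'b::real_normed_vector) \<le> e"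
proof -
  define i where "i = (\<lambda>m. nat \<lfloor>t / T * 2 ^ m\<rfloor>)"
  define q where "q = (\<lambda>m. real (i m) * T / 2 ^ m)"
  have x: "0 \<le> t / T" "t / T \<le> 1" using T t by auto
  have ri: "real (i m) \<le> t / T * 2 ^ m" "t / T * 2 ^ m < real (i m) + 1" for m
  proof -
    have "0 \<le> t / T * 2 ^ m" using x by (intro mult_nonneg_nonneg) auto
    then have "real (i m) = real_of_int \<lfloor>t / T * 2 ^ m\<rfloor>" unfolding i_def by (intro of_nat_nat) simp
    then show "real (i m) \<le> t / T * 2 ^ m" "t / T * 2 ^ m < real (i m) + 1" by linarith+
  qed
  have "t / T * 2 ^ m \<le> 1 * 2 ^ m" for m
    using x by (intro mult_right_mono) auto
  then have im: "i m \<le> 2 ^ m" for m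
    using ri(1)[of m] by (metis mult_1 of_nat_le_iff of_nat_numeral of_nat_power order_trans)
  have low: "q m \<le> t" for m
    using ri(1)[of m] T by (simp add: q_def field_simps)
  have up: "t - T / 2 ^ m \<le> q m" for m
  proof -
    have "t * 2 ^ m < T + real (i m) * T" using ri(2)[of m] T by (simp add: field_simps)
    then have "t < (T + real (i m) * T) / 2 ^ m" by (simp add: pos_less_divide_eq)
    then show ?thesis by (simp add: q_def add_divide_distrib)
  qed
  have q0: "0 \<le> q m" for m using T by (simp add: q_def)
  have "(\<lambda>m. t - T * (1 / 2) ^ m) \<longlonglongrightarrow> t - T * 0"
    by (intro tendsto_intros LIMSEQ_realpow_zero) auto
  then have "q \<longlonglongrightarrow> t"
    by (intro tendsto_sandwich[of _ q sequentially "\<lambda>_. t"]) (use up low in \<open>auto simp: power_divide\<close>)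
  then have "(\<lambda>m. f (q m)) \<longlonglongrightarrow> f t"
    using q0 low t order_trans[OF low] by (intro continuous_on_tendsto_compose[OF f]) auto
  then have "(\<lambda>m. norm (f (q m))) \<longlonglongrightarrow> norm (f t)" by (rule tendsto_norm)
  then show ?thesis
    by (rule LIMSEQ_le_const2) (use le[OF im] in \<open>auto simp: q_def\<close>)
qed

text \<open>The exceptional set is the increasing union of the events for dyadic grids, so it is
  measurable and inherits their common bound. Continuity is required of the single path, since it
  holds only almost surely.\<close>

lemma continuous_maximal_inequality:
  fixes X :: "real \<Rightarrow> 'w \<Rightarrow> 'b::euclidean_space"
  assumes T: "0 < T" and X: "\<And>t. 0 \<le> t \<Longrightarrow> X t \<in> borel_measurable (F t)" "\<And>t. 0 \<le> t \<Longrightarrow> sq_integrable M (X t)"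
    and orth: "\<And>s t \<xi>. 0 \<le> s \<Longrightarrow> s \<le> t \<Longrightarrow> \<xi> \<in> borel_measurable (F s) \<Longrightarrow> sq_integrable M \<xi> \<Longrightarrow>
      expectation (\<lambda>\<omega>. \<xi> \<omega> *\<^sub>R (X t \<omega> - X s \<omega>)) = 0"
    and v: "expectation (\<lambda>\<omega>. (norm (X T \<omega>))\<^sup>2) \<le> v" and e: "0 < e"
  obtains E where "E \<in> sets M" "e\<^sup>2 * prob E \<le> v"
    "\<And>\<omega> t. \<omega> \<in> space M - E \<Longrightarrow> continuous_on {0..T} (\<lambda>t. X t \<omega>) \<Longrightarrow> t \<in> {0..T} \<Longrightarrow> norm (X t \<omega>) \<le> e"
proof -
  define E where "E = (\<lambda>m. {\<omega>\<in>space M. \<exists>i\<le>2 ^ m. e < norm (X (real i * T / 2 ^ m) \<omega>)})"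
  have [measurable]: "X (real i * T / 2 ^ m) \<in> borel_measurable M" for i m :: nat
    using filtration_measurable[OF _ X(1)] T by simp
  have EM: "E m \<in> sets M" for m
    unfolding E_def by measurable
  have prob_E: "e\<^sup>2 * prob (E m) \<le> v" for m
  proof -
    \<comment> \<open>Grid times are frozen after index \<open>2 ^ m\<close>, since the discrete
      inequality expects a time for every natural number.\<close>
    define \<tau> where "\<tau> = (\<lambda>i. real (min i (2 ^ m)) * T / 2 ^ m)"
    have \<tau>: "0 \<le> \<tau> i" "i \<le> j \<Longrightarrow> \<tau> i \<le> \<tau> j" for i j
      using T by (auto simp: \<tau>_def intro!: divide_right_mono mult_right_mono)
    have "e\<^sup>2 * prob {\<omega>\<in>space M. \<exists>i\<le>2 ^ m. e < norm (X (\<tau> i) \<omega>)} \<le> expectation (\<lambda>\<omega>. (norm (X (\<tau> (2 ^ m)) \<omega>))\<^sup>2)"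
      by (rule maximal_inequality[OF \<tau>(1) X(1)[OF \<tau>(1)] X(2)[OF \<tau>(1)] \<tau>(2) orth[OF \<tau>(1) \<tau>(2)] e])
    moreover have "{\<omega>\<in>space M. \<exists>i\<le>2 ^ m. e < norm (X (\<tau> i) \<omega>)} = E m"
      unfolding E_def \<tau>_def by (intro Collect_cong conj_cong refl ex_cong) (auto simp: min_absorb1)
    moreover have "\<tau> (2 ^ m) = T" by (simp add: \<tau>_def)
    ultimately show ?thesis using v by simp
  qed
  have "E m \<subseteq> E (Suc m)" for m
  proof
    fix \<omega> assume "\<omega> \<in> E m"
    then obtain i where i: "\<omega> \<in> space M" "i \<le> 2 ^ m" "e < norm (X (real i * T / 2 ^ m) \<omega>)"
      by (auto simp: E_def)
    have "real (2 * i) * T / 2 ^ Suc m = real i * T / 2 ^ m" by simp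
    then have "e < norm (X (real (2 * i) * T / 2 ^ Suc m) \<omega>)" using i(3) by (simp only:)
    moreover have "2 * i \<le> 2 ^ Suc m" using i(2) by simp
    ultimately show "\<omega> \<in> E (Suc m)" using i(1) unfolding E_def by blast
  qed
  then have "incseq E" by (rule incseq_SucI)
  then have "(\<lambda>m. e\<^sup>2 * prob (E m)) \<longlonglongrightarrow> e\<^sup>2 * prob (\<Union>m. E m)"
    using EM by (intro tendsto_mult_left finite_Lim_measure_incseq) auto
  then have "e\<^sup>2 * prob (\<Union>m. E m) \<le> v"
    by (rule LIMSEQ_le_const2) (use prob_E in auto)
  moreover have "norm (X t \<omega>) \<le> e"
    if "\<omega> \<in> space M - (\<Union>m. E m)" "continuous_on {0..T} (\<lambda>t. X t \<omega>)" "t \<in> {0..T}" for \<omega> t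
  proof (rule dense_dyadic[OF T that(3,2)])
    fix m i :: nat assume "i \<le> 2 ^ m"
    then show "norm (X (real i * T / 2 ^ m) \<omega>) \<le> e"
      using that(1) by (auto simp: E_def not_less)
  qed
  ultimately show ?thesis using that[of "\<Union>m. E m"] EM by auto
qed

text \<open>Almost surely uniform convergence makes the limit continuous, and Fatou's lemma
  identifies it at each time with the mean-square limit of the stopped step integrals.\<close>

proposition continuous_wiener_integral_exists:
  fixes \<sigma> :: "real \<Rightarrow> 'b::euclidean_space"
  assumes \<sigma>: "\<sigma> \<in> borel_measurable borel" "\<And>t. norm (\<sigma> t) \<le> C" and T: "0 < T"
  obtains Z where "\<And>t. t \<in> {0..T} \<Longrightarrow> Z t \<in> borel_measurable (F t)"
    "\<And>t. t \<in> {0..T} \<Longrightarrow> is_wiener_integral M W t \<sigma> (Z t)"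
    "AE \<omega> in M. continuous_on {0..T} (\<lambda>t. Z t \<omega>)" "\<And>\<omega>. Z 0 \<omega> = 0"
proof -
  note \<sigma>(1)[measurable]
  \<comment> \<open>With squared errors of order \<open>(1 / 8) ^ j\<close> and levels
    \<open>(1 / 2) ^ j\<close>, the exceptional events have probability at most
    \<open>4 * (1 / 2) ^ j\<close>, which is summable.\<close>
  define \<epsilon> where "\<epsilon> = (\<lambda>j::nat. (1 / 8 :: real) ^ j)"
  have \<epsilon>0: "0 < \<epsilon> j" for j by (simp add: \<epsilon>_def)
  have "\<forall>j. \<exists>k p c. partition_upto k p T \<and>
    (\<integral>\<^sup>+s. ennreal ((norm (step_function k p c s - indicator {0..T} s *\<^sub>R \<sigma> s))\<^sup>2) \<partial>lborel) < ennreal (\<epsilon> j)"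
  proof
    fix j
    obtain k p c where "partition_upto k p T"
      "(\<integral>\<^sup>+s. ennreal ((norm (step_function k p c s - indicator {0..T} s *\<^sub>R \<sigma> s))\<^sup>2) \<partial>lborel) < ennreal (\<epsilon> j)"
      by (rule step_function_L2_approximation[OF \<sigma> T \<epsilon>0[of j]], rule that)
    then show "\<exists>k p c. partition_upto k p T \<and>
      (\<integral>\<^sup>+s. ennreal ((norm (step_function k p c s - indicator {0..T} s *\<^sub>R \<sigma> s))\<^sup>2) \<partial>lborel) < ennreal (\<epsilon> j)"
      by blast
  qed
  then obtain k p c where part: "\<And>j. partition_upto (k j) (p j) T" and
    app: "\<And>j. (\<integral>\<^sup>+s. ennreal ((norm (step_function (k j) (p j) (c j) s - indicator {0..T} s *\<^sub>R \<sigma> s))\<^sup>2) \<partial>lborel) < ennreal (\<epsilon> j)"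
    unfolding choice_iff by (elim exE) (rule that, auto)
  define I where "I = (\<lambda>j. running_integral (k j) (p j) (c j))"
  have IF: "0 \<le> t \<Longrightarrow> I j t \<in> borel_measurable (F t)" for j t
    unfolding I_def by (rule running_integral_measurable[OF part])
  have Isq: "0 \<le> t \<Longrightarrow> sq_integrable M (I j t)" for j t
    unfolding I_def by (rule sq_integrable_step_integral[OF partition_upto_min[OF part]])
  have IM [measurable]: "0 \<le> t \<Longrightarrow> I j t \<in> borel_measurable M" for j t
    by (rule sq_integrable_measurable[OF Isq])
  have Icont: "AE \<omega> in M. \<forall>j. continuous_on {0..T} (\<lambda>t. I j t \<omega>)"
    unfolding AE_all_countable
  proof
    fix j show "AE \<omega> in M. continuous_on {0..T} (\<lambda>t. I j t \<omega>)"
      using running_integral_continuous[OF part[of j], of "c j"] unfolding I_def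
      by (rule eventually_mono) (erule continuous_on_subset, auto)
  qed
  have dist: "(\<integral>\<^sup>+\<omega>. ennreal ((norm (I i t \<omega> - I j t \<omega>))\<^sup>2) \<partial>M) \<le> ennreal (4 * \<epsilon> j)" if "j \<le> i" "0 \<le> t" for i j t
  proof -
    let ?d = "\<lambda>j s. step_function (k j) (p j) (c j) s - indicator {0..T} s *\<^sub>R \<sigma> s"
    have "(\<integral>\<^sup>+\<omega>. ennreal ((norm (I i t \<omega> - I j t \<omega>))\<^sup>2) \<partial>M) \<le> (\<integral>\<^sup>+s. ennreal ((norm (?d i s - ?d j s))\<^sup>2) \<partial>lborel)"
      using running_integral_isometry[OF part part that(2)] by (simp add: I_def)
    also have "\<dots> \<le> 2 * (\<integral>\<^sup>+s. ennreal ((norm (?d i s))\<^sup>2) \<partial>lborel) + 2 * (\<integral>\<^sup>+s. ennreal ((norm (?d j s))\<^sup>2) \<partial>lborel)"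
      by (rule nn_integral_norm_diff_sq) measurable
    also have "\<dots> \<le> 2 * ennreal (\<epsilon> j) + 2 * ennreal (\<epsilon> j)"
    proof (intro add_mono mult_left_mono)
      have "\<epsilon> i \<le> \<epsilon> j" unfolding \<epsilon>_def using that(1) by (intro power_decreasing) auto
      then show "(\<integral>\<^sup>+s. ennreal ((norm (?d i s))\<^sup>2) \<partial>lborel) \<le> ennreal (\<epsilon> j)"
        using app[of i] by (meson ennreal_leI less_imp_le order_trans)
      show "(\<integral>\<^sup>+s. ennreal ((norm (?d j s))\<^sup>2) \<partial>lborel) \<le> ennreal (\<epsilon> j)"
        using app[of j] by (rule less_imp_le)
    qed auto
    also have "\<dots> = ennreal (4 * \<epsilon> j)"
      using \<epsilon>0[of j] by (simp add: ennreal_plus[symmetric] ennreal_mult[symmetric] ennreal_numeral[symmetric] del: ennreal_plus ennreal_numeral)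
    finally show ?thesis .
  qed
  have ex_E: "\<exists>E. E \<in> sets M \<and> ((1 / 2) ^ j)\<^sup>2 * prob E \<le> 4 * \<epsilon> j \<and>
    (\<forall>\<omega> t. \<omega> \<in> space M - E \<longrightarrow> continuous_on {0..T} (\<lambda>t. I (Suc j) t \<omega> - I j t \<omega>) \<longrightarrow> t \<in> {0..T} \<longrightarrow>
      norm (I (Suc j) t \<omega> - I j t \<omega>) \<le> (1 / 2) ^ j)" for j
  proof (rule continuous_maximal_inequality[OF T, of "\<lambda>t \<omega>. I (Suc j) t \<omega> - I j t \<omega>" "4 * \<epsilon> j" "(1 / 2) ^ j"])
    fix t :: real assume t: "0 \<le> t"
    show "(\<lambda>\<omega>. I (Suc j) t \<omega> - I j t \<omega>) \<in> borel_measurable (F t)" by (intro borel_measurable_diff IF t)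
    show "sq_integrable M (\<lambda>\<omega>. I (Suc j) t \<omega> - I j t \<omega>)" by (intro sq_integrable_diff Isq t)
  next
    fix s t :: real and \<xi> :: "'w \<Rightarrow> real"
    assume st: "0 \<le> s" "s \<le> t" and \<xi>: "\<xi> \<in> borel_measurable (F s)" "sq_integrable M \<xi>"
    have t: "0 \<le> t" using st by simp
    have i: "integrable M (\<lambda>\<omega>. \<xi> \<omega> *\<^sub>R (I j t \<omega> - I j s \<omega>))" for j
      by (intro integrable_scaleR_sq_integrable \<xi> sq_integrable_diff Isq t st)
    have "expectation (\<lambda>\<omega>. \<xi> \<omega> *\<^sub>R (I (Suc j) t \<omega> - I j t \<omega> - (I (Suc j) s \<omega> - I j s \<omega>))) =
        expectation (\<lambda>\<omega>. \<xi> \<omega> *\<^sub>R (I (Suc j) t \<omega> - I (Suc j) s \<omega>) - \<xi> \<omega> *\<^sub>R (I j t \<omega> - I j s \<omega>))"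
      by (simp add: algebra_simps)
    also have "\<dots> = 0"
      unfolding Bochner_Integration.integral_diff[OF i i]
      by (simp add: I_def running_integral_orthogonal[OF part st \<xi>])
    finally show "expectation (\<lambda>\<omega>. \<xi> \<omega> *\<^sub>R (I (Suc j) t \<omega> - I j t \<omega> - (I (Suc j) s \<omega> - I j s \<omega>))) = 0" .
  next
    have "ennreal (expectation (\<lambda>\<omega>. (norm (I (Suc j) T \<omega> - I j T \<omega>))\<^sup>2)) =
        (\<integral>\<^sup>+\<omega>. ennreal ((norm (I (Suc j) T \<omega> - I j T \<omega>))\<^sup>2) \<partial>M)"
      using sq_integrable_diff[OF Isq Isq, of T T "Suc j" j] T
      by (intro nn_integral_eq_integral[symmetric]) (auto simp: sq_integrable_def)
    also have "\<dots> \<le> ennreal (4 * \<epsilon> j)" using dist[of j "Suc j" T] T by simp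
    finally show "expectation (\<lambda>\<omega>. (norm (I (Suc j) T \<omega> - I j T \<omega>))\<^sup>2) \<le> 4 * \<epsilon> j"
      by (rule ennreal_le_iff[THEN iffD1, rotated]) (use \<epsilon>0[of j] in simp)
  qed (simp, blast)
  from choice[OF allI[OF ex_E]] obtain E where E': "\<forall>j. E j \<in> sets M \<and> ((1 / 2) ^ j)\<^sup>2 * prob (E j) \<le> 4 * \<epsilon> j \<and>
    (\<forall>\<omega> t. \<omega> \<in> space M - E j \<longrightarrow> continuous_on {0..T} (\<lambda>t. I (Suc j) t \<omega> - I j t \<omega>) \<longrightarrow> t \<in> {0..T} \<longrightarrow>
      norm (I (Suc j) t \<omega> - I j t \<omega>) \<le> (1 / 2) ^ j)"
    by (rule exE)
  have E: "E j \<in> sets M" "((1 / 2) ^ j)\<^sup>2 * prob (E j) \<le> 4 * \<epsilon> j" for j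
    using E' by blast+
  have small: "norm (I (Suc j) t \<omega> - I j t \<omega>) \<le> (1 / 2) ^ j"
    if "\<omega> \<in> space M - E j" "continuous_on {0..T} (\<lambda>t. I (Suc j) t \<omega> - I j t \<omega>)" "t \<in> {0..T}" for j \<omega> t
    using E' that by blast
  have "prob (E j) \<le> 4 * (1 / 2) ^ j" for j
  proof -
    have "4 * \<epsilon> j = ((1 / 2) ^ j)\<^sup>2 * (4 * (1 / 2) ^ j)"
      by (simp add: \<epsilon>_def power2_eq_square power_mult_distrib[symmetric])
    then show ?thesis using E(2)[of j] by (simp only: mult_le_cancel_left_pos zero_less_power half_gt_zero_iff zero_less_one zero_less_divide_1_iff zero_less_numeral)
  qed
  then have "summable (\<lambda>j. prob (E j))"
    by (intro summable_comparison_test'[OF summable_mult[OF summable_geometric, of "1 / 2" 4]]) auto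
  then have BC: "AE \<omega> in M. eventually (\<lambda>j. \<omega> \<in> space M - E j) sequentially"
    by (intro borel_cantelli_AE1 E) (auto simp: less_top[symmetric])
  \<comment> \<open>\<open>lim\<close> is taken for every outcome, with an unspecified value where
    there is no convergence. This keeps \<open>Z t\<close> measurable over \<open>F t\<close>
    although convergence is only almost sure.\<close>
  define Z where "Z = (\<lambda>t \<omega>. lim (\<lambda>j. I j t \<omega>))"
  have unif: "AE \<omega> in M. uniform_limit {0..T} (\<lambda>j t. I j t \<omega>) (\<lambda>t. Z t \<omega>) sequentially"
    using BC Icont
  proof eventually_elim
    case (elim \<omega>)
    \<comment> \<open>The estimate holds from an index on that depends on the outcome, hence the
      Weierstrass test with an eventual bound.\<close>
    from elim(1) have "eventually (\<lambda>j. \<forall>t\<in>{0..T}. norm (I (Suc j) t \<omega> - I j t \<omega>) \<le> (1 / 2) ^ j) sequentially"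
      by (rule eventually_mono) (intro ballI small, use elim(2) in \<open>auto intro!: continuous_intros\<close>)
    moreover have tel: "(\<Sum>i<n. I (Suc i) t \<omega> - I i t \<omega>) = I n t \<omega> - I 0 t \<omega>" for n t
      by (rule sum_lessThan_telescope)
    ultimately have "uniform_limit {0..T} (\<lambda>n t. \<Sum>i<n. I (Suc i) t \<omega> - I i t \<omega>)
        (\<lambda>t. suminf (\<lambda>i. I (Suc i) t \<omega> - I i t \<omega>)) sequentially"
      by (intro Weierstrass_m_test_ev) (auto intro: summable_geometric)
    then have "uniform_limit {0..T} (\<lambda>n t. (I n t \<omega> - I 0 t \<omega>) + I 0 t \<omega>)
        (\<lambda>t. suminf (\<lambda>i. I (Suc i) t \<omega> - I i t \<omega>) + I 0 t \<omega>) sequentially"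
      unfolding tel by (intro uniform_limit_intros)
    then have u: "uniform_limit {0..T} (\<lambda>n t. I n t \<omega>)
        (\<lambda>t. suminf (\<lambda>i. I (Suc i) t \<omega> - I i t \<omega>) + I 0 t \<omega>) sequentially" by simp
    have eqZ: "Z t \<omega> = suminf (\<lambda>i. I (Suc i) t \<omega> - I i t \<omega>) + I 0 t \<omega>" if "t \<in> {0..T}" for t
      unfolding Z_def by (rule limI) (rule tendsto_uniform_limitI[OF u that])
    show ?case using u by (simp add: uniform_limit_iff eqZ)
  qed
  have ZF: "Z t \<in> borel_measurable (F t)" if "0 \<le> t" for t
    unfolding Z_def by (intro borel_measurable_lim_metric IF that)
  show thesis
  proof
    show "Z t \<in> borel_measurable (F t)" if "t \<in> {0..T}" for t using ZF that by simp
    show "Z 0 \<omega> = 0" for \<omega>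
      by (simp add: Z_def I_def running_integral_0[OF part])
    show "AE \<omega> in M. continuous_on {0..T} (\<lambda>t. Z t \<omega>)"
      using unif Icont
      by eventually_elim (rule uniform_limit_theorem, auto)
    fix t assume t: "t \<in> {0..T}"
    then have t0: "0 \<le> t" by simp
    have ZM [measurable]: "Z t \<in> borel_measurable M" by (rule filtration_measurable[OF t0 ZF[OF t0]])
    have Zlim: "AE \<omega> in M. (\<lambda>j. I j t \<omega>) \<longlonglongrightarrow> Z t \<omega>"
      using unif by eventually_elim (rule tendsto_uniform_limitI[OF _ t])
    have \<epsilon>_lim: "(\<lambda>j. ennreal (4 * \<epsilon> j)) \<longlonglongrightarrow> 0"
    proof -
      have "(\<lambda>j. 4 * \<epsilon> j) \<longlonglongrightarrow> 4 * 0"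
        unfolding \<epsilon>_def by (intro tendsto_intros LIMSEQ_realpow_zero) auto
      then show ?thesis using tendsto_ennrealI by fastforce
    qed
    have fatou: "(\<integral>\<^sup>+\<omega>. ennreal ((norm (I j t \<omega> - Z t \<omega>))\<^sup>2) \<partial>M) \<le> ennreal (4 * \<epsilon> j)" for j
    proof -
      have "AE \<omega> in M. liminf (\<lambda>i. ennreal ((norm (I i t \<omega> - I j t \<omega>))\<^sup>2)) = ennreal ((norm (I j t \<omega> - Z t \<omega>))\<^sup>2)"
        using Zlim
      proof eventually_elim
        case (elim \<omega>)
        then have "(\<lambda>i. ennreal ((norm (I i t \<omega> - I j t \<omega>))\<^sup>2)) \<longlonglongrightarrow> ennreal ((norm (Z t \<omega> - I j t \<omega>))\<^sup>2)"
          by (intro tendsto_ennrealI tendsto_intros)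
        then show ?case
          unfolding norm_minus_commute[of "I j t \<omega>" "Z t \<omega>"] by (rule lim_imp_Liminf[OF sequentially_bot])
      qed
      then have "(\<integral>\<^sup>+\<omega>. ennreal ((norm (I j t \<omega> - Z t \<omega>))\<^sup>2) \<partial>M) =
          (\<integral>\<^sup>+\<omega>. liminf (\<lambda>i. ennreal ((norm (I i t \<omega> - I j t \<omega>))\<^sup>2)) \<partial>M)"
        by (intro nn_integral_cong_AE) (erule eventually_mono, simp)
      also have "\<dots> \<le> liminf (\<lambda>i. \<integral>\<^sup>+\<omega>. ennreal ((norm (I i t \<omega> - I j t \<omega>))\<^sup>2) \<partial>M)"
        using t0 by (intro nn_integral_liminf) measurable
      also have "\<dots> \<le> limsup (\<lambda>i. \<integral>\<^sup>+\<omega>. ennreal ((norm (I i t \<omega> - I j t \<omega>))\<^sup>2) \<partial>M)"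
        by (rule Liminf_le_Limsup) simp
      also have "\<dots> \<le> ennreal (4 * \<epsilon> j)"
        by (rule Limsup_bounded) (use dist[OF _ t0] in \<open>auto simp: eventually_sequentially\<close>)
      finally show ?thesis .
    qed
    show "is_wiener_integral M W t \<sigma> (Z t)"
      unfolding is_wiener_integral_def
    proof (intro conjI exI[of _ k] exI[of _ "\<lambda>j i. min t (p j i)"] exI[of _ c] allI ZM)
      fix j
      show "mono_on {..k j} (\<lambda>i. min t (p j i))" "(\<lambda>i. min t (p j i)) ` {..k j} \<subseteq> {0..t}"
        using partition_upto_min[OF part t0, of j] by (auto simp: partition_upto_def)
    next
      have "(\<integral>\<^sup>+s\<in>{0..t}. ennreal ((norm (step_function (k j) (\<lambda>i. min t (p j i)) (c j) s - \<sigma> s))\<^sup>2) \<partial>lborel)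
          \<le> ennreal (4 * \<epsilon> j)" for j
      proof -
        have "(\<integral>\<^sup>+s\<in>{0..t}. ennreal ((norm (step_function (k j) (\<lambda>i. min t (p j i)) (c j) s - \<sigma> s))\<^sup>2) \<partial>lborel)
            \<le> (\<integral>\<^sup>+s. ennreal ((norm (step_function (k j) (p j) (c j) s - indicator {0..T} s *\<^sub>R \<sigma> s))\<^sup>2) \<partial>lborel)"
          unfolding step_function_min using t by (intro nn_integral_mono) (auto simp: indicator_def)
        also have "\<dots> \<le> ennreal (\<epsilon> j)" using app[of j] by (rule less_imp_le)
        also have "\<dots> \<le> ennreal (4 * \<epsilon> j)" using \<epsilon>0[of j] by (intro ennreal_leI) simp
        finally show ?thesis .
      qed
      then show "(\<lambda>j. \<integral>\<^sup>+s\<in>{0..t}. ennreal ((norm (step_function (k j) (\<lambda>i. min t (p j i)) (c j) s - \<sigma> s))\<^sup>2) \<partial>lborel) \<longlonglongrightarrow> 0"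
        by (intro tendsto_sandwich[OF _ _ tendsto_const \<epsilon>_lim]) auto
      show "(\<lambda>j. \<integral>\<^sup>+\<omega>. ennreal ((norm (step_integral W (k j) (\<lambda>i. min t (p j i)) (c j) \<omega> - Z t \<omega>))\<^sup>2) \<partial>M) \<longlonglongrightarrow> 0"
        using fatou unfolding I_def by (intro tendsto_sandwich[OF _ _ tendsto_const \<epsilon>_lim]) auto
    qed
  qed
qed

text \<open>An adapted process with continuous paths almost surely agrees with the limit of its left
  dyadic samples, which is progressively measurable even if the filtration is not complete.\<close>

lemma progressive_modification:
  fixes Z :: "real \<Rightarrow> 'w \<Rightarrow> 'b::euclidean_space"
  assumes Z: "\<And>t. t \<in> {0..T} \<Longrightarrow> Z t \<in> borel_measurable (F t)"
    and c: "AE \<omega> in M. continuous_on {0..T} (\<lambda>t. Z t \<omega>)" and T: "0 < T"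
  obtains Z' where "\<And>t. t \<in> {0..T} \<Longrightarrow> joint_measurable (F t) (truncate_time t Z')"
    "AE \<omega> in M. \<forall>t\<in>{0..T}. Z' t \<omega> = Z t \<omega>" "\<And>t. t \<notin> {0..T} \<Longrightarrow> Z' t = (\<lambda>_. 0)"
proof
  \<comment> \<open>Rounding down, so that a sample never looks ahead of \<open>t\<close>.\<close>
  define q :: "nat \<Rightarrow> real \<Rightarrow> real" where "q = (\<lambda>k t. real_of_int \<lfloor>t * 2 ^ k\<rfloor> / 2 ^ k)"
  define Z' where "Z' = truncate_time T (\<lambda>t \<omega>. lim (\<lambda>k. Z (q k t) \<omega>))"
  have q: "q k t \<le> t" "t - (1 / 2) ^ k \<le> q k t" "0 \<le> t \<Longrightarrow> 0 \<le> q k t" for k t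
  proof -
    have r: "real_of_int \<lfloor>t * 2 ^ k\<rfloor> \<le> t * 2 ^ k" "t * 2 ^ k < real_of_int \<lfloor>t * 2 ^ k\<rfloor> + 1"
      by linarith+
    then have "t < (real_of_int \<lfloor>t * 2 ^ k\<rfloor> + 1) / 2 ^ k" by (simp add: pos_less_divide_eq)
    then show "t - (1 / 2) ^ k \<le> q k t" by (simp add: q_def add_divide_distrib power_one_over)
    show "q k t \<le> t" using r(1) by (simp add: q_def field_simps)
    show "0 \<le> t \<Longrightarrow> 0 \<le> q k t" by (simp add: q_def)
  qed
  show "Z' t = (\<lambda>_. 0)" if "t \<notin> {0..T}" for t using that by (auto simp: Z'_def truncate_time_def)
  show "AE \<omega> in M. \<forall>t\<in>{0..T}. Z' t \<omega> = Z t \<omega>"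
    using c
  proof eventually_elim
    case (elim \<omega>)
    show ?case
    proof
      fix t assume t: "t \<in> {0..T}"
      have "(\<lambda>k. t - (1 / 2) ^ k) \<longlonglongrightarrow> t - 0"
        by (intro tendsto_intros LIMSEQ_realpow_zero) auto
      then have "(\<lambda>k. q k t) \<longlonglongrightarrow> t"
        by (intro tendsto_sandwich[of _ "\<lambda>k. q k t" sequentially "\<lambda>_. t"]) (use q in auto)
      then have "(\<lambda>k. Z (q k t) \<omega>) \<longlonglongrightarrow> Z t \<omega>"
        using q t order_trans[OF q(1)] by (intro continuous_on_tendsto_compose[OF elim]) auto
      then show "Z' t \<omega> = Z t \<omega>" using t by (simp add: Z'_def truncate_time_def limI)
    qed
  qed
  fix t assume t: "t \<in> {0..T}"
  \<comment> \<open>The guards keep the sampled time inside \<open>[0, t]\<close>, so each of the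
    countably many branches is measurable over \<open>F t\<close>; for times in
    \<open>[0, t]\<close> the branch selected by the floor satisfies them.\<close>
  define g where "g = (\<lambda>k (i::int) (w :: real \<times> 'w).
    if fst w \<in> {0..t} \<and> real_of_int i / 2 ^ k \<in> {0..t} then Z (real_of_int i / 2 ^ k) (snd w) else 0)"
  have gm: "(\<lambda>w. g k i w) \<in> borel_measurable (borel \<Otimes>\<^sub>M F t)" for k i
  proof (cases "real_of_int i / 2 ^ k \<in> {0..t}")
    case True
    then have "Z (real_of_int i / 2 ^ k) \<in> borel_measurable (F t)"
      using t by (intro filtration_measurable_mono[OF _ _ Z]) auto
    then have [measurable]: "(\<lambda>w. Z (real_of_int i / 2 ^ k) (snd w)) \<in> borel_measurable ((borel :: real measure) \<Otimes>\<^sub>M F t)"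
      by (rule measurable_compose[OF measurable_snd])
    have "(\<lambda>w. if fst w \<in> {0..t} then Z (real_of_int i / 2 ^ k) (snd w) else 0) \<in> borel_measurable (borel \<Otimes>\<^sub>M F t)"
      by measurable
    then show ?thesis using True by (simp add: g_def)
  next
    case False
    then have "g k i = (\<lambda>_. 0)" by (auto simp: g_def)
    then show ?thesis by simp
  qed
  have fl: "(\<lambda>w. \<lfloor>fst w * (2 :: real) ^ k\<rfloor>) \<in> borel \<Otimes>\<^sub>M F t \<rightarrow>\<^sub>M count_space UNIV" for k :: nat
    by measurable
  have "(\<lambda>w. lim (\<lambda>k. g k \<lfloor>fst w * 2 ^ k\<rfloor> w)) \<in> borel_measurable (borel \<Otimes>\<^sub>M F t)"
    by (intro borel_measurable_lim_metric measurable_compose_countable[OF gm fl])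
  moreover have "truncate_time t Z' (fst w) (snd w) = lim (\<lambda>k. g k \<lfloor>fst w * 2 ^ k\<rfloor> w)" for w
  proof (cases "fst w \<in> {0..t}")
    case True
    have "q k (fst w) \<in> {0..t}" for k
    proof -
      have "q k (fst w) \<le> fst w" "0 \<le> fst w \<Longrightarrow> 0 \<le> q k (fst w)" by (rule q)+
      then show ?thesis using True by auto
    qed
    then have "g k \<lfloor>fst w * 2 ^ k\<rfloor> w = Z (q k (fst w)) (snd w)" for k
      using True by (simp add: g_def q_def)
    then show ?thesis using True t by (simp add: Z'_def truncate_time_def)
  qed (auto simp: g_def truncate_time_def)
  ultimately show "joint_measurable (F t) (truncate_time t Z')"
    by (simp add: joint_measurable_def case_prod_unfold)
qed

end

section \<open>Closing the loop\<close>

lemma joint_measurable_cong_sets: "sets N = sets N' \<Longrightarrow> joint_measurable N V \<longleftrightarrow> joint_measurable N' V"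
  unfolding joint_measurable_def
  by (intro arg_cong[where f = "\<lambda>S. _ \<in> S"] measurable_cong_sets sets_pair_measure_cong refl)

text \<open>The modification vanishes outside \<open>[0, T]\<close>, so truncation at
  \<open>T\<close> leaves it unchanged, and its measurability over \<open>F T\<close> gives joint
  measurability over \<open>M\<close>.\<close>

lemma (in delay_system) progressive_noise_exists:
  obtains Z where "wiener_noise Z" "\<And>t. t \<in> {0..T} \<Longrightarrow> joint_measurable (F t) (truncate_time t Z)"
proof -
  have T: "0 < T" using times by simp
  obtain Z1 where Z1: "\<And>t. t \<in> {0..T} \<Longrightarrow> Z1 t \<in> borel_measurable (F t)"
    "\<And>t. t \<in> {0..T} \<Longrightarrow> is_wiener_integral M W t \<sigma> (Z1 t)"
    "AE \<omega> in M. continuous_on {0..T} (\<lambda>t. Z1 t \<omega>)" "\<And>\<omega>. Z1 0 \<omega> = 0"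
    by (rule continuous_wiener_integral_exists[OF \<sigma>(1,2) T]) blast
  obtain Z where Z: "\<And>t. t \<in> {0..T} \<Longrightarrow> joint_measurable (F t) (truncate_time t Z)"
    "AE \<omega> in M. \<forall>t\<in>{0..T}. Z t \<omega> = Z1 t \<omega>" "\<And>t. t \<notin> {0..T} \<Longrightarrow> Z t = (\<lambda>_. 0)"
    by (rule progressive_modification[OF Z1(1,3) T], assumption, rule that)
  have ZT: "truncate_time T Z = Z"
    using Z(3) by (fastforce simp: truncate_time_def fun_eq_iff)
  have jZ: "joint_measurable M Z"
  proof -
    have "(\<lambda>w. (fst w, snd w)) \<in> borel \<Otimes>\<^sub>M M \<rightarrow>\<^sub>M borel \<Otimes>\<^sub>M F T"
      by (intro measurable_Pair measurable_fst
          measurable_compose[OF measurable_snd filtration_measurable[OF T_nonneg measurable_ident_sets[OF refl]]])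
    from measurable_compose[OF this Z(1)[of T, unfolded joint_measurable_def]] T_nonneg
    show ?thesis by (simp add: joint_measurable_def ZT case_prod_unfold)
  qed
  have "wiener_noise Z"
    unfolding wiener_noise_def
  proof (intro conjI ballI jZ)
    fix t assume t: "t \<in> {0..T}"
    have "AE \<omega> in M. Z1 t \<omega> = Z t \<omega>"
      using Z(2) by eventually_elim (use t in auto)
    then show "is_wiener_integral M W t \<sigma> (Z t)"
      by (rule is_wiener_integral_cong[OF Z1(2)[OF t] joint_measurable_section[OF jZ]])
  next
    show "AE \<omega> in M. continuous_on {0..T} (\<lambda>t. Z t \<omega>) \<and> Z 0 \<omega> = 0"
      using Z1(3) Z(2)
    proof eventually_elim
      case (elim \<omega>)
      have "continuous_on {0..T} (\<lambda>t. Z t \<omega>)"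
        by (rule continuous_on_eq[OF elim(1)]) (use elim(2) in auto)
      then show ?case using elim(2) Z1(4) T_nonneg by auto
    qed
  qed
  then show ?thesis using that Z(1) by blast
qed

section \<open>The linear feedback loop and existence of an optimal control\<close>

context lq_system
begin

text \<open>Inserting the feedback into the equation for the control path gives a linear equation
  with coefficient \<open>\<Gamma> = - \<beta> L\<close>, forced by the noise, and variation of
  constants solves it with the flow \<open>\<Psi>\<close> and its inverse \<open>\<Xi>\<close>. As
  an explicit formula in the noise the solution is measurable and square integrable; evaluated over
  \<open>F t\<close> it is adapted.\<close>

proposition closed_loop_exists:
  fixes L :: "real \<Rightarrow> real^'n^'m"
  assumes L: "L \<in> borel_measurable borel" "\<And>t. norm (L t) \<le> D"
  obtains U X Z where "admissible M F W T h A0 B0 \<sigma>0 U X" "adapted_on F T X"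
    "AE \<omega> in M. \<forall>t\<in>{0..T}. artstein T h A0 B0 U X t \<omega> = \<Phi> t *v (noise Z t \<omega> + control U t \<omega>) \<and>
      U t \<omega> = - (L t *v (noise Z t \<omega> + control U t \<omega>))"
proof -
  note L(1)[measurable]
  obtain Z where Z: "wiener_noise Z" "\<And>t. t \<in> {0..T} \<Longrightarrow> joint_measurable (F t) (truncate_time t Z)"
    by (rule progressive_noise_exists) blast
  have jZ: "joint_measurable M Z" using Z(1) by (simp add: wiener_noise_def)
  obtain E where E: "\<And>t. norm (\<beta> t) \<le> E" by (rule \<beta>_bounded) blast
  define \<Gamma> where "\<Gamma> = (\<lambda>t. - (\<beta> t ** L t))"
  have \<Gamma>m [measurable]: "\<Gamma> \<in> borel_measurable borel" unfolding \<Gamma>_def by measurable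
  obtain D' where D': "\<And>s t. norm (\<beta> s ** L t) \<le> D'"
    using matrix_bound_mult[of \<beta> E L D, OF E L(2)] by blast
  have \<Gamma>b: "norm (\<Gamma> t) \<le> D'" for t using D' by (simp add: \<Gamma>_def)
  obtain \<Psi> \<Xi> :: "real \<Rightarrow> real^'n^'n" and K where \<Psi>: "primitive_on 0 T (\<lambda>r. \<Gamma> r ** \<Psi> r) \<Psi>" and inv: "\<And>t. \<Psi> t ** \<Xi> t = mat 1"
    and \<Psi>': "continuous_on UNIV \<Psi>" "\<And>t. norm (\<Psi> t) \<le> K" and \<Xi>: "continuous_on UNIV \<Xi>" "\<And>t. norm (\<Xi> t) \<le> K"
    by (rule fundamental_pair_exists[OF \<Gamma>m \<Gamma>b T_nonneg]) blast
  have [measurable]: "\<Psi> \<in> borel_measurable borel" "\<Xi> \<in> borel_measurable borel"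
    using \<Psi>'(1) \<Xi>(1) by (auto intro: borel_measurable_continuous_onI)
  obtain K' where K': "\<And>s t. norm (\<Xi> s ** \<Gamma> t) \<le> K'"
    using matrix_bound_mult[of \<Xi> K \<Gamma> D', OF \<Xi>(2) \<Gamma>b] by blast
  \<comment> \<open>\<open>c\<close>, \<open>V\<close> and \<open>x\<close> take the driving process
    as an argument because they are evaluated both at \<open>Z\<close> and at \<open>Z\<close>
    truncated at time \<open>t\<close>.\<close>
  define c :: "(real \<Rightarrow> 'w \<Rightarrow> real^'n) \<Rightarrow> real \<Rightarrow> 'w \<Rightarrow> real^'n"
    where "c = (\<lambda>Z t \<omega>. \<Psi> t *v (LBINT s:{0..t}. (\<Xi> s ** \<Gamma> s) *v noise Z s \<omega>))"
  define V :: "(real \<Rightarrow> 'w \<Rightarrow> real^'n) \<Rightarrow> real \<Rightarrow> 'w \<Rightarrow> real^'m"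
    where "V = (\<lambda>Z t \<omega>. (- L t) *v (noise Z t \<omega> + c Z t \<omega>))"
  define x :: "(real \<Rightarrow> 'w \<Rightarrow> real^'n) \<Rightarrow> real \<Rightarrow> 'w \<Rightarrow> real^'n"
    where "x = (\<lambda>Z t \<omega>. \<Phi> t *v (noise Z t \<omega> + (LBINT s:{0..t - h}. \<beta> s *v V Z s \<omega>)))"
  have jV: "joint_measurable N (V Z1)" and jx: "joint_measurable N (x Z1)"
    if Z1: "joint_measurable N Z1" and N: "sigma_finite_measure N" for N Z1
  proof -
    have n: "joint_measurable N (noise Z1)"
      unfolding noise_def noise_path_def
      by (intro joint_measurable_add joint_measurable_matrix joint_measurable_integral N Z1) measurable
    have "joint_measurable N (c Z1)"
      unfolding c_def by (intro joint_measurable_matrix joint_measurable_integral N n) measurable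
    then show V: "joint_measurable N (V Z1)"
      unfolding V_def using n by (intro joint_measurable_add joint_measurable_matrix) measurable
    show "joint_measurable N (x Z1)"
      unfolding x_def
      by (intro joint_measurable_add joint_measurable_matrix joint_measurable_integral_between N n V) measurable
  qed
  have V_cong: "V (truncate_time t Z) s \<omega> = V Z s \<omega>" if "s \<in> {0..t}" for s t \<omega>
  proof -
    have n: "noise (truncate_time t Z) r \<omega> = noise Z r \<omega>" if "r \<in> {0..s}" for r
      using that \<open>s \<in> {0..t}\<close> by (intro noise_cong) (auto simp: truncate_time_def)
    have "c (truncate_time t Z) s \<omega> = c Z s \<omega>"
      unfolding c_def by (intro arg_cong[where f = "(*v) _"] set_lebesgue_integral_cong) (auto simp: n)
    then show ?thesis using n[of s] that by (simp add: V_def)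
  qed
  have x_cong: "x (truncate_time t Z) t \<omega> = x Z t \<omega>" if "0 \<le> t" for t \<omega>
  proof -
    have "noise (truncate_time t Z) t \<omega> = noise Z t \<omega>"
      using that by (intro noise_cong) (auto simp: truncate_time_def)
    moreover have "(LBINT s:{0..t - h}. \<beta> s *v V (truncate_time t Z) s \<omega>) = (LBINT s:{0..t - h}. \<beta> s *v V Z s \<omega>)"
      by (intro set_lebesgue_integral_cong) (use V_cong times in auto)
    ultimately show ?thesis by (simp add: x_def)
  qed
  have Va: "V Z t \<in> borel_measurable (F t)" and xa: "x Z t \<in> borel_measurable (F t)" if t: "t \<in> {0..T}" for t
  proof -
    \<comment> \<open>The image of the measure under the identity is a probability measure on
      \<open>F t\<close>. Applying the measurability results to it instead of \<open>M\<close> gives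
      measurability over \<open>F t\<close>, and truncating the noise at \<open>t\<close> does not
      change the values at time \<open>t\<close>.\<close>
    define N where "N = distr M (F t) (\<lambda>x. x)"
    have t0: "0 \<le> t" using t by simp
    interpret N: prob_space N
      unfolding N_def by (rule prob_space_distr) (rule filtration_measurable[OF t0 measurable_ident_sets[OF refl]])
    have sets_N: "sets N = sets (F t)" by (simp add: N_def)
    have Zt: "joint_measurable N (truncate_time t Z)"
      using Z(2)[OF t] joint_measurable_cong_sets[OF sets_N] by blast
    have sf: "sigma_finite_measure N" ..
    have "V (truncate_time t Z) t = V Z t" "x (truncate_time t Z) t = x Z t"
      using V_cong x_cong t by (auto simp: fun_eq_iff)
    then show "V Z t \<in> borel_measurable (F t)" "x Z t \<in> borel_measurable (F t)"
      using joint_measurable_section[OF jV[OF Zt sf], of t] joint_measurable_section[OF jx[OF Zt sf], of t]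
        measurable_cong_sets[OF sets_N refl] by auto
  qed
  have sf: "sigma_finite_measure M" ..
  note n2 = uniform_l2_noise[OF Z(1)]
  have q2: "l2_process M T (\<lambda>s \<omega>. (\<Xi> s ** \<Gamma> s) *v noise Z s \<omega>)"
    by (rule l2_process_matrix[OF _ K' uniform_l2_process_l2[OF n2]]) measurable
  have "uniform_l2_process M T (c Z)"
    unfolding c_def by (rule uniform_l2_process_matrix[OF _ \<Psi>'(2) uniform_l2_process_integral[OF q2 T_nonneg]]) measurable
  then have V2: "l2_process M T (V Z)"
    unfolding V_def
    by (intro uniform_l2_process_l2 uniform_l2_process_matrix[of _ D] uniform_l2_process_add n2) (use L(2) in auto)
  \<comment> \<open>The formula for \<open>V\<close> does not vanish at negative times by itself, so
    the convention on \<open>[-h, 0)\<close> is imposed here.\<close>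
  define U where "U = (\<lambda>t \<omega>. if t < 0 then 0 else V Z t \<omega>)"
  define X where "X = x Z"
  have UV: "U t \<omega> = V Z t \<omega>" if "0 \<le> t" for t \<omega> using that by (simp add: U_def)
  have U0: "U s \<omega> = 0" if "s \<in> {-h..<0}" for s \<omega> using that by (simp add: U_def)
  have tU: "truncate_time T U s \<omega> = V Z s \<omega>" if "s \<in> {0..T}" for s \<omega>
    using that by (simp add: truncate_time_def U_def)
  have Um: "measurable_process M T U"
    by (rule measurable_process_joint[OF jV[OF jZ sf]]) (simp add: UV)
  have Xm: "measurable_process M T X"
    unfolding X_def by (rule measurable_process_joint[OF jx[OF jZ sf]]) simp
  have L2: "L2_adapted M F T U"
    unfolding L2_adapted_def
  proof (intro conjI Um)
    have "U t = V Z t" if "0 \<le> t" for t using UV[OF that] by auto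
    then show "adapted_on F T U" using Va by (auto simp: adapted_on_def)
    have "(\<integral>\<^sup>+t\<in>{0..T}. ennreal ((norm (U t \<omega>))\<^sup>2) \<partial>lborel) = (\<integral>\<^sup>+t\<in>{0..T}. ennreal ((norm (V Z t \<omega>))\<^sup>2) \<partial>lborel)" for \<omega>
      by (intro nn_integral_cong) (auto simp: UV indicator_def)
    then show "(\<integral>\<^sup>+\<omega>. (\<integral>\<^sup>+t\<in>{0..T}. ennreal ((norm (U t \<omega>))\<^sup>2) \<partial>lborel) \<partial>M) < \<infinity>"
      using V2 by (simp add: l2_process_def)
  qed
  note U2 = L2_adapted_l2_process[OF L2 T_nonneg]
  have Xf: "X t \<omega> = \<Phi> t *v (noise Z t \<omega> + control U (t - h) \<omega>)" if "t \<in> {0..T}" for t \<omega>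
  proof -
    have "(LBINT s:{0..t - h}. \<beta> s *v V Z s \<omega>) = control U (t - h) \<omega>"
      unfolding control_eq by (intro set_lebesgue_integral_cong) (use that times tU in auto)
    then show ?thesis by (simp add: X_def x_def)
  qed
  have sde: "solves_sde M W T (\<lambda>t \<omega>. state_drift U X t \<omega>) \<sigma>0 X"
  proof (rule solves_sdeI[OF Z(1) Xm])
    fix t assume t: "t \<in> {0..T}"
    have "joint_measurable M (\<lambda>t \<omega>. LBINT s:{0..t}. drift U X s \<omega>)"
      by (rule joint_measurable_integral[OF sf joint_measurable_drift[OF Um Xm]])
    from joint_measurable_section[OF this, of t]
    show "(\<lambda>\<omega>. LBINT s=ereal 0..ereal t. state_drift U X s \<omega>) \<in> borel_measurable M"
      using state_drift_eq(1)[OF Um U0 Xm _ t] by (simp cong: measurable_cong)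
  next
    have T: "T \<in> {0..T}" using T_nonneg by simp
    show "AE \<omega> in M. primitive_on 0 T ((\<lambda>\<omega> s. \<beta> (s - h) *v truncate_time T U (s - h) \<omega>) \<omega>)
        ((\<lambda>\<omega> t. control U (t - h) \<omega>) \<omega>) \<and> (\<lambda>\<omega> t. control U (t - h) \<omega>) \<omega> 0 = 0 \<and>
      (\<forall>t\<in>{0..T}. X t \<omega> = \<Phi> t *v (noise_path (\<lambda>s. Z s \<omega>) t + (\<lambda>\<omega> t. control U (t - h) \<omega>) \<omega> t)) \<and>
      set_borel_measurable lborel {0..T} (\<lambda>s. state_drift U X s \<omega>) \<and>
      (AE s in lborel. s \<in> {0..T} \<longrightarrow> state_drift U X s \<omega> =
        A s *v X s \<omega> + \<Phi> s *v (\<lambda>\<omega> s. \<beta> (s - h) *v truncate_time T U (s - h) \<omega>) \<omega> s)"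
      using control_path_integrable[OF U2] AE_space
    proof eventually_elim
      case (elim \<omega>)
      have "primitive_on 0 T (\<lambda>s. \<beta> (s - h) *v truncate_time T U (s - h) \<omega>) (\<lambda>t. control U (t - h) \<omega>)"
        unfolding control_def
        by (rule control_path_delayed_primitive[OF elim(1)]) (auto simp: truncate_time_def)
      moreover have "control U (0 - h) \<omega> = 0"
        unfolding control_def by (rule control_path_nonpos) (use times in simp)
      moreover have "\<Phi> s *v (\<beta> (s - h) *v v) = B s *v v" for s v
        by (simp add: \<beta>_def matrix_vector_mul_assoc matrix_mul_assoc inverse)
      ultimately show ?case
        using Xf state_drift_eq(3,4)[OF Um U0 Xm elim(2) T] by (simp add: noise_def)
    qed
  qed
  have adm: "admissible M F W T h A0 B0 \<sigma>0 U X"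
    unfolding admissible_def using L2 U0 sde by blast
  \<comment> \<open>The explicit \<open>c\<close> satisfies the integral equation it was designed
    for, so it is the control path of the resulting \<open>U\<close>; this closes the loop.\<close>
  have cc: "AE \<omega> in M. \<forall>t\<in>{0..T}. control U t \<omega> = c Z t \<omega>"
    using l2_process_path_integrable[OF q2]
  proof eventually_elim
    case (elim \<omega>)
    define q where "q = (\<lambda>t. LBINT s:{0..t}. (\<Xi> s ** \<Gamma> s) *v noise Z s \<omega>)"
    have "primitive_on 0 T (\<lambda>t. (\<Xi> t ** \<Gamma> t) *v noise Z t \<omega>) q"
      using primitive_on_set_integral[OF elim, of 0] by (simp add: q_def)
    from primitive_on_product[OF bounded_bilinear_matrix_vector_mult \<Psi> this]
    have "primitive_on 0 T (\<lambda>t. (\<Gamma> t ** \<Psi> t) *v q t + \<Psi> t *v ((\<Xi> t ** \<Gamma> t) *v noise Z t \<omega>)) (\<lambda>t. c Z t \<omega>)"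
      by (simp add: c_def q_def)
    moreover have "(\<Gamma> t ** \<Psi> t) *v q t + \<Psi> t *v ((\<Xi> t ** \<Gamma> t) *v noise Z t \<omega>) = \<beta> t *v V Z t \<omega>" for t
    proof -
      have "\<Psi> t *v ((\<Xi> t ** \<Gamma> t) *v v) = \<Gamma> t *v v" for v
        by (simp add: matrix_vector_mul_assoc matrix_mul_assoc inv)
      moreover have "\<Gamma> t *v v = \<beta> t *v ((- L t) *v v)" for v
        by (simp add: \<Gamma>_def matrix_vector_mul_assoc[symmetric] mv.minus_left mv.minus_right)
      moreover have "(\<Gamma> t ** \<Psi> t) *v q t = \<Gamma> t *v c Z t \<omega>"
        by (simp add: c_def q_def matrix_vector_mul_assoc)
      ultimately show ?thesis by (simp add: V_def mv.add_right add.commute)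
    qed
    ultimately have p: "primitive_on 0 T (\<lambda>t. \<beta> t *v V Z t \<omega>) (\<lambda>t. c Z t \<omega>)" by simp
    show ?case
    proof
      fix t assume t: "t \<in> {0..T}"
      have "c Z t \<omega> - c Z 0 \<omega> = (LBINT s:{0..t}. \<beta> s *v V Z s \<omega>)"
        using primitive_on_diff[OF p, of 0 t] t by simp
      also have "\<dots> = control U t \<omega>"
        unfolding control_eq by (intro set_lebesgue_integral_cong) (use t tU in auto)
      finally show "control U t \<omega> = c Z t \<omega>"
        using set_integral_Icc_self[of 0 "\<lambda>s. (\<Xi> s ** \<Gamma> s) *v noise Z s \<omega>"]
        by (simp add: c_def mv.zero_right)
    qed
  qed
  have XZ: "AE \<omega> in M. \<forall>t\<in>{0..T}. X t \<omega> = \<Phi> t *v (noise Z t \<omega> + control U (t - h) \<omega>)"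
    using Xf by simp
  have af: "AE \<omega> in M. \<forall>t\<in>{0..T}. artstein T h A0 B0 U X t \<omega> = \<Phi> t *v (noise Z t \<omega> + control U t \<omega>)"
    by (rule artstein_formula[OF Um _ U2 XZ]) (rule U0)
  show ?thesis
  proof (rule that[OF adm])
    show "adapted_on F T X" using xa by (simp add: adapted_on_def X_def)
    show "AE \<omega> in M. \<forall>t\<in>{0..T}. artstein T h A0 B0 U X t \<omega> = \<Phi> t *v (noise Z t \<omega> + control U t \<omega>) \<and>
      U t \<omega> = - (L t *v (noise Z t \<omega> + control U t \<omega>))"
      using af cc by eventually_elim (auto simp: UV V_def mv.minus_left)
  qed
qed

text \<open>The exceptional set is enclosed in two null strips of the product, which avoids any
  measurability argument for the feedback identity with the given coefficients.\<close>

lemma AE_lborel_productI: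
  assumes "AE t in lborel. p t" "AE \<omega> in M. q \<omega>"
    and "\<And>t \<omega>. p t \<Longrightarrow> q \<omega> \<Longrightarrow> r t \<omega>"
  shows "AE (t, \<omega>) in lborel \<Otimes>\<^sub>M M. r t \<omega>"
proof -
  obtain N1 where N1: "{t. \<not> p t} \<subseteq> N1" "N1 \<in> null_sets lborel"
    using assms(1) by (auto elim!: AE_E simp: null_sets_def)
  obtain N2 where N2: "{\<omega>\<in>space M. \<not> q \<omega>} \<subseteq> N2" "N2 \<in> null_sets M"
    using assms(2) by (auto elim!: AE_E simp: null_sets_def)
  have "N1 \<times> space M \<in> null_sets (lborel \<Otimes>\<^sub>M M)" "space lborel \<times> N2 \<in> null_sets (lborel \<Otimes>\<^sub>M M)"
    using N1(2) N2(2) by (auto simp: null_sets_def emeasure_pair_measure_Times)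
  then have "N1 \<times> space M \<union> space lborel \<times> N2 \<in> null_sets (lborel \<Otimes>\<^sub>M M)" by (rule null_sets.Un)
  then show ?thesis
    by (rule AE_I') (use N1(1) N2(1) assms(3) in \<open>auto simp: space_pair_measure\<close>)
qed

text \<open>A bounded inverse of \<open>R\<close> bounds both the quadratic coefficient
  \<open>S\<close> and the feedback gain, which is what the Riccati equation and the closed-loop
  equation require.\<close>

proposition optimal_feedback_exists:
  assumes Ri: "\<And>t. norm (matrix_inv (R t)) \<le> D"
    and R0: "set_borel_measurable borel {0..T} (\<lambda>t. matrix_inv (R0 t))"
  shows "\<exists>P. riccati_solution T h A0 B0 Q0 G R0 P \<and> (\<forall>t\<in>{0..T - h}. transpose (P t) = P t) \<and>
    (\<forall>P'. riccati_solution T h A0 B0 Q0 G R0 P' \<longrightarrow> (\<forall>t\<in>{0..T - h}. P' t = P t)) \<and>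
    (\<exists>U X. admissible M F W T h A0 B0 \<sigma>0 U X \<and> adapted_on F T X \<and> feedback_law M T h A0 B0 R0 P U X)"
proof -
  have Th: "0 \<le> T - h" using times by simp
  obtain E where E: "\<And>t. norm (\<beta> t) \<le> E" by (rule \<beta>_bounded) blast
  obtain K where K: "\<And>X::real^'m^'n. norm (transpose X) \<le> norm X * K" "0 \<le> K"
    using bounded_linear.nonneg_bounded[OF bounded_linear_transpose] by blast
  have tb: "norm (transpose (\<beta> t)) \<le> E * K" for t
    using K E[of t] by (meson mult_right_mono order_trans)
  obtain D1 where D1: "\<And>s t. norm (matrix_inv (R s) ** transpose (\<beta> t)) \<le> D1"
    using matrix_bound_mult[of "\<lambda>t. matrix_inv (R t)" D "\<lambda>t. transpose (\<beta> t)", OF Ri tb] by blast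
  have D1': "norm (matrix_inv (R t) ** transpose (\<beta> t)) \<le> D1" for t by (rule D1)
  obtain D2 where D2: "\<And>s t. norm (\<beta> s ** (matrix_inv (R t) ** transpose (\<beta> t))) \<le> D2"
    using matrix_bound_mult[of \<beta> E "\<lambda>t. matrix_inv (R t) ** transpose (\<beta> t)", OF E D1'] by blast
  obtain D3 where D3: "\<And>t. norm (Q_tilde t) \<le> D3" by (rule Q_tilde_bounded) blast
  have Sb: "norm (S t) \<le> max D2 D3" for t
    using D2[of t t] by (simp add: S_def matrix_mul_assoc le_max_iff_disj)
  have Qb: "norm (Q_tilde t) \<le> max D2 D3" for t using D3[of t] by (simp add: le_max_iff_disj)
  obtain P' where P': "primitive_on 0 (T - h) (\<lambda>t. P' t ** S t ** P' t - Q_tilde t) P'" "P' (T - h) = G_tilde"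
    "\<And>t. t \<in> {0..T - h} \<Longrightarrow> transpose (P' t) = P' t"
    "\<And>P'' t. primitive_on 0 (T - h) (\<lambda>t. P'' t ** S t ** P'' t - Q_tilde t) P'' \<Longrightarrow> P'' (T - h) = G_tilde \<Longrightarrow>
       t \<in> {0..T - h} \<Longrightarrow> P'' t = P' t"
    by (rule riccati_terminal_value[OF S_measurable Sb S_psd Q_tilde_measurable Qb Q_tilde_psd G_tilde_psd Th]) blast
  define P where "P = (\<lambda>t. transpose (\<Theta> t) ** P' t ** \<Theta> t)"
  \<comment> \<open>The gain must be a bounded Borel function at all times, so \<open>P'\<close> is
    frozen beyond \<open>[0, T - h]\<close>; the feedback law concerns times up to
    \<open>T - h\<close> only.\<close>
  define p where "p = (\<lambda>t. P' (max 0 (min (T - h) t)))"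
  have P'c: "continuous_on {0..T - h} P'" by (rule primitive_on_continuous[OF P'(1)])
  have [measurable]: "p \<in> borel_measurable borel"
    unfolding p_def by (rule borel_measurable_continuous_onI[OF continuous_on_clamp[OF P'c Th]])
  obtain Dp where Dp: "\<And>t. norm (p t) \<le> Dp"
    unfolding p_def by (rule bounded_clamp[OF P'c Th]) blast
  define L where "L = (\<lambda>t. matrix_inv (R t) ** transpose (\<beta> t) ** p t)"
  have Lm: "L \<in> borel_measurable borel" unfolding L_def by measurable
  obtain DL where "\<And>s t. norm (matrix_inv (R s) ** transpose (\<beta> s) ** p t) \<le> DL"
    using matrix_bound_mult[of "\<lambda>t. matrix_inv (R t) ** transpose (\<beta> t)" D1 p, OF D1' Dp] by blast
  then have Lb: "norm (L t) \<le> DL" for t by (simp add: L_def)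
  obtain U X Z where adm: "admissible M F W T h A0 B0 \<sigma>0 U X" and Xa: "adapted_on F T X" and
    cl: "AE \<omega> in M. \<forall>t\<in>{0..T}. artstein T h A0 B0 U X t \<omega> = \<Phi> t *v (noise Z t \<omega> + control U t \<omega>) \<and>
      U t \<omega> = - (L t *v (noise Z t \<omega> + control U t \<omega>))"
    by (rule closed_loop_exists[OF Lm Lb]) blast
  have "AE t in lborel. t \<in> {0..T - h} \<longrightarrow> B_bar T h A0 B0 t = \<Phi> t ** \<beta> t \<and> R t = R0 t"
    using B_bar_eq R(4) by eventually_elim (use times in auto)
  then have fb: "feedback_law M T h A0 B0 R0 P U X"
    unfolding feedback_law_def
  proof (rule AE_lborel_productI[OF _ cl], intro impI)
    fix t \<omega>
    assume 1: "t \<in> {0..T - h} \<longrightarrow> B_bar T h A0 B0 t = \<Phi> t ** \<beta> t \<and> R t = R0 t"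
      and 2: "\<forall>t\<in>{0..T}. artstein T h A0 B0 U X t \<omega> = \<Phi> t *v (noise Z t \<omega> + control U t \<omega>) \<and>
        U t \<omega> = - (L t *v (noise Z t \<omega> + control U t \<omega>))" and t: "t \<in> {0..T - h}"
    have tT: "t \<in> {0..T}" using t times by auto
    have "L t = matrix_inv (R0 t) ** transpose (B_bar T h A0 B0 t) ** P t ** \<Phi> t"
      using 1 t by (simp add: L_def p_def P_def matrix_transpose_mul matrix_mul_assoc flow_cancel)
    then show "U t \<omega> = - ((matrix_inv (R0 t) ** transpose (B_bar T h A0 B0 t) ** P t) *v artstein T h A0 B0 U X t \<omega>)"
      using 2 tT by (simp add: matrix_vector_mul_assoc)
  qed
  have "riccati_solution T h A0 B0 Q0 G R0 P"
    unfolding P_def by (rule riccati_from_tilde[OF P'(1,2) R0])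
  moreover have "\<forall>t\<in>{0..T - h}. transpose (P t) = P t"
    using P'(3) by (simp add: P_def matrix_transpose_mul matrix_mul_assoc)
  \<comment> \<open>Any solution is conjugated into the transformed equation, where uniqueness is
    known, and then conjugated back.\<close>
  moreover have "P2 t = P t" if "riccati_solution T h A0 B0 Q0 G R0 P2" "t \<in> {0..T - h}" for P2 t
  proof -
    have "transpose (\<Phi> t) ** P2 t ** \<Phi> t = P' t"
      using P'(4)[OF riccati_to_tilde[OF that(1)] that(2)] by simp
    then have "P t = transpose (\<Theta> t) ** (transpose (\<Phi> t) ** P2 t ** \<Phi> t) ** \<Theta> t" by (simp add: P_def)
    then show ?thesis by (simp add: matrix_mul_assoc flow_cancel)
  qed
  ultimately show ?thesis using adm Xa fb by blast
qed

end

section \<open>The original data\<close>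

text \<open>The coefficients are only determined almost everywhere; they are replaced by bounded Borel
  representatives that satisfy the constraints everywhere.\<close>

lemma lq_system_representatives:
  fixes A :: "real \<Rightarrow> real^'n^'n" and B :: "real \<Rightarrow> real^'m^'n" and \<sigma> :: "real \<Rightarrow> real^'n"
    and Q :: "real \<Rightarrow> real^'n^'n" and R :: "real \<Rightarrow> real^'m^'m"
  assumes times: "0 < h" "h < T" and M: "filtered_prob_space M F" "wiener_process M F W"
    and A: "Linf_on {0..T + h} UNIV A" and B: "Linf_on {0..T + h} UNIV B" and \<sigma>: "Linf_on {0..T} UNIV \<sigma>"
    and Q: "Linf_on {0..T} psd_matrices Q" and G: "G \<in> psd_matrices"
    and R: "Linf_on {0..T} S R" "S \<subseteq> pd_matrices" "mat 1 \<in> S"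
  obtains C A' B' \<sigma>' \<Phi> \<Theta> Q' R' where "lq_system M F W T h C A' A B' B \<sigma>' \<sigma> \<Phi> \<Theta> Q' Q R' R G" "\<And>t. R' t \<in> S"
proof -
  obtain A' CA where A': "A' \<in> borel_measurable borel" "\<And>t. norm (A' t) \<le> CA"
    "AE t in lborel. t \<in> {0..T + h} \<longrightarrow> A' t = A t"
    by (rule Linf_on_representative[OF A _ UNIV_I]) auto
  obtain B' CB where B': "B' \<in> borel_measurable borel" "\<And>t. norm (B' t) \<le> CB"
    "AE t in lborel. t \<in> {0..T + h} \<longrightarrow> B' t = B t"
    by (rule Linf_on_representative[OF B _ UNIV_I]) auto
  obtain \<sigma>' C\<sigma> where \<sigma>': "\<sigma>' \<in> borel_measurable borel" "\<And>t. norm (\<sigma>' t) \<le> C\<sigma>"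
    "AE t in lborel. t \<in> {0..T} \<longrightarrow> \<sigma>' t = \<sigma> t"
    by (rule Linf_on_representative[OF \<sigma> _ UNIV_I]) auto
  \<comment> \<open>The zero matrix is the default value for the representative of
    \<open>Q\<close>.\<close>
  have "(0 :: real^'n^'n) \<in> psd_matrices"
    by (simp add: psd_matrices_def transpose_def vec_eq_iff mv.zero_left)
  then obtain Q' CQ where Q': "Q' \<in> borel_measurable borel" "\<And>t. norm (Q' t) \<le> CQ" "\<And>t. Q' t \<in> psd_matrices"
    "AE t in lborel. t \<in> {0..T} \<longrightarrow> Q' t = Q t"
    by (rule Linf_on_representative[OF Q, rotated]) auto
  obtain R' CR where R': "R' \<in> borel_measurable borel" "\<And>t. norm (R' t) \<le> CR" "\<And>t. R' t \<in> S"
    "AE t in lborel. t \<in> {0..T} \<longrightarrow> R' t = R t"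
    by (rule Linf_on_representative[OF R(1) _ R(3)]) auto
  have Th: "0 \<le> T + h" using times by simp
  obtain \<Phi> \<Theta> K where \<Phi>: "primitive_on 0 (T + h) (\<lambda>r. A' r ** \<Phi> r) \<Phi>" "primitive_on 0 (T + h) (\<lambda>r. - (\<Theta> r ** A' r)) \<Theta>"
    "continuous_on UNIV \<Phi>" "continuous_on UNIV \<Theta>" "\<And>t. norm (\<Phi> t) \<le> K" "\<And>t. norm (\<Theta> t) \<le> K"
    "\<And>t. \<Theta> t ** \<Phi> t = mat 1" "\<And>t. \<Phi> t ** \<Theta> t = mat 1" "\<Phi> 0 = mat 1" "\<Theta> 0 = mat 1"
    by (rule fundamental_pair_exists[OF A'(1,2) Th]) blast
  define C where "C = Max {CA, CB, C\<sigma>, CQ, CR, K}"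
  have le: "CA \<le> C" "CB \<le> C" "C\<sigma> \<le> C" "CQ \<le> C" "CR \<le> C" "K \<le> C"
    by (simp_all add: C_def)
  have bounds: "norm (A' t) \<le> C" "norm (B' t) \<le> C" "norm (\<sigma>' t) \<le> C" "norm (Q' t) \<le> C" "norm (R' t) \<le> C"
    "norm (\<Phi> t) \<le> C" "norm (\<Theta> t) \<le> C" for t
    using A'(2) B'(2) \<sigma>'(2) Q'(2) R'(2) \<Phi>(5,6) le order_trans by blast+
  have m: "set_borel_measurable borel {0..T + h} A" "set_borel_measurable borel {0..T + h} B"
    "set_borel_measurable borel {0..T} Q" "set_borel_measurable borel {0..T} R"
    using A B Q R(1) by (auto simp: Linf_on_def)
  have R'_pd: "R' t \<in> pd_matrices" for t using R'(3) R(2) by blast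
  have "lq_system M F W T h C A' A B' B \<sigma>' \<sigma> \<Phi> \<Theta> Q' Q R' R G"
    by unfold_locales (fact times M A' B' \<sigma>' Q' R' R'_pd \<Phi> bounds m G)+
  then show ?thesis using R'(3) that by blast
qed

lemma mat_1_pd: "mat 1 \<in> pd_matrices"
  by (simp add: pd_matrices_def transpose_mat)

text \<open>Verification and existence are separate claims because \<open>R\<close> may degenerate
  while positive definite at almost every time. Uniqueness of the optimal control is claimed up to
  \<open>T - h\<close>, since later values affect neither the state before \<open>T\<close> nor the
  control cost. Symmetry of \<open>P\<close> is a hypothesis in the first claim and a conclusion in
  the second, where \<open>P\<close> is also the only solution.\<close>

theorem theorem9:
  fixes M :: "'w measure" and F :: "real \<Rightarrow> 'w measure" and W :: "real \<Rightarrow> 'w \<Rightarrow> real"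
    and T h :: real
    and A :: "real \<Rightarrow> real^'n^'n" and B :: "real \<Rightarrow> real^'m^'n" and \<sigma> :: "real \<Rightarrow> real^'n"
    and Q :: "real \<Rightarrow> real^'n^'n" and G :: "real^'n^'n" and R :: "real \<Rightarrow> real^'m^'m"
  assumes "0 < T" and "0 < h" and "h < T"
    and "filtered_prob_space M F" and "wiener_process M F W"
    and "Linf_on {0..T + h} UNIV A" and "Linf_on {0..T + h} UNIV B" and "Linf_on {0..T} UNIV \<sigma>"
    and "\<forall>\<tau>. 0 < \<tau> \<longrightarrow> \<tau> < T + h \<longrightarrow> invertible (gramian (T + h) A B \<tau>)"
    and "Linf_on {0..T} psd_matrices Q" and "G \<in> psd_matrices" and "Linf_on {0..T} pd_matrices R"
  shows
    "(\<forall>P U X.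
        riccati_solution T h A B Q G R P \<and> (\<forall>t\<in>{0..T - h}. transpose (P t) = P t) \<and>
        admissible M F W T h A B \<sigma> U X \<and> feedback_law M T h A B R P U X \<longrightarrow>
          optimal M F W T h A B \<sigma> Q G R U X \<and>
          (\<forall>U' X'. optimal M F W T h A B \<sigma> Q G R U' X' \<longrightarrow>
             (AE (t, \<omega>) in lborel \<Otimes>\<^sub>M M. t \<in> {0..T - h} \<longrightarrow> U' t \<omega> = U t \<omega>)) \<and>
          solves_sde M W T
            (\<lambda>t \<omega>. A t *v artstein T h A B U X t \<omega> + B_bar T h A B t *v U t \<omega>) \<sigma>
            (artstein T h A B U X)) \<and>
     (Linf_on {0..T} UNIV (\<lambda>t. matrix_inv (R t)) \<longrightarrow>
        (\<exists>P. riccati_solution T h A B Q G R P \<and> (\<forall>t\<in>{0..T - h}. transpose (P t) = P t) \<and>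
          (\<forall>P'. riccati_solution T h A B Q G R P' \<longrightarrow> (\<forall>t\<in>{0..T - h}. P' t = P t)) \<and>
          (\<exists>U X. admissible M F W T h A B \<sigma> U X \<and> adapted_on F T X \<and>
            feedback_law M T h A B R P U X)))"
proof (intro conjI allI impI)
  obtain C A' B' \<sigma>' \<Phi> \<Theta> Q' R' where "lq_system M F W T h C A' A B' B \<sigma>' \<sigma> \<Phi> \<Theta> Q' Q R' R G"
    by (rule lq_system_representatives[OF assms(2-8,10-12) order_refl mat_1_pd])
  then interpret lq_system M F W T h C A' A B' B \<sigma>' \<sigma> \<Phi> \<Theta> Q' Q R' R G .
  fix P U X U' X'
  assume "riccati_solution T h A B Q G R P \<and> (\<forall>t\<in>{0..T - h}. transpose (P t) = P t) \<and>
    admissible M F W T h A B \<sigma> U X \<and> feedback_law M T h A B R P U X"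
  then have *: "riccati_solution T h A B Q G R P" "\<And>t. t \<in> {0..T - h} \<Longrightarrow> transpose (P t) = P t"
    "admissible M F W T h A B \<sigma> U X" "feedback_law M T h A B R P U X"
    by auto
  show "optimal M F W T h A B \<sigma> Q G R U X"
    "solves_sde M W T (\<lambda>t \<omega>. A t *v artstein T h A B U X t \<omega> + B_bar T h A B t *v U t \<omega>) \<sigma> (artstein T h A B U X)"
    by (rule feedback_optimal[OF *]; assumption)+
  show "AE (t, \<omega>) in lborel \<Otimes>\<^sub>M M. t \<in> {0..T - h} \<longrightarrow> U' t \<omega> = U t \<omega>"
    if "optimal M F W T h A B \<sigma> Q G R U' X'"
    by (rule feedback_optimal(2)[OF * that])
next
  assume inv: "Linf_on {0..T} UNIV (\<lambda>t. matrix_inv (R t))"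
  then obtain D where D: "AE t in lborel. t \<in> {0..T} \<longrightarrow> norm (matrix_inv (R t)) \<le> D"
    by (auto simp: Linf_on_def)
  \<comment> \<open>The bound on the inverse is built into the constraint set, so the representative
    satisfies it at every time. Taking the maximum with the norm for the identity matrix keeps that
    matrix, the default value, in the set.\<close>
  define S where "S = pd_matrices \<inter> {X :: real^'m^'m. norm (matrix_inv X) \<le> max D (norm (matrix_inv (mat 1 :: real^'m^'m)))}"
  have "AE t in lborel. t \<in> {0..T} \<longrightarrow> R t \<in> pd_matrices"
    using assms(12) by (simp add: Linf_on_def)
  with D have "AE t in lborel. t \<in> {0..T} \<longrightarrow> R t \<in> S"
    by eventually_elim (auto simp: S_def)
  then have RS: "Linf_on {0..T} S R"
    using assms(12) by (simp add: Linf_on_def)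
  have S: "S \<subseteq> pd_matrices" "mat 1 \<in> S" using mat_1_pd by (auto simp: S_def)
  obtain C A' B' \<sigma>' \<Phi> \<Theta> Q' R' where lq: "lq_system M F W T h C A' A B' B \<sigma>' \<sigma> \<Phi> \<Theta> Q' Q R' R G"
    and R': "\<And>t. R' t \<in> S"
    by (rule lq_system_representatives[OF assms(2-8,10,11) RS S]) blast
  have "norm (matrix_inv (R' t)) \<le> max D (norm (matrix_inv (mat 1 :: real^'m^'m)))" for t
    using R'[of t] by (simp add: S_def)
  then show "\<exists>P. riccati_solution T h A B Q G R P \<and> (\<forall>t\<in>{0..T - h}. transpose (P t) = P t) \<and>
      (\<forall>P'. riccati_solution T h A B Q G R P' \<longrightarrow> (\<forall>t\<in>{0..T - h}. P' t = P t)) \<and>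
      (\<exists>U X. admissible M F W T h A B \<sigma> U X \<and> adapted_on F T X \<and> feedback_law M T h A B R P U X)"
    using inv by (intro lq_system.optimal_feedback_exists[OF lq]) (auto simp: Linf_on_def)
qed

end
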